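(* Let $1\le s\le n$ and put $m=\dim_{\mathbb{F}_\ell}W_s$. Let $\psi_s \colon G_k \to GL_m(\mathbb{F}_\ell)$ be the Galois representation attached to $W_s$. Then the Galois representation $\rho_{A_s,\ell}$ attached to $A_s[\ell]$ has, in a suitable $\mathbb{F}_\ell$-basis, the block upper triangular form $$\rho_{A_s,\ell} \sim \begin{pmatrix} \psi_s & * & \cdots & * \\ & \psi_s(-1) & \cdots & * \\ & & \ddots & \vdots \\ & & & \psi_s(1-\varphi(\ell^s)) \end{pmatrix},$$ where $\varphi$ is Euler's totient function and the $\varphi(\ell^s)$ diagonal blocks are $\psi_s(-i)$ for $0\le i\le \varphi(\ell^s)-1$.
   Context: $k$ is a number field, $\bar k$ a fixed algebraic closure, $G_k=\mathrm{Gal}(\bar k/k)$, $\ell$ a prime. $\mathcal{T}(k,\ell)$ is the maximal pro-$\ell$ extension of $k(\mu_{\ell^\infty})$ unramified away from $\ell$. For a $G_k$-set $T$, $k(T)$ is the subfield of $\bar k$ fixed by the kernel of $G_k\to\mathrm{Aut}(T)$. Curve: $C/k$ is a smooth projective geometrically irreducible curve with affine model $y^{\ell^n}=f(x)$, $n\ge1$, $f=\lambda\prod_{\xi\in S}(x-\xi)^{n_\xi}\in k[x]$, $\lambda\in k^\times$, $S\subset\bar k$ the (finite) set of distinct roots of $f$, $0<n_\xi<\ell^n$, and $S$ equals the branch locus of the $x$-coordinate covering $C\to\mathbb{P}^1$ (in particular $\infty$ is not a branch point, so $\ell^n\mid\deg f$). The Jacobian $J$ of $C$ has good reduction at all finite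 places not above $\ell$, and $k(S)\subseteq\mathcal{T}(k,\ell)$. Tower: for $0\le s\le n$, $C_s/k$ is the smooth projective curve with affine model $(y_s)^{\ell^s}=f(x)$ (so $C_0=\mathbb{P}^1$, $C_n=C$); $\Pi_s\colon C_s\to\mathbb{P}^1$ is the $x$-coordinate, and for $s\ge1$, $\pi_s\colon C_s\to C_{s-1}$ is the degree $\ell$ map given by $y_{s-1}=y_s^\ell$. $J_s=\mathrm{Jac}(C_s)$. The pullback $\pi_s^*\colon J_{s-1}\to J_s$ is a closed immersion, by which $J_{s-1}$ is viewed as an abelian subvariety of $J_s$; $A_s:=J_s/J_{s-1}$ for $1\le s\le n$. Branch strata: $S[j]:=\{\xi\in S:\mathrm{ord}_\ell n_\xi=j\}$, and $S[<s]:=\bigcup_{j=0}^{s-1}S[j]$. Divisors: $\mathrm{Div}\,C_s$ is the group of divisors of $C_s$ over $\bar k$, $\mathrm{Div}^0$ its degree zero part. For $\xi\in\mathbb{P}^1(\bar k)$, $[\xi]_s:=\sum_{\eta\in\Pi_s^{-1}(\xi)}\eta$ (each point with coefficient 1). $\mathcal{W}_s:=\langle[\xi]_s:\xi\in S[<s]\rangle$, $\mathcal{W}_s^0:=\mathcal{W}_s\cap\mathrm{Div}^0C_s$. $\alpha_s\colon\mathcal{W}_s^0\to A_s$ is the composite $\mathcal{W}_s^0\hookrightarrow\mathrm{Div}^0C_s\twoheadrightarrow J_s(\bar k)\twoheadrightarrow A_s(\bar k)$, and $W_s:=\alpha_s(\mathcal{W}_s^0)$, which is a $G_k$-stable $\mathbb{F}_\ell$-subspace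 of $A_s[\ell]$. Tate twists: $\mathbb{F}_\ell(1)$ is the one-dimensional $\mathbb{F}_\ell$-space on which $G_k$ acts by the mod $\ell$ cyclotomic character $\chi$; for $i\in\mathbb{Z}$ and an $\mathbb{F}_\ell[G_k]$-module $V$ with representation $\rho$, $\rho(i)=\rho\otimes\chi^i$ is the representation attached to the twist $V(i)$. $\sim$ denotes equivalence of representations. *)

theory Defs
  imports
    "HOL-Computational_Algebra.Computational_Algebra"
    "HOL-Algebra.Free_Abelian_Groups"
    "HOL-Number_Theory.Totient"
    "HOL-Library.Poly_Mapping"
    "Jordan_Normal_Form.Matrix"
    "Berlekamp_Zassenhaus.Finite_Field"
begin

section \<open>Number fields and Galois groups\<close>

text \<open>
  The algebraic closure of the base field is a whole type \<open>'a\<close>; the fields below it are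
  subsets of \<open>'a\<close>.
\<close>

definition is_subfield :: "'a::field set \<Rightarrow> bool" where
  "is_subfield L \<longleftrightarrow> 1 \<in> L \<and> (\<forall>a\<in>L. \<forall>b\<in>L. a - b \<in> L \<and> a * b \<in> L) \<and> (\<forall>a\<in>L. inverse a \<in> L)"

definition number_field :: "'a::field_char_0 set \<Rightarrow> bool" where
  "number_field k \<longleftrightarrow> is_subfield k \<and>
     (\<exists>B. finite B \<and> k = range (\<lambda>q. \<Sum>b\<in>B. of_rat (q b) * b))"

definition algebraic_over :: "'a::field set \<Rightarrow> 'a \<Rightarrow> bool" where
  "algebraic_over k a \<longleftrightarrow> (\<exists>p. p \<noteq> 0 \<and> (\<forall>i. Polynomial.coeff p i \<in> k) \<and> poly p a = 0)"

text \<open>If \<open>'a\<close> is an algebraic closure of \<open>F\<close>, this is the absolute Galois group of \<open>F\<close>.\<close>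

definition Gal :: "'a::field set \<Rightarrow> ('a \<Rightarrow> 'a) set" where
  "Gal F = {\<sigma>. field_isom \<sigma> \<and> (\<forall>a\<in>F. \<sigma> a = a)}"

definition fixed_field :: "('a \<Rightarrow> 'a) set \<Rightarrow> 'a set" where
  "fixed_field H = {a. \<forall>\<sigma>\<in>H. \<sigma> a = a}"

definition field_of_set :: "'a::field set \<Rightarrow> 'a set \<Rightarrow> 'a set" where
  "field_of_set k T = fixed_field {\<sigma> \<in> Gal k. \<forall>t\<in>T. \<sigma> t = t}"

text \<open>
  Only used when \<open>'a\<close> is an algebraic closure of \<open>F\<close> of characteristic \<open>0\<close>, so that
  separability is automatic.
\<close>

definition galois_ext :: "'a::field set \<Rightarrow> 'a set \<Rightarrow> bool" where
  "galois_ext F L \<longleftrightarrow> is_subfield L \<and> F \<subseteq> L \<and> (\<forall>\<sigma>\<in>Gal F. \<sigma> ` L = L)"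

definition Gal_rel :: "'a::field set \<Rightarrow> 'a set \<Rightarrow> ('a \<Rightarrow> 'a) set" where
  "Gal_rel F L = (\<lambda>\<sigma>. restrict \<sigma> L) ` Gal F"

definition pro_l_ext :: "nat \<Rightarrow> 'a::field set \<Rightarrow> 'a set \<Rightarrow> bool" where
  "pro_l_ext l F L \<longleftrightarrow> galois_ext F L \<and>
     (\<forall>M. M \<subseteq> L \<and> galois_ext F M \<and> finite (Gal_rel F M) \<longrightarrow> (\<exists>a. card (Gal_rel F M) = l ^ a))"


section \<open>Valuation rings\<close>

definition valuation_ring :: "'a::field set \<Rightarrow> 'a set \<Rightarrow> bool" where
  "valuation_ring L R \<longleftrightarrow> R \<subseteq> L \<and> 1 \<in> R \<and> (\<forall>a\<in>R. \<forall>b\<in>R. a - b \<in> R \<and> a * b \<in> R) \<and>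
     (\<forall>a\<in>L. a \<in> R \<or> inverse a \<in> R)"

definition nonunits :: "'a::field set \<Rightarrow> 'a set" where
  "nonunits R = {a \<in> R. a = 0 \<or> inverse a \<notin> R}"

text \<open>
  Finite places of an algebraic extension of the rationals are its proper valuation rings.
  The finite places of the number field \<open>k\<close> are the sets \<open>w \<inter> k\<close> for finite places \<open>w\<close> of its
  algebraic closure.
\<close>

definition finite_place :: "'a::field set \<Rightarrow> 'a set \<Rightarrow> bool" where
  "finite_place L V \<longleftrightarrow> valuation_ring L V \<and> V \<noteq> L"

definition inertia_group :: "'a::field set \<Rightarrow> 'a set \<Rightarrow> ('a \<Rightarrow> 'a) set" where
  "inertia_group F w = {\<sigma> \<in> Gal F. \<sigma> ` w = w \<and> (\<forall>a\<in>w. \<sigma> a - a \<in> nonunits w)}"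

text \<open>
  For \<open>L\<close> Galois over \<open>F\<close>, the inertia group of \<open>w \<inter> L\<close> in the group of \<open>L\<close> over \<open>F\<close> is the image
  of \<open>inertia_group F w\<close>. Infinite places play no role, as \<open>F\<close> will be totally complex.
\<close>

definition unramified_away :: "nat \<Rightarrow> 'a::field set \<Rightarrow> 'a set \<Rightarrow> bool" where
  "unramified_away l F L \<longleftrightarrow>
     (\<forall>w. finite_place UNIV w \<and> of_nat l \<notin> nonunits w \<longrightarrow>
        (\<forall>\<sigma>\<in>inertia_group F w. \<forall>a\<in>L. \<sigma> a = a))"

definition cyclotomic_tower :: "'a::field set \<Rightarrow> nat \<Rightarrow> 'a set" where
  "cyclotomic_tower k l = is_subfield hull (k \<union> {z. \<exists>a. z ^ (l ^ a) = 1})"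

text \<open>The field \<open>\<T>(k, l)\<close>.\<close>

definition max_pro_l :: "'a::field set \<Rightarrow> nat \<Rightarrow> 'a set" where
  "max_pro_l k l = \<Union>{L. pro_l_ext l (cyclotomic_tower k l) L \<and>
                          unramified_away l (cyclotomic_tower k l) L}"


section \<open>Curves and divisors\<close>

text \<open>
  A smooth projective curve over the algebraically closed field \<open>'a\<close> is given by its function
  field, a subfield \<open>L\<close> of \<open>'f\<close> containing the constants \<open>range emb\<close>. The points of the curve are
  the places of \<open>L\<close>: a point is identified with its local ring. A finite morphism of curves is
  an inclusion of function fields \<open>L' \<subseteq> L\<close>; it sends the point \<open>P\<close> to \<open>P \<inter> L'\<close>.
\<close>

definition points :: "('a::field \<Rightarrow> 'f::field) \<Rightarrow> 'f set \<Rightarrow> 'f set set" where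
  "points emb L = {P. valuation_ring L P \<and> range emb \<subseteq> P \<and> P \<noteq> L}"

definition uniformizer :: "'f::field set \<Rightarrow> 'f" where
  "uniformizer P = (SOME t. t \<noteq> 0 \<and> nonunits P = (*) t ` P)"

definition place_ord :: "'f::field set \<Rightarrow> 'f \<Rightarrow> int" where
  "place_ord P z = (THE d. \<exists>u. u \<in> P - nonunits P \<and> z = uniformizer P powi d * u)"

definition ramification :: "'f::field set \<Rightarrow> 'f set \<Rightarrow> int" where
  "ramification P Q = place_ord P (uniformizer Q)"

definition branch_locus :: "('a::field \<Rightarrow> 'f::field) \<Rightarrow> 'f set \<Rightarrow> 'f set \<Rightarrow> 'f set set" where
  "branch_locus emb L' L = {P \<inter> L' | P. P \<in> points emb L \<and> ramification P (P \<inter> L') > 1}"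

definition Div :: "('a::field \<Rightarrow> 'f::field) \<Rightarrow> 'f set \<Rightarrow> ('f set \<Rightarrow>\<^sub>0 int) monoid" where
  "Div emb L = free_Abelian_group (points emb L)"

definition div_degree :: "('p \<Rightarrow>\<^sub>0 int) \<Rightarrow> int" where
  "div_degree D = (\<Sum>P\<in>Poly_Mapping.keys D. Poly_Mapping.lookup D P)"

definition Div0 :: "('a::field \<Rightarrow> 'f::field) \<Rightarrow> 'f set \<Rightarrow> ('f set \<Rightarrow>\<^sub>0 int) monoid" where
  "Div0 emb L = (Div emb L)\<lparr>carrier := {D \<in> carrier (Div emb L). div_degree D = 0}\<rparr>"

definition principal_div :: "('a::field \<Rightarrow> 'f::field) \<Rightarrow> 'f set \<Rightarrow> 'f \<Rightarrow> ('f set \<Rightarrow>\<^sub>0 int)" where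
  "principal_div emb L z =
     (\<Sum>P\<in>{P \<in> points emb L. place_ord P z \<noteq> 0}. frag_cmul (place_ord P z) (frag_of P))"

definition principal_divs :: "('a::field \<Rightarrow> 'f::field) \<Rightarrow> 'f set \<Rightarrow> ('f set \<Rightarrow>\<^sub>0 int) set" where
  "principal_divs emb L = principal_div emb L ` (L - {0})"

definition Jac :: "('a::field \<Rightarrow> 'f::field) \<Rightarrow> 'f set \<Rightarrow> ('f set \<Rightarrow>\<^sub>0 int) set monoid" where
  "Jac emb L = Div0 emb L Mod principal_divs emb L"

definition div_class ::
  "('a::field \<Rightarrow> 'f::field) \<Rightarrow> 'f set \<Rightarrow> ('f set \<Rightarrow>\<^sub>0 int) \<Rightarrow> ('f set \<Rightarrow>\<^sub>0 int) set" where
  "div_class emb L D = principal_divs emb L #>\<^bsub>Div0 emb L\<^esub> D"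

definition pullback ::
  "('a::field \<Rightarrow> 'f::field) \<Rightarrow> 'f set \<Rightarrow> 'f set \<Rightarrow> ('f set \<Rightarrow>\<^sub>0 int) \<Rightarrow> ('f set \<Rightarrow>\<^sub>0 int)" where
  "pullback emb L' L =
     frag_extend (\<lambda>Q. \<Sum>P\<in>{P \<in> points emb L. P \<inter> L' = Q}. frag_cmul (ramification P Q) (frag_of P))"

definition Jac_pullback_image ::
  "('a::field \<Rightarrow> 'f::field) \<Rightarrow> 'f set \<Rightarrow> 'f set \<Rightarrow> ('f set \<Rightarrow>\<^sub>0 int) set set" where
  "Jac_pullback_image emb L' L = (\<lambda>D. div_class emb L (pullback emb L' L D)) ` carrier (Div0 emb L')"


section \<open>Projective models of the Jacobian and good reduction\<close>

text \<open>
  Polynomials in the variables \<open>X\<^sub>0, X\<^sub>1, \<dots>\<close>. A point of projective \<open>N\<close>-space is represented by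
  a function on \<open>nat\<close>, of which only the values at \<open>0, \<dots>, N\<close> matter.
\<close>

type_synonym 'a mpoly = "(nat \<Rightarrow>\<^sub>0 nat) \<Rightarrow>\<^sub>0 'a"

definition mp_eval :: "'a::field mpoly \<Rightarrow> (nat \<Rightarrow> 'a) \<Rightarrow> 'a" where
  "mp_eval p v = (\<Sum>m\<in>Poly_Mapping.keys p. Poly_Mapping.lookup p m *
     (\<Prod>i\<in>Poly_Mapping.keys m. v i ^ Poly_Mapping.lookup m i))"

definition mp_deriv_eval :: "nat \<Rightarrow> 'a::field mpoly \<Rightarrow> (nat \<Rightarrow> 'a) \<Rightarrow> 'a" where
  "mp_deriv_eval j p v = (\<Sum>m\<in>Poly_Mapping.keys p. Poly_Mapping.lookup p m *
     of_nat (Poly_Mapping.lookup m j) *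
     (\<Prod>i\<in>Poly_Mapping.keys m. v i ^ (Poly_Mapping.lookup m i - (if i = j then 1 else 0))))"

definition has_coeffs_in :: "'a::field set \<Rightarrow> 'a mpoly \<Rightarrow> bool" where
  "has_coeffs_in R p \<longleftrightarrow> (\<forall>m. Poly_Mapping.lookup p m \<in> R)"

definition is_form :: "nat \<Rightarrow> 'a::field mpoly \<Rightarrow> bool" where
  "is_form N p \<longleftrightarrow> (\<exists>d. \<forall>m\<in>Poly_Mapping.keys p. Poly_Mapping.keys m \<subseteq> {..N} \<and>
     (\<Sum>i\<in>Poly_Mapping.keys m. Poly_Mapping.lookup m i) = d)"

definition is_biform :: "nat \<Rightarrow> nat \<Rightarrow> nat \<Rightarrow> 'a::field mpoly \<Rightarrow> bool" where
  "is_biform N d d' p \<longleftrightarrow> (\<forall>m\<in>Poly_Mapping.keys p. Poly_Mapping.keys m \<subseteq> {..2 * N + 1} \<and>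
     (\<Sum>i\<in>Poly_Mapping.keys m \<inter> {..N}. Poly_Mapping.lookup m i) = d \<and>
     (\<Sum>i\<in>Poly_Mapping.keys m - {..N}. Poly_Mapping.lookup m i) = d')"

definition join_coords :: "nat \<Rightarrow> (nat \<Rightarrow> 'a) \<Rightarrow> (nat \<Rightarrow> 'a) \<Rightarrow> nat \<Rightarrow> 'a" where
  "join_coords N u v i = (if i \<le> N then u i else v (i - Suc N))"

definition proj_eq :: "nat \<Rightarrow> (nat \<Rightarrow> 'a::field) \<Rightarrow> (nat \<Rightarrow> 'a) \<Rightarrow> bool" where
  "proj_eq N u v \<longleftrightarrow> (\<exists>t. t \<noteq> 0 \<and> (\<forall>i\<le>N. u i = t * v i))"

definition vanishing_forms :: "'a::field set \<Rightarrow> nat \<Rightarrow> (nat \<Rightarrow> 'a) set \<Rightarrow> 'a mpoly set" where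
  "vanishing_forms k N X = {p. is_form N p \<and> has_coeffs_in k p \<and> (\<forall>v\<in>X. mp_eval p v = 0)}"

text \<open>
  From here on the curve has function field \<open>UNIV :: 'f set\<close>, generated over the constants by
  \<open>x\<close> and \<open>y\<close>, and is defined over \<open>k\<close> by an equation in \<open>x\<close> and \<open>y\<close> with coefficients in \<open>k\<close>. So
  an automorphism of \<open>'a\<close> over \<open>k\<close> acts on functions through their coefficients.
\<close>

definition lift_aut ::
  "('a::field \<Rightarrow> 'f::field) \<Rightarrow> 'f \<Rightarrow> 'f \<Rightarrow> ('a \<Rightarrow> 'a) \<Rightarrow> 'f \<Rightarrow> 'f" where
  "lift_aut emb x y \<sigma> = (THE h. field_hom h \<and> (\<forall>a. h (emb a) = emb (\<sigma> a)) \<and> h x = x \<and> h y = y)"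

definition div_act ::
  "('a::field \<Rightarrow> 'f::field) \<Rightarrow> 'f \<Rightarrow> 'f \<Rightarrow> ('a \<Rightarrow> 'a) \<Rightarrow> ('f set \<Rightarrow>\<^sub>0 int) \<Rightarrow> ('f set \<Rightarrow>\<^sub>0 int)" where
  "div_act emb x y \<sigma> = frag_extend (\<lambda>P. frag_of (lift_aut emb x y \<sigma> ` P))"

text \<open>
  \<open>\<iota>\<close> embeds the Jacobian variety over \<open>k\<close> into projective \<open>N\<close>-space: it identifies the group of
  divisor classes, as a Galois module, with a closed subvariety over \<open>k\<close> such that
  subtraction is a morphism (in each point given locally by bihomogeneous forms) and so is every
  Abel-Jacobi map \<open>P \<mapsto> [P - P\<^sub>0]\<close> (given by an \<open>(N+1)\<close>-tuple \<open>h\<close> of rational functions, which is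
  evaluated at \<open>P\<close> after multiplication by a suitable \<open>u\<close>). The image is then an abelian variety
  over \<open>k\<close>, and by the Albanese property \<open>\<iota>\<close> is an isomorphism from the Jacobian onto it.
\<close>

definition jacobian_embedding ::
  "'a::field set \<Rightarrow> ('a \<Rightarrow> 'f::field) \<Rightarrow> 'f \<Rightarrow> 'f \<Rightarrow> nat \<Rightarrow>
     (('f set \<Rightarrow>\<^sub>0 int) set \<Rightarrow> nat \<Rightarrow> 'a) \<Rightarrow> bool" where
  "jacobian_embedding k emb x y N \<iota> \<longleftrightarrow>
     (let J = Jac emb UNIV; X = \<iota> ` carrier J in
       (\<forall>c\<in>carrier J. \<exists>i\<le>N. \<iota> c i \<noteq> 0) \<and>
       (\<forall>c\<in>carrier J. \<forall>c'\<in>carrier J. proj_eq N (\<iota> c) (\<iota> c') \<longrightarrow> c = c') \<and>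
       (\<forall>v. (\<exists>i\<le>N. v i \<noteq> 0) \<and> (\<forall>p\<in>vanishing_forms k N X. mp_eval p v = 0) \<longrightarrow>
          (\<exists>c\<in>carrier J. proj_eq N v (\<iota> c))) \<and>
       (\<forall>\<sigma>\<in>Gal k. \<forall>c\<in>carrier J. proj_eq N (\<iota> (div_act emb x y \<sigma> ` c)) (\<lambda>i. \<sigma> (\<iota> c i))) \<and>
       (\<forall>c\<in>carrier J. \<forall>c'\<in>carrier J. \<exists>G d d'.
          (\<forall>i\<le>N. is_biform N d d' (G i)) \<and>
          (\<exists>i\<le>N. mp_eval (G i) (join_coords N (\<iota> c) (\<iota> c')) \<noteq> 0) \<and>
          (\<forall>a\<in>carrier J. \<forall>b\<in>carrier J.
             (\<exists>i\<le>N. mp_eval (G i) (join_coords N (\<iota> a) (\<iota> b)) \<noteq> 0) \<longrightarrow>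
             proj_eq N (\<lambda>i. mp_eval (G i) (join_coords N (\<iota> a) (\<iota> b)))
               (\<iota> (a \<otimes>\<^bsub>J\<^esub> inv\<^bsub>J\<^esub> b)))) \<and>
       (\<forall>P0\<in>points emb UNIV. \<exists>h. (\<exists>i\<le>N. h i \<noteq> 0) \<and>
          (\<forall>P\<in>points emb UNIV. \<forall>u.
             (\<forall>i\<le>N. u * h i \<in> P) \<and> (\<exists>i\<le>N. u * h i \<notin> nonunits P) \<longrightarrow>
             (\<exists>v. (\<forall>i\<le>N. u * h i - emb (v i) \<in> nonunits P) \<and>
                  proj_eq N v (\<iota> (div_class emb UNIV (frag_of P - frag_of P0)))))))"

text \<open>
  Let \<open>w\<close> be a valuation ring of \<open>'a\<close> and \<open>v\<close> have coordinates in \<open>w\<close>. The Jacobian matrix at \<open>v\<close>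
  of the forms in \<open>I\<close> with coefficients in \<open>w\<close> has rank at least \<open>r\<close> over the residue field of \<open>w\<close>:
  some \<open>r\<close> rows are linearly independent. For \<open>w = UNIV\<close> the residue field is \<open>'a\<close> itself.
\<close>

definition jacobian_rank_ge ::
  "'a::field mpoly set \<Rightarrow> nat \<Rightarrow> 'a set \<Rightarrow> (nat \<Rightarrow> 'a) \<Rightarrow> nat \<Rightarrow> bool" where
  "jacobian_rank_ge I N w v r \<longleftrightarrow>
     (\<exists>g. (\<forall>i<r. g i \<in> I \<and> has_coeffs_in w (g i)) \<and>
        (\<forall>c. (\<forall>i<r. c i \<in> w) \<and> (\<forall>j\<le>N. (\<Sum>i<r. c i * mp_deriv_eval j (g i) v) \<in> nonunits w) \<longrightarrow>
           (\<forall>i<r. c i \<in> nonunits w)))"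

text \<open>
  Geometric points of the special fibre at \<open>w\<close>, in primitive coordinates. The residue field of
  \<open>w\<close> is an algebraic closure of the residue field of \<open>w \<inter> k\<close>. If \<open>I\<close> consists of all forms over
  \<open>k\<close> vanishing on a variety, then the forms in \<open>I\<close> with coefficients in \<open>w\<close> define its closure in
  projective space over \<open>w \<inter> k\<close>, which is flat.
\<close>

definition special_fibre :: "'a::field mpoly set \<Rightarrow> nat \<Rightarrow> 'a set \<Rightarrow> (nat \<Rightarrow> 'a) set" where
  "special_fibre I N w = {v. (\<forall>i\<le>N. v i \<in> w) \<and> (\<exists>i\<le>N. v i \<notin> nonunits w) \<and>
     (\<forall>p\<in>I. has_coeffs_in w p \<longrightarrow> mp_eval p v \<in> nonunits w)}"

text \<open>
  The Jacobian has good reduction at the finite place \<open>V\<close> of \<open>k\<close> if the closure of a suitable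
  projective model is smooth over \<open>V\<close>. Here \<open>r\<close> is the codimension of the model: the
  Jacobian criterion is required with the same \<open>r\<close> on the generic and on the special fibre.
\<close>

definition jacobian_good_reduction ::
  "'a::field set \<Rightarrow> ('a \<Rightarrow> 'f::field) \<Rightarrow> 'f \<Rightarrow> 'f \<Rightarrow> 'a set \<Rightarrow> bool" where
  "jacobian_good_reduction k emb x y V \<longleftrightarrow>
     (\<exists>N \<iota> r. jacobian_embedding k emb x y N \<iota> \<and>
        (let X = \<iota> ` carrier (Jac emb UNIV); I = vanishing_forms k N X in
          (\<forall>v\<in>X. jacobian_rank_ge I N UNIV v r \<and> \<not> jacobian_rank_ge I N UNIV v (Suc r)) \<and>
          (\<forall>w. valuation_ring UNIV w \<and> w \<inter> k = V \<longrightarrow>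
             (\<forall>v\<in>special_fibre I N w. jacobian_rank_ge I N w v r))))"


section \<open>The superelliptic tower\<close>

text \<open>
  The function field of \<open>C\<^sub>s\<close>, realised inside that of \<open>C\<^sub>n\<close> with \<open>y\<^sub>s = y ^ (l ^ (n - s))\<close>, so that
  \<open>y\<^bsub>s-1\<^esub> = y\<^sub>s ^ l\<close> and \<open>y\<^sub>s ^ (l ^ s) = f(x)\<close>. For \<open>s = 0\<close> it is the field of rational functions
  in \<open>x\<close>.
\<close>

definition tower_field ::
  "('a::field \<Rightarrow> 'f::field) \<Rightarrow> 'f \<Rightarrow> 'f \<Rightarrow> nat \<Rightarrow> nat \<Rightarrow> nat \<Rightarrow> 'f set" where
  "tower_field emb x y l n s = is_subfield hull (range emb \<union> {x, y ^ (l ^ (n - s))})"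

text \<open>
  Irreducibility of the affine model is over the algebraic closure \<open>'a\<close>, i.e. geometric. A point
  of \<open>C\<^sub>0\<close> lies over \<open>\<xi> \<in> 'a\<close> iff \<open>x - \<xi>\<close> vanishes there; the point at infinity is not of this kind.
\<close>

locale superelliptic_setup =
  fixes k :: "'a::{alg_closed_field,field_char_0} set"
    and l n :: nat
    and f :: "'a poly" and lam :: 'a and S :: "'a set" and e :: "'a \<Rightarrow> nat"
    and emb :: "'a \<Rightarrow> 'f::field" and x y :: 'f
  assumes k_number_field: "number_field k"
    and algebraic_closure: "\<And>a. algebraic_over k a"
    and prime_l: "Factorial_Ring.prime l"
    and n_pos: "n \<ge> 1"
    and f_coeffs: "\<And>i. Polynomial.coeff f i \<in> k"
    and f_eq: "f = Polynomial.smult lam (\<Prod>\<xi>\<in>S. [:- \<xi>, 1:] ^ e \<xi>)"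
    and lam: "lam \<in> k" "lam \<noteq> 0"
    and finite_S: "finite S"
    and e_bounds: "\<And>\<xi>. \<xi> \<in> S \<Longrightarrow> 0 < e \<xi> \<and> e \<xi> < l ^ n"
    and irreducible_model: "Factorial_Ring.irreducible (Polynomial.monom 1 (l ^ n) - [:f:])"
    and emb: "field_hom emb"
    and x_transcendental: "\<And>p. poly (map_poly emb p) x = 0 \<Longrightarrow> p = 0"
    and y_eq: "y ^ (l ^ n) = poly (map_poly emb f) x"
    and function_field: "tower_field emb x y l n n = UNIV"
    and branch: "branch_locus emb (tower_field emb x y l n 0) (tower_field emb x y l n n) =
          {Q \<in> points emb (tower_field emb x y l n 0). \<exists>\<xi>\<in>S. x - emb \<xi> \<in> nonunits Q}"
    and good_reduction:
      "\<And>V. finite_place k V \<Longrightarrow> of_nat l \<notin> nonunits V \<Longrightarrow> jacobian_good_reduction k emb x y V"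
    and branch_field: "field_of_set k S \<subseteq> max_pro_l k l"

text \<open>The group of geometric points of \<open>A\<^sub>s = J\<^sub>s / J\<^bsub>s-1\<^esub>\<close>, and the class in it of a divisor on \<open>C\<^sub>s\<close>.\<close>

definition A_group ::
  "('a::field \<Rightarrow> 'f::field) \<Rightarrow> 'f \<Rightarrow> 'f \<Rightarrow> nat \<Rightarrow> nat \<Rightarrow> nat \<Rightarrow> ('f set \<Rightarrow>\<^sub>0 int) set set monoid" where
  "A_group emb x y l n s = Jac emb (tower_field emb x y l n s) Mod
     Jac_pullback_image emb (tower_field emb x y l n (s - 1)) (tower_field emb x y l n s)"

definition A_class ::
  "('a::field \<Rightarrow> 'f::field) \<Rightarrow> 'f \<Rightarrow> 'f \<Rightarrow> nat \<Rightarrow> nat \<Rightarrow> nat \<Rightarrow> ('f set \<Rightarrow>\<^sub>0 int) \<Rightarrow>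
     ('f set \<Rightarrow>\<^sub>0 int) set set" where
  "A_class emb x y l n s D =
     Jac_pullback_image emb (tower_field emb x y l n (s - 1)) (tower_field emb x y l n s)
       #>\<^bsub>Jac emb (tower_field emb x y l n s)\<^esub> div_class emb (tower_field emb x y l n s) D"

text \<open>The elements are sets of sets of divisors, whence the double image.\<close>

definition A_act ::
  "('a::field \<Rightarrow> 'f::field) \<Rightarrow> 'f \<Rightarrow> 'f \<Rightarrow> ('a \<Rightarrow> 'a) \<Rightarrow> ('f set \<Rightarrow>\<^sub>0 int) set set \<Rightarrow>
     ('f set \<Rightarrow>\<^sub>0 int) set set" where
  "A_act emb x y \<sigma> a = ((`) (div_act emb x y \<sigma>)) ` a"

definition stratum :: "nat \<Rightarrow> 'a set \<Rightarrow> ('a \<Rightarrow> nat) \<Rightarrow> nat \<Rightarrow> 'a set" where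
  "stratum l S e j = {\<xi> \<in> S. multiplicity l (e \<xi>) = j}"

definition strata_below :: "nat \<Rightarrow> 'a set \<Rightarrow> ('a \<Rightarrow> nat) \<Rightarrow> nat \<Rightarrow> 'a set" where
  "strata_below l S e s = (\<Union>j<s. stratum l S e j)"

definition fibre_div :: "('a::field \<Rightarrow> 'f::field) \<Rightarrow> 'f \<Rightarrow> 'f set \<Rightarrow> 'a \<Rightarrow> ('f set \<Rightarrow>\<^sub>0 int)" where
  "fibre_div emb x L \<xi> = (\<Sum>P\<in>{P \<in> points emb L. x - emb \<xi> \<in> nonunits P}. frag_of P)"

definition W_divs ::
  "('a::field \<Rightarrow> 'f::field) \<Rightarrow> 'f \<Rightarrow> 'f \<Rightarrow> nat \<Rightarrow> nat \<Rightarrow> 'a set \<Rightarrow> ('a \<Rightarrow> nat) \<Rightarrow> nat \<Rightarrow>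
     ('f set \<Rightarrow>\<^sub>0 int) set" where
  "W_divs emb x y l n S e s =
     generate (Div emb (tower_field emb x y l n s))
       (fibre_div emb x (tower_field emb x y l n s) ` strata_below l S e s)"

definition W_space ::
  "('a::field \<Rightarrow> 'f::field) \<Rightarrow> 'f \<Rightarrow> 'f \<Rightarrow> nat \<Rightarrow> nat \<Rightarrow> 'a set \<Rightarrow> ('a \<Rightarrow> nat) \<Rightarrow> nat \<Rightarrow>
     ('f set \<Rightarrow>\<^sub>0 int) set set set" where
  "W_space emb x y l n S e s = A_class emb x y l n s `
     (W_divs emb x y l n S e s \<inter> carrier (Div0 emb (tower_field emb x y l n s)))"


section \<open>Representations over a prime field\<close>

definition torsion :: "('g, 'b) monoid_scheme \<Rightarrow> nat \<Rightarrow> 'g set" where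
  "torsion G l = {a \<in> carrier G. a [^]\<^bsub>G\<^esub> l = \<one>\<^bsub>G\<^esub>}"

text \<open>
  The field with \<open>l = CARD('p)\<close> elements is \<open>'p mod_ring\<close>. A subgroup \<open>V\<close> of a commutative group
  \<open>G\<close> killed by \<open>l\<close> is a vector space over it, written multiplicatively.
\<close>

definition Fl_lincomb ::
  "('g, 'b) monoid_scheme \<Rightarrow> 'g list \<Rightarrow> 'p::prime_card mod_ring vec \<Rightarrow> 'g" where
  "Fl_lincomb G b c = finprod G (\<lambda>i. (b ! i) [^]\<^bsub>G\<^esub> to_int_mod_ring (vec_index c i)) {..<length b}"

definition Fl_basis ::
  "'p::prime_card itself \<Rightarrow> ('g, 'b) monoid_scheme \<Rightarrow> 'g set \<Rightarrow> 'g list \<Rightarrow> bool" where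
  "Fl_basis TYPE('p) G V b \<longleftrightarrow> set b \<subseteq> V \<and>
     bij_betw (Fl_lincomb G b) (carrier_vec (length b) :: 'p mod_ring vec set) V"

text \<open>Column \<open>j\<close> holds the coordinates of \<open>h (b ! j)\<close>.\<close>

definition rep_matrix ::
  "('g, 'b) monoid_scheme \<Rightarrow> 'g list \<Rightarrow> ('g \<Rightarrow> 'g) \<Rightarrow> 'p::prime_card mod_ring mat" where
  "rep_matrix G b h = mat (length b) (length b)
     (\<lambda>(i, j). vec_index (the_inv_into (carrier_vec (length b)) (Fl_lincomb G b) (h (b ! j))) i)"

definition cyclotomic_char :: "('a::field \<Rightarrow> 'a) \<Rightarrow> 'p::prime_card mod_ring" where
  "cyclotomic_char \<sigma> =
     (THE c. \<forall>z. z ^ CARD('p) = 1 \<longrightarrow> \<sigma> z = z ^ nat (to_int_mod_ring c))"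

definition twist ::
  "(('a::field \<Rightarrow> 'a) \<Rightarrow> 'p::prime_card mod_ring mat) \<Rightarrow> int \<Rightarrow> ('a \<Rightarrow> 'a) \<Rightarrow> 'p mod_ring mat" where
  "twist \<rho> i \<sigma> = (cyclotomic_char \<sigma> powi i) \<cdot>\<^sub>m \<rho> \<sigma>"

definition mat_block :: "'r mat \<Rightarrow> nat \<Rightarrow> nat \<Rightarrow> nat \<Rightarrow> 'r mat" where
  "mat_block M m i j = mat m m (\<lambda>(a, b). M $$ (i * m + a, j * m + b))"

definition block_upper_triangular ::
  "nat \<Rightarrow> nat \<Rightarrow> (nat \<Rightarrow> 'r::zero mat) \<Rightarrow> 'r mat \<Rightarrow> bool" where
  "block_upper_triangular m d D M \<longleftrightarrow> M \<in> carrier_mat (d * m) (d * m) \<and>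
     (\<forall>i<d. \<forall>j<i. mat_block M m i j = 0\<^sub>m m m) \<and> (\<forall>i<d. mat_block M m i i = D i)"

end

theory Submission
  imports
    Defs
    "Berlekamp_Zassenhaus.Unique_Factorization_Poly"
    "Jordan_Normal_Form.Determinant"
begin

text \<open>
  The cover \<open>C\<^sub>s\<close> of the line is cyclic of degree \<open>K = l ^ s\<close>, with deck transformation
  \<open>\<delta>: y\<^sub>s \<mapsto> \<zeta> y\<^sub>s\<close>, so \<open>\<Delta> = \<delta> - 1\<close> acts on \<open>A\<^sub>s\<close>. The cyclotomic polynomial
  \<open>\<Phi>\<^sub>K(\<delta>)\<close> is the pullback of the pushforward to \<open>C\<^bsub>s-1\<^esub>\<close>, hence vanishes on \<open>A\<^sub>s\<close>; as
  \<open>\<Phi>\<^sub>K(X) = (X - 1) ^ \<phi>(K) + l u(X)\<close> with \<open>u(1) = 1\<close>, the \<open>l\<close>-torsion of \<open>A\<^sub>s\<close> is the kernel of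
  \<open>\<Delta> ^ \<phi>(K)\<close>. By Hilbert 90 a class killed by \<open>\<Delta>\<close> is represented by a \<open>\<delta>\<close>-invariant divisor, so
  the kernel of \<open>\<Delta>\<close> is \<open>W\<^sub>s\<close>. The endomorphism \<open>\<Delta>\<close> is surjective: every \<open>x - a\<close> is a norm from
  the function field of the curve, so a divisor may be moved in its class to have degree \<open>0\<close> on each
  fibre, and such a divisor is a multiple of \<open>1 - \<delta>\<close> because \<open>\<delta>\<close> permutes each fibre transitively.
  Hence \<open>\<Delta> ^ i\<close> identifies the \<open>i\<close>-th graded piece of the filtration of the \<open>l\<close>-torsion by the
  kernels of the powers of \<open>\<Delta>\<close> with \<open>W\<^sub>s\<close>. If \<open>\<sigma>(\<zeta> ^ c) = \<zeta>\<close> then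
  \<open>\<delta> \<sigma> = \<sigma> \<delta> ^ c\<close>, so \<open>\<Delta> ^ i \<sigma>\<close> agrees with \<open>c ^ i \<sigma> \<Delta> ^ i\<close> up to multiples of
  \<open>\<Delta> ^ (i + 1)\<close>, and \<open>c\<close> is the inverse of the cyclotomic character modulo \<open>l\<close>: this is the
  twist by \<open>-i\<close>.
\<close>

section \<open>Subfields and valuation rings\<close>

text \<open>The decisive input is surjectivity of \<Delta>: it makes each graded piece of the
  filtration as large as the kernel instead of merely a subspace of it. Two facts feed it. That x -
  a is a norm is a case of Tsen's theorem, obtained here from the symmetry of the cyclic algebra of
  f and x - a: writing x - a as a norm from the field of an N-th root of f is traded for writing f
  as a norm from the field of T, where T^N = x - a. That field is again rational over an
  algebraically closed field, and each linear factor of f splits there into conjugates. Secondly, a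
  point fixed by \<delta> is required to bring the degree of the resulting divisor to 0; it exists
  at every level because irreducibility of the model prevents f from being an l-th power. As
  elements of A_s are sets of sets of divisors, the geometry is done with degree 0 divisors modulo
  \<open>trivial_divs\<close>, and classes come last. Since \<delta> is defined over k(\<zeta>)
  only, a Galois automorphism is carried along with the exponents by which it twists
  \<delta>.\<close>

lemma subfield_one: "is_subfield L \<Longrightarrow> 1 \<in> L"
  and subfield_diff: "is_subfield L \<Longrightarrow> a \<in> L \<Longrightarrow> b \<in> L \<Longrightarrow> a - b \<in> L"
  and subfield_mult: "is_subfield L \<Longrightarrow> a \<in> L \<Longrightarrow> b \<in> L \<Longrightarrow> a * b \<in> L"
  and subfield_inverse: "is_subfield L \<Longrightarrow> a \<in> L \<Longrightarrow> inverse a \<in> L"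
  by (auto simp: is_subfield_def)

lemma subfield_zero: "is_subfield L \<Longrightarrow> 0 \<in> L"
  using subfield_diff[of L 1 1] subfield_one[of L] by simp

lemma subfield_uminus: "is_subfield L \<Longrightarrow> a \<in> L \<Longrightarrow> - a \<in> L"
  using subfield_diff[of L 0 a] subfield_zero[of L] by simp

lemma subfield_add: "is_subfield L \<Longrightarrow> a \<in> L \<Longrightarrow> b \<in> L \<Longrightarrow> a + b \<in> L"
  using subfield_diff[of L a "- b"] subfield_uminus[of L b] by simp

lemma subfield_divide: "is_subfield L \<Longrightarrow> a \<in> L \<Longrightarrow> b \<in> L \<Longrightarrow> a / b \<in> L"
  using subfield_mult[of L a "inverse b"] subfield_inverse[of L b] by (simp add: field_simps)

lemma subfield_power: "is_subfield L \<Longrightarrow> a \<in> L \<Longrightarrow> a ^ n \<in> L"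
  by (induction n) (auto intro: subfield_one subfield_mult)

lemma subfield_powi: "is_subfield L \<Longrightarrow> a \<in> L \<Longrightarrow> a powi d \<in> L"
  by (auto simp: power_int_def intro: subfield_power subfield_inverse)

lemma subfield_sum: "is_subfield L \<Longrightarrow> (\<And>i. i \<in> I \<Longrightarrow> h i \<in> L) \<Longrightarrow> sum h I \<in> L"
  by (induction I rule: infinite_finite_induct) (auto intro: subfield_zero subfield_add)

lemma subfield_prod: "is_subfield L \<Longrightarrow> (\<And>i. i \<in> I \<Longrightarrow> h i \<in> L) \<Longrightarrow> prod h I \<in> L"
  by (induction I rule: infinite_finite_induct) (auto intro: subfield_one subfield_mult)

lemmas subfield_closed = subfield_one subfield_zero subfield_diff subfield_add subfield_uminus
  subfield_mult subfield_inverse subfield_divide subfield_power subfield_powi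

lemma is_subfield_hull: "is_subfield (is_subfield hull X)"
  unfolding hull_def by (auto simp: is_subfield_def)

text \<open>The ambient field \<open>L\<close> is an explicit subset, because the rings of all
  levels of the tower live in one type and are compared by intersection.\<close>

locale valuation_subring =
  fixes L P :: "'f::field set"
  assumes subfield: "is_subfield L" and valuation_ring: "valuation_ring L P"
begin

lemma subset: "P \<subseteq> L"
  and one: "1 \<in> P"
  and diff: "a \<in> P \<Longrightarrow> b \<in> P \<Longrightarrow> a - b \<in> P"
  and mult: "a \<in> P \<Longrightarrow> b \<in> P \<Longrightarrow> a * b \<in> P"
  and mem_or_inverse: "a \<in> L \<Longrightarrow> a \<in> P \<or> inverse a \<in> P"
  using valuation_ring by (auto simp: valuation_ring_def)

lemma zero: "0 \<in> P"
  using diff[OF one one] by simp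

lemma uminus: "a \<in> P \<Longrightarrow> - a \<in> P"
  using diff[OF zero] by simp

lemma add: "a \<in> P \<Longrightarrow> b \<in> P \<Longrightarrow> a + b \<in> P"
  using diff[of a "- b"] uminus[of b] by simp

lemma power: "a \<in> P \<Longrightarrow> a ^ n \<in> P"
  by (induction n) (auto intro: one mult)

lemma sum: "(\<And>i. i \<in> I \<Longrightarrow> h i \<in> P) \<Longrightarrow> sum h I \<in> P"
  by (induction I rule: infinite_finite_induct) (auto intro: zero add)

lemma prod: "(\<And>i. i \<in> I \<Longrightarrow> h i \<in> P) \<Longrightarrow> prod h I \<in> P"
  by (induction I rule: infinite_finite_induct) (auto intro: one mult)

lemma nonunits_subset: "nonunits P \<subseteq> P"
  by (auto simp: nonunits_def)

lemma zero_nonunit: "0 \<in> nonunits P"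
  by (auto simp: nonunits_def zero)

lemma unit_iff: "u \<in> P - nonunits P \<longleftrightarrow> u \<in> P \<and> u \<noteq> 0 \<and> inverse u \<in> P"
  by (auto simp: nonunits_def)

lemma one_unit: "1 \<in> P - nonunits P"
  unfolding unit_iff by (auto simp: one)

lemma unit_mult: "u \<in> P - nonunits P \<Longrightarrow> v \<in> P - nonunits P \<Longrightarrow> u * v \<in> P - nonunits P"
  unfolding unit_iff by (auto simp: mult)

lemma unit_inverse: "u \<in> P - nonunits P \<Longrightarrow> inverse u \<in> P - nonunits P"
  unfolding unit_iff by auto

lemma nonunit_mult: assumes "a \<in> nonunits P" "b \<in> P" shows "a * b \<in> nonunits P"
proof (rule ccontr)
  assume "a * b \<notin> nonunits P"
  then have "a * b \<in> P - nonunits P"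
    using assms nonunits_subset mult by auto
  then have "a * b \<noteq> 0" "inverse (a * b) \<in> P" unfolding unit_iff by auto
  then have "inverse a \<in> P"
    using mult[of b "inverse (a * b)"] assms by (simp add: field_simps)
  with assms \<open>a * b \<noteq> 0\<close> show False by (auto simp: nonunits_def)
qed

lemma nonunit_mult': "a \<in> P \<Longrightarrow> b \<in> nonunits P \<Longrightarrow> a * b \<in> nonunits P"
  using nonunit_mult[of b a] by (simp add: mult.commute)

text \<open>One of \<open>a / b\<close> and \<open>b / a\<close> lies in \<open>P\<close>, so the
  sum is a nonunit times an element of \<open>P\<close>.\<close>

lemma nonunit_add: assumes "a \<in> nonunits P" "b \<in> nonunits P" shows "a + b \<in> nonunits P"
proof -
  have *: "a + b \<in> nonunits P" if ab: "a \<in> nonunits P" "b \<in> nonunits P" "b \<noteq> 0" "a / b \<in> P" for a b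
  proof -
    have "a + b = b * (1 + a / b)" using ab by (simp add: field_simps)
    with nonunit_mult[OF ab(2) add[OF one ab(4)]] show ?thesis by simp
  qed
  show ?thesis
  proof (cases "a = 0 \<or> b = 0")
    case False
    have "a \<in> L" "b \<in> L" using assms nonunits_subset subset by auto
    then have "a / b \<in> P \<or> b / a \<in> P"
      using mem_or_inverse[of "a / b"] subfield_divide[OF subfield] by simp
    then show ?thesis using *[of a b] *[of b a] False assms by (auto simp: add.commute)
  qed (use assms in auto)
qed

lemma nonunit_uminus: "a \<in> nonunits P \<Longrightarrow> - a \<in> nonunits P"
  using nonunit_mult[of a "- 1"] uminus[OF one] by simp

lemma nonunit_diff: "a \<in> nonunits P \<Longrightarrow> b \<in> nonunits P \<Longrightarrow> a - b \<in> nonunits P"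
  using nonunit_add[of a "- b"] nonunit_uminus[of b] by simp

lemma nonunit_sum: "(\<And>i. i \<in> I \<Longrightarrow> h i \<in> nonunits P) \<Longrightarrow> Groups_Big.sum h I \<in> nonunits P"
  by (induction I rule: infinite_finite_induct) (auto intro: zero_nonunit nonunit_add)

lemma nonunit_prime:
  "a \<in> P \<Longrightarrow> b \<in> P \<Longrightarrow> a * b \<in> nonunits P \<Longrightarrow> a \<in> nonunits P \<or> b \<in> nonunits P"
  using unit_mult[of a b] by auto

lemma nonunit_power: "a \<in> P \<Longrightarrow> a ^ n \<in> nonunits P \<Longrightarrow> a \<in> nonunits P"
proof (induction n)
  case (Suc n)
  then show ?case using nonunit_prime[of a "a ^ n"] power by auto
qed (use one_unit in auto)

lemma inverse_nonunit: "a \<in> L \<Longrightarrow> a \<notin> P \<Longrightarrow> inverse a \<in> nonunits P"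
  using mem_or_inverse[of a] zero by (auto simp: nonunits_def)

lemma unit_plus_nonunit: "u \<in> P - nonunits P \<Longrightarrow> a \<in> nonunits P \<Longrightarrow> u + a \<in> P - nonunits P"
  using nonunit_diff[of "u + a" a] add[of u a] nonunits_subset by auto

text \<open>If \<open>w\<close> were outside \<open>P\<close>, its inverse \<open>v\<close> would
  lie in \<open>P\<close>, and the equation divided by \<open>w ^ (m - 1)\<close> would write
  \<open>w\<close> as a polynomial in \<open>v\<close> over \<open>P\<close>.\<close>

lemma integrally_closed:
  assumes w: "w \<in> L" and m: "0 < m" and a: "\<And>i. i < m \<Longrightarrow> a i \<in> P"
    and eq: "w ^ m = (\<Sum>i<m. a i * w ^ i)"
  shows "w \<in> P"
proof (rule ccontr)
  assume nw: "w \<notin> P"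
  define v where "v = inverse w"
  have v: "v \<in> P" using mem_or_inverse[OF w] nw by (auto simp: v_def)
  have w0: "w \<noteq> 0" using nw zero by auto
  have "w = w ^ m * v ^ (m - 1)"
    using m w0 by (cases m) (auto simp: v_def field_simps)
  also have "\<dots> = (\<Sum>i<m. a i * v ^ (m - 1 - i))"
    unfolding eq sum_distrib_right
  proof (rule sum.cong)
    fix i assume "i \<in> {..<m}"
    then have "m - 1 = i + (m - 1 - i)" by auto
    then have "v ^ (m - 1) = v ^ i * v ^ (m - 1 - i)" by (metis power_add)
    then show "a i * w ^ i * v ^ (m - 1) = a i * v ^ (m - 1 - i)"
      using w0 by (simp add: v_def field_simps)
  qed auto
  also have "\<dots> \<in> P" by (auto intro!: sum mult power v a)
  finally show False using nw by simp
qed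

lemma restrict: "is_subfield K \<Longrightarrow> K \<subseteq> L \<Longrightarrow> valuation_subring K (P \<inter> K)"
  by unfold_locales (auto simp: valuation_ring_def intro: one diff mult subfield_closed
      dest: mem_or_inverse)

lemma nonunits_restrict: "is_subfield K \<Longrightarrow> nonunits (P \<inter> K) = nonunits P \<inter> K"
  by (auto simp: nonunits_def subfield_inverse)

end

section \<open>Discrete valuation rings\<close>

text \<open>The condition does not mention \<open>uniformizer P\<close>, which is an arbitrary
  choice and has to be related to \<open>t\<close> first. Requiring \<open>P \<noteq> L\<close>
  excludes the trivial valuation, for which \<open>t = 1\<close> would do.\<close>

locale dvr = valuation_subring +
  assumes discrete: "\<exists>t\<in>L. t \<noteq> 0 \<and> (\<forall>w\<in>L. w \<noteq> 0 \<longrightarrow> (\<exists>d u. u \<in> P - nonunits P \<and> w = t powi d * u))"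
    and proper: "P \<noteq> L"
begin

text \<open>A unit \<open>t\<close> would force \<open>L = P\<close>; if \<open>t\<close> lies
  outside \<open>P\<close>, its inverse serves.\<close>

lemma parameter:
  "\<exists>t. t \<in> nonunits P \<and> t \<noteq> 0 \<and> (\<forall>w\<in>L. w \<noteq> 0 \<longrightarrow> (\<exists>d u. u \<in> P - nonunits P \<and> w = t powi d * u))"
proof -
  obtain t where t: "t \<in> L" "t \<noteq> 0" "\<And>w. w \<in> L \<Longrightarrow> w \<noteq> 0 \<Longrightarrow> \<exists>d u. u \<in> P - nonunits P \<and> w = t powi d * u"
    using discrete by blast
  show ?thesis
  proof (cases "t \<in> P")
    case True
    have "t \<in> nonunits P"
    proof (rule ccontr)
      assume "t \<notin> nonunits P"
      with True have tu: "t \<in> P" "inverse t \<in> P" using unit_iff[of t] by auto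
      have "w \<in> P" if w: "w \<in> L" for w
      proof (cases "w = 0")
        case False
        then obtain d u where "u \<in> P" "w = t powi d * u" using t(3)[OF w] by blast
        moreover have "t powi d \<in> P" using tu by (auto simp: power_int_def intro: power)
        ultimately show ?thesis using mult by auto
      qed (auto intro: zero)
      with proper subset show False by auto
    qed
    with t show ?thesis by blast
  next
    case False
    have "\<exists>d u. u \<in> P - nonunits P \<and> w = inverse t powi d * u" if w: "w \<in> L" "w \<noteq> 0" for w
    proof -
      obtain d u where "u \<in> P - nonunits P" "w = t powi d * u" using t(3)[OF w] by blast
      then show ?thesis by (intro exI[of _ "- d"] exI[of _ u]) (simp add: power_int_minus power_int_inverse)
    qed
    then show ?thesis using inverse_nonunit[OF t(1) False] t(2) by (intro exI[of _ "inverse t"]) auto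
  qed
qed

lemma powi_nonunit_iff:
  assumes t: "t \<in> nonunits P" "t \<noteq> 0" and u: "u \<in> P - nonunits P"
  shows "t powi d * u \<in> P \<longleftrightarrow> d \<ge> 0" "t powi d * u \<in> nonunits P \<longleftrightarrow> d > 0"
proof -
  have tP: "t \<in> P" using t nonunits_subset by auto
  have uP: "u \<in> P" "u \<noteq> 0" using u unit_iff by auto
  have pos: "t powi d * u \<in> nonunits P" if "d > 0" for d
  proof -
    have "t powi d = t * t ^ (nat d - 1)" using that by (cases "nat d") (auto simp: power_int_def)
    then have "t powi d * u = t * (t ^ (nat d - 1) * u)" by (simp only: mult.assoc)
    then show ?thesis using nonunit_mult[OF t(1) mult[OF power[OF tP] uP(1)]] by (simp only:)
  qed
  have neg: "t powi d * u \<notin> P" if "d < 0" for d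
  proof
    assume "t powi d * u \<in> P"
    then have "t powi (- d) * inverse u * (t powi d * u) \<in> nonunits P"
    proof -
      have "inverse u \<in> P - nonunits P" using unit_inverse[OF u] .
      then have "t powi (- d) * 1 \<in> nonunits P" 
        using that nonunit_power tP t
        by (cases "nat (-d)") (auto simp: power_int_def intro!: nonunit_mult power)
      then show ?thesis using \<open>inverse u \<in> P - nonunits P\<close> \<open>t powi d * u \<in> P\<close>
        by (auto intro!: nonunit_mult)
    qed
    moreover have "t powi (- d) * inverse u * (t powi d * u) = 1"
      using t uP by (simp add: power_int_minus field_simps)
    ultimately show False using one_unit by simp
  qed
  have zer: "t powi 0 * u \<in> P - nonunits P" using u by simp
  show "t powi d * u \<in> P \<longleftrightarrow> d \<ge> 0"
    using pos[of d] neg[of d] zer nonunits_subset by (cases "d = 0"; cases "d < 0") auto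
  show "t powi d * u \<in> nonunits P \<longleftrightarrow> d > 0"
    using pos[of d] neg[of d] zer nonunits_subset by (cases "d = 0"; cases "d < 0") auto
qed

lemma uniformizer: "uniformizer P \<noteq> 0" "nonunits P = (*) (uniformizer P) ` P"
proof -
  obtain t where t: "t \<in> nonunits P" "t \<noteq> 0"
     "\<And>w. w \<in> L \<Longrightarrow> w \<noteq> 0 \<Longrightarrow> \<exists>d u. u \<in> P - nonunits P \<and> w = t powi d * u"
    using parameter by blast
  have "nonunits P \<subseteq> (*) t ` P"
  proof
    fix w assume w: "w \<in> nonunits P"
    show "w \<in> (*) t ` P"
    proof (cases "w = 0")
      case True
      then show ?thesis using zero by (intro image_eqI[of _ _ 0]) auto
    next
      case False
      then obtain d u where u: "u \<in> P - nonunits P" "w = t powi d * u"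
        using t(3)[of w] w nonunits_subset subset by blast
      with w t have d: "d > 0" using powi_nonunit_iff by blast
      have "w = t * (t powi (d - 1) * u)" using u t(2) by (simp add: power_int_diff)
      moreover have "t powi (d - 1) * u \<in> P" using powi_nonunit_iff[OF t(1,2) u(1)] d by simp
      ultimately show ?thesis by blast
    qed
  qed
  then have "t \<noteq> 0 \<and> nonunits P = (*) t ` P" using t nonunit_mult by auto
  then have "uniformizer P \<noteq> 0 \<and> nonunits P = (*) (uniformizer P) ` P"
    unfolding uniformizer_def by (rule someI)
  then show "uniformizer P \<noteq> 0" "nonunits P = (*) (uniformizer P) ` P" by auto
qed

lemma uniformizer_nonunit: "uniformizer P \<in> nonunits P"
  using uniformizer(2) one by (metis image_eqI mult.right_neutral)

lemma uniformizer_mem: "uniformizer P \<in> L"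
  using uniformizer_nonunit nonunits_subset subset by auto

text \<open>The chosen uniformizer \<open>p\<close> and a parameter \<open>t\<close> differ by a
  unit \<open>q\<close>. Indeed \<open>t = p * q\<close>, and if \<open>q\<close> were a nonunit,
  both factors would have positive exponent in \<open>t\<close>, so that \<open>t\<close> would be a
  unit times a power of \<open>t\<close> with exponent at least 2.\<close>

lemma uniformizer_decomposition:
  assumes w: "w \<in> L" "w \<noteq> 0"
  shows "\<exists>d u. u \<in> P - nonunits P \<and> w = uniformizer P powi d * u"
proof -
  obtain t where t: "t \<in> nonunits P" "t \<noteq> 0"
     "\<And>w. w \<in> L \<Longrightarrow> w \<noteq> 0 \<Longrightarrow> \<exists>d u. u \<in> P - nonunits P \<and> w = t powi d * u"
    using parameter by blast
  define p where "p = uniformizer P"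
  have p: "p \<noteq> 0" "p \<in> nonunits P" using uniformizer(1) uniformizer_nonunit by (auto simp: p_def)
  obtain q where q: "q \<in> P" "t = p * q" using t(1) uniformizer(2) by (auto simp: p_def)
  have "q \<notin> nonunits P"
  proof
    assume qn: "q \<in> nonunits P"
    have "p \<in> L" "q \<in> L" using p q nonunits_subset subset by auto
    moreover have "q \<noteq> 0" using q t by auto
    ultimately obtain a u b v where *: "u \<in> P - nonunits P" "p = t powi a * u"
      "v \<in> P - nonunits P" "q = t powi b * v" using t(3) p by metis
    have ab: "a > 0" "b > 0" using p(2) qn * powi_nonunit_iff t by blast+
    have "t powi (1 - (a + b)) * 1 = u * v"
      using q(2) * t(2) by (simp add: power_int_diff power_int_add field_simps)
    also have "\<dots> \<in> P" using * mult by auto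
    finally show False using ab powi_nonunit_iff(1)[OF t(1,2) one_unit, of "1 - (a + b)"] by linarith
  qed
  with q have q': "q \<in> P - nonunits P" by auto
  obtain d u where u: "u \<in> P - nonunits P" "w = t powi d * u" using t(3)[OF w] by blast
  have "q powi d \<in> P - nonunits P"
    using q' unit_iff by (auto simp: power_int_def intro: power simp flip: power_inverse)
  then have "q powi d * u \<in> P - nonunits P" using u unit_mult by auto
  moreover have "w = uniformizer P powi d * (q powi d * u)"
    using u q p by (simp add: p_def power_int_mult_distrib)
  ultimately show ?thesis by blast
qed

lemma place_ord_eqI:
  assumes "u \<in> P - nonunits P"
  shows "place_ord P (uniformizer P powi d * u) = d"
  unfolding place_ord_def
proof (rule the_equality)
  show "\<exists>ua. ua \<in> P - nonunits P \<and> uniformizer P powi d * u = uniformizer P powi d * ua"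
    using assms by auto
next
  fix d' assume "\<exists>v. v \<in> P - nonunits P \<and> uniformizer P powi d * u = uniformizer P powi d' * v"
  then obtain v where v: "v \<in> P - nonunits P" "uniformizer P powi d * u = uniformizer P powi d' * v"
    by blast
  have nz: "u \<noteq> 0" "v \<noteq> 0" using assms v unit_iff by auto
  have "uniformizer P powi (d' - d) * 1 = u * inverse v"
    using v(2) nz uniformizer(1) by (simp add: power_int_diff field_simps)
  also have "\<dots> \<in> P - nonunits P" using assms v unit_inverse unit_mult by auto
  finally show "d' = d"
    using powi_nonunit_iff[OF uniformizer_nonunit uniformizer(1) one_unit, of "d' - d"] by auto
qed

lemma place_ord_decomposition:
  assumes w: "w \<in> L" "w \<noteq> 0"
  shows "\<exists>u. u \<in> P - nonunits P \<and> w = uniformizer P powi place_ord P w * u"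
  using uniformizer_decomposition[OF w] place_ord_eqI by force

lemma place_ord_uniformizer: "place_ord P (uniformizer P) = 1"
  using place_ord_eqI[OF one_unit, of 1] by simp

lemma
  assumes w: "w \<in> L" "w \<noteq> 0"
  shows mem_iff_ord: "w \<in> P \<longleftrightarrow> place_ord P w \<ge> 0"
    and nonunit_iff_ord: "w \<in> nonunits P \<longleftrightarrow> place_ord P w > 0"
  using place_ord_decomposition[OF w] powi_nonunit_iff[OF uniformizer_nonunit uniformizer(1)] by metis+

lemma unit_iff_ord: "w \<in> L \<Longrightarrow> w \<noteq> 0 \<Longrightarrow> w \<in> P - nonunits P \<longleftrightarrow> place_ord P w = 0"
  using mem_iff_ord[of w] nonunit_iff_ord[of w] by auto

lemma ord_mult:
  assumes a: "a \<in> L" "a \<noteq> 0" and b: "b \<in> L" "b \<noteq> 0"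
  shows "place_ord P (a * b) = place_ord P a + place_ord P b"
proof -
  obtain u v where "u \<in> P - nonunits P" "a = uniformizer P powi place_ord P a * u"
    "v \<in> P - nonunits P" "b = uniformizer P powi place_ord P b * v"
    using place_ord_decomposition a b by metis
  then show ?thesis
    using place_ord_eqI[OF unit_mult[of u v], of "place_ord P a + place_ord P b"] uniformizer(1)
    by (metis (no_types, lifting) mult.assoc mult.left_commute power_int_add)
qed

lemma ord_one: "place_ord P 1 = 0"
  using place_ord_eqI[OF one_unit, of 0] by simp

lemma ord_inverse: "a \<in> L \<Longrightarrow> a \<noteq> 0 \<Longrightarrow> place_ord P (inverse a) = - place_ord P a"
  using ord_mult[of a "inverse a"] subfield_inverse[OF subfield, of a] ord_one by simp

lemma ord_divide:
  "a \<in> L \<Longrightarrow> a \<noteq> 0 \<Longrightarrow> b \<in> L \<Longrightarrow> b \<noteq> 0 \<Longrightarrow> place_ord P (a / b) = place_ord P a - place_ord P b"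
  using ord_mult[of a "inverse b"] subfield_inverse[OF subfield, of b] ord_inverse[of b]
  by (simp add: divide_inverse)

lemma ord_power: "a \<in> L \<Longrightarrow> a \<noteq> 0 \<Longrightarrow> place_ord P (a ^ n) = int n * place_ord P a"
  by (induction n) (auto simp: ord_one ord_mult subfield_power[OF subfield] algebra_simps)

lemma ord_powi: "a \<in> L \<Longrightarrow> a \<noteq> 0 \<Longrightarrow> place_ord P (a powi d) = d * place_ord P a"
  by (auto simp: power_int_def ord_power ord_inverse subfield_power[OF subfield]
      subfield_inverse[OF subfield] simp flip: power_inverse)

lemma ord_prod:
  assumes "finite I" "\<And>i. i \<in> I \<Longrightarrow> h i \<in> L \<and> h i \<noteq> 0"
  shows "place_ord P (Groups_Big.prod h I) = (\<Sum>i\<in>I. place_ord P (h i))"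
  using assms
proof (induction I)
  case (insert i I)
  have "Groups_Big.prod h I \<in> L" "Groups_Big.prod h I \<noteq> 0"
    using insert subfield_prod[OF subfield, of I h] by auto
  then show ?case using insert by (auto simp: ord_mult)
qed (auto simp: ord_one)

lemma ord_add_eq:
  assumes a: "a \<in> L" "a \<noteq> 0" and b: "b \<in> L" "b \<noteq> 0 \<Longrightarrow> place_ord P a < place_ord P b"
  shows "a + b \<noteq> 0" "place_ord P (a + b) = place_ord P a"
proof -
  have "b / a \<in> nonunits P"
  proof (cases "b = 0")
    case False
    then show ?thesis using a b nonunit_iff_ord[of "b / a"] ord_divide[of b a]
      subfield_divide[OF subfield] by auto
  qed (auto intro: zero_nonunit)
  then have u: "1 + b / a \<in> P - nonunits P" using unit_plus_nonunit[OF one_unit] by auto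
  have eq: "a + b = a * (1 + b / a)" using a by (simp add: field_simps)
  have nz: "1 + b / a \<noteq> 0" using u unit_iff by auto
  with eq a show "a + b \<noteq> 0" by auto
  have "1 + b / a \<in> L" using u subset by auto
  then have "place_ord P (1 + b / a) = 0" using u unit_iff_ord nz by blast
  then show "place_ord P (a + b) = place_ord P a"
    unfolding eq using ord_mult[of a "1 + b / a"] a nz \<open>1 + b / a \<in> L\<close> by auto
qed

text \<open>An element of \<open>P'\<close> outside \<open>P\<close> has a pole, and its powers
  absorb the pole of any given element of \<open>L\<close>.\<close>

lemma dvr_maximal:
  assumes "valuation_ring L P'" "P' \<noteq> L" "P \<subseteq> P'"
  shows "P' = P"
proof (rule ccontr)
  assume "P' \<noteq> P"
  then obtain w where w: "w \<in> P'" "w \<notin> P" using assms by auto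
  interpret P': valuation_subring L P' using assms subfield by unfold_locales
  have wL: "w \<in> L" "w \<noteq> 0" using w P'.subset zero by auto
  have ow: "place_ord P w < 0" using mem_iff_ord[OF wL] w by auto
  have "z \<in> P'" if z: "z \<in> L" for z
  proof (cases "z = 0")
    case False
    define k where "k = nat \<bar>place_ord P z\<bar>"
    have L: "z / w ^ k \<in> L" "w ^ k \<in> L" using z wL subfield by (auto intro!: subfield_closed)
    have "place_ord P (z / w ^ k) = place_ord P z - int k * place_ord P w"
      using z wL False L by (simp add: ord_divide ord_power)
    moreover have "int k * (- place_ord P w) \<ge> int k * 1" using ow by (intro mult_left_mono) auto
    ultimately have "z / w ^ k \<in> P" using mem_iff_ord[OF L(1)] False wL by (auto simp: k_def)
    then have "z / w ^ k * w ^ k \<in> P'" using assms w by (intro P'.mult P'.power) auto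
    then show ?thesis using wL by auto
  qed (auto intro: P'.zero)
  with P'.subset assms show False by auto
qed

end

text \<open>The valuation \<open>v\<close> need not be normalised: an element \<open>t\<close> of
  least positive value is the parameter, and division of \<open>v w\<close> by \<open>v t\<close>
  leaves a remainder that is again a value, hence 0.\<close>

lemma (in valuation_subring) dvrI:
  fixes v :: "_ \<Rightarrow> int"
  assumes hom: "\<And>a b. a \<in> L \<Longrightarrow> a \<noteq> 0 \<Longrightarrow> b \<in> L \<Longrightarrow> b \<noteq> 0 \<Longrightarrow> v (a * b) = v a + v b"
    and mem: "\<And>a. a \<in> L \<Longrightarrow> a \<noteq> 0 \<Longrightarrow> a \<in> P \<longleftrightarrow> v a \<ge> 0"
    and ntriv: "\<exists>a\<in>L. a \<noteq> 0 \<and> v a \<noteq> 0"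
  shows "dvr L P"
proof -
  have one: "v 1 = 0" using hom[of 1 1] subfield_one[OF subfield] by auto
  have inv: "v (inverse a) = - v a" if "a \<in> L" "a \<noteq> 0" for a
    using hom[of a "inverse a"] that subfield_inverse[OF subfield, of a] one by auto
  have pow: "v (a ^ n) = int n * v a" if "a \<in> L" "a \<noteq> 0" for a n
    by (induction n) (use that in \<open>auto simp: one hom subfield_power[OF subfield] algebra_simps\<close>)
  have powi: "v (a powi d) = d * v a" if "a \<in> L" "a \<noteq> 0" for a d
    using that by (auto simp: power_int_def pow inv subfield_power[OF subfield]
      subfield_inverse[OF subfield] simp flip: power_inverse)
  have unit: "a \<in> P - nonunits P \<longleftrightarrow> v a = 0" if "a \<in> L" "a \<noteq> 0" for a
    using that mem[of a] mem[of "inverse a"] inv[of a] subfield_inverse[OF subfield, of a]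
    unfolding unit_iff by auto
  obtain a where a: "a \<in> L" "a \<noteq> 0" "v a \<noteq> 0" using ntriv by auto
  define b where "b = (if v a > 0 then a else inverse a)"
  have b: "b \<in> L" "b \<noteq> 0" "v b > 0"
    using a inv[of a] subfield_inverse[OF subfield, of a] by (auto simp: b_def)
  define Q where "Q = (\<lambda>m. \<exists>t. t \<in> L \<and> t \<noteq> 0 \<and> v t > 0 \<and> nat (v t) = m)"
  define m where "m = (LEAST m. Q m)"
  have "Q (nat (v b))" using b by (auto simp: Q_def)
  then have "Q m" unfolding m_def by (rule LeastI)
  then obtain t where t: "t \<in> L" "t \<noteq> 0" "v t > 0" "nat (v t) = m" by (auto simp: Q_def)
  have least: "v s \<ge> v t" if "s \<in> L" "s \<noteq> 0" "v s > 0" for s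
  proof -
    have "Q (nat (v s))" using that by (auto simp: Q_def)
    then have "m \<le> nat (v s)" unfolding m_def by (rule Least_le)
    then show ?thesis using t that by auto
  qed
  show ?thesis
  proof
    show "\<exists>t\<in>L. t \<noteq> 0 \<and> (\<forall>w\<in>L. w \<noteq> 0 \<longrightarrow> (\<exists>d u. u \<in> P - nonunits P \<and> w = t powi d * u))"
    proof (intro bexI[of _ t] conjI ballI impI)
      fix w assume w: "w \<in> L" "w \<noteq> 0"
      define d where "d = v w div v t"
      define u where "u = w * t powi (- d)"
      have tL: "t powi (- d) \<in> L" using t subfield by (auto intro: subfield_closed)
      then have u: "u \<in> L" "u \<noteq> 0" using w t by (auto simp: u_def intro: subfield_mult[OF subfield])
      have vu: "v u = v w - d * v t" using hom[of w "t powi (- d)"] powi[of t "-d"] w t tL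
        by (auto simp: u_def)
      then have "v u = v w mod v t" by (simp add: d_def minus_div_mult_eq_mod)
      then have "0 \<le> v u" "v u < v t" using t by auto
      with least[OF u] have "v u = 0" by linarith
      then have "u \<in> P - nonunits P" using unit u by auto
      moreover have "w = t powi d * u" using t by (simp add: u_def power_int_minus)
      ultimately show "\<exists>d u. u \<in> P - nonunits P \<and> w = t powi d * u" by blast
    qed (use t in auto)
    show "P \<noteq> L"
      using mem[of "inverse t"] inv[of t] t subfield_inverse[OF subfield, of t] by auto
  qed
qed

text \<open>In the induction \<open>c\<close> serves the old points, and by maximality of the two
  rings some \<open>d\<close> has a zero at \<open>P\<close> and a pole at the new point
  \<open>R\<close>. A high power of \<open>c\<close> times \<open>d\<close> works unless
  \<open>c\<close> vanishes at \<open>R\<close>; then \<open>1 + c\<close> takes its place, which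
  has the same poles and is a unit at \<open>P\<close> and \<open>R\<close>.\<close>

lemma dvr_approximation_neg:
  assumes P: "dvr L P" and "finite T" "\<And>Q. Q \<in> T \<Longrightarrow> dvr L Q \<and> Q \<noteq> P"
  shows "\<exists>c\<in>L. c \<noteq> 0 \<and> place_ord P c > 0 \<and> (\<forall>Q\<in>T. place_ord Q c < 0)"
  using assms(2,3)
proof (induction T)
  case empty
  interpret dvr L P by fact
  show ?case using uniformizer uniformizer_mem place_ord_uniformizer by (intro bexI[of _ "uniformizer P"]) auto
next
  case (insert R T)
  interpret P: dvr L P by fact
  interpret R: dvr L R using insert by auto
  obtain c where c: "c \<in> L" "c \<noteq> 0" "place_ord P c > 0" "\<And>Q. Q \<in> T \<Longrightarrow> place_ord Q c < 0"
    using insert by auto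
  have "\<not> P \<subseteq> R" "\<not> R \<subseteq> P"
    using P.dvr_maximal[OF R.valuation_ring R.proper] R.dvr_maximal[OF P.valuation_ring P.proper] insert
    by auto
  then obtain a b where ab: "a \<in> P" "a \<notin> R" "b \<in> R" "b \<notin> P" by auto
  define d where "d = a / b"
  have abL: "a \<in> L" "b \<in> L" "a \<noteq> 0" "b \<noteq> 0"
    using ab P.subset R.subset P.zero R.zero by auto
  then have d: "d \<in> L" "d \<noteq> 0" by (auto simp: d_def intro: subfield_divide[OF P.subfield])
  have dP: "place_ord P d > 0" using P.mem_iff_ord abL ab P.ord_divide by (force simp: d_def)
  have dR: "place_ord R d < 0" using R.mem_iff_ord abL ab R.ord_divide by (force simp: d_def)
  show ?case
  proof (cases "place_ord R c \<le> 0")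
    case le: True
    define k where "k = (\<Sum>Q\<in>T. nat \<bar>place_ord Q d\<bar>) + 1"
    have "place_ord Q (c ^ k * d) = int k * place_ord Q c + place_ord Q d" if "dvr L Q" for Q
    proof -
      interpret dvr L Q by fact
      show ?thesis using c d by (simp add: ord_mult ord_power subfield_power[OF subfield])
    qed
    note o = this
    have "place_ord Q (c ^ k * d) < 0" if "Q \<in> T" for Q
    proof -
      have "nat \<bar>place_ord Q d\<bar> < k" using member_le_sum[OF that, of "\<lambda>Q. nat \<bar>place_ord Q d\<bar>"] insert
        by (auto simp: k_def)
      moreover have "int k * place_ord Q c \<le> int k * (- 1)" using c(4)[OF that]
        by (intro mult_left_mono) auto
      ultimately show ?thesis using o[of Q] insert that by auto
    qed
    moreover have "place_ord P (c ^ k * d) > 0" using o[OF P] c dP by (auto intro: add_nonneg_pos)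
    moreover have "place_ord R (c ^ k * d) < 0" using o[OF R.dvr_axioms] le dR
      by (auto intro!: add_nonpos_neg simp: mult_nonneg_nonpos)
    ultimately show ?thesis
      using c d by (intro bexI[of _ "c ^ k * d"]) (auto intro: subfield_mult subfield_power P.subfield)
  next
    case gt: False
    define k where "k = (\<Sum>Q\<in>T. nat \<bar>place_ord Q d\<bar>) + 1"
    have cL: "1 + c \<in> L" using c by (intro subfield_add P.subfield subfield_one)
    have pos: "1 + c \<noteq> 0 \<and> place_ord Q (1 + c) = 0" if "dvr L Q" "place_ord Q c > 0" for Q
    proof -
      interpret dvr L Q by fact
      show ?thesis using ord_add_eq[of 1 c] that ord_one c subfield_one[OF subfield] by auto
    qed
    have neg: "place_ord Q (1 + c) = place_ord Q c" if "dvr L Q" "place_ord Q c < 0" for Q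
    proof -
      interpret dvr L Q by fact
      show ?thesis using ord_add_eq[of c 1] that ord_one c subfield_one[OF subfield] by (auto simp: add.commute)
    qed
    have nz: "1 + c \<noteq> 0" using pos[OF P] c by auto
    have "place_ord Q ((1 + c) ^ k * d) = int k * place_ord Q (1 + c) + place_ord Q d" if "dvr L Q" for Q
    proof -
      interpret dvr L Q by fact
      show ?thesis using cL nz d by (simp add: ord_mult ord_power subfield_power[OF subfield])
    qed
    note o = this
    have "place_ord Q ((1 + c) ^ k * d) < 0" if "Q \<in> T" for Q
    proof -
      have "nat \<bar>place_ord Q d\<bar> < k" using member_le_sum[OF that, of "\<lambda>Q. nat \<bar>place_ord Q d\<bar>"] insert
        by (auto simp: k_def)
      moreover have "int k * place_ord Q c \<le> int k * (- 1)" using c(4)[OF that]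
        by (intro mult_left_mono) auto
      ultimately show ?thesis using o[of Q] neg[of Q] c(4)[OF that] insert that by auto
    qed
    moreover have "place_ord P ((1 + c) ^ k * d) > 0" using o[OF P] pos[OF P] c dP by auto
    moreover have "place_ord R ((1 + c) ^ k * d) < 0" using o[OF R.dvr_axioms] pos[OF R.dvr_axioms] gt dR
      by auto
    ultimately show ?thesis
      using nz cL d by (intro bexI[of _ "(1 + c) ^ k * d"]) (auto intro: subfield_mult subfield_power P.subfield)
  qed
qed

text \<open>For large \<open>k\<close> the element \<open>(t + c ^ k) / (1 + c ^ k)\<close> behaves
  like \<open>t\<close> where \<open>c\<close> vanishes and like 1 where \<open>c\<close> has a
  pole.\<close>

lemma dvr_approximation:
  assumes P: "dvr L P" and T: "finite T" "\<And>Q. Q \<in> T \<Longrightarrow> dvr L Q \<and> Q \<noteq> P"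
  shows "\<exists>w\<in>L. w \<noteq> 0 \<and> place_ord P w = 1 \<and> (\<forall>Q\<in>T. place_ord Q w = 0)"
proof -
  interpret P: dvr L P by fact
  obtain c where c: "c \<in> L" "c \<noteq> 0" "place_ord P c > 0" "\<And>Q. Q \<in> T \<Longrightarrow> place_ord Q c < 0"
    using dvr_approximation_neg[OF P T] by blast
  define t where "t = uniformizer P"
  have t: "t \<in> L" "t \<noteq> 0" "place_ord P t = 1"
    using P.uniformizer P.uniformizer_mem P.place_ord_uniformizer by (auto simp: t_def)
  \<comment> \<open>The sum lets \<open>c ^ k\<close> outweigh \<open>t\<close> at every
    \<open>Q\<close>; the added 2 makes \<open>c ^ k\<close> vanish to order at least 2 at
    \<open>P\<close>, where \<open>t\<close> has order 1.\<close>
  define k where "k = (\<Sum>Q\<in>T. nat \<bar>place_ord Q t\<bar>) + 2"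
  have cL: "c ^ k \<in> L" "1 + c ^ k \<in> L" using c by (auto intro!: subfield_closed P.subfield)
  have pos: "1 + c ^ k \<noteq> 0 \<and> place_ord Q (1 + c ^ k) = 0 \<and> place_ord Q (c ^ k) = int k * place_ord Q c"
    if "dvr L Q" "place_ord Q c > 0" for Q
  proof -
    interpret dvr L Q by fact
    have "place_ord Q (c ^ k) = int k * place_ord Q c" using c by (simp add: ord_power)
    moreover have "int k * place_ord Q c > 0" using that(2) by (simp add: k_def sum_nonneg add_pos_nonneg)
    ultimately show ?thesis using ord_add_eq[of 1 "c ^ k"] ord_one c cL subfield_one[OF subfield]
      by auto
  qed
  have neg: "1 + c ^ k \<noteq> 0 \<and> place_ord Q (1 + c ^ k) = int k * place_ord Q c \<and> place_ord Q (c ^ k) = int k * place_ord Q c"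
    if "dvr L Q" "place_ord Q c < 0" for Q
  proof -
    interpret dvr L Q by fact
    have "place_ord Q (c ^ k) = int k * place_ord Q c" using c by (simp add: ord_power)
    moreover have "k > 0" by (simp add: k_def)
    then have "int k * place_ord Q c < 0" using that by (auto intro: mult_pos_neg)
    ultimately show ?thesis using ord_add_eq[of "c ^ k" 1] that ord_one c cL subfield_one[OF subfield]
      by (auto simp: add.commute)
  qed
  define w where "w = (t + c ^ k) / (1 + c ^ k)"
  have nz: "1 + c ^ k \<noteq> 0" using pos[OF P c(3)] by auto
  have tc: "t + c ^ k \<in> L" using t cL by (intro subfield_add P.subfield)
  have wL: "w \<in> L" unfolding w_def by (intro subfield_divide P.subfield tc cL)
  have kc: "int k * place_ord P c \<ge> 2 * 1" using c(3) by (intro mult_mono) (auto simp: k_def)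
  have P1: "t + c ^ k \<noteq> 0" "place_ord P (t + c ^ k) = 1"
    using P.ord_add_eq[of t "c ^ k"] t cL c pos[OF P c(3)] kc by auto
  have "place_ord P w = 1" using P1 P.ord_divide[of "t + c ^ k" "1 + c ^ k"] tc cL nz pos[OF P c(3)]
    by (simp add: w_def)
  moreover have "place_ord Q w = 0" if Q: "Q \<in> T" for Q
  proof -
    interpret dvr L Q using T Q by auto
    have "nat \<bar>place_ord Q t\<bar> < k" using member_le_sum[OF Q, of "\<lambda>Q. nat \<bar>place_ord Q t\<bar>"] T
      by (auto simp: k_def)
    moreover have "int k * place_ord Q c \<le> int k * (- 1)" using c(4)[OF Q]
      by (intro mult_left_mono) auto
    ultimately have "place_ord Q (c ^ k + t) = place_ord Q (c ^ k)"
      using ord_add_eq(2)[of "c ^ k" t] cL t c neg[OF dvr_axioms c(4)[OF Q]] by auto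
    then show ?thesis using ord_divide[of "t + c ^ k" "1 + c ^ k"] tc cL nz P1 neg[OF dvr_axioms c(4)[OF Q]]
      by (simp add: w_def add.commute)
  qed
  ultimately show ?thesis using wL P1 nz by (intro bexI[of _ w]) (auto simp: w_def)
qed

section \<open>Function fields of Kummer covers of the line\<close>

text \<open>As polynomials in \<open>a\<close> both sides are monic of degree \<open>N\<close>, and
  their difference vanishes at the \<open>N\<close> elements \<open>z ^ i * b\<close>. These are
  distinct only for \<open>b \<noteq> 0\<close>, whence the case distinction.\<close>

lemma prod_roots_of_unity:
  fixes a b z :: "'b::idom"
  assumes N: "N > 0" and z: "z ^ N = 1" "inj_on (\<lambda>i. z ^ i) {..<N}"
  shows "(\<Prod>i<N. a - z ^ i * b) = a ^ N - b ^ N"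
proof (cases "b = 0")
  case True
  then show ?thesis using N by (simp add: power_0_left)
next
  case False
  define Q where "Q = (\<Prod>i<N. [:- (z ^ i * b), 1:])"
  define D where "D = Polynomial.monom 1 N - [:b ^ N:] - Q"
  have Q: "degree Q = N" "Polynomial.coeff Q N = 1"
  proof -
    show *: "degree Q = N" unfolding Q_def by (subst degree_prod_eq_sum_degree) auto
    have "lead_coeff Q = 1" unfolding Q_def by (subst lead_coeff_prod) auto
    with * show "Polynomial.coeff Q N = 1" by simp
  qed
  have zN: "(z ^ i) ^ N = 1" for i using z(1) by (metis power_mult mult.commute power_one)
  have "D = 0"
  proof (rule ccontr)
    assume D0: "D \<noteq> 0"
    have "degree D < N"
    proof (rule degree_lessI)
      show "D \<noteq> 0 \<or> N > 0" using N by auto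
      show "\<forall>k\<ge>N. Polynomial.coeff D k = 0"
        using Q N by (auto simp: D_def coeff_pCons le_less coeff_eq_0 split: nat.splits)
    qed
    moreover have "(\<lambda>i. z ^ i * b) ` {..<N} \<subseteq> {w. poly D w = 0}"
      by (auto simp: D_def Q_def poly_monom poly_prod power_mult_distrib zN)
    then have "card ((\<lambda>i. z ^ i * b) ` {..<N}) \<le> card {w. poly D w = 0}"
      using poly_roots_finite[OF D0] by (intro card_mono) auto
    then have "N \<le> card {w. poly D w = 0}"
      using z False by (subst (asm) card_image) (auto simp: inj_on_def)
    moreover have "card {w. poly D w = 0} \<le> degree D" using card_poly_roots_bound[OF D0] .
    ultimately show False by simp
  qed
  then have "poly Q a = a ^ N - b ^ N"
    by (metis D_def eq_iff_diff_eq_0 poly_diff poly_monom poly_const_conv mult_1)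
  then show ?thesis by (simp add: Q_def poly_prod)
qed

text \<open>Substitution of \<open>u\<close> for x and \<open>v\<close> for y in a polynomial in y
  over the polynomials in x, with \<open>h\<close> applied to the constants. Varying
  \<open>h\<close> and \<open>v\<close> gives the conjugate evaluations out of which automorphisms
  are made.\<close>

definition bieval :: "('a::comm_ring_1 \<Rightarrow> 'f::comm_ring_1) \<Rightarrow> 'f \<Rightarrow> 'f \<Rightarrow> 'a poly poly \<Rightarrow> 'f" where
  "bieval h u v G = poly (map_poly (\<lambda>p. poly (map_poly h p) u) G) v"

lemma comm_ring_hom_eval:
  assumes "comm_ring_hom h"
  shows "comm_ring_hom (\<lambda>p. poly (map_poly h p) u)"
proof -
  interpret comm_ring_hom h by fact
  interpret m: map_poly_comm_ring_hom h ..
  show ?thesis by unfold_locales (auto simp: hom_distribs)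
qed

lemma eval_const:
  assumes "comm_ring_hom h"
  shows "poly (map_poly h [:a:]) u = h a"
proof -
  interpret comm_ring_hom h by fact
  have "map_poly h (Polynomial.monom a 0) = Polynomial.monom (h a) 0" by (rule map_poly_monom) simp
  then show ?thesis by (simp add: monom_0)
qed

lemma comm_ring_hom_bieval:
  assumes "comm_ring_hom h"
  shows "comm_ring_hom (bieval h u v)"
  using comm_ring_hom_eval[OF comm_ring_hom_eval[OF assms], of u v] by (simp add: bieval_def[abs_def])

lemma bieval_monom:
  assumes "comm_ring_hom h"
  shows "bieval h u v (Polynomial.monom p i) = poly (map_poly h p) u * v ^ i"
proof -
  interpret comm_ring_hom "\<lambda>p. poly (map_poly h p) u" by (rule comm_ring_hom_eval) fact
  show ?thesis by (simp add: bieval_def map_poly_monom poly_monom)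
qed

lemma bieval_const:
  assumes "comm_ring_hom h"
  shows "bieval h u v [:p:] = poly (map_poly h p) u"
  using bieval_monom[OF assms, of u v p 0] by (simp add: monom_0)

text \<open>Polynomials over k[x] admit only pseudo-division. A nonzero \<open>M\<close> of least
  degree in \<open>I\<close> divides a constant multiple of the prime element \<open>\<Phi>\<close>,
  so \<open>\<Phi>\<close> divides \<open>M\<close> or the cofactor; the latter makes
  \<open>M\<close> free of y, which \<open>const\<close> forbids. Thus \<open>\<Phi>\<close> has
  least degree, and being monic it divides with remainder. The ideal will be the kernel of an
  evaluation, and later an annihilator.\<close>

lemma ideal_generated_by_irreducible:
  fixes \<Phi> :: "'a::field poly poly" and I :: "'a poly poly set"
  assumes \<Phi>: "\<Phi> = Polynomial.monom 1 N - [:f:]" "Factorial_Ring.irreducible \<Phi>" "N > 0" "\<Phi> \<in> I"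
    and add: "\<And>G H. G \<in> I \<Longrightarrow> H \<in> I \<Longrightarrow> G - H \<in> I"
    and mult: "\<And>G H. G \<in> I \<Longrightarrow> H * G \<in> I"
    and const: "\<And>c. [:c:] \<in> I \<Longrightarrow> c = 0"
    and G: "G \<in> I"
  shows "\<Phi> dvd G"
proof -
  have deg: "degree \<Phi> = N" and lead: "lead_coeff \<Phi> = 1"
  proof -
    have "Polynomial.coeff \<Phi> k = (if k = N then 1 else if k = 0 then - f else 0)" for k
      using \<Phi>(3) by (auto simp: \<Phi>(1) coeff_pCons split: nat.splits)
    note c = this
    show *: "degree \<Phi> = N" by (rule order.antisym) (auto intro!: degree_le le_degree simp: c)
    show "lead_coeff \<Phi> = 1" unfolding * by (simp add: c)
  qed
  have prime: "prime_elem \<Phi>" using \<Phi>(2) by simp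
  have \<Phi>0: "\<Phi> \<noteq> 0" using prime by auto
  have large: "N \<le> degree G" if "G \<in> I" "G \<noteq> 0" for G
  proof -
    define Q where "Q = (\<lambda>d. \<exists>G\<in>I. G \<noteq> 0 \<and> degree G = d)"
    have "Q N" using \<Phi>(4) \<Phi>0 deg by (auto simp: Q_def)
    then have "Q (LEAST d. Q d)" by (rule LeastI)
    then obtain M where M: "M \<in> I" "M \<noteq> 0" "degree M = (LEAST d. Q d)" by (auto simp: Q_def)
    have least: "degree M \<le> degree H" if "H \<in> I" "H \<noteq> 0" for H
      unfolding M(3) by (rule Least_le) (use that in \<open>auto simp: Q_def\<close>)
    obtain q r where qr: "pseudo_divmod \<Phi> M = (q, r)" by fastforce
    define c where "c = lead_coeff M ^ (Suc (degree \<Phi>) - degree M)"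
    have c0: "c \<noteq> 0" using M(2) by (simp add: c_def)
    have eq: "Polynomial.smult c \<Phi> = M * q + r" and r: "r = 0 \<or> degree r < degree M"
      using pseudo_divmod[OF M(2) qr] by (auto simp: c_def)
    have "r = [:c:] * \<Phi> - q * M" using eq by (simp add: algebra_simps)
    then have "r \<in> I" using add mult M \<Phi>(4) by metis
    with least r have "r = 0" by force
    with eq have eq: "Polynomial.smult c \<Phi> = M * q" by simp
    have "\<Phi> dvd M * q" unfolding eq[symmetric] by (simp add: dvd_smult)
    then consider "\<Phi> dvd M" | "\<Phi> dvd q" unfolding prime_elem_dvd_mult_iff[OF prime] by blast
    then have "N \<le> degree M"
    proof cases
      case 1
      then show ?thesis using dvd_imp_degree_le M deg by blast
    next
      case 2
      have q0: "q \<noteq> 0" using eq c0 \<Phi>0 by auto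
      have "N \<le> degree q" using dvd_imp_degree_le[OF 2 q0] deg by simp
      moreover have "N = degree M + degree q"
        using arg_cong[OF eq, of degree] c0 deg degree_mult_eq[OF M(2) q0] by simp
      ultimately have "degree M = 0" by simp
      then obtain m where "M = [:m:]" by (auto elim: degree_eq_zeroE)
      with M const show ?thesis by auto
    qed
    with least[OF that] show ?thesis by simp
  qed
  obtain q r where qr: "pseudo_divmod G \<Phi> = (q, r)" by fastforce
  have eq: "G = \<Phi> * q + r" and r: "r = 0 \<or> degree r < N"
    using pseudo_divmod[OF \<Phi>0 qr] lead deg by auto
  have "r = G - q * \<Phi>" using eq by (simp add: algebra_simps)
  then have "r \<in> I" using add mult G \<Phi>(4) by metis
  with large r have "r = 0" by force
  with eq show ?thesis by simp
qed

lemma kernel_bieval: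
  fixes h :: "'a::field \<Rightarrow> 'f::field"
  assumes h: "field_hom h" and tr: "\<And>p. poly (map_poly h p) u = 0 \<Longrightarrow> p = 0"
    and irr: "Factorial_Ring.irreducible (Polynomial.monom 1 N - [:f:])" and N: "N > 0"
    and v: "v ^ N = poly (map_poly h f) u"
  shows "bieval h u v G = 0 \<longleftrightarrow> (Polynomial.monom 1 N - [:f:]) dvd G"
proof -
  interpret h: field_hom h by fact
  have h': "comm_ring_hom h" ..
  interpret b: comm_ring_hom "bieval h u v" by (rule comm_ring_hom_bieval[OF h'])
  have \<Phi>: "bieval h u v (Polynomial.monom 1 N - [:f:]) = 0"
    by (simp add: b.hom_minus bieval_const[OF h'] bieval_monom[OF h'] v)
  show ?thesis
  proof
    assume "bieval h u v G = 0"
    then show "(Polynomial.monom 1 N - [:f:]) dvd G"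
      by (intro ideal_generated_by_irreducible[OF refl irr N, of "{G. bieval h u v G = 0}"])
         (auto simp: b.hom_minus b.hom_mult bieval_const[OF h'] bieval_monom[OF h'] v intro: tr)
  next
    assume "(Polynomial.monom 1 N - [:f:]) dvd G"
    then show "bieval h u v G = 0" using \<Phi> by (auto simp: dvd_def b.hom_mult)
  qed
qed

lemma field_hom_eqI:
  assumes "field_hom g" "field_hom h" and "is_subfield hull X = UNIV" and "\<And>a. a \<in> X \<Longrightarrow> g a = h a"
  shows "g = h"
proof -
  interpret g: field_hom g by fact
  interpret h: field_hom h by fact
  have "is_subfield {a. g a = h a}"
    by (auto simp: is_subfield_def g.hom_minus h.hom_minus g.hom_mult h.hom_mult g.hom_inverse h.hom_inverse)
  then have "is_subfield hull X \<subseteq> {a. g a = h a}"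
    using assms(4) by (intro hull_minimal) auto
  with assms(3) show ?thesis by auto
qed

locale kummer_curve =
  fixes emb :: "'a::{alg_closed_field,field_char_0} \<Rightarrow> 'f::field" and x y :: 'f
    and f :: "'a poly" and N :: nat
  assumes emb: "field_hom emb"
    and transcendental: "\<And>p. poly (map_poly emb p) x = 0 \<Longrightarrow> p = 0"
    and irreducible: "Factorial_Ring.irreducible (Polynomial.monom 1 N - [:f:])"
    and N_pos: "N > 0"
    and y_power: "y ^ N = poly (map_poly emb f) x"
    and generated: "is_subfield hull (range emb \<union> {x, y}) = UNIV"
begin

sublocale emb: field_hom emb by (rule emb)

lemma emb_comm_ring: "comm_ring_hom emb" ..

lemma kernel: "bieval emb x y G = 0 \<longleftrightarrow> (Polynomial.monom 1 N - [:f:]) dvd G"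
  by (rule kernel_bieval[OF emb transcendental irreducible N_pos y_power])

lemma fraction_representation: "\<exists>G H. bieval emb x y H \<noteq> 0 \<and> w = bieval emb x y G / bieval emb x y H"
proof -
  interpret b: comm_ring_hom "bieval emb x y" by (rule comm_ring_hom_bieval[OF emb_comm_ring])
  let ?X = "{w. \<exists>G H. bieval emb x y H \<noteq> 0 \<and> w = bieval emb x y G / bieval emb x y H}"
  have I: "v \<in> ?X" if "bieval emb x y H \<noteq> 0" "v = bieval emb x y G / bieval emb x y H" for v G H
    using that by blast
  have "is_subfield ?X"
    unfolding is_subfield_def
  proof (intro conjI ballI)
    show "1 \<in> ?X" by (rule I[of 1 _ 1]) (simp_all add: b.hom_one)
    fix v w assume "v \<in> ?X" "w \<in> ?X"
    then obtain G H G' H' where *: "bieval emb x y H \<noteq> 0" "v = bieval emb x y G / bieval emb x y H"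
      "bieval emb x y H' \<noteq> 0" "w = bieval emb x y G' / bieval emb x y H'" by blast
    show "v - w \<in> ?X"
      by (rule I[of "H * H'" _ "G * H' - G' * H"])
         (use * in \<open>simp_all add: b.hom_mult b.hom_minus diff_frac_eq\<close>)
    show "v * w \<in> ?X"
      by (rule I[of "H * H'" _ "G * G'"]) (use * in \<open>simp_all add: b.hom_mult\<close>)
    show "inverse v \<in> ?X"
    proof (cases "bieval emb x y G = 0")
      case True
      then show ?thesis using * by (intro I[of 1 _ 0]) (simp_all add: b.hom_one b.hom_zero)
    next
      case False
      then show ?thesis using * by (intro I[of G _ H]) simp_all
    qed
  qed
  moreover have "range emb \<union> {x, y} \<subseteq> ?X"
  proof -
    have "emb a \<in> ?X" for a
      by (rule I[of 1 _ "[:[:a:]:]"]) (simp_all add: b.hom_one bieval_const[OF emb_comm_ring] eval_const[OF emb_comm_ring])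
    moreover have "x \<in> ?X"
      by (rule I[of 1 _ "[:[:0,1:]:]"]) (simp_all add: b.hom_one bieval_const[OF emb_comm_ring] map_poly_pCons)
    moreover have "y \<in> ?X"
      by (rule I[of 1 _ "Polynomial.monom 1 1"]) (simp_all add: b.hom_one bieval_monom[OF emb_comm_ring])
    ultimately show ?thesis by auto
  qed
  ultimately have "is_subfield hull (range emb \<union> {x, y}) \<subseteq> ?X" by (intro hull_minimal)
  then show ?thesis using generated by blast
qed

lemma hom_eqI:
  assumes "field_hom g" "field_hom h" "\<And>a. g (emb a) = h (emb a)" "g x = h x" "g y = h y"
  shows "g = h"
  by (rule field_hom_eqI[OF assms(1,2) generated]) (use assms(3-) in auto)

text \<open>Both evaluations have the kernel generated by the equation, so sending a fraction of one
  to the corresponding fraction of the other is well defined. The deck transformation is the case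
  where \<open>\<sigma>\<close> is the identity, the lift of a Galois automorphism the case
  \<open>c = 1\<close>.\<close>

lemma hom_extension:
  fixes \<sigma> :: "'a \<Rightarrow> 'a"
  assumes \<sigma>: "field_hom \<sigma>" "map_poly \<sigma> f = f" and c: "c ^ N = 1"
  shows "\<exists>h. field_hom h \<and> (\<forall>a. h (emb a) = emb (\<sigma> a)) \<and> h x = x \<and> h y = emb c * y"
proof -
  interpret \<sigma>: field_hom \<sigma> by fact
  interpret e: field_hom "emb \<circ> \<sigma>" by unfold_locales (auto simp: hom_distribs)
  have mp: "map_poly (emb \<circ> \<sigma>) p = map_poly emb (map_poly \<sigma> p)" for p
    by (simp add: map_poly_map_poly)
  let ?E = "bieval emb x y" and ?E' = "bieval (emb \<circ> \<sigma>) x (emb c * y)"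
  have e': "comm_ring_hom (emb \<circ> \<sigma>)" ..
  interpret b: comm_ring_hom ?E by (rule comm_ring_hom_bieval[OF emb_comm_ring])
  interpret b': comm_ring_hom ?E' by (rule comm_ring_hom_bieval[OF e'])
  have tr: "p = 0" if "poly (map_poly (emb \<circ> \<sigma>) p) x = 0" for p
    using transcendental[of "map_poly \<sigma> p"] that unfolding mp
    by (simp add: map_poly_eq_0_iff)
  have "(emb c * y) ^ N = poly (map_poly (emb \<circ> \<sigma>) f) x"
    unfolding mp \<sigma>(2) using c by (simp add: power_mult_distrib y_power flip: emb.hom_power)
  then have ker: "?E' G = 0 \<longleftrightarrow> ?E G = 0" for G
    unfolding kernel by (intro kernel_bieval[OF e.field_hom_axioms tr irreducible N_pos])
  define h where "h = (\<lambda>w. THE v. \<exists>G H. ?E H \<noteq> 0 \<and> w = ?E G / ?E H \<and> v = ?E' G / ?E' H)"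
  have h: "h (?E G / ?E H) = ?E' G / ?E' H" if "?E H \<noteq> 0" for G H
    unfolding h_def
  proof (rule the_equality)
    show "\<exists>Ga Ha. ?E Ha \<noteq> 0 \<and> ?E G / ?E H = ?E Ga / ?E Ha \<and> ?E' G / ?E' H = ?E' Ga / ?E' Ha"
      using that by blast
  next
    fix v assume "\<exists>Ga Ha. ?E Ha \<noteq> 0 \<and> ?E G / ?E H = ?E Ga / ?E Ha \<and> v = ?E' Ga / ?E' Ha"
    then obtain G' H' where *: "?E H' \<noteq> 0" "?E G / ?E H = ?E G' / ?E H'" "v = ?E' G' / ?E' H'" by blast
    have "?E (G * H' - G' * H) = 0" using * that by (simp add: b.hom_mult b.hom_minus frac_eq_eq)
    then have "?E' (G * H' - G' * H) = 0" by (simp only: ker)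
    then show "v = ?E' G / ?E' H" using * that ker[of H] ker[of H']
      by (simp add: b'.hom_mult b'.hom_minus frac_eq_eq)
  qed
  have h1: "h (?E G) = ?E' G" for G using h[of 1 G] by (simp add: b.hom_one b'.hom_one)
  have "field_hom h"
  proof
    show "h 0 = 0" using h1[of 0] by (simp add: b.hom_zero b'.hom_zero)
    show "h 1 = 1" using h1[of 1] by (simp add: b.hom_one b'.hom_one)
    fix v w
    obtain G H G' H' where *: "?E H \<noteq> 0" "v = ?E G / ?E H" "?E H' \<noteq> 0" "w = ?E G' / ?E H'"
      using fraction_representation by meson
    have E'0: "?E' H \<noteq> 0" "?E' H' \<noteq> 0" using * ker by auto
    have "v + w = ?E (G * H' + G' * H) / ?E (H * H')" using * by (simp add: b.hom_mult b.hom_add add_frac_eq)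
    then have "h (v + w) = ?E' (G * H' + G' * H) / ?E' (H * H')" using h[of "H * H'" "G * H' + G' * H"] * by (simp add: b.hom_mult)
    then show "h (v + w) = h v + h w" using * h E'0 by (simp add: b'.hom_mult b'.hom_add add_frac_eq)
    have "v * w = ?E (G * G') / ?E (H * H')" using * by (simp add: b.hom_mult)
    then have "h (v * w) = ?E' (G * G') / ?E' (H * H')" using h[of "H * H'" "G * G'"] * by (simp add: b.hom_mult)
    then show "h (v * w) = h v * h w" using * h by (simp add: b'.hom_mult)
  qed
  moreover have "h (emb a) = emb (\<sigma> a)" for a
    using h1[of "[:[:a:]:]"] by (simp add: bieval_const[OF emb_comm_ring] bieval_const[OF e'] eval_const[OF emb_comm_ring] eval_const[OF e'])
  moreover have "h x = x"
    using h1[of "[:[:0,1:]:]"] by (simp add: bieval_const[OF emb_comm_ring] bieval_const[OF e'] map_poly_pCons)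
  moreover have "h y = emb c * y"
    using h1[of "Polynomial.monom 1 1"] by (simp add: bieval_monom[OF emb_comm_ring] bieval_monom[OF e'])
  ultimately show ?thesis by blast
qed

end

section \<open>The deck transformation, its fixed fields and norms\<close>

locale kummer_cover = kummer_curve emb x y f N
  for emb :: "'a::{alg_closed_field,field_char_0} \<Rightarrow> 'f::field" and x y f N +
  fixes \<zeta> :: 'a and \<delta> :: "'f \<Rightarrow> 'f"
  assumes primitive: "\<And>i. \<zeta> ^ i = 1 \<longleftrightarrow> N dvd i"
    and \<delta>: "field_hom \<delta>"
    and \<delta>_emb: "\<And>a. \<delta> (emb a) = emb a"
    and \<delta>_x: "\<delta> x = x"
    and \<delta>_y: "\<delta> y = emb \<zeta> * y"
begin

sublocale \<delta>: field_hom \<delta> by (rule \<delta>)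

lemma funpow_hom: "field_hom (\<delta> ^^ i)"
proof (induction i)
  case (Suc i)
  then interpret i: field_hom "\<delta> ^^ i" .
  show ?case by unfold_locales (auto simp: hom_distribs)
qed (unfold_locales, auto)

lemma funpow_emb: "(\<delta> ^^ i) (emb a) = emb a"
  by (induction i) (auto simp: \<delta>_emb)

lemma funpow_x: "(\<delta> ^^ i) x = x"
  by (induction i) (auto simp: \<delta>_x)

lemma funpow_y: "(\<delta> ^^ i) y = emb (\<zeta> ^ i) * y"
  by (induction i) (auto simp: \<delta>_y \<delta>_emb hom_distribs)

lemma funpow_mod: "N dvd i \<Longrightarrow> \<delta> ^^ i = id"
  by (rule hom_eqI[OF funpow_hom]) (auto simp: funpow_emb funpow_x funpow_y primitive[THEN iffD2], unfold_locales, auto)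

lemma primitive_power: "\<zeta> ^ N = 1"
  by (simp add: primitive)

lemma primitive_neq_0: "\<zeta> \<noteq> 0"
  using primitive_power N_pos by (auto simp: power_0_left)

lemma primitive_eq_iff: "i < N \<Longrightarrow> j < N \<Longrightarrow> \<zeta> ^ i = \<zeta> ^ j \<longleftrightarrow> i = j"
proof (induction i j rule: linorder_wlog)
  case (le i j)
  have "\<zeta> ^ j = \<zeta> ^ i * \<zeta> ^ (j - i)" using le by (simp flip: power_add)
  then have "\<zeta> ^ i = \<zeta> ^ j \<longleftrightarrow> N dvd j - i" using primitive_neq_0 primitive by auto
  then show ?case using le by (auto dest: dvd_imp_le)
qed auto

lemma primitive_inj: "inj_on (\<lambda>i. \<zeta> ^ i) {..<N}"
  by (auto simp: inj_on_def primitive_eq_iff)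

text \<open>For \<open>K = l ^ s\<close> this is the function field of the curve at level
  \<open>s\<close>, described by Galois theory; \<open>fixed_eq_hull\<close> recovers the
  generators. The description makes stability under \<delta> immediate.\<close>

definition fixed :: "nat \<Rightarrow> 'f set" where "fixed K = {w. (\<delta> ^^ K) w = w}"

lemma subfield_fixed: "is_subfield (fixed K)"
proof -
  interpret K: field_hom "\<delta> ^^ K" by (rule funpow_hom)
  show ?thesis by (auto simp: is_subfield_def fixed_def K.hom_minus K.hom_mult K.hom_inverse)
qed

lemma emb_fixed: "emb a \<in> fixed K" and x_fixed: "x \<in> fixed K"
  by (auto simp: fixed_def funpow_emb funpow_x)

lemma fixed_N: "fixed N = UNIV"
  by (auto simp: fixed_def funpow_mod)

lemma fixed_funpow: "w \<in> fixed K \<Longrightarrow> (\<delta> ^^ i) w \<in> fixed K"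
  unfolding fixed_def mem_Collect_eq by (metis add.commute comp_apply funpow_add)

lemma fixed_multiple: "w \<in> fixed K \<Longrightarrow> K dvd i \<Longrightarrow> (\<delta> ^^ i) w = w"
proof (elim dvdE)
  fix j assume "w \<in> fixed K" "i = K * j"
  moreover have "(\<delta> ^^ (K * j)) w = w" if "(\<delta> ^^ K) w = w"
    using that by (induction j) (simp_all add: funpow_add)
  ultimately show "(\<delta> ^^ i) w = w" by (simp add: fixed_def)
qed

lemma fixed_mono: "K dvd K' \<Longrightarrow> fixed K \<subseteq> fixed K'"
  using fixed_multiple by (auto simp: fixed_def)

definition rat_field :: "'f set" where "rat_field = is_subfield hull (range emb \<union> {x})"

lemma subfield_rat: "is_subfield rat_field"
  unfolding rat_field_def by (rule is_subfield_hull)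

lemma emb_rat: "emb a \<in> rat_field" and x_rat: "x \<in> rat_field"
  using hull_subset[of "range emb \<union> {x}" is_subfield] by (auto simp: rat_field_def)

lemma rat_fixed: "rat_field \<subseteq> fixed K"
  unfolding rat_field_def
  by (rule hull_minimal) (use subfield_fixed emb_fixed x_fixed in auto)

lemma rat_funpow: "w \<in> rat_field \<Longrightarrow> (\<delta> ^^ i) w = w"
  using rat_fixed[of i] by (auto simp: fixed_def)

lemma poly_rat: "poly (map_poly emb p) x \<in> rat_field"
  unfolding poly_altdef
  by (intro subfield_sum subfield_rat subfield_mult subfield_power x_rat) (simp add: coeff_map_poly emb_rat)

lemma y_power_rat: "y ^ N \<in> rat_field"
  by (simp add: y_power poly_rat)

lemma geometric_sum_root_of_unity:
  assumes "K * M = N"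
  shows "(\<Sum>j<M. \<zeta> ^ (K * j * i)) = (if M dvd i then of_nat M else 0)"
proof -
  have K: "K > 0" using assms N_pos by (cases K) auto
  have eq: "(\<Sum>j<M. \<zeta> ^ (K * j * i)) = (\<Sum>j<M. (\<zeta> ^ (K * i)) ^ j)"
    by (simp add: power_mult[symmetric] mult_ac)
  have iff: "\<zeta> ^ (K * i) = 1 \<longleftrightarrow> M dvd i" using assms K by (auto simp: primitive)
  have "(\<zeta> ^ (K * i)) ^ M = 1" using assms by (auto simp: primitive mult_ac simp flip: power_mult)
  then show ?thesis unfolding eq using iff geometric_sum[of "\<zeta> ^ (K * i)" M] by auto
qed

text \<open>Averaging over the powers of \<open>\<delta> ^^ K\<close> leaves the element alone and
  kills every monomial \<open>y ^ i\<close> whose exponent is not a multiple of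
  \<open>M\<close>.\<close>

lemma average:
  assumes KM: "K * M = N" and p: "\<And>i. Polynomial.coeff p i \<in> rat_field" and w: "poly p y \<in> fixed K"
  shows "poly p y \<in> is_subfield hull (rat_field \<union> {y ^ M})"
proof -
  define U where "U = is_subfield hull (rat_field \<union> {y ^ M})"
  have M: "M > 0" using KM N_pos by (cases M) auto
  have H: "is_subfield U" unfolding U_def by (rule is_subfield_hull)
  have sub: "rat_field \<subseteq> U" "y ^ M \<in> U"
    using hull_subset[of "rat_field \<union> {y ^ M}" is_subfield] by (auto simp: U_def)
  have "of_nat M * poly p y = (\<Sum>j<M. (\<delta> ^^ (K * j)) (poly p y))"
    using fixed_multiple[OF w] by simp
  also have "\<dots> = (\<Sum>j<M. \<Sum>i\<le>degree p. Polynomial.coeff p i * (emb (\<zeta> ^ (K * j * i)) * y ^ i))"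
  proof (intro sum.cong refl)
    fix j
    interpret d: field_hom "\<delta> ^^ (K * j)" by (rule funpow_hom)
    show "(\<delta> ^^ (K * j)) (poly p y) = (\<Sum>i\<le>degree p. Polynomial.coeff p i * (emb (\<zeta> ^ (K * j * i)) * y ^ i))"
      unfolding poly_altdef
      by (simp add: d.hom_sum d.hom_mult d.hom_power rat_funpow[OF p] funpow_y power_mult_distrib
          power_mult emb.hom_power)
  qed
  also have "\<dots> = (\<Sum>i\<le>degree p. Polynomial.coeff p i * y ^ i * emb (\<Sum>j<M. \<zeta> ^ (K * j * i)))"
    by (subst sum.swap) (simp add: sum_distrib_left emb.hom_sum mult_ac)
  also have "\<dots> = (\<Sum>i\<le>degree p. Polynomial.coeff p i * (if M dvd i then of_nat M * y ^ i else 0))"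
    unfolding geometric_sum_root_of_unity[OF KM] by (intro sum.cong) (auto simp: emb.hom_of_nat)
  also have "\<dots> \<in> U"
  proof (intro subfield_sum H subfield_mult)
    fix i
    show "Polynomial.coeff p i \<in> U" using p sub by auto
    have "of_nat M \<in> U" using sub(1) emb_rat[of "of_nat M"] by (auto simp: emb.hom_of_nat)
    moreover have "y ^ (M * j) \<in> U" for j by (subst power_mult) (rule subfield_power[OF H sub(2)])
    ultimately show "(if M dvd i then of_nat M * y ^ i else 0) \<in> U"
      by (auto elim!: dvdE intro!: subfield_mult subfield_zero H)
  qed
  finally have "of_nat M * poly p y / of_nat M \<in> U"
    using sub(1) emb_rat[of "of_nat M"] by (intro subfield_divide H) (auto simp: emb.hom_of_nat)
  moreover have "(of_nat M :: 'f) \<noteq> 0" using M emb.hom_0_iff[of "of_nat M"] by (simp add: emb.hom_of_nat)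
  ultimately show ?thesis by (simp add: U_def)
qed

definition norm :: "nat \<Rightarrow> 'f \<Rightarrow> 'f" where "norm K w = (\<Prod>i<K. (\<delta> ^^ i) w)"

lemma norm_fixed:
  assumes "w \<in> fixed K"
  shows "norm K w \<in> fixed 1"
proof -
  have "(\<delta> ^^ 1) (norm K w) = (\<Prod>i<K. (\<delta> ^^ Suc i) w)"
    by (simp add: norm_def \<delta>.hom_prod)
  also have "\<dots> = (\<Prod>i<K. (\<delta> ^^ i) w)"
  proof (cases K)
    case (Suc K')
    have "(\<Prod>i<K. (\<delta> ^^ Suc i) w) = (\<Prod>i<K'. (\<delta> ^^ Suc i) w) * (\<delta> ^^ K) w"
      unfolding Suc by simp
    also have "(\<delta> ^^ K) w = w" using assms by (simp add: fixed_def)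
    finally show ?thesis unfolding Suc by (subst prod.lessThan_Suc_shift) (simp add: mult.commute)
  qed simp
  finally show ?thesis by (simp add: fixed_def norm_def)
qed

lemma funpow_eq_0_iff: "(\<delta> ^^ i) w = 0 \<longleftrightarrow> w = 0"
proof -
  interpret field_hom "\<delta> ^^ i" by (rule funpow_hom)
  show ?thesis by simp
qed

lemma norm_eq_0_iff: "K > 0 \<Longrightarrow> norm K w = 0 \<longleftrightarrow> w = 0"
  by (auto simp: norm_def funpow_eq_0_iff)

lemma norm_mult: "norm K (v * w) = norm K v * norm K w"
proof -
  have "(\<delta> ^^ i) (v * w) = (\<delta> ^^ i) v * (\<delta> ^^ i) w" for i
  proof -
    interpret field_hom "\<delta> ^^ i" by (rule funpow_hom)
    show ?thesis by (rule hom_mult)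
  qed
  then show ?thesis by (simp add: norm_def prod.distrib)
qed

lemma norm_rat: "w \<in> rat_field \<Longrightarrow> norm K w = w ^ K"
  by (simp add: norm_def rat_funpow)

text \<open>An inverse in \<open>k(x)[y]\<close> is the product of the other conjugates divided by the norm.\<close>

lemma polynomial_representation: "\<exists>p. (\<forall>i. Polynomial.coeff p i \<in> rat_field) \<and> w = poly p y"
proof -
  let ?R = "{w. \<exists>p. (\<forall>i. Polynomial.coeff p i \<in> rat_field) \<and> w = poly p y}"
  have R: "poly p y \<in> ?R" if "\<And>i. Polynomial.coeff p i \<in> rat_field" for p using that by blast
  have mult: "v * w \<in> ?R" if vw: "v \<in> ?R" "w \<in> ?R" for v w
  proof -
    obtain p q where "\<forall>i. Polynomial.coeff p i \<in> rat_field" "v = poly p y"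
      "\<forall>i. Polynomial.coeff q i \<in> rat_field" "w = poly q y" using vw by blast
    then show ?thesis using R[of "p * q"]
      by (auto simp: coeff_mult intro!: subfield_sum subfield_rat subfield_mult)
  qed
  have const: "c \<in> ?R" if "c \<in> rat_field" for c
    using R[of "[:c:]"] that by (auto simp: coeff_pCons subfield_zero[OF subfield_rat] split: nat.splits)
  have prod: "prod h I \<in> ?R" if "\<And>i. i \<in> I \<Longrightarrow> h i \<in> ?R" for h :: "nat \<Rightarrow> 'f" and I
    using that
  proof (induction I rule: infinite_finite_induct)
    case (insert i I)
    then have "h i * prod h I \<in> ?R" by (intro mult) auto
    then show ?case using insert by simp
  next
    case empty
    have "1 \<in> ?R" by (rule const) (rule subfield_one[OF subfield_rat])
    then show ?case by simp
  next
    case infinite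
    have "1 \<in> ?R" by (rule const) (rule subfield_one[OF subfield_rat])
    then show ?case using infinite by simp
  qed
  have conj: "(\<delta> ^^ i) w \<in> ?R" if wR: "w \<in> ?R" for w i
  proof -
    interpret d: field_hom "\<delta> ^^ i" by (rule funpow_hom)
    obtain p where p: "\<forall>j. Polynomial.coeff p j \<in> rat_field" "w = poly p y" using wR by blast
    have "(\<delta> ^^ i) w = poly p ((\<delta> ^^ i) y)"
      unfolding p(2) unfolding poly_altdef
      by (simp add: d.hom_sum d.hom_mult d.hom_power rat_funpow[OF spec[OF p(1)]])
    also have "\<dots> = poly (pcompose p [:0, emb (\<zeta> ^ i):]) y"
      by (simp add: poly_pcompose funpow_y mult.commute)
    finally have "(\<delta> ^^ i) w = poly (pcompose p [:0, emb (\<zeta> ^ i):]) y" .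
    then show ?thesis
      using R[of "pcompose p [:0, emb (\<zeta> ^ i):]"] p(1)
      by (simp add: coeff_pcompose_linear subfield_mult[OF subfield_rat] subfield_power[OF subfield_rat] emb_rat)
  qed
  have "is_subfield ?R"
    unfolding is_subfield_def
  proof (intro conjI ballI)
    show "1 \<in> ?R" by (rule const) (rule subfield_one[OF subfield_rat])
    fix v w assume vw: "v \<in> ?R" "w \<in> ?R"
    show "v * w \<in> ?R" by (rule mult) fact+
    obtain p q where "\<forall>i. Polynomial.coeff p i \<in> rat_field" "v = poly p y"
      "\<forall>i. Polynomial.coeff q i \<in> rat_field" "w = poly q y" using vw by blast
    then show "v - w \<in> ?R" using R[of "p - q"] by (auto intro!: subfield_diff subfield_rat)
    show "inverse v \<in> ?R"
    proof (cases "v = 0")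
      case False
      have nR: "norm N v \<in> ?R" unfolding norm_def by (intro prod conj vw)
      obtain p where p: "\<forall>i. Polynomial.coeff p i \<in> rat_field" "norm N v = poly p y" using nR by blast
      \<comment> \<open>The norm is invariant under \<delta>, so averaging over the whole group
        leaves only powers of \<open>y ^ N\<close>, which are rational functions of x.\<close>
      have "norm N v \<in> is_subfield hull (rat_field \<union> {y ^ N})"
        using average[of 1 N p] p norm_fixed[of v N] fixed_N by auto
      also have "\<dots> \<subseteq> rat_field" by (rule hull_minimal) (use subfield_rat y_power_rat in auto)
      finally have n: "norm N v \<in> rat_field" .
      have "norm N v = v * (\<Prod>i<N - 1. (\<delta> ^^ Suc i) v)"
        unfolding norm_def using N_pos by (cases N) (simp_all only: prod.lessThan_Suc_shift, auto)
      then have "inverse v = (\<Prod>i<N - 1. (\<delta> ^^ Suc i) v) * inverse (norm N v)"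
        using False norm_eq_0_iff[OF N_pos, of v] by (simp add: field_simps)
      also have "\<dots> \<in> ?R" by (intro mult prod conj vw const subfield_inverse subfield_rat n)
      finally show ?thesis .
    qed (use const[of 0] subfield_zero[OF subfield_rat] in auto)
  qed
  moreover have "y \<in> ?R"
    using R[of "[:0, 1:]"] by (auto simp: coeff_pCons subfield_zero subfield_one subfield_rat split: nat.splits)
  ultimately have "is_subfield hull (range emb \<union> {x, y}) \<subseteq> ?R"
    using const emb_rat x_rat by (intro hull_minimal) auto
  then show ?thesis using generated by blast
qed

lemma fixed_eq_hull:
  assumes KM: "K * M = N"
  shows "fixed K = is_subfield hull (range emb \<union> {x, y ^ M})"
proof
  let ?H = "is_subfield hull (range emb \<union> {x, y ^ M})"
  have "rat_field \<subseteq> ?H" unfolding rat_field_def by (rule hull_mono) auto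
  then have "is_subfield hull (rat_field \<union> {y ^ M}) \<subseteq> ?H"
    using hull_subset[of "range emb \<union> {x, y ^ M}" is_subfield] is_subfield_hull
    by (intro hull_minimal) (auto simp del: insert_is_Un)
  then show "fixed K \<subseteq> ?H"
  proof (intro subsetI)
    fix w assume "w \<in> fixed K"
    moreover obtain p where "\<And>i. Polynomial.coeff p i \<in> rat_field" "w = poly p y"
      using polynomial_representation by blast
    ultimately have "w \<in> is_subfield hull (rat_field \<union> {y ^ M})" using average[OF KM] by blast
    then show "w \<in> ?H" using \<open>is_subfield hull (rat_field \<union> {y ^ M}) \<subseteq> ?H\<close> by blast
  qed
  have "(\<delta> ^^ K) (y ^ M) = y ^ M"
  proof -
    interpret d: field_hom "\<delta> ^^ K" by (rule funpow_hom)
    show ?thesis using KM by (simp add: d.hom_power funpow_y power_mult_distrib primitive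
      flip: emb.hom_power power_mult)
  qed
  then show "?H \<subseteq> fixed K"
    using subfield_fixed[of K] emb_fixed x_fixed by (intro hull_minimal) (auto simp: fixed_def)
qed

lemma fixed_1: "fixed 1 = rat_field"
proof
  have eq: "fixed 1 = is_subfield hull (range emb \<union> {x, y ^ N})" by (rule fixed_eq_hull) simp
  show "fixed 1 \<subseteq> rat_field"
    unfolding eq by (rule hull_minimal) (use subfield_rat emb_rat x_rat y_power_rat in auto)
qed (rule rat_fixed)

lemma norm_in_rat: "w \<in> fixed K \<Longrightarrow> norm K w \<in> rat_field"
  using norm_fixed fixed_1 by auto

text \<open>Hilbert 90: some power of \<open>y\<close> has a nonzero Lagrange resolvent.\<close>

lemma hilbert90:
  assumes KM: "K * M = N" and u: "u \<in> fixed K" "norm K u = 1"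
  shows "\<exists>h\<in>fixed K. h \<noteq> 0 \<and> u * \<delta> h = h"
proof -
  have K: "K > 0" and M: "M > 0" using KM N_pos by (cases K; cases M; auto)+
  have norm_Suc: "u * \<delta> (norm i u) = norm (Suc i) u" for i
    unfolding norm_def by (subst prod.lessThan_Suc_shift) (simp add: \<delta>.hom_prod)
  \<comment> \<open>The Lagrange resolvent of \<theta>. The coefficients \<open>norm i u\<close>
    form the cocycle generated by \<open>u\<close>, which closes up after \<open>K\<close> steps
    because \<open>norm K u = 1\<close>.\<close>
  define r where "r = (\<lambda>\<theta>. \<Sum>i<K. norm i u * (\<delta> ^^ i) \<theta>)"
  have res: "u * \<delta> (r \<theta>) = r \<theta>" if "\<theta> \<in> fixed K" for \<theta>
  proof -
    have "u * \<delta> (r \<theta>) = (\<Sum>i<K. norm (Suc i) u * (\<delta> ^^ Suc i) \<theta>)"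
      by (simp add: r_def \<delta>.hom_sum \<delta>.hom_mult sum_distrib_left norm_Suc flip: mult.assoc)
    also have "\<dots> = (\<Sum>i<Suc K. norm i u * (\<delta> ^^ i) \<theta>) - norm 0 u * (\<delta> ^^ 0) \<theta>"
      by (subst sum.lessThan_Suc_shift) simp
    also have "\<dots> = r \<theta>" using u that by (simp add: r_def norm_def fixed_def)
    finally show ?thesis .
  qed
  have rfix: "r \<theta> \<in> fixed K" if "\<theta> \<in> fixed K" for \<theta>
    unfolding r_def norm_def
    by (intro subfield_sum subfield_mult subfield_prod subfield_fixed fixed_funpow u that)
  have z: "y ^ M \<in> fixed K"
    unfolding fixed_eq_hull[OF KM] using hull_subset[of "range emb \<union> {x, y ^ M}" is_subfield] by auto
  \<comment> \<open>If \<open>y\<close> vanished, the monomial of degree 1 would be a multiple of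
    the equation, which has degree \<open>N\<close> in y; so \<open>N = 1\<close>.\<close>
  have "y \<noteq> 0 \<or> K = 1"
  proof (rule ccontr)
    assume a: "\<not> (y \<noteq> 0 \<or> K = 1)"
    then have "emb \<zeta> * y = y" by simp
    then have "\<delta> = id" using a by (intro hom_eqI[OF \<delta>]) (auto simp: \<delta>_emb \<delta>_x, unfold_locales, auto)
    have "bieval emb x y (Polynomial.monom 1 1) = 0" using a by (simp add: bieval_monom[OF emb_comm_ring])
    then obtain q where q: "Polynomial.monom 1 1 = (Polynomial.monom 1 N - [:f:]) * q"
      unfolding kernel dvd_def by blast
    have q0: "q \<noteq> 0" "Polynomial.monom 1 N - [:f:] \<noteq> 0" using q by auto
    have "degree (Polynomial.monom 1 N - [:f:]) \<ge> N"
      using N_pos by (intro le_degree) (auto simp: coeff_pCons split: nat.splits)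
    moreover have "1 = degree (Polynomial.monom 1 N - [:f:]) + degree q"
      using arg_cong[OF q, of degree] degree_mult_eq[OF q0(2,1)] by (simp add: degree_monom_eq)
    ultimately have "N \<le> 1" by simp
    with KM a K M show False by (cases K; cases M; auto)
  qed
  then consider "K = 1" | "y \<noteq> 0" by blast
  then show ?thesis
  proof cases
    case 1
    then have "\<delta> 1 = 1" "u = 1" using u by (auto simp: norm_def \<delta>.hom_one)
    then show ?thesis using subfield_one[OF subfield_fixed] by (intro bexI[of _ 1]) auto
  next
    case y0: 2
    have "\<exists>j. r ((y ^ M) ^ j) \<noteq> 0"
    proof (rule ccontr)
      assume "\<not> ?thesis"
      then have r0: "r ((y ^ M) ^ j) = 0" for j by auto
      have a: "(\<Sum>i<K. norm i u * emb (\<zeta> ^ (M * j * i))) = 0" for j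
      proof -
        have "r ((y ^ M) ^ j) = (\<Sum>i<K. norm i u * emb (\<zeta> ^ (M * j * i))) * (y ^ M) ^ j"
          unfolding r_def sum_distrib_right
        proof (intro sum.cong refl)
          fix i
          interpret d: field_hom "\<delta> ^^ i" by (rule funpow_hom)
          have "(\<delta> ^^ i) ((y ^ M) ^ j) = emb (\<zeta> ^ (M * j * i)) * (y ^ M) ^ j"
            by (simp add: d.hom_power funpow_y power_mult_distrib emb.hom_power mult_ac flip: power_mult)
          then show "norm i u * (\<delta> ^^ i) ((y ^ M) ^ j) = norm i u * emb (\<zeta> ^ (M * j * i)) * (y ^ M) ^ j"
            by simp
        qed
        then show ?thesis using r0[of j] y0 by simp
      qed
      \<comment> \<open>Summing the vanishing coefficients over \<open>j\<close> isolates the term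
        \<open>i = 0\<close> by orthogonality of the roots of unity, and that term contributes
        \<open>K\<close>.\<close>
      have "0 = (\<Sum>j<K. \<Sum>i<K. norm i u * emb (\<zeta> ^ (M * j * i)))" by (simp only: a) simp
      also have "\<dots> = (\<Sum>i<K. norm i u * emb (\<Sum>j<K. \<zeta> ^ (M * j * i)))"
        by (subst sum.swap) (simp add: sum_distrib_left emb.hom_sum)
      also have "\<dots> = (\<Sum>i<K. if i = 0 then of_nat K else 0)"
        using geometric_sum_root_of_unity[of M K] KM
        by (intro sum.cong) (auto simp: norm_def emb.hom_of_nat mult.commute dest: dvd_imp_le)
      also have "\<dots> = of_nat K" using K by simp
      finally show False using K emb.hom_0_iff[of "of_nat K"] by (simp add: emb.hom_of_nat)
    qed
    then obtain j where "r ((y ^ M) ^ j) \<noteq> 0" by blast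
    then show ?thesis using res rfix z subfield_power[OF subfield_fixed z]
      by (intro bexI[of _ "r ((y ^ M) ^ j)"]) auto
  qed
qed

end

section \<open>Tsen's theorem for x - a, by means of a module over the function field\<close>

lemma underdetermined_system:
  fixes c :: "nat \<Rightarrow> nat \<Rightarrow> 'r::idom"
  shows "\<exists>v. (\<exists>j\<le>N. v j \<noteq> 0) \<and> (\<forall>r<N. (\<Sum>j\<le>N. v j * c j r) = 0)"
proof -
  \<comment> \<open>A row of zeros makes the matrix square and visibly singular: the last unit
    vector is killed by the transpose.\<close>
  define A where "A = mat (Suc N) (Suc N) (\<lambda>(r, j). if r < N then c j r else 0)"
  have A: "A \<in> carrier_mat (Suc N) (Suc N)" by (simp add: A_def)
  have "transpose_mat A *\<^sub>v unit_vec (Suc N) N = 0\<^sub>v (Suc N)"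
  proof (rule eq_vecI)
    fix i assume "i < dim_vec (0\<^sub>v (Suc N) :: 'r vec)"
    then show "(transpose_mat A *\<^sub>v unit_vec (Suc N) N) $ i = 0\<^sub>v (Suc N) $ i"
      using A by (simp add: scalar_prod_right_unit[of _ "Suc N"]) (simp add: A_def)
  qed (use A in auto)
  moreover have "unit_vec (Suc N) N \<noteq> (0\<^sub>v (Suc N) :: 'r vec)" by (simp add: unit_vec_nonzero)
  ultimately have "\<exists>v. v \<in> carrier_vec (Suc N) \<and> v \<noteq> 0\<^sub>v (Suc N) \<and> transpose_mat A *\<^sub>v v = 0\<^sub>v (Suc N)"
    by (intro exI[of _ "unit_vec (Suc N) N"]) auto
  then have "det (transpose_mat A) = 0"
    using det_0_iff_vec_prod_zero[of "transpose_mat A" "Suc N"] A by auto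
  then have "det A = 0" using det_transpose[OF A] by simp
  then obtain v where v: "v \<in> carrier_vec (Suc N)" "v \<noteq> 0\<^sub>v (Suc N)" "A *\<^sub>v v = 0\<^sub>v (Suc N)"
    using det_0_iff_vec_prod_zero[OF A] by auto
  have "\<exists>j\<le>N. v $ j \<noteq> 0"
  proof (rule ccontr)
    assume "\<not> ?thesis"
    then have "v = 0\<^sub>v (Suc N)" using v(1) by (intro eq_vecI) auto
    with v show False by simp
  qed
  moreover have "(\<Sum>j\<le>N. v $ j * c j r) = 0" if r: "r < N" for r
  proof -
    have "0 = (A *\<^sub>v v) $ r" using v(3) r by simp
    also have "\<dots> = (\<Sum>j<Suc N. (if r < N then c j r else 0) * v $ j)"
      using A v(1) r unfolding index_mult_mat_vec[of r A v, OF r[THEN less_SucI, folded carrier_matD(1)[OF A]]]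
      by (auto simp: scalar_prod_def A_def lessThan_atLeast0 intro!: sum.cong)
    finally show ?thesis using r by (simp add: lessThan_Suc_atMost mult.commute)
  qed
  ultimately show ?thesis by (intro exI[of _ "\<lambda>j. v $ j"]) auto
qed

text \<open>
  With \<open>x = T\<^sup>N + a\<close>, the polynomial ring in \<open>T\<close> is a free module of rank \<open>N\<close> over the polynomial
  ring in \<open>x\<close>. Given a polynomial \<open>z\<close> in \<open>T\<close> with norm \<open>f(x)\<close>, the operator
  \<open>p(T) \<mapsto> z(T) p(\<omega>T)\<close> satisfies the equation of \<open>y\<close>, and it commutes with multiplication by \<open>T\<close>
  up to the root of unity \<open>\<omega>\<close>.
\<close>

locale twisted_module =
  fixes a \<omega> :: "'a::{alg_closed_field,field_char_0}" and N :: nat and z :: "'a poly"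
begin

definition base_change :: "'a poly \<Rightarrow> 'a poly" where
  "base_change c = pcompose c (Polynomial.monom 1 N + [:a:])"

definition twist_op :: "'a poly \<Rightarrow> 'a poly" where "twist_op p = z * pcompose p [:0, \<omega>:]"

text \<open>Horner's scheme for the operator obtained from \<open>G\<close> by putting
  \<open>twist_op\<close> for y and multiplication by \<open>base_change c\<close> for a coefficient
  \<open>c\<close>, applied to \<open>p\<close>.\<close>

definition act :: "'a poly poly \<Rightarrow> 'a poly \<Rightarrow> 'a poly" where
  "act G p = fold_coeffs (\<lambda>c h. base_change c * p + twist_op h) G 0"

lemma base_change_simps:
  "base_change 0 = 0" "base_change 1 = 1"
  "base_change (c + d) = base_change c + base_change d"
  "base_change (c * d) = base_change c * base_change d"
  by (simp_all add: base_change_def pcompose_add pcompose_mult)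

lemma twist_op_simps:
  "twist_op 0 = 0" "twist_op (p + q) = twist_op p + twist_op q"
  by (simp_all add: twist_op_def pcompose_add algebra_simps)

lemma act_0: "act 0 p = 0"
  by (simp add: act_def)

lemma act_pCons: "act (pCons c G) p = base_change c * p + twist_op (act G p)"
  by (cases "c = 0 \<and> G = 0") (auto simp: act_def base_change_simps twist_op_simps)

lemma act_zero_right: "act G 0 = 0"
  by (induction G) (auto simp: act_0 act_pCons twist_op_simps)

lemma act_const: "act [:c:] p = base_change c * p"
  by (simp add: act_pCons act_0 twist_op_simps)

lemma act_add: "act (G + H) p = act G p + act H p"
  by (induction G H rule: poly_induct2)
     (auto simp: act_0 act_pCons base_change_simps twist_op_simps algebra_simps)

lemma act_minus: "act (G - H) p = act G p - act H p"
  using act_add[of "G - H" H p] by (simp add: algebra_simps)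

lemma act_sum: "act (sum h I) p = (\<Sum>i\<in>I. act (h i) p)"
  by (induction I rule: infinite_finite_induct) (auto simp: act_0 act_add)

lemma act_one: "act 1 p = p"
  using act_const[of 1 p] by (simp add: base_change_simps pCons_one)

lemma act_monom: "act (Polynomial.monom c i) p = base_change c * (twist_op ^^ i) p"
  if "\<And>c p. twist_op (base_change c * p) = base_change c * twist_op p"
  by (induction i) (auto simp: monom_0 monom_Suc act_0 act_const act_pCons base_change_simps twist_op_simps that)

end

locale norm_module = twisted_module a \<omega> N z for a \<omega> N z +
  fixes f :: "'a::{alg_closed_field,field_char_0} poly" and \<zeta> :: 'a
  assumes N: "N > 0" and root: "\<omega> ^ N = 1" and inverse_root: "\<omega> * \<zeta> = 1"
    and norm: "(\<Prod>j<N. pcompose z [:0, \<omega> ^ j:]) = pcompose f (Polynomial.monom 1 N + [:a:])"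
begin

lemma base_change_twist: "pcompose (base_change c) [:0, \<omega>:] = base_change c"
proof -
  have "pcompose (Polynomial.monom 1 N) [:0, \<omega>:] = Polynomial.monom 1 N"
    by (rule poly_eqI) (auto simp: coeff_pcompose_linear root)
  then show ?thesis
    unfolding base_change_def pcompose_assoc[symmetric] by (simp add: pcompose_add pcompose_const)
qed

lemma twist_op_base_change: "twist_op (base_change c * p) = base_change c * twist_op p"
  by (simp add: twist_op_def pcompose_mult base_change_twist)

lemma act_base_change: "act G (base_change c * p) = base_change c * act G p"
  by (induction G) (auto simp: act_0 act_pCons twist_op_base_change algebra_simps)

lemma act_smult: "act (Polynomial.smult c G) p = base_change c * act G p"
  by (induction G) (auto simp: act_0 act_pCons base_change_simps twist_op_base_change algebra_simps)

lemma act_mult: "act (G * H) p = act G (act H p)"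
  by (induction G) (auto simp: act_0 act_pCons act_add act_smult base_change_simps)

text \<open>Multiplication by T thus realises the deck transformation y \<mapsto> \<zeta> y on the
  operators; this holds because \<open>twist_op\<close> substitutes \<open>\<omega>\<close> T for T
  and \<open>\<omega>\<close> is inverse to \<open>\<zeta>\<close>.\<close>

lemma twist_op_shift: "[:0, 1:] * act G p = act (pcompose G [:0, [:\<zeta>:]:]) ([:0, 1:] * p)"
proof (induction G)
  case (pCons c G)
  have T: "[:0, 1:] * twist_op h = Polynomial.smult \<zeta> (twist_op ([:0, 1:] * h))" for h
  proof -
    have "twist_op ([:0, 1:] * h) = Polynomial.smult \<omega> ([:0, 1:] * twist_op h)"
      by (simp add: twist_op_def pcompose_mult pcompose_pCons)
    then show ?thesis using inverse_root by (simp add: mult.commute)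
  qed
  have b: "base_change [:\<zeta>:] = [:\<zeta>:]" by (simp add: base_change_def pcompose_const)
  have "act (pcompose (pCons c G) [:0, [:\<zeta>:]:]) ([:0, 1:] * p) =
      base_change c * ([:0, 1:] * p) + base_change [:\<zeta>:] * twist_op (act (pcompose G [:0, [:\<zeta>:]:]) ([:0, 1:] * p))"
  proof -
    have "pcompose (pCons c G) [:0, [:\<zeta>:]:] = pCons c (Polynomial.smult [:\<zeta>:] (pcompose G [:0, [:\<zeta>:]:]))"
      by (simp add: pcompose_pCons)
    then show ?thesis by (simp only: act_pCons act_smult twist_op_base_change)
  qed
  also have "\<dots> = [:0, 1:] * act (pCons c G) p"
    unfolding b pCons.IH[symmetric] using T[of "act G p"] by (simp add: act_pCons algebra_simps)
  finally show ?case ..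
qed (simp add: act_0)

lemma pcompose_pCons_0_1: "pcompose q (pCons 0 1) = q"
  using pcompose_idR[of q] by (simp only: one_pCons)

lemma twist_op_funpow: "(twist_op ^^ i) p = (\<Prod>j<i. pcompose z [:0, \<omega> ^ j:]) * pcompose p [:0, \<omega> ^ i:]"
proof (induction i)
  case (Suc i)
  have c: "pcompose (pcompose q [:0, \<omega> ^ j:]) [:0, \<omega>:] = pcompose q [:0, \<omega> ^ Suc j:]" for q j
    by (simp add: pcompose_assoc[symmetric] pcompose_pCons mult.commute)
  have "pcompose (\<Prod>j<i. pcompose z [:0, \<omega> ^ j:]) [:0, \<omega>:] = (\<Prod>j<i. pcompose z [:0, \<omega> ^ Suc j:])"
    by (simp add: pcompose_prod c del: power_Suc)
  then have "(twist_op ^^ Suc i) p = (z * (\<Prod>j<i. pcompose z [:0, \<omega> ^ Suc j:])) * pcompose p [:0, \<omega> ^ Suc i:]"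
    by (simp add: Suc twist_op_def pcompose_mult c mult.assoc del: power_Suc)
  also have "z * (\<Prod>j<i. pcompose z [:0, \<omega> ^ Suc j:]) = (\<Prod>j<Suc i. pcompose z [:0, \<omega> ^ j:])"
    by (subst prod.lessThan_Suc_shift) (simp add: pcompose_pCons_0_1 del: power_Suc)
  finally show ?case .
qed (simp add: pcompose_pCons_0_1)

lemma act_equation: "act (Polynomial.monom 1 N - [:f:]) p = 0"
  by (simp add: act_minus act_const act_monom[OF twist_op_base_change] base_change_simps twist_op_funpow root pcompose_pCons_0_1)
     (simp add: norm base_change_def)

lemma base_change_eq_0: "base_change c = 0 \<Longrightarrow> c = 0"
proof -
  have "degree (Polynomial.monom 1 N + [:a:]) = N"
    using N by (intro order.antisym degree_le le_degree) (auto simp: coeff_pCons split: nat.splits)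
  then show "base_change c = 0 \<Longrightarrow> c = 0" using N by (auto simp: base_change_def pcompose_eq_0_iff)
qed

text \<open>The annihilator of 1 is an ideal containing the equation but no nonzero polynomial in x
  alone. Hence 1 spans a copy of the coordinate ring of the curve, which has the same rank
  \<open>N\<close> over k[x] as the whole module.\<close>

lemma act_one_eq_0:
  assumes "Factorial_Ring.irreducible (Polynomial.monom 1 N - [:f:])" "act G 1 = 0"
  shows "(Polynomial.monom 1 N - [:f:]) dvd G"
  by (rule ideal_generated_by_irreducible[OF refl assms(1) N, of "{G. act G 1 = 0}"])
     (use assms act_equation[of 1] in \<open>auto simp: act_minus act_mult act_zero_right act_const dest: base_change_eq_0\<close>)

lemma coordinates: "\<exists>c. p = (\<Sum>r<N. base_change (c r) * [:0, 1:] ^ r)"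
proof (induction p)
  case 0
  show ?case by (rule exI[of _ "\<lambda>_. 0"]) (simp add: base_change_simps)
next
  case (pCons b p)
  then obtain c where c: "p = (\<Sum>r<N. base_change (c r) * [:0, 1:] ^ r)" by blast
  obtain N' where N': "N = Suc N'" using N by (cases N) auto
  have TN: "[:0, 1:] ^ N = base_change [:- a, 1:]"
    by (simp add: base_change_def pcompose_pCons monom_altdef)
  define d where "d = (\<lambda>r. if r = 0 then [:b:] + [:- a, 1:] * c N' else c (r - 1))"
  have "pCons b p = [:b:] + [:0, 1:] * p" by simp
  also have "[:0, 1:] * p = (\<Sum>r<N'. base_change (c r) * [:0, 1:] ^ Suc r) + base_change (c N') * [:0, 1:] ^ N"
    unfolding c N' by (simp add: sum_distrib_left algebra_simps)
  also have "[:b:] + \<dots> = (\<Sum>r<N. base_change (d r) * [:0, 1:] ^ r)"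
  proof -
    have shift: "(\<Sum>r<N. g r) = g 0 + (\<Sum>r<N'. g (Suc r))" for g :: "nat \<Rightarrow> 'a poly"
      unfolding N' by (rule sum.lessThan_Suc_shift)
    have "base_change [:b:] = [:b:]" by (simp add: base_change_def pcompose_const)
    then show ?thesis unfolding TN shift
      by (simp add: d_def base_change_simps(3,4) mult.commute del: mult_pCons_left mult_pCons_right)
  qed
  finally show ?case by blast
qed

lemma linear_dependence:
  "\<exists>v. (\<exists>j\<le>N. v j \<noteq> 0) \<and> (\<Sum>j\<le>N. base_change (v j) * u j) = 0"
proof -
  have "\<forall>j. \<exists>c. u j = (\<Sum>r<N. base_change (c r) * [:0, 1:] ^ r)" using coordinates by blast
  from choice[OF this] obtain c where c: "\<And>j. u j = (\<Sum>r<N. base_change (c j r) * [:0, 1:] ^ r)"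
    by blast
  obtain v where v: "\<exists>j\<le>N. v j \<noteq> 0" "\<And>r. r < N \<Longrightarrow> (\<Sum>j\<le>N. v j * c j r) = 0"
    using underdetermined_system[of N c] by blast
  have bs: "base_change (sum h I) = (\<Sum>i\<in>I. base_change (h i))" for h :: "nat \<Rightarrow> 'a poly" and I
    by (induction I rule: infinite_finite_induct) (auto simp: base_change_simps)
  have "(\<Sum>j\<le>N. base_change (v j) * u j) = (\<Sum>r<N. base_change (\<Sum>j\<le>N. v j * c j r) * [:0, 1:] ^ r)"
    unfolding bs c sum_distrib_left sum_distrib_right
    by (subst sum.swap) (simp add: base_change_simps mult.assoc)
  also have "\<dots> = 0" using v by (simp add: base_change_simps)
  finally show ?thesis using v by blast
qed

text \<open>The \<open>N\<close> vectors \<open>y^j 1\<close> with \<open>j < N\<close>, together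
  with T, are too many for a module of rank \<open>N\<close>, so \<open>q T = G 1\<close> for some
  \<open>G\<close> and \<open>q\<close>. Each further conjugate of \<open>G\<close> can be moved
  past T by the commutation rule, so the product of all conjugates sends 1 to \<open>q ^ N\<close>
  times \<open>T ^ N\<close>, and \<open>T ^ N\<close> is x - a.\<close>

lemma norm_identity:
  assumes irr: "Factorial_Ring.irreducible (Polynomial.monom 1 N - [:f:])"
  shows "\<exists>G q. q \<noteq> 0 \<and>
    (Polynomial.monom 1 N - [:f:]) dvd (\<Prod>j<N. pcompose G [:0, [:\<zeta> ^ j:]:]) - [:q ^ N * [:- a, 1:]:]"
proof -
  define T where "T = ([:0, 1:] :: 'a poly)"
  define u where "u = (\<lambda>j. if j < N then act (Polynomial.monom 1 j) 1 else T)"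
  obtain v where v: "\<exists>j\<le>N. v j \<noteq> 0" "(\<Sum>j\<le>N. base_change (v j) * u j) = 0"
    using linear_dependence[of u] by blast
  define q where "q = v N"
  define G where "G = - (\<Sum>j<N. Polynomial.monom (v j) j)"
  have "act (\<Sum>j<N. Polynomial.monom (v j) j) 1 = (\<Sum>j<N. base_change (v j) * u j)"
    unfolding act_sum by (intro sum.cong) (auto simp: u_def act_monom[OF twist_op_base_change] base_change_simps)
  then have "act G 1 + (\<Sum>j<N. base_change (v j) * u j) = 0"
    using act_minus[of 0 "\<Sum>j<N. Polynomial.monom (v j) j" 1] by (simp add: G_def act_0)
  moreover have "base_change q * T + (\<Sum>j<N. base_change (v j) * u j) = 0"
    using v(2) by (simp add: q_def u_def lessThan_Suc_atMost[symmetric] add.commute)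
  ultimately have G: "act G 1 = base_change q * T" by (metis add_right_cancel)
  \<comment> \<open>Otherwise the relation involves only the vectors \<open>y^j 1\<close> and yields
    a multiple of the equation of degree below \<open>N\<close> in y.\<close>
  have "q \<noteq> 0"
  proof
    assume "q = 0"
    then have "(Polynomial.monom 1 N - [:f:]) dvd G"
      using G by (intro act_one_eq_0 irr) (simp add: base_change_simps)
    moreover have "degree (Polynomial.monom 1 N - [:f:]) \<ge> N"
      using N by (intro le_degree) (auto simp: coeff_pCons split: nat.splits)
    moreover have "degree G < N" unfolding G_def degree_minus
      using N by (intro degree_lessI) (auto simp: coeff_sum)
    ultimately have "G = 0" using dvd_imp_degree_le by (metis le_trans not_less)
    have "v j = 0" if "j < N" for j
      using arg_cong[OF \<open>G = 0\<close>, of "\<lambda>G. Polynomial.coeff G j"] that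
      by (simp add: G_def coeff_sum if_distrib cong: if_cong)
    with \<open>q = 0\<close> v(1) show False by (auto simp: q_def le_less)
  qed
  define R where "R = (\<lambda>i. \<Prod>j<i. pcompose G [:0, [:\<zeta> ^ j:]:])"
  have R: "act (R i) 1 = base_change (q ^ i) * T ^ i" for i
  proof (induction i)
    case 0
    then show ?case by (simp add: R_def act_one base_change_simps)
  next
    case (Suc i)
    have pc: "pcompose (pcompose G [:0, [:\<zeta> ^ j:]:]) [:0, [:\<zeta>:]:] = pcompose G [:0, [:\<zeta> ^ Suc j:]:]" for j
      by (simp add: pcompose_assoc[symmetric] pcompose_pCons mult.commute)
    have "R (Suc i) = pcompose (R i) [:0, [:\<zeta>:]:] * G"
      unfolding R_def by (subst prod.lessThan_Suc_shift) (simp add: pcompose_prod pc pcompose_pCons_0_1 mult.commute del: power_Suc)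
    then have "act (R (Suc i)) 1 = act (pcompose (R i) [:0, [:\<zeta>:]:]) (base_change q * T)"
      by (simp add: act_mult G)
    also have "\<dots> = base_change q * act (pcompose (R i) [:0, [:\<zeta>:]:]) T" by (rule act_base_change)
    also have "act (pcompose (R i) [:0, [:\<zeta>:]:]) T = T * act (R i) 1"
      using twist_op_shift[of "R i" 1] by (simp only: T_def mult_1_right)
    also have "base_change q * (T * act (R i) 1) = base_change (q ^ Suc i) * T ^ Suc i"
      by (simp add: Suc base_change_simps mult_ac)
    finally show ?case .
  qed
  have "T ^ N = base_change [:- a, 1:]"
    by (simp add: T_def base_change_def pcompose_pCons monom_altdef)
  then have "act (R N - [:q ^ N * [:- a, 1:]:]) 1 = 0"
    by (simp only: act_minus act_const R base_change_simps mult_1_right) simp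
  then have "(Polynomial.monom 1 N - [:f:]) dvd R N - [:q ^ N * [:- a, 1:]:]" by (rule act_one_eq_0[OF irr])
  with \<open>q \<noteq> 0\<close> show ?thesis unfolding R_def by blast
qed

end

text \<open>It suffices to treat constants and linear factors. With \<open>b ^ N = r - a\<close> the
  factor x - r becomes \<open>T ^ N - b ^ N\<close>, the product of the conjugates of b - T up to a
  sign, and the sign is absorbed by \<open>d\<close> with \<open>d ^ N = - 1\<close>.\<close>

lemma polynomial_norm_exists:
  fixes f :: "'a::{alg_closed_field,field_char_0} poly"
  assumes N: "N > 0" and w: "\<omega> ^ N = 1" "inj_on (\<lambda>i. \<omega> ^ i) {..<N}"
  shows "\<exists>z. (\<Prod>j<N. pcompose z [:0, \<omega> ^ j:]) = pcompose f (Polynomial.monom 1 N + [:a:])"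
proof -
  let ?X = "Polynomial.monom 1 N + [:a:]"
  let ?P = "\<lambda>f. \<exists>z. (\<Prod>j<N. pcompose z [:0, \<omega> ^ j:]) = pcompose f ?X"
  have mult: "?P (g * h)" if gh: "?P g" "?P h" for g h
  proof -
    obtain u v where "(\<Prod>j<N. pcompose u [:0, \<omega> ^ j:]) = pcompose g ?X"
      "(\<Prod>j<N. pcompose v [:0, \<omega> ^ j:]) = pcompose h ?X" using gh by blast
    then show ?thesis by (intro exI[of _ "u * v"]) (simp add: pcompose_mult prod.distrib)
  qed
  have const: "?P [:c:]" for c
  proof -
    obtain d where "d ^ N = c" using nth_root_exists[OF N] by blast
    then show ?thesis by (intro exI[of _ "[:d:]"]) (simp add: pcompose_const poly_const_pow)
  qed
  have linear: "?P [:- r, 1:]" for r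
  proof -
    obtain b d where b: "b ^ N = r - a" and d: "d ^ N = (- 1 :: 'a)" using nth_root_exists[OF N] by metis
    have inj: "inj_on (\<lambda>i. [:\<omega>:] ^ i) {..<N}" using w(2) by (auto simp: inj_on_def poly_const_pow)
    have "(\<Prod>j<N. pcompose (Polynomial.smult d [:b, - 1:]) [:0, \<omega> ^ j:]) =
        (\<Prod>j<N. [:d:] * ([:b:] - [:\<omega>:] ^ j * [:0, 1:]))"
      by (intro prod.cong refl) (simp add: pcompose_pCons pcompose_smult poly_const_pow)
    also have "\<dots> = [:d:] ^ N * ([:b:] ^ N - [:0, 1:] ^ N)"
      unfolding prod.distrib using prod_roots_of_unity[OF N _ inj, of "[:b:]" "[:0, 1:]"] w(1)
      by (simp add: poly_const_pow)
    also have "\<dots> = pcompose [:- r, 1:] ?X"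
      by (simp add: poly_const_pow b d pcompose_pCons monom_altdef)
    finally show ?thesis by blast
  qed
  show ?thesis
  proof (cases "f = 0")
    case True
    then show ?thesis using const[of 0] by simp
  next
    case False
    then obtain A where A: "f = Polynomial.smult (lead_coeff f) (\<Prod>r\<in>#A. [:- r, 1:])"
      using alg_closed_imp_factorization by blast
    have "?P (\<Prod>r\<in>#A. [:- r, 1:])"
    proof (induction A)
      case empty
      show ?case using const[of 1] by simp
    next
      case (add r A)
      then have "?P ([:- r, 1:] * (\<Prod>r\<in>#A. [:- r, 1:]))" by (intro mult linear)
      then show ?case by (simp only: image_mset_add_mset prod_mset.add_mset)
    qed
    then have "?P ([:lead_coeff f:] * (\<Prod>r\<in>#A. [:- r, 1:]))" by (intro mult const)
    then show ?thesis using A by simp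
  qed
qed

text \<open>In the function field, \<open>norm_identity\<close> says that the norm of
  \<open>G\<close> is \<open>q ^ N\<close> times x - a. Since \<open>q\<close> is rational its norm
  is \<open>q ^ N\<close>, so the quotient has norm x - a.\<close>

lemma (in kummer_cover) linear_polynomial_is_norm: "\<exists>g. norm N g = x - emb a"
proof -
  define \<omega> where "\<omega> = \<zeta> ^ (N - 1)"
  have inv: "\<omega> * \<zeta> = 1" using N_pos primitive_power by (simp add: \<omega>_def flip: power_Suc2)
  have "\<omega> ^ i = inverse (\<zeta> ^ i)" for i using inv primitive_neq_0
    by (metis inverse_unique mult.commute power_inverse)
  then have w: "\<omega> ^ N = 1" "inj_on (\<lambda>i. \<omega> ^ i) {..<N}"
    using primitive_power primitive_inj by (auto simp: inj_on_def)
  obtain z where z: "(\<Prod>j<N. pcompose z [:0, \<omega> ^ j:]) = pcompose f (Polynomial.monom 1 N + [:a:])"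
    using polynomial_norm_exists[OF N_pos w] by blast
  interpret norm_module a \<omega> N z f \<zeta>
    by unfold_locales (use N_pos w inv z in auto)
  obtain G q where G: "q \<noteq> 0"
    "(Polynomial.monom 1 N - [:f:]) dvd (\<Prod>j<N. pcompose G [:0, [:\<zeta> ^ j:]:]) - [:q ^ N * [:- a, 1:]:]"
    using norm_identity[OF irreducible] by blast
  interpret b: comm_ring_hom "bieval emb x y" by (rule comm_ring_hom_bieval[OF emb_comm_ring])
  interpret p: comm_ring_hom "\<lambda>p. poly (map_poly emb p) x" by (rule comm_ring_hom_eval[OF emb_comm_ring])
  define qx where "qx = poly (map_poly emb q) x"
  have qx: "qx \<noteq> 0" "qx \<in> rat_field" using G(1) transcendental poly_rat by (auto simp: qx_def)
  have conj: "bieval emb x y (pcompose G [:0, [:\<zeta> ^ j:]:]) = (\<delta> ^^ j) (bieval emb x y G)" for j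
  proof (induction G)
    case 0
    interpret d: field_hom "\<delta> ^^ j" by (rule funpow_hom)
    show ?case by (simp add: b.hom_zero)
  next
    case (pCons c G)
    interpret d: field_hom "\<delta> ^^ j" by (rule funpow_hom)
    have e: "pCons c H = [:c:] + Polynomial.monom 1 1 * H" for H :: "'a poly poly"
      by (simp add: monom_altdef)
    have "pcompose (pCons c G) [:0, [:\<zeta> ^ j:]:] = [:c:] + Polynomial.monom 1 1 * ([:[:\<zeta> ^ j:]:] * pcompose G [:0, [:\<zeta> ^ j:]:])"
      by (simp add: pcompose_pCons monom_altdef)
    then have "bieval emb x y (pcompose (pCons c G) [:0, [:\<zeta> ^ j:]:]) =
       poly (map_poly emb c) x + y * (emb (\<zeta> ^ j) * (\<delta> ^^ j) (bieval emb x y G))"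
      using pCons.IH by (simp only: b.hom_add b.hom_mult bieval_const[OF emb_comm_ring]
          bieval_monom[OF emb_comm_ring] eval_const[OF emb_comm_ring]) (simp add: eval_const[OF emb_comm_ring] p.hom_one)
    also have "\<dots> = (\<delta> ^^ j) (bieval emb x y (pCons c G))"
      unfolding e[of G] by (simp add: b.hom_add b.hom_mult bieval_const[OF emb_comm_ring]
        bieval_monom[OF emb_comm_ring] d.hom_add d.hom_mult funpow_y rat_funpow[OF poly_rat] p.hom_one)
    finally show ?case .
  qed
  have "bieval emb x y ((\<Prod>j<N. pcompose G [:0, [:\<zeta> ^ j:]:]) - [:q ^ N * [:- a, 1:]:]) = 0"
    using G(2) by (simp only: kernel)
  then have "norm N (bieval emb x y G) = bieval emb x y [:q ^ N * [:- a, 1:]:]"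
    by (simp add: b.hom_minus b.hom_prod conj norm_def)
  also have "\<dots> = qx ^ N * (x - emb a)"
  proof -
    have "poly (map_poly emb [:- a, 1:]) x = x - emb a"
    proof -
      have "[:- a, 1:] = Polynomial.monom 1 1 - [:a:]" by (simp add: monom_altdef)
      then have "poly (map_poly emb [:- a, 1:]) x = poly (map_poly emb (Polynomial.monom 1 1)) x - emb a"
        by (simp only: p.hom_minus eval_const[OF emb_comm_ring])
      then show ?thesis by (simp add: map_poly_monom poly_monom)
    qed
    then show ?thesis by (simp only: bieval_const[OF emb_comm_ring] p.hom_mult p.hom_power qx_def)
  qed
  finally have n: "norm N (bieval emb x y G) = qx ^ N * (x - emb a)" .
  have "norm N (inverse qx) = inverse (qx ^ N)"
    using norm_rat[OF subfield_inverse[OF subfield_rat qx(2)]] by (simp add: power_inverse)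
  then have "norm N (inverse qx * bieval emb x y G) = x - emb a"
    using qx(1) by (simp add: norm_mult n)
  then show ?thesis by blast
qed

text \<open>Transitivity of norms: \<open>h\<close> is the relative norm of \<open>g\<close> from
  the top field to \<open>fixed K\<close>.\<close>

lemma (in kummer_cover) linear_polynomial_is_norm_fixed:
  assumes "K * M = N"
  shows "\<exists>g\<in>fixed K. norm K g = x - emb a"
proof -
  obtain g where g: "norm N g = x - emb a" using linear_polynomial_is_norm by blast
  define h where "h = (\<Prod>j<M. (\<delta> ^^ (K * j)) g)"
  have K: "K > 0" using assms N_pos by (cases K) auto
  have NK: "(\<delta> ^^ K) h = h"
  proof -
    interpret d: field_hom "\<delta> ^^ K" by (rule funpow_hom)
    obtain M' where M': "M = Suc M'" using assms N_pos by (cases M) auto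
    have "(\<delta> ^^ K) h = (\<Prod>j<M. (\<delta> ^^ (K * Suc j)) g)"
      by (simp add: h_def d.hom_prod funpow_add)
    also have "\<dots> = (\<Prod>j<M'. (\<delta> ^^ (K * Suc j)) g) * g"
      unfolding M' using assms by (simp add: funpow_mod M')
    also have "\<dots> = h" unfolding h_def M' by (subst prod.lessThan_Suc_shift) (simp add: mult.commute)
    finally show ?thesis .
  qed
  have "norm K h = (\<Prod>i<K. \<Prod>j<M. (\<delta> ^^ (i + K * j)) g)"
    unfolding norm_def h_def
  proof (intro prod.cong refl)
    fix i
    interpret d: field_hom "\<delta> ^^ i" by (rule funpow_hom)
    show "(\<delta> ^^ i) (\<Prod>j<M. (\<delta> ^^ (K * j)) g) = (\<Prod>j<M. (\<delta> ^^ (i + K * j)) g)"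
      by (simp add: d.hom_prod funpow_add)
  qed
  also have "\<dots> = (\<Prod>(j, i)\<in>{..<M} \<times> {..<K}. (\<delta> ^^ (i + K * j)) g)"
    by (subst prod.swap) (simp add: prod.cartesian_product)
  also have "\<dots> = (\<Prod>m<N. (\<delta> ^^ m) g)"
  proof (rule prod.reindex_bij_witness[of _ "\<lambda>m. (m div K, m mod K)" "\<lambda>(j, i). i + K * j"])
    fix m assume "m \<in> {..<N}"
    then show "(m div K, m mod K) \<in> {..<M} \<times> {..<K}"
      using K assms by (auto simp: less_mult_imp_div_less mult.commute)
  next
    fix b assume "b \<in> {..<M} \<times> {..<K}"
    then obtain j i where b: "b = (j, i)" "j < M" "i < K" by auto
    have "i + K * j < K + K * j" using b by simp
    also have "\<dots> = K * Suc j" by simp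
    also have "\<dots> \<le> K * M" using b by (intro mult_le_mono2) auto
    finally show "(case b of (j, i) \<Rightarrow> i + K * j) \<in> {..<N}" using b assms by auto
  qed (use K in auto)
  finally show ?thesis using NK g by (auto simp: fixed_def norm_def)
qed

text \<open>A root \<omega> of 1 + X + ... + X^(l - 1) has order \<open>l\<close>, and an
  \<open>l ^ (n - 1)\<close>-th root \<zeta> of \<omega> has order \<open>l ^ n\<close>: the gcd of
  \<open>l ^ n\<close> with an exponent that kills \<zeta> is a power of \<open>l\<close>, and a
  proper one would already give \<omega> = 1.\<close>

lemma primitive_root_exists:
  assumes l: "Factorial_Ring.prime l"
  shows "\<exists>\<zeta>::'a::{alg_closed_field,field_char_0}. \<forall>i. \<zeta> ^ i = 1 \<longleftrightarrow> l ^ n dvd i"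
proof (cases n)
  case 0
  then show ?thesis by (intro exI[of _ 1]) auto
next
  case (Suc n')
  have l1: "l > 1" using l prime_gt_1_nat by blast
  define p where "p = (\<Sum>i<l. Polynomial.monom (1::'a) i)"
  have "Polynomial.coeff p (l - 1) = 1" using l1 by (simp add: p_def coeff_sum)
  then have "degree p > 0" using l1 le_degree[of p "l - 1"] by auto
  then obtain \<omega> where "poly p \<omega> = 0" using alg_closed_imp_poly_has_root by blast
  then have sum: "(\<Sum>i<l. \<omega> ^ i) = 0" by (simp add: p_def poly_sum poly_monom)
  have w1: "\<omega> \<noteq> 1" using sum l1 by auto
  have wl: "\<omega> ^ l = 1" using sum geometric_sum[OF w1, of l] w1 by simp
  obtain \<zeta> where z: "\<zeta> ^ (l ^ n') = \<omega>" using nth_root_exists[of "l ^ n'"] l1 by auto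
  have zn: "\<zeta> ^ (l ^ n) = 1" unfolding Suc power_Suc2 by (simp add: power_mult z wl)
  have "\<zeta> ^ i = 1 \<longleftrightarrow> l ^ n dvd i" for i
  proof
    assume "l ^ n dvd i"
    then show "\<zeta> ^ i = 1" using zn by (auto simp: dvd_def power_mult)
  next
    assume i: "\<zeta> ^ i = 1"
    show "l ^ n dvd i"
    proof (rule ccontr)
      assume nd: "\<not> l ^ n dvd i"
      have i0: "i \<noteq> 0" using nd by (metis dvd_0_right)
      obtain b c where bc: "i * b = l ^ n * c + gcd i (l ^ n)" using bezout_nat[OF i0] by metis
      have "gcd i (l ^ n) dvd l ^ n" by simp
      then obtain j where j: "j \<le> n" "gcd i (l ^ n) = l ^ j" using divides_primepow_nat[OF l] by blast
      have "j < n" using nd j by (metis gcd_dvd1 le_neq_implies_less)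
      then have "l ^ j dvd l ^ n'" using Suc by (intro le_imp_power_dvd) auto
      have "\<zeta> ^ (i * b) = \<zeta> ^ (l ^ n * c) * \<zeta> ^ (l ^ j)" unfolding bc j(2) by (simp add: power_add)
      then have "\<zeta> ^ (l ^ j) = 1" using i zn by (simp add: power_mult)
      then have "\<zeta> ^ (l ^ n') = 1" using \<open>l ^ j dvd l ^ n'\<close> by (auto simp: dvd_def power_mult)
      with z w1 show False by simp
    qed
  qed
  then show ?thesis by blast
qed

section \<open>Extension of valuation rings\<close>

text \<open>Chevalley's extension theorem. A subring \<open>M\<close> maximal among those that
  contain \<open>R0\<close> but not \<open>inverse t\<close> is a valuation ring: if it contained
  neither \<open>w\<close> nor \<open>inverse w\<close>, adjoining either would express
  \<open>inverse t\<close> as a polynomial in it over \<open>M\<close>, and of two such expressions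
  of least degree the longer could be shortened.\<close>

lemma valuation_ring_extension:
  fixes L R0 :: "'f::field set"
  assumes L: "is_subfield L" and R0: "R0 \<subseteq> L" "1 \<in> R0" "\<And>a b. a \<in> R0 \<Longrightarrow> b \<in> R0 \<Longrightarrow> a - b \<in> R0 \<and> a * b \<in> R0"
    and t: "t \<in> R0" "inverse t \<notin> R0"
  shows "\<exists>P. valuation_ring L P \<and> R0 \<subseteq> P \<and> inverse t \<notin> P"
proof -
  define subr where "subr = (\<lambda>R. R \<subseteq> L \<and> (1::'f) \<in> R \<and> (\<forall>a\<in>R. \<forall>b\<in>R. a - b \<in> R \<and> a * b \<in> R))"
  define \<A> where "\<A> = {R. subr R \<and> R0 \<subseteq> R \<and> inverse t \<notin> R}"
  have "R0 \<in> \<A>" using R0 t by (auto simp: \<A>_def subr_def)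
  moreover have "\<Union> \<C> \<in> \<A>" if C: "\<C> \<noteq> {}" "subset.chain \<A> \<C>" for \<C>
  proof -
    have mem: "subr R" "R0 \<subseteq> R" "inverse t \<notin> R" if "R \<in> \<C>" for R
      using that C(2) by (auto simp: subset.chain_def \<A>_def)
    have "subr (\<Union> \<C>)"
      unfolding subr_def
    proof (intro conjI ballI)
      show "\<Union> \<C> \<subseteq> L" using mem by (auto simp: subr_def)
      obtain R where "R \<in> \<C>" using C(1) by blast
      then show "1 \<in> \<Union> \<C>" using mem by (auto simp: subr_def)
      fix a b assume "a \<in> \<Union> \<C>" "b \<in> \<Union> \<C>"
      then obtain R R' where R: "R \<in> \<C>" "R' \<in> \<C>" "a \<in> R" "b \<in> R'" by blast
      have "R \<subseteq> R' \<or> R' \<subseteq> R" using R C(2) unfolding subset.chain_def by blast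
      then obtain R'' where "R'' \<in> \<C>" "a \<in> R''" "b \<in> R''" using R by blast
      then show "a - b \<in> \<Union> \<C>" "a * b \<in> \<Union> \<C>" using mem(1)[of R''] unfolding subr_def by blast+
    qed
    moreover have "R0 \<subseteq> \<Union> \<C>" using mem C(1) by blast
    moreover have "inverse t \<notin> \<Union> \<C>" using mem by blast
    ultimately show ?thesis by (simp add: \<A>_def)
  qed
  ultimately obtain M where M: "M \<in> \<A>" "\<And>X. X \<in> \<A> \<Longrightarrow> M \<subseteq> X \<Longrightarrow> X = M"
    using subset_Zorn_nonempty[of \<A>] by blast
  have M_sub: "M \<subseteq> L" and M1: "1 \<in> M" and Md: "\<And>a b. a \<in> M \<Longrightarrow> b \<in> M \<Longrightarrow> a - b \<in> M"
    and Mm: "\<And>a b. a \<in> M \<Longrightarrow> b \<in> M \<Longrightarrow> a * b \<in> M" and MR: "R0 \<subseteq> M" and Mt: "inverse t \<notin> M"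
    using M(1) by (auto simp: \<A>_def subr_def)
  have M0: "0 \<in> M" using Md[OF M1 M1] by simp
  have Ma: "a + b \<in> M" if "a \<in> M" "b \<in> M" for a b
    using Md[OF that(1) Md[OF M0 that(2)]] by simp
  have Ms: "sum h I \<in> M" if "\<And>i. i \<in> I \<Longrightarrow> h i \<in> M" for h :: "nat \<Rightarrow> 'f" and I
    using that by (induction I rule: infinite_finite_induct) (auto intro: M0 Ma)
  have Mp: "a ^ i \<in> M" if "a \<in> M" for a i using that by (induction i) (auto intro: M1 Mm)
  have tM: "t \<in> M" using t MR by auto
  have t0: "t \<noteq> 0" using t R0(3)[of 1 1] R0(2) by auto
  define E where "E = (\<lambda>w n. \<exists>a. (\<forall>i. a i \<in> M) \<and> (\<Sum>i\<le>n. a i * w ^ i) = inverse t)"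
  have adjoin: "\<exists>n. E w n" if w: "w \<in> L" "w \<notin> M" for w
  proof -
    define R where "R = {poly p w | p. \<forall>i. Polynomial.coeff p i \<in> M}"
    have RI: "poly p w \<in> R" if "\<And>i. Polynomial.coeff p i \<in> M" for p using that by (auto simp: R_def)
    have MR': "M \<subseteq> R"
    proof
      fix a assume "a \<in> M"
      then show "a \<in> R" using RI[of "[:a:]"] M0 by (auto simp: coeff_pCons split: nat.splits)
    qed
    have "subr R"
      unfolding subr_def
    proof (intro conjI ballI)
      show "R \<subseteq> L" using w M_sub by (auto simp: R_def poly_altdef intro!: subfield_sum subfield_mult subfield_power L)
      show "1 \<in> R" using MR' M1 by auto
      fix a b assume "a \<in> R" "b \<in> R"
      then obtain p q where "a = poly p w" "b = poly q w" "\<forall>i. Polynomial.coeff p i \<in> M" "\<forall>i. Polynomial.coeff q i \<in> M"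
        by (auto simp: R_def)
      then show "a - b \<in> R" "a * b \<in> R"
        using RI[of "p - q"] RI[of "p * q"] by (auto simp: coeff_mult intro!: Md Ms Mm)
    qed
    moreover have "w \<in> R" using RI[of "[:0, 1:]"] M0 M1 by (auto simp: coeff_pCons split: nat.splits)
    ultimately have "inverse t \<in> R" using M(2)[of R] MR' MR w(2) by (auto simp: \<A>_def)
    then obtain p where "inverse t = poly p w" "\<forall>i. Polynomial.coeff p i \<in> M" by (auto simp: R_def)
    then show ?thesis unfolding E_def poly_altdef by metis
  qed
  \<comment> \<open>The elements of 1 + tM are units of \<open>M\<close>. If the inverse of one were
    missing, adjoining it would produce \<open>inverse t\<close>; clearing denominators by a power
    of the form \<open>1 - t * r'\<close> then puts \<open>inverse t\<close> into
    \<open>M\<close>.\<close>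
  have unit: "1 - t * r \<noteq> 0 \<and> inverse (1 - t * r) \<in> M" if r: "r \<in> M" for r
  proof
    show nz: "1 - t * r \<noteq> 0"
    proof
      assume "1 - t * r = 0"
      then have "inverse t = r" using t0 by (simp add: field_simps)
      with Mt r show False by simp
    qed
    show "inverse (1 - t * r) \<in> M"
    proof (rule ccontr)
      assume n: "inverse (1 - t * r) \<notin> M"
      have "1 - t * r \<in> L" using Md[OF M1 Mm[OF tM r]] M_sub by auto
      with n obtain n a where a: "\<And>i. a i \<in> M" "(\<Sum>i\<le>n. a i * inverse (1 - t * r) ^ i) = inverse t"
        using adjoin subfield_inverse[OF L] unfolding E_def by metis
      have "(1 - t * r) ^ n * inverse t = (\<Sum>i\<le>n. a i * (1 - t * r) ^ (n - i))"
        unfolding a(2)[symmetric] sum_distrib_left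
      proof (intro sum.cong refl)
        fix i assume "i \<in> {..n}"
        then have "(1 - t * r) ^ n = (1 - t * r) ^ (n - i) * (1 - t * r) ^ i" by (simp flip: power_add)
        then show "(1 - t * r) ^ n * (a i * inverse (1 - t * r) ^ i) = a i * (1 - t * r) ^ (n - i)"
          using nz by (simp add: field_simps)
      qed
      then have b: "(1 - t * r) ^ n * inverse t \<in> M"
        using a(1) r tM by (auto intro!: Ms Mm Mp Md M1)
      have "\<exists>r'\<in>M. (1 - t * r) ^ n = 1 - t * r'"
      proof (induction n)
        case 0
        then show ?case using M0 by (intro bexI[of _ 0]) auto
      next
        case (Suc n)
        then obtain r' where r': "r' \<in> M" "(1 - t * r) ^ n = 1 - t * r'" by blast
        have "(1 - t * r) ^ Suc n = 1 - t * (r + r' - t * (r * r'))"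
          unfolding power_Suc r'(2) by (simp add: algebra_simps)
        moreover have "r + r' - t * (r * r') \<in> M" using r r' tM by (intro Md Ma Mm)
        ultimately show ?case by blast
      qed
      then obtain r' where r': "r' \<in> M" "(1 - t * r) ^ n = 1 - t * r'" by blast
      have "inverse t = (1 - t * r) ^ n * inverse t + r'" unfolding r'(2) using t0 by (simp add: field_simps)
      with b r' Ma Mt show False by metis
    qed
  qed
  \<comment> \<open>Multiplied by \<open>t\<close>, the relation for \<open>inverse w\<close> reads
    1 = t b(0) + higher terms. As \<open>1 - t * b 0\<close> is a unit, \<open>w ^ n\<close> becomes
    a combination of lower powers, which is substituted for the leading term of the relation for
    \<open>w\<close>.\<close>
  have reduce: "\<exists>n'<n. E w n'" if w: "E w n" "E (inverse w) m" "m \<le> n" "w \<noteq> 0" for w n m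
  proof -
    obtain a b where a: "\<And>i. a i \<in> M" "(\<Sum>i\<le>n. a i * w ^ i) = inverse t"
      and b: "\<And>i. b i \<in> M" "(\<Sum>i\<le>m. b i * inverse w ^ i) = inverse t"
      using w unfolding E_def by blast
    define c where "c = inverse (1 - t * b 0)"
    have c: "c \<in> M" "1 - t * b 0 \<noteq> 0" using unit[OF b(1)] by (auto simp: c_def)
    have "1 = t * (\<Sum>i\<le>m. b i * inverse w ^ i)" using b(2) t0 by simp
    also have "\<dots> = t * b 0 + (\<Sum>i<m. t * (b (Suc i) * inverse w ^ Suc i))"
      unfolding sum.atMost_shift by (simp add: distrib_left sum_distrib_left)
    finally have "1 - t * b 0 = (\<Sum>i<m. t * (b (Suc i) * inverse w ^ Suc i))"
      by (metis add_diff_cancel_left')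
    then have "c * (1 - t * b 0) = c * (\<Sum>i<m. t * (b (Suc i) * inverse w ^ Suc i))"
      by (rule arg_cong)
    then have one: "1 = (\<Sum>i<m. c * t * b (Suc i) * inverse w ^ Suc i)"
      using c by (simp add: c_def sum_distrib_left mult.assoc)
    have n0: "n \<noteq> 0"
    proof
      assume "n = 0"
      then have "a 0 = inverse t" using a(2) by simp
      with a(1)[of 0] Mt show False by simp
    qed
    have "w ^ n = (\<Sum>i<m. c * t * b (Suc i) * w ^ (n - Suc i))"
    proof -
      have "w ^ n * 1 = (\<Sum>i<m. w ^ n * (c * t * b (Suc i) * inverse w ^ Suc i))"
        by (subst one) (simp only: sum_distrib_left)
      also have "\<dots> = (\<Sum>i<m. c * t * b (Suc i) * w ^ (n - Suc i))"
      proof (intro sum.cong refl)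
        fix i assume "i \<in> {..<m}"
        then have "w ^ n = w ^ (n - Suc i) * w ^ Suc i" using w(3) by (simp flip: power_add del: power_Suc)
        then show "w ^ n * (c * t * b (Suc i) * inverse w ^ Suc i) = c * t * b (Suc i) * w ^ (n - Suc i)"
          using w(4) by (simp add: power_inverse del: power_Suc)
      qed
      finally show ?thesis by simp
    qed
    also have "\<dots> = (\<Sum>j<n. (if n - Suc j < m then c * t * b (n - j) else 0) * w ^ j)"
    proof -
      have "(\<Sum>i<m. c * t * b (Suc i) * w ^ (n - Suc i)) = (\<Sum>i<n. (if i < m then c * t * b (Suc i) else 0) * w ^ (n - Suc i))"
        using w(3) by (intro sum.mono_neutral_cong_left) auto
      also have "\<dots> = (\<Sum>j<n. (if n - Suc j < m then c * t * b (Suc (n - Suc j)) else 0) * w ^ (n - Suc (n - Suc j)))"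
        by (rule sum.nat_diff_reindex[symmetric])
      also have "\<dots> = (\<Sum>j<n. (if n - Suc j < m then c * t * b (n - j) else 0) * w ^ j)"
        by (intro sum.cong) (auto simp: Suc_diff_Suc)
      finally show ?thesis .
    qed
    finally have wn: "w ^ n = (\<Sum>j<n. (if n - Suc j < m then c * t * b (n - j) else 0) * w ^ j)" .
    define d where "d = (\<lambda>j. a j + a n * (if n - Suc j < m then c * t * b (n - j) else 0))"
    have "inverse t = (\<Sum>j<n. a j * w ^ j) + a n * w ^ n"
      unfolding a(2)[symmetric] by (simp add: lessThan_Suc_atMost[symmetric])
    also have "\<dots> = (\<Sum>j<n. d j * w ^ j)"
      unfolding wn by (simp add: d_def sum_distrib_left sum.distrib distrib_right mult.assoc)
    also have "\<dots> = (\<Sum>j\<le>n - 1. d j * w ^ j)"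
      using n0 by (cases n) (auto simp: lessThan_Suc_atMost)
    finally have "(\<Sum>j\<le>n - 1. d j * w ^ j) = inverse t" ..
    moreover have "\<forall>j. d j \<in> M" using a b c tM M0 by (auto simp: d_def intro!: Ma Mm)
    ultimately have "E w (n - 1)" unfolding E_def by blast
    with n0 show ?thesis by (intro exI[of _ "n - 1"]) auto
  qed
  have "w \<in> M \<or> inverse w \<in> M" if w: "w \<in> L" for w
  proof (rule ccontr)
    assume c: "\<not> (w \<in> M \<or> inverse w \<in> M)"
    then have w0: "w \<noteq> 0" using M0 by auto
    define n m where "n = (LEAST n. E w n)" and "m = (LEAST n. E (inverse w) n)"
    have "\<exists>n. E w n" "\<exists>n. E (inverse w) n" using adjoin subfield_inverse[OF L w] w c by auto
    then have nm: "E w n" "E (inverse w) m" unfolding n_def m_def by (auto intro: LeastI_ex)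
    consider "m \<le> n" | "n \<le> m" by linarith
    then show False
    proof cases
      case 1
      then obtain n' where "n' < n" "E w n'" using reduce[OF nm _ w0] by blast
      then show False unfolding n_def using not_less_Least by blast
    next
      case 2
      moreover have "E (inverse (inverse w)) n" "inverse w \<noteq> 0" using nm(1) w0 by simp_all
      ultimately obtain m' where "m' < m" "E (inverse w) m'" using reduce[OF nm(2)] by blast
      then show False unfolding m_def using not_less_Least by blast
    qed
  qed
  then have "valuation_ring L M" using M_sub M1 Md Mm by (auto simp: valuation_ring_def)
  with MR Mt show ?thesis by blast
qed

text \<open>In the equation of \<open>w\<close> over \<open>K\<close> at least two terms share the
  least value, so some power \<open>w ^ d\<close> with \<open>0 < d \<le> m\<close> is a unit times
  a power of \<open>t\<close>. As \<open>d\<close> divides \<open>fact m\<close>, the exponent of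
  \<open>w ^ fact m\<close> makes sense for all \<open>w\<close> simultaneously; it is
  \<open>fact m\<close> times the extended valuation.\<close>

lemma dvr_extension:
  assumes P: "valuation_subring L P" and K: "K \<subseteq> L" "dvr K (P \<inter> K)" and m: "m > 0"
    and alg: "\<And>w. w \<in> L \<Longrightarrow> \<exists>a. (\<forall>i\<le>m. a i \<in> K) \<and> a m \<noteq> 0 \<and> (\<Sum>i\<le>m. a i * w ^ i) = 0"
  shows "dvr L P"
proof -
  interpret P: valuation_subring L P by fact
  interpret Q: dvr K "P \<inter> K" by fact
  define t where "t = uniformizer (P \<inter> K)"
  have tK: "t \<in> K" "t \<noteq> 0" using Q.uniformizer Q.uniformizer_mem by (auto simp: t_def)
  have tQ: "t \<in> nonunits (P \<inter> K)" using Q.uniformizer_nonunit by (simp add: t_def)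
  have tP: "t \<in> nonunits P" using tQ P.nonunits_restrict[OF Q.subfield] by auto
  have unitQ: "u \<in> P - nonunits P" if "u \<in> (P \<inter> K) - nonunits (P \<inter> K)" for u
    using that P.nonunits_restrict[OF Q.subfield] by auto
  have tpow: "t powi d \<in> P \<longleftrightarrow> d \<ge> 0" "t powi d \<in> P - nonunits P \<longleftrightarrow> d = 0" for d
  proof -
    have L: "t powi d \<in> K" using tK Q.subfield by (intro subfield_powi)
    have "t powi d \<in> P \<inter> K \<longleftrightarrow> d \<ge> 0" "t powi d \<in> nonunits (P \<inter> K) \<longleftrightarrow> d > 0"
      using Q.powi_nonunit_iff[OF tQ tK(2) Q.one_unit, of d] by auto
    then show "t powi d \<in> P \<longleftrightarrow> d \<ge> 0" "t powi d \<in> P - nonunits P \<longleftrightarrow> d = 0"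
      using L P.nonunits_restrict[OF Q.subfield] by auto
  qed
  have key: "\<exists>d e. 0 < d \<and> d \<le> m \<and> (\<exists>u. u \<in> P - nonunits P \<and> w ^ d = t powi e * u)"
    if w: "w \<in> L" "w \<noteq> 0" for w
  proof -
    obtain a where a: "\<And>i. i \<le> m \<Longrightarrow> a i \<in> K" "a m \<noteq> 0" "(\<Sum>i\<le>m. a i * w ^ i) = 0" using alg[OF w(1)] by blast
    define I where "I = {i. i \<le> m \<and> a i \<noteq> 0}"
    have I: "finite I" "m \<in> I" using a by (auto simp: I_def)
    define T where "T = (\<lambda>i. a i * w ^ i)"
    have T: "T i \<in> L" "T i \<noteq> 0" if "i \<in> I" for i
      using that a(1)[of i] K w by (auto simp: T_def I_def intro!: subfield_mult subfield_power P.subfield)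
    \<comment> \<open>This selects a term of least value. A second term of that value must exist,
      for otherwise the sum divided by the selected term would be a unit and not 0.\<close>
    have max: "\<exists>j\<in>I'. \<forall>i\<in>I'. T i / T j \<in> P" if "finite I'" "I' \<noteq> {}" "I' \<subseteq> I" for I'
      using that
    proof (induction rule: finite_ne_induct)
      case (singleton i)
      then show ?case using T[of i] P.one by auto
    next
      case (insert k I')
      then obtain j where j: "j \<in> I'" "\<forall>i\<in>I'. T i / T j \<in> P" by auto
      have Tk: "T k \<in> L" "T k \<noteq> 0" "T j \<in> L" "T j \<noteq> 0" using T insert j by auto
      then have "T k / T j \<in> P \<or> T j / T k \<in> P"
        using P.mem_or_inverse[of "T k / T j"] subfield_divide[OF P.subfield] by auto
      then show ?case
      proof
        assume "T j / T k \<in> P"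
        moreover have "T i / T k = T i / T j * (T j / T k)" for i using Tk by simp
        ultimately have "\<forall>i\<in>I'. T i / T k \<in> P" using j(2) P.mult by metis
        then show ?thesis using Tk P.one by (intro bexI[of _ k]) auto
      qed (use j in auto)
    qed
    obtain j where j: "j \<in> I" "\<And>i. i \<in> I \<Longrightarrow> T i / T j \<in> P" using max[of I] I by auto
    have "\<exists>i\<in>I - {j}. T i / T j \<notin> nonunits P"
    proof (rule ccontr)
      assume n: "\<not> ?thesis"
      have "0 = (\<Sum>i\<in>I. T i)"
        unfolding a(3)[symmetric] T_def by (intro sum.mono_neutral_right) (auto simp: I_def)
      then have "0 = (\<Sum>i\<in>I. T i) / T j" by simp
      also have "\<dots> = 1 + (\<Sum>i\<in>I - {j}. T i / T j)"
        using I(1) j T(2)[OF j(1)] by (simp add: sum_divide_distrib add_divide_distrib sum.remove[OF I(1) j(1)])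
      finally have "1 + (\<Sum>i\<in>I - {j}. T i / T j) = 0" ..
      moreover have "1 + (\<Sum>i\<in>I - {j}. T i / T j) \<in> P - nonunits P"
        using n by (intro P.unit_plus_nonunit P.one_unit P.nonunit_sum) auto
      ultimately show False using P.zero_nonunit by auto
    qed
    then obtain i where i: "i \<in> I" "i \<noteq> j" "T i / T j \<notin> nonunits P" by auto
    then have u: "T i / T j \<in> P - nonunits P" using j by auto
    have "\<exists>i j. i \<in> I \<and> j \<in> I \<and> i < j \<and> T i / T j \<in> P - nonunits P"
    proof (cases "i < j")
      case False
      then show ?thesis using i j P.unit_inverse[OF u] by (intro exI[of _ j] exI[of _ i]) auto
    qed (use i j u in blast)
    then obtain i j where ij: "i \<in> I" "j \<in> I" "i < j" "T i / T j \<in> P - nonunits P" by blast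
    have aK: "a i / a j \<in> K" "a i / a j \<noteq> 0" "a j \<noteq> 0"
      using ij a by (auto simp: I_def intro!: subfield_divide Q.subfield)
    then obtain v where v: "v \<in> (P \<inter> K) - nonunits (P \<inter> K)" "a i / a j = t powi place_ord (P \<inter> K) (a i / a j) * v"
      using Q.place_ord_decomposition unfolding t_def by blast
    have "w ^ j = w ^ (j - i) * w ^ i" using ij by (simp flip: power_add)
    then have "w ^ (j - i) = a i / a j * inverse (T i / T j)"
      using w aK by (simp add: T_def field_simps)
    also have "\<dots> = t powi place_ord (P \<inter> K) (a i / a j) * (v * inverse (T i / T j))"
      by (subst v(2)) simp
    finally have "w ^ (j - i) = t powi place_ord (P \<inter> K) (a i / a j) * (v * inverse (T i / T j))" .
    moreover have "v * inverse (T i / T j) \<in> P - nonunits P"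
      using unitQ[OF v(1)] P.unit_inverse[OF ij(4)] by (rule P.unit_mult)
    moreover have "0 < j - i" "j - i \<le> m" using ij by (auto simp: I_def)
    ultimately show ?thesis by blast
  qed
  have unit_pow: "u ^ i \<in> P - nonunits P" if "u \<in> P - nonunits P" for u i
  proof (induction i)
    case 0
    then show ?case using P.one_unit by simp
  next
    case (Suc i)
    then show ?case unfolding power_Suc using P.unit_mult that by blast
  qed
  define v where "v = (\<lambda>w. SOME e. \<exists>u. u \<in> P - nonunits P \<and> w ^ fact m = t powi e * u)"
  have v: "\<exists>u. u \<in> P - nonunits P \<and> w ^ fact m = t powi v w * u" if wL: "w \<in> L" "w \<noteq> 0" for w
  proof -
    obtain d e u where d: "0 < d" "d \<le> m" "u \<in> P - nonunits P" "w ^ d = t powi e * u" using key[OF wL] by blast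
    then have "d dvd fact m" using dvd_fact[of d m] by auto
    then obtain c where c: "fact m = d * c" by auto
    have "w ^ fact m = t powi (e * int c) * u ^ c"
      unfolding c power_mult d(4) by (simp add: power_mult_distrib power_int_mult)
    then have "\<exists>e u. u \<in> P - nonunits P \<and> w ^ fact m = t powi e * u" using unit_pow[OF d(3)] by blast
    then show ?thesis unfolding v_def by (rule someI_ex)
  qed
  have v_unique: "v w = e" if w: "w \<in> L" "w \<noteq> 0" "u \<in> P - nonunits P" "w ^ fact m = t powi e * u" for w e u
  proof -
    obtain u' where u': "u' \<in> P - nonunits P" "w ^ fact m = t powi v w * u'" using v[OF w(1,2)] by blast
    have nz: "u \<noteq> 0" "u' \<noteq> 0" using u' that P.unit_iff by auto
    have "t powi (e - v w) = u' * inverse u" using u'(2) that(4) tK nz by (simp add: power_int_diff field_simps)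
    then have "t powi (e - v w) \<in> P - nonunits P" using u' that P.unit_mult P.unit_inverse by metis
    then show ?thesis using tpow(2) by auto
  qed
  show ?thesis
  proof (rule P.dvrI[of v])
    fix a b assume ab: "a \<in> L" "a \<noteq> 0" "b \<in> L" "b \<noteq> 0"
    obtain u u' where "u \<in> P - nonunits P" "a ^ fact m = t powi v a * u"
      "u' \<in> P - nonunits P" "b ^ fact m = t powi v b * u'" using v ab by metis
    then show "v (a * b) = v a + v b" using tK ab
      by (intro v_unique[of _ "u * u'"] P.unit_mult subfield_mult P.subfield)
         (auto simp: power_mult_distrib power_int_add)
  next
    fix a assume a: "a \<in> L" "a \<noteq> 0"
    obtain u where u: "u \<in> P - nonunits P" "a ^ fact m = t powi v a * u" using v a by blast
    have u0: "u \<noteq> 0" "u \<in> P" "inverse u \<in> P" using u P.unit_iff by auto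
    have "a \<in> P \<longleftrightarrow> a ^ fact m \<in> P"
    proof
      assume am: "a ^ fact m \<in> P"
      show "a \<in> P"
      proof (rule P.integrally_closed[of a "fact m" "\<lambda>i. if i = 0 then a ^ fact m else 0"])
        have "(\<Sum>i<fact m. (if i = 0 then a ^ fact m else 0) * a ^ i) = (\<Sum>i\<in>{0}. a ^ fact m * a ^ i)"
          by (intro sum.mono_neutral_cong_right) auto
        then show "a ^ fact m = (\<Sum>i<fact m. (if i = 0 then a ^ fact m else 0) * a ^ i)" by simp
      qed (use am a P.zero in auto)
    qed (rule P.power)
    also have "\<dots> \<longleftrightarrow> t powi v a \<in> P"
    proof
      assume "a ^ fact m \<in> P"
      then have "a ^ fact m * inverse u \<in> P" using u0 P.mult by auto
      then show "t powi v a \<in> P" using u(2) u0 by (simp add: mult.assoc)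
    qed (use u u0 P.mult in auto)
    finally show "a \<in> P \<longleftrightarrow> v a \<ge> 0" using tpow by simp
  next
    have "t \<in> L" using tK K by auto
    have "t ^ fact m = t powi int (fact m) * 1" unfolding power_int_of_nat by simp
    from v_unique[OF \<open>t \<in> L\<close> tK(2) P.one_unit this] have "v t \<noteq> 0" by simp
    then show "\<exists>a\<in>L. a \<noteq> 0 \<and> v a \<noteq> 0" using tK \<open>t \<in> L\<close> by blast
  qed
qed

section \<open>Valuations under field homomorphisms and restriction to subfields\<close>

lemma valuation_subring_image:
  assumes h: "field_hom h" and P: "valuation_subring L P"
  shows "valuation_subring (h ` L) (h ` P)" "nonunits (h ` P) = h ` nonunits P"
proof -
  interpret h: field_hom h by fact
  interpret P: valuation_subring L P by fact
  show "valuation_subring (h ` L) (h ` P)"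
  proof
    show "is_subfield (h ` L)"
      unfolding is_subfield_def
      using subfield_closed[OF P.subfield] by (auto simp flip: h.hom_minus h.hom_mult h.hom_inverse)
    show "valuation_ring (h ` L) (h ` P)"
      unfolding valuation_ring_def
      using P.subset P.one P.diff P.mult P.mem_or_inverse
      by (auto simp flip: h.hom_minus h.hom_mult h.hom_inverse) (metis h.hom_one image_eqI)
  qed
  have "inverse (h a) \<in> h ` P \<longleftrightarrow> inverse a \<in> P" for a
    by (auto simp flip: h.hom_inverse)
  then show "nonunits (h ` P) = h ` nonunits P" by (auto simp: nonunits_def)
qed

text \<open>The uniformizer chosen for the image need not be the image of the chosen uniformizer.
  Orders change at first by the factor \<open>place_ord\<close> of that image, which is positive and
  divides 1.\<close>

lemma dvr_image:
  assumes h: "field_hom h" and P: "dvr L P"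
  shows "dvr (h ` L) (h ` P)"
    and "w \<in> L \<Longrightarrow> w \<noteq> 0 \<Longrightarrow> place_ord (h ` P) (h w) = place_ord P w"
proof -
  interpret h: field_hom h by fact
  interpret P: dvr L P by fact
  interpret I: valuation_subring "h ` L" "h ` P" by (rule valuation_subring_image[OF h P.valuation_subring_axioms])
  have nu: "nonunits (h ` P) = h ` nonunits P" by (rule valuation_subring_image[OF h P.valuation_subring_axioms])
  have powi: "h (a powi d) = h a powi d" for a d by (auto simp: power_int_def h.hom_power h.hom_inverse)
  have unit: "h u \<in> h ` P - nonunits (h ` P) \<longleftrightarrow> u \<in> P - nonunits P" for u unfolding nu by auto
  have dec: "\<exists>u. u \<in> h ` P - nonunits (h ` P) \<and> h w = h (uniformizer P) powi place_ord P w * u"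
    if "w \<in> L" "w \<noteq> 0" for w
    using P.place_ord_decomposition[OF that] unit powi by (metis h.hom_mult)
  show D: "dvr (h ` L) (h ` P)"
  proof
    show "\<exists>t\<in>h ` L. t \<noteq> 0 \<and> (\<forall>w\<in>h ` L. w \<noteq> 0 \<longrightarrow> (\<exists>d u. u \<in> h ` P - nonunits (h ` P) \<and> w = t powi d * u))"
    proof (intro bexI[of _ "h (uniformizer P)"] conjI ballI impI)
      fix w assume "w \<in> h ` L" "w \<noteq> 0"
      then obtain w' where w': "w' \<in> L" "w' \<noteq> 0" "w = h w'" by auto
      show "\<exists>d u. u \<in> h ` P - nonunits (h ` P) \<and> w = h (uniformizer P) powi d * u"
        using dec[OF w'(1,2)] w'(3) by blast
    qed (use P.uniformizer P.uniformizer_mem in auto)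
    show "h ` P \<noteq> h ` L" using P.proper by (simp add: inj_image_eq_iff h.inj_f)
  qed
  interpret D: dvr "h ` L" "h ` P" by fact
  have "place_ord (h ` P) (h w) = place_ord P w * place_ord (h ` P) (h (uniformizer P))"
    if w: "w \<in> L" "w \<noteq> 0" for w
  proof -
    obtain u where u: "u \<in> h ` P - nonunits (h ` P)" "h w = h (uniformizer P) powi place_ord P w * u"
      using dec[OF w] by blast
    have "h (uniformizer P) \<in> h ` L" "h (uniformizer P) \<noteq> 0" "u \<in> h ` L" "u \<noteq> 0"
      using P.uniformizer P.uniformizer_mem u I.subset I.zero_nonunit by auto
    then show ?thesis unfolding u(2)
      using u(1) D.unit_iff_ord[of u]
      by (subst D.ord_mult) (auto simp: D.ord_powi intro!: subfield_powi I.subfield)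
  qed
  note o = this
  have "place_ord (h ` P) (h (uniformizer P)) = 1"
  proof -
    obtain w where w: "w \<in> L" "uniformizer (h ` P) = h w" using D.uniformizer_mem by auto
    have w0: "w \<noteq> 0" using D.uniformizer w by auto
    have "1 = place_ord P w * place_ord (h ` P) (h (uniformizer P))"
      using o[OF w(1) w0] D.place_ord_uniformizer w(2) by simp
    moreover have "place_ord (h ` P) (h (uniformizer P)) > 0"
    proof -
      have "h (uniformizer P) \<in> nonunits (h ` P)" unfolding nu using P.uniformizer_nonunit by auto
      then show ?thesis
        using D.nonunit_iff_ord[of "h (uniformizer P)"] P.uniformizer P.uniformizer_mem by auto
    qed
    ultimately show ?thesis by (metis pos_zmult_eq_1_iff mult.commute)
  qed
  with o show "w \<in> L \<Longrightarrow> w \<noteq> 0 \<Longrightarrow> place_ord (h ` P) (h w) = place_ord P w" by simp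
qed

lemma dvr_restrict_ord:
  assumes P: "dvr L P" and Q: "dvr K (P \<inter> K)" and K: "K \<subseteq> L" and w: "w \<in> K" "w \<noteq> 0"
  shows "place_ord P w = ramification P (P \<inter> K) * place_ord (P \<inter> K) w"
    and "ramification P (P \<inter> K) > 0"
proof -
  interpret P: dvr L P by fact
  interpret Q: dvr K "P \<inter> K" by fact
  have nu: "nonunits (P \<inter> K) = nonunits P \<inter> K" by (rule P.nonunits_restrict[OF Q.subfield])
  obtain u where u: "u \<in> P \<inter> K - nonunits (P \<inter> K)" "w = uniformizer (P \<inter> K) powi place_ord (P \<inter> K) w * u"
    using Q.place_ord_decomposition[OF w] by blast
  have u': "u \<in> P - nonunits P" using u(1) nu by auto
  have L: "uniformizer (P \<inter> K) \<in> L" "uniformizer (P \<inter> K) \<noteq> 0" "u \<in> L" "u \<noteq> 0"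
    using Q.uniformizer Q.uniformizer_mem K u' P.subset P.unit_iff by auto
  have "place_ord P u = 0" using P.unit_iff_ord L u' by blast
  then show "place_ord P w = ramification P (P \<inter> K) * place_ord (P \<inter> K) w"
    using L by (subst u(2), subst P.ord_mult) (auto simp: ramification_def P.ord_powi intro!: subfield_powi P.subfield)
  show "ramification P (P \<inter> K) > 0"
    using P.nonunit_iff_ord[OF L(1,2)] Q.uniformizer_nonunit nu by (simp add: ramification_def)
qed

section \<open>Points of the tower\<close>

context kummer_cover begin

abbreviation ev :: "'a poly \<Rightarrow> 'f" where "ev p \<equiv> poly (map_poly emb p) x"

sublocale ev: comm_ring_hom ev by (rule comm_ring_hom_eval[OF emb_comm_ring])

lemma ev_eq_0_iff: "ev p = 0 \<longleftrightarrow> p = 0"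
  using transcendental[of p] by auto

lemma ev_const: "ev [:a:] = emb a"
  by (rule eval_const[OF emb_comm_ring])

lemma ev_monom: "ev (Polynomial.monom a i) = emb a * x ^ i"
  by (simp add: map_poly_monom poly_monom)

lemma ev_linear: "ev [:- a, 1:] = x - emb a"
proof -
  have "[:- a, 1:] = Polynomial.monom 1 1 - [:a:]" by (simp add: monom_altdef)
  then show ?thesis by (simp only: ev.hom_minus ev_monom ev_const) simp
qed

lemma rat_representation: "w \<in> rat_field \<Longrightarrow> \<exists>p q. q \<noteq> 0 \<and> w = ev p / ev q"
proof -
  let ?X = "{w. \<exists>p q. q \<noteq> 0 \<and> w = ev p / ev q}"
  have I: "v \<in> ?X" if "q \<noteq> 0" "v = ev p / ev q" for v p q using that by blast
  have "is_subfield ?X"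
    unfolding is_subfield_def
  proof (intro conjI ballI)
    show "1 \<in> ?X" by (rule I[of 1 _ 1]) simp_all
    fix v w assume "v \<in> ?X" "w \<in> ?X"
    then obtain p q p' q' where *: "q \<noteq> 0" "v = ev p / ev q" "q' \<noteq> 0" "w = ev p' / ev q'" by blast
    show "v - w \<in> ?X"
      by (rule I[of "q * q'" _ "p * q' - p' * q"])
         (use * in \<open>simp_all add: ev.hom_mult ev.hom_minus diff_frac_eq ev_eq_0_iff\<close>)
    show "v * w \<in> ?X" by (rule I[of "q * q'" _ "p * p'"]) (use * in \<open>simp_all add: ev.hom_mult\<close>)
    show "inverse v \<in> ?X"
    proof (cases "p = 0")
      case True
      then show ?thesis using * by (intro I[of 1 _ 0]) simp_all
    next
      case False
      then show ?thesis using * by (intro I[of p _ q]) simp_all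
    qed
  qed
  moreover have "emb a \<in> ?X" for a by (rule I[of 1 _ "[:a:]"]) (simp_all add: ev_const)
  moreover have "x \<in> ?X" by (rule I[of 1 _ "Polynomial.monom 1 1"]) (simp_all add: ev_monom poly_monom)
  ultimately have "rat_field \<subseteq> ?X" unfolding rat_field_def by (intro hull_minimal) auto
  then show "w \<in> rat_field \<Longrightarrow> ?thesis" by blast
qed

text \<open>Points of the line are labelled by \<open>'a option\<close>, with \<open>None\<close> for the point at infinity.\<close>

definition over :: "'a option \<Rightarrow> 'f set \<Rightarrow> bool" where
  "over c P \<longleftrightarrow> (case c of Some a \<Rightarrow> x - emb a \<in> nonunits P | None \<Rightarrow> x \<notin> P)"

definition param :: "'a option \<Rightarrow> 'f" where
  "param c = (case c of Some a \<Rightarrow> x - emb a | None \<Rightarrow> inverse x)"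

text \<open>The valuation of the line at \<open>c\<close>, on polynomials in x; at infinity a
  polynomial has a pole of order its degree.\<close>

definition pord :: "'a option \<Rightarrow> 'a poly \<Rightarrow> int" where
  "pord c p = (case c of Some a \<Rightarrow> int (Polynomial.order a p) | None \<Rightarrow> - int (degree p))"

lemma x_neq: "x - emb a \<noteq> 0" "x \<noteq> 0"
proof -
  have *: "x - emb a \<noteq> 0" for a unfolding ev_linear[symmetric] ev_eq_0_iff by simp
  show "x - emb a \<noteq> 0" "x \<noteq> 0" using *[of a] *[of 0] by simp_all
qed

lemma param_neq_0: "param c \<noteq> 0"
  using x_neq(1) x_neq(2) by (auto simp: param_def simp del: right_minus_eq split: option.splits)

lemma param_rat: "param c \<in> rat_field"
  by (auto simp: param_def split: option.splits intro!: subfield_closed subfield_rat emb_rat x_rat)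

end

locale tower_valuation = kummer_cover emb x y f N \<zeta> \<delta> + valuation_subring L P
  for emb :: "'a::{alg_closed_field,field_char_0} \<Rightarrow> 'f::field" and x y f N \<zeta> \<delta> and L P :: "'f set" +
  assumes rat_sub: "rat_field \<subseteq> L" and emb_mem: "\<And>a. emb a \<in> P"
begin

lemma emb_unit: "a \<noteq> 0 \<Longrightarrow> emb a \<in> P - nonunits P"
  using emb_mem[of a] emb_mem[of "inverse a"] by (subst unit_iff) (auto simp: emb.hom_inverse)

lemma x_L: "x \<in> L"
  using rat_sub x_rat by auto

lemma ev_mem: "x \<in> P \<Longrightarrow> ev p \<in> P"
  unfolding poly_altdef by (intro sum mult power) (auto simp: coeff_map_poly emb_mem)

lemma ev_residue:
  assumes "over (Some a) P"
  shows "ev p - emb (poly p a) \<in> nonunits P"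
proof -
  have "x - emb a \<in> nonunits P" using assms by (simp add: over_def)
  then have x: "x \<in> P" using nonunits_subset add[of "x - emb a" "emb a"] emb_mem by auto
  have "poly (p - [:poly p a:]) a = 0" by simp
  then have "[:- a, 1:] dvd p - [:poly p a:]" by (simp only: poly_eq_0_iff_dvd)
  then obtain q where "p - [:poly p a:] = [:- a, 1:] * q" by (elim dvdE)
  then have "ev p - emb (poly p a) = (x - emb a) * ev q"
    by (metis ev.hom_minus ev.hom_mult ev_const ev_linear)
  then show ?thesis using \<open>x - emb a \<in> nonunits P\<close> ev_mem[OF x] by (simp add: nonunit_mult)
qed

lemma param_nonunit: "over c P \<Longrightarrow> param c \<in> nonunits P"
  using inverse_nonunit[OF x_L] by (auto simp: over_def param_def split: option.splits)

lemma residue_unit: "u - emb r \<in> nonunits P \<Longrightarrow> r \<noteq> 0 \<Longrightarrow> u \<in> P - nonunits P"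
  using unit_plus_nonunit[OF emb_unit, of r "u - emb r"] by simp

text \<open>The residue \<open>r\<close> is the value at the point of the cofactor prime to x - a,
  respectively the leading coefficient at infinity. Keeping the residue, and not only the fact that
  \<open>u\<close> is a unit, is what later allows roots of \<open>u\<close> to be compared with
  constants.\<close>

lemma ev_decomposition:
  assumes c: "over c P" and p: "p \<noteq> 0"
  shows "\<exists>u r. u \<in> rat_field \<and> ev p = param c powi pord c p * u \<and> r \<noteq> 0 \<and> u - emb r \<in> nonunits P"
proof (cases c)
  case (Some a)
  obtain q where q: "p = [:- a, 1:] ^ Polynomial.order a p * q" "\<not> [:- a, 1:] dvd q"
    using order_decomp[OF p, of a] by blast
  have "ev p = (x - emb a) ^ Polynomial.order a p * ev q"
    by (subst q(1)) (simp only: ev.hom_mult ev.hom_power ev_linear)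
  moreover have "poly q a \<noteq> 0" using q(2) by (simp add: poly_eq_0_iff_dvd)
  ultimately show ?thesis using Some c ev_residue[of a q] poly_rat
    by (intro exI[of _ "ev q"] exI[of _ "poly q a"]) (auto simp: param_def pord_def)
next
  case None
  define m where "m = degree p"
  define u where "u = ev p * inverse x ^ m"
  have ix: "inverse x \<in> nonunits P" using param_nonunit[OF c] None by (simp add: param_def)
  have "u = (\<Sum>i\<le>m. emb (Polynomial.coeff p i) * inverse x ^ (m - i))"
    unfolding u_def sum_distrib_right poly_altdef m_def
  proof (rule sum.cong)
    show "{..degree (map_poly emb p)} = {..degree p}" by simp
    fix i assume "i \<in> {..degree p}"
    then have "inverse x ^ degree p = inverse x ^ (degree p - i) * inverse x ^ i" by (simp flip: power_add)
    then show "Polynomial.coeff (map_poly emb p) i * x ^ i * inverse x ^ degree p =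
        emb (Polynomial.coeff p i) * inverse x ^ (degree p - i)"
      using x_neq(2) by (simp add: coeff_map_poly field_simps)
  qed
  also have "\<dots> = emb (lead_coeff p) + (\<Sum>i<m. emb (Polynomial.coeff p i) * inverse x ^ (m - i))"
    by (simp add: lessThan_Suc_atMost[symmetric] m_def add.commute)
  finally have u: "u - emb (lead_coeff p) = (\<Sum>i<m. emb (Polynomial.coeff p i) * inverse x ^ (m - i))" by simp
  have "inverse x ^ (m - i) \<in> nonunits P" if "i < m" for i
  proof -
    have "m - i = Suc (m - i - 1)" using that by simp
    then show ?thesis using nonunit_mult[OF ix power, of "inverse x" "m - i - 1"] ix nonunits_subset
      by (metis power_Suc subsetD)
  qed
  then have "u - emb (lead_coeff p) \<in> nonunits P"
    unfolding u by (intro nonunit_sum nonunit_mult' emb_mem) auto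
  moreover have "ev p = param c powi pord c p * u"
    using None x_neq(2) by (simp add: u_def param_def pord_def m_def power_int_minus power_inverse)
  moreover have "u \<in> rat_field" unfolding u_def
    by (intro subfield_mult subfield_power subfield_inverse subfield_rat poly_rat x_rat)
  ultimately show ?thesis using p by (intro exI[of _ u] exI[of _ "lead_coeff p"]) auto
qed

lemma param_powi_unit: "over c P \<Longrightarrow> u \<in> P - nonunits P \<Longrightarrow> param c powi d * u \<in> P \<longleftrightarrow> d \<ge> 0"
proof -
  assume c: "over c P" and u: "u \<in> P - nonunits P"
  have t: "param c \<in> nonunits P" by (rule param_nonunit[OF c])
  have u': "u \<in> P" "u \<noteq> 0" "inverse u \<in> P" using u unit_iff by auto
  show "param c powi d * u \<in> P \<longleftrightarrow> d \<ge> 0"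
  proof
    assume m: "param c powi d * u \<in> P"
    show "d \<ge> 0"
    proof (rule ccontr)
      assume d: "\<not> d \<ge> 0"
      have "param c ^ nat (- d) \<in> nonunits P"
        using d nonunit_mult[OF t power, of "param c" "nat (- d) - 1"] t nonunits_subset
        by (cases "nat (- d)") auto
      then have "param c ^ nat (- d) * (param c powi d * u) \<in> nonunits P" using m by (rule nonunit_mult)
      also have "param c ^ nat (- d) * (param c powi d * u) = u"
        using d param_neq_0[of c] by (simp add: power_int_def power_inverse field_simps)
      finally show False using u by simp
    qed
  next
    assume "d \<ge> 0"
    then show "param c powi d * u \<in> P" using t u' nonunits_subset by (auto simp: power_int_def intro!: mult power)
  qed
qed

lemma rat_decomposition:
  assumes c: "over c P" and w: "w = ev p / ev q" "p \<noteq> 0" "q \<noteq> 0"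
  shows "\<exists>u. u \<in> rat_field \<and> u \<in> P - nonunits P \<and> w = param c powi (pord c p - pord c q) * u"
proof -
  obtain u r where u: "u \<in> rat_field" "ev p = param c powi pord c p * u" "r \<noteq> 0" "u - emb r \<in> nonunits P"
    using ev_decomposition[OF c w(2)] by blast
  obtain v s where v: "v \<in> rat_field" "ev q = param c powi pord c q * v" "s \<noteq> 0" "v - emb s \<in> nonunits P"
    using ev_decomposition[OF c w(3)] by blast
  have U: "u \<in> P - nonunits P" "v \<in> P - nonunits P" using u v residue_unit by auto
  then have "u * inverse v \<in> P - nonunits P" using unit_mult unit_inverse by blast
  moreover have "w = param c powi (pord c p - pord c q) * (u * inverse v)"
    unfolding w(1) u(2) v(2) using param_neq_0[of c] by (simp add: power_int_diff field_simps)
  ultimately show ?thesis using u v by (intro exI[of _ "u * inverse v"])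
    (auto intro!: subfield_mult subfield_inverse subfield_rat)
qed

lemma rat_mem_iff:
  "over c P \<Longrightarrow> w = ev p / ev q \<Longrightarrow> p \<noteq> 0 \<Longrightarrow> q \<noteq> 0 \<Longrightarrow> w \<in> P \<longleftrightarrow> pord c p - pord c q \<ge> 0"
  using rat_decomposition param_powi_unit by metis

lemma rat_dvr: assumes c: "over c P" shows "dvr rat_field (P \<inter> rat_field)"
proof -
  interpret R: valuation_subring rat_field "P \<inter> rat_field"
    by (rule restrict[OF subfield_rat rat_sub])
  have nu: "nonunits (P \<inter> rat_field) = nonunits P \<inter> rat_field" by (rule nonunits_restrict[OF subfield_rat])
  show ?thesis
  proof
    show "\<exists>t\<in>rat_field. t \<noteq> 0 \<and> (\<forall>w\<in>rat_field. w \<noteq> 0 \<longrightarrow>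
        (\<exists>d u. u \<in> P \<inter> rat_field - nonunits (P \<inter> rat_field) \<and> w = t powi d * u))"
    proof (intro bexI[of _ "param c"] conjI ballI impI param_neq_0 param_rat)
      fix w assume w: "w \<in> rat_field" "w \<noteq> 0"
      then obtain p q where pq: "q \<noteq> 0" "w = ev p / ev q" using rat_representation by blast
      then have "p \<noteq> 0" using w by auto
      then obtain u where u: "u \<in> rat_field" "u \<in> P - nonunits P" "w = param c powi (pord c p - pord c q) * u"
        using rat_decomposition[OF c pq(2) _ pq(1)] by blast
      then have "u \<in> P \<inter> rat_field - nonunits (P \<inter> rat_field)" using nu by auto
      then show "\<exists>d u. u \<in> P \<inter> rat_field - nonunits (P \<inter> rat_field) \<and> w = param c powi d * u"
        using u(3) by blast
    qed
    have "inverse (param c) \<notin> P" using param_nonunit[OF c] param_neq_0[of c] by (auto simp: nonunits_def)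
    then show "P \<inter> rat_field \<noteq> rat_field"
      using subfield_inverse[OF subfield_rat param_rat, of c] by auto
  qed
qed

lemma rat_param_ord: assumes c: "over c P" shows "place_ord (P \<inter> rat_field) (param c) = 1"
proof -
  interpret Q: dvr rat_field "P \<inter> rat_field" by (rule rat_dvr[OF c])
  have nu: "nonunits (P \<inter> rat_field) = nonunits P \<inter> rat_field" by (rule nonunits_restrict[OF subfield_rat])
  obtain p q where pq: "q \<noteq> 0" "uniformizer (P \<inter> rat_field) = ev p / ev q"
    using rat_representation[OF Q.uniformizer_mem] by blast
  then have p0: "p \<noteq> 0" using Q.uniformizer by auto
  obtain u where u: "u \<in> rat_field" "u \<in> P - nonunits P"
    "uniformizer (P \<inter> rat_field) = param c powi (pord c p - pord c q) * u"
    using rat_decomposition[OF c pq(2) p0 pq(1)] by blast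
  have u0: "u \<noteq> 0" using u zero_nonunit by auto
  have "place_ord (P \<inter> rat_field) u = 0" using Q.unit_iff_ord[OF u(1) u0] u nu by auto
  then have "1 = (pord c p - pord c q) * place_ord (P \<inter> rat_field) (param c)"
    using Q.place_ord_uniformizer u0 u(1) param_rat[of c] param_neq_0[of c] unfolding u(3)
    by (subst (asm) Q.ord_mult) (auto simp: Q.ord_powi intro!: subfield_powi subfield_rat)
  moreover have "place_ord (P \<inter> rat_field) (param c) > 0"
    using Q.nonunit_iff_ord[OF param_rat param_neq_0] param_nonunit[OF c] nu param_rat by auto
  ultimately show ?thesis by (metis pos_zmult_eq_1_iff mult.commute)
qed

lemma over_unique: assumes "over c P" "over c' P" shows "c = c'"
proof (cases c; cases c')
  fix a b assume ab: "c = Some a" "c' = Some b"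
  then have "(x - emb b) - (x - emb a) \<in> nonunits P"
    using assms nonunit_diff[of "x - emb b" "x - emb a"] by (simp only: over_def option.case)
  then have "emb (a - b) \<in> nonunits P" by (simp add: emb.hom_minus)
  then show ?thesis using emb_unit[of "a - b"] ab by auto
next
  fix a assume ab: "c = Some a" "c' = None"
  then have "x - emb a + emb a \<in> P" using assms nonunits_subset emb_mem by (intro add) (auto simp: over_def)
  then show ?thesis using assms ab by (simp add: over_def)
next
  fix a assume ab: "c = None" "c' = Some a"
  then have "x - emb a + emb a \<in> P" using assms nonunits_subset emb_mem by (intro add) (auto simp: over_def)
  then show ?thesis using assms ab by (simp add: over_def)
qed simp

text \<open>If \<open>x \<in> P\<close>, some nonzero polynomial in x is a nonunit, because
  otherwise all fractions would lie in \<open>P\<close>. It splits into linear factors, and one of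
  them lies in the maximal ideal.\<close>

lemma over_exists:
  assumes "\<not> rat_field \<subseteq> P"
  shows "\<exists>c. over c P"
proof (cases "x \<in> P")
  case False
  then show ?thesis by (intro exI[of _ None]) (simp add: over_def)
next
  case True
  have "\<exists>p. p \<noteq> 0 \<and> ev p \<in> nonunits P"
  proof (rule ccontr)
    assume n: "\<not> ?thesis"
    have "w \<in> P" if w: "w \<in> rat_field" for w
    proof -
      obtain p q where pq: "q \<noteq> 0" "w = ev p / ev q" using rat_representation[OF w] by blast
      have "ev q \<in> P - nonunits P" using n pq ev_mem[OF True] by auto
      then show ?thesis unfolding pq(2) divide_inverse
        using unit_iff[of "ev q"] ev_mem[OF True] by (intro mult) auto
    qed
    with assms show False by auto
  qed
  then obtain p where p: "p \<noteq> 0" "ev p \<in> nonunits P" by blast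
  obtain A where A: "p = Polynomial.smult (lead_coeff p) (\<Prod>r\<in>#A. [:- r, 1:])"
    using alg_closed_imp_factorization[OF p(1)] by blast
  have smult: "Polynomial.smult a g = [:a:] * g" for a and g :: "'a poly" by simp
  have "ev p = emb (lead_coeff p) * ev (\<Prod>r\<in>#A. [:- r, 1:])"
    by (subst A, subst smult) (simp only: ev.hom_mult ev_const)
  moreover have "emb (lead_coeff p) \<in> P - nonunits P" using p by (intro emb_unit) auto
  ultimately have "ev (\<Prod>r\<in>#A. [:- r, 1:]) \<in> nonunits P"
    using nonunit_prime[of "emb (lead_coeff p)" "ev (\<Prod>r\<in>#A. [:- r, 1:])"] p ev_mem[OF True] by auto
  then have "\<exists>r\<in>#A. x - emb r \<in> nonunits P"
  proof (induction A)
    case empty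
    then show ?case using one_unit by simp
  next
    case (add r A)
    have "ev (\<Prod>r\<in>#add_mset r A. [:- r, 1:]) = (x - emb r) * ev (\<Prod>r\<in>#A. [:- r, 1:])"
      by (simp only: image_mset_add_mset prod_mset.add_mset ev.hom_mult ev_linear)
    then have "x - emb r \<in> nonunits P \<or> ev (\<Prod>r\<in>#A. [:- r, 1:]) \<in> nonunits P"
      using add.prems nonunit_prime[of "x - emb r" "ev (\<Prod>r\<in>#A. [:- r, 1:])"] ev_mem[OF True] True
        diff emb_mem by simp
    then show ?case using add.IH by auto
  qed
  then obtain r where "x - emb r \<in> nonunits P" by blast
  then show ?thesis by (intro exI[of _ "Some r"]) (simp add: over_def)
qed

end

context kummer_cover begin

text \<open>The polynomial with the conjugates of \<open>w\<close> as roots is invariant under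
  \<delta>, so its coefficients are rational functions of x.\<close>

lemma characteristic_equation:
  assumes w: "w \<in> fixed K" and K: "K > 0"
  shows "\<exists>a. (\<forall>i. a i \<in> rat_field) \<and> a K = 1 \<and> (\<Sum>i\<le>K. a i * w ^ i) = 0"
proof -
  define p where "p = (\<Prod>i<K. [:- (\<delta> ^^ i) w, 1:])"
  interpret m: map_poly_comm_ring_hom \<delta> ..
  have "map_poly \<delta> p = (\<Prod>i<K. [:- (\<delta> ^^ Suc i) w, 1:])"
  proof -
    have "map_poly \<delta> [:- v, 1:] = [:- \<delta> v, 1:]" for v
    proof -
      have "[:- v, 1:] = Polynomial.monom 1 1 - Polynomial.monom v 0" by (simp add: monom_altdef)
      then show ?thesis by (simp only: m.hom_minus map_poly_monom[of \<delta>, OF \<delta>.hom_zero] \<delta>.hom_one) (simp add: monom_altdef)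
    qed
    then show ?thesis unfolding p_def by (simp add: m.hom_prod)
  qed
  also have "\<dots> = p"
  proof -
    obtain K' where K': "K = Suc K'" using K by (cases K) auto
    have "(\<Prod>i<K. [:- (\<delta> ^^ Suc i) w, 1:]) = (\<Prod>i<K'. [:- (\<delta> ^^ Suc i) w, 1:]) * [:- (\<delta> ^^ K) w, 1:]"
      unfolding K' by simp
    also have "(\<delta> ^^ K) w = w" using w by (simp add: fixed_def)
    finally show ?thesis unfolding p_def K' by (subst (2) prod.lessThan_Suc_shift) (simp add: mult.commute)
  qed
  finally have "\<delta> (Polynomial.coeff p i) = Polynomial.coeff p i" for i
    by (metis coeff_map_poly \<delta>.hom_zero)
  then have rat: "Polynomial.coeff p i \<in> rat_field" for i
    unfolding fixed_1[symmetric] by (simp add: fixed_def)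
  have deg: "degree p = K"
    unfolding p_def by (subst degree_prod_eq_sum_degree) auto
  have "lead_coeff p = 1" unfolding p_def by (subst lead_coeff_prod) auto
  moreover have "poly p w = 0" unfolding p_def poly_prod using K by (auto intro!: bexI[of _ 0])
  ultimately show ?thesis using rat deg by (intro exI[of _ "Polynomial.coeff p"]) (auto simp: poly_altdef)
qed

definition pts :: "nat \<Rightarrow> 'f set set" where "pts K = points emb (fixed K)"

lemma tower_valuation: "P \<in> pts K \<Longrightarrow> tower_valuation emb x y f N \<zeta> \<delta> (fixed K) P"
  unfolding pts_def points_def
  by (intro tower_valuation.intro kummer_cover_axioms valuation_subring.intro
      tower_valuation_axioms.intro subfield_fixed rat_fixed) auto

text \<open>\<open>fixed K\<close> is integral over the field of rational functions, so a ring
  containing the latter would be all of \<open>fixed K\<close>.\<close>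

lemma rat_not_subset:
  assumes P: "P \<in> pts K" and K: "K > 0"
  shows "\<not> rat_field \<subseteq> P"
proof
  interpret tower_valuation emb x y f N \<zeta> \<delta> "fixed K" P by (rule tower_valuation[OF P])
  assume r: "rat_field \<subseteq> P"
  have "w \<in> P" if w: "w \<in> fixed K" for w
  proof -
    obtain a where a: "\<And>i. a i \<in> rat_field" "a K = 1" "(\<Sum>i\<le>K. a i * w ^ i) = 0"
      using characteristic_equation[OF w K] by blast
    have "w ^ K + (\<Sum>i<K. a i * w ^ i) = 0"
      using a(2,3) by (simp add: lessThan_Suc_atMost[symmetric] add.commute)
    then have "w ^ K = (\<Sum>i<K. - a i * w ^ i)"
      by (simp add: sum_negf eq_neg_iff_add_eq_0)
    moreover have "- a i \<in> P" for i using a(1) r uminus by auto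
    ultimately show "w \<in> P" using integrally_closed[OF w K, of "\<lambda>i. - a i"] by blast
  qed
  then show False using P subset by (auto simp: pts_def points_def)
qed

lemma over_exists: "P \<in> pts K \<Longrightarrow> K > 0 \<Longrightarrow> \<exists>c. over c P"
  using rat_not_subset tower_valuation.over_exists[OF tower_valuation] by blast

lemma over_unique: "P \<in> pts K \<Longrightarrow> over c P \<Longrightarrow> over c' P \<Longrightarrow> c = c'"
  using tower_valuation.over_unique[OF tower_valuation] by blast

lemma pts_dvr:
  assumes P: "P \<in> pts K" and K: "K > 0"
  shows "dvr (fixed K) P"
proof -
  interpret tower_valuation emb x y f N \<zeta> \<delta> "fixed K" P by (rule tower_valuation[OF P])
  obtain c where c: "over c P" using over_exists rat_not_subset[OF P K] by blast
  show ?thesis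
  proof (rule dvr_extension[OF valuation_subring_axioms rat_fixed rat_dvr[OF c] K])
    fix w assume "w \<in> fixed K"
    then show "\<exists>a. (\<forall>i\<le>K. a i \<in> rat_field) \<and> a K \<noteq> 0 \<and> (\<Sum>i\<le>K. a i * w ^ i) = 0"
      using characteristic_equation[OF _ K] by (metis zero_neq_one)
  qed
qed

text \<open>Membership of a rational function is decided by the orders of its numerator and
  denominator at \<open>c\<close>, whatever the level.\<close>

lemma pts_restrict_rat:
  assumes P: "P \<in> pts K" "over c P" and P': "P' \<in> pts K'" "over c P'"
  shows "P \<inter> rat_field = P' \<inter> rat_field"
proof -
  interpret P: tower_valuation emb x y f N \<zeta> \<delta> "fixed K" P by (rule tower_valuation[OF P(1)])
  interpret P': tower_valuation emb x y f N \<zeta> \<delta> "fixed K'" P' by (rule tower_valuation[OF P'(1)])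
  have "w \<in> P \<longleftrightarrow> w \<in> P'" if w: "w \<in> rat_field" for w
  proof (cases "w = 0")
    case False
    obtain p q where pq: "q \<noteq> 0" "w = ev p / ev q" using rat_representation[OF w] by blast
    then have "p \<noteq> 0" using False by auto
    then show ?thesis using P.rat_mem_iff[OF P(2) pq(2) _ pq(1)] P'.rat_mem_iff[OF P'(2) pq(2) _ pq(1)] by blast
  qed (use P.zero P'.zero in auto)
  then show ?thesis by blast
qed

text \<open>Chevalley's theorem is applied to the polynomials in x, where x - a is not invertible.
  For infinity the polynomials in 1/x are used, written as \<open>ev p / x ^ j\<close> with the
  degree of \<open>p\<close> at most \<open>j\<close>.\<close>

lemma pts_exists: "\<exists>P\<in>pts K. over c P"
proof -
  have main: "\<exists>P. valuation_ring (fixed K) P \<and> R0 \<subseteq> P \<and> inverse t \<notin> P"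
    if "R0 \<subseteq> rat_field" "1 \<in> R0" "\<And>a b. a \<in> R0 \<Longrightarrow> b \<in> R0 \<Longrightarrow> a - b \<in> R0 \<and> a * b \<in> R0" "t \<in> R0" "inverse t \<notin> R0" for R0 t
    using valuation_ring_extension[OF subfield_fixed, of R0 K t] that rat_fixed by blast
  have point: "P \<in> pts K" if P: "valuation_ring (fixed K) P" "range emb \<subseteq> P" "inverse t \<notin> P" "t \<in> rat_field" for P t
  proof -
    have "inverse t \<in> fixed K" using P(4) subfield_inverse[OF subfield_rat] rat_fixed by blast
    then show ?thesis using P by (auto simp: pts_def points_def)
  qed
  show ?thesis
  proof (cases c)
    case (Some a)
    have "\<exists>P. valuation_ring (fixed K) P \<and> range ev \<subseteq> P \<and> inverse (x - emb a) \<notin> P"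
    proof (rule main)
      show "range ev \<subseteq> rat_field" using poly_rat by auto
      show "1 \<in> range ev" using ev.hom_one by (metis rangeI)
      show "u - v \<in> range ev \<and> u * v \<in> range ev" if "u \<in> range ev" "v \<in> range ev" for u v
        using that by (auto simp flip: ev.hom_minus ev.hom_mult)
      show "x - emb a \<in> range ev" by (metis ev_linear rangeI)
      show "inverse (x - emb a) \<notin> range ev"
      proof
        assume "inverse (x - emb a) \<in> range ev"
        then obtain p where p: "inverse (x - emb a) = ev p" by auto
        then have "ev ([:- a, 1:] * p) = ev 1"
          using x_neq(1)[of a] by (simp only: ev.hom_mult ev_linear ev.hom_one) (metis right_inverse)
        then have "ev ([:- a, 1:] * p - 1) = 0" by (simp only: ev.hom_minus) simp
        then have "[:- a, 1:] * p = 1" by (simp only: ev_eq_0_iff) simp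
        then have "poly ([:- a, 1:] * p) a = poly 1 a" by (rule arg_cong)
        then show False by simp
      qed
    qed
    then obtain P where P: "valuation_ring (fixed K) P" "range ev \<subseteq> P" "inverse (x - emb a) \<notin> P" by blast
    have "range emb \<subseteq> P" using P(2) ev_const by (metis image_subset_iff subset_eq rangeI)
    then have "P \<in> pts K" using P point[of P "x - emb a"] by (auto intro!: subfield_diff subfield_rat x_rat emb_rat)
    moreover have "x - emb a \<in> P" using P(2) ev_linear by (metis rangeI subsetD)
    then have "over c P" using P(3) x_neq(1) Some by (simp add: over_def nonunits_def)
    ultimately show ?thesis by blast
  next
    case None
    define R0 where "R0 = {ev p / x ^ j | p j. degree p \<le> j}"
    have RI: "v \<in> R0" if "v = ev p / x ^ j" "degree p \<le> j" for v p j using that by (auto simp: R0_def)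
    have "\<exists>P. valuation_ring (fixed K) P \<and> R0 \<subseteq> P \<and> inverse (inverse x) \<notin> P"
    proof (rule main)
      show "R0 \<subseteq> rat_field"
        by (auto simp: R0_def intro!: subfield_divide subfield_power subfield_rat poly_rat x_rat)
      show "1 \<in> R0" by (rule RI[of _ 1 0]) auto
      show "u - v \<in> R0 \<and> u * v \<in> R0" if uv: "u \<in> R0" "v \<in> R0" for u v
      proof -
        obtain p i q j where *: "u = ev p / x ^ i" "degree p \<le> i" "v = ev q / x ^ j" "degree q \<le> j"
          using uv by (auto simp: R0_def)
        have xm: "ev (Polynomial.monom 1 i) = x ^ i" for i by (simp add: ev_monom poly_monom)
        have "u - v = ev (p * Polynomial.monom 1 j - q * Polynomial.monom 1 i) / x ^ (i + j)"
          using * x_neq(2) by (simp add: ev.hom_minus ev.hom_mult xm poly_monom power_add diff_frac_eq)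
        moreover have "degree (p * Polynomial.monom 1 j - q * Polynomial.monom 1 i) \<le> i + j"
          using * by (intro degree_diff_le order.trans[OF degree_mult_le]) (auto simp: degree_monom_eq)
        ultimately have "u - v \<in> R0" by (rule RI)
        moreover have "u * v = ev (p * q) / x ^ (i + j)"
          using * by (simp add: ev.hom_mult power_add)
        then have "u * v \<in> R0" by (rule RI) (use * in \<open>auto intro: order.trans[OF degree_mult_le]\<close>)
        ultimately show ?thesis by blast
      qed
      show "inverse x \<in> R0" by (rule RI[of _ 1 1]) (auto simp: field_simps)
      show "inverse (inverse x) \<notin> R0"
      proof
        assume "inverse (inverse x) \<in> R0"
        then obtain p j where pj: "x = ev p / x ^ j" "degree p \<le> j" by (auto simp: R0_def)
        then have "x * x ^ j = ev p" using x_neq(2) by (metis nonzero_eq_divide_eq power_eq_0_iff)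
        then have "ev (p - Polynomial.monom 1 (Suc j)) = 0" by (simp add: ev.hom_minus ev_monom poly_monom)
        then have "p = Polynomial.monom 1 (Suc j)" by (simp only: ev_eq_0_iff) simp
        then have "degree p = Suc j" by (simp add: degree_monom_eq)
        with pj show False by simp
      qed
    qed
    then obtain P where P: "valuation_ring (fixed K) P" "R0 \<subseteq> P" "inverse (inverse x) \<notin> P" by blast
    have "emb a \<in> P" for a using RI[of "emb a" "[:a:]" 0] P(2) by (auto simp: ev_const)
    then have "P \<in> pts K" using P point[of P "inverse x"] by (auto intro!: subfield_inverse subfield_rat x_rat)
    then show ?thesis using P(3) None by (intro bexI[of _ P]) (auto simp: over_def)
  qed
qed

text \<open>Away from infinity and from the zeros of the denominators in its characteristic
  equation, \<open>w\<close> is integral over the valuation ring.\<close>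

lemma pts_finite_poles:
  assumes w: "w \<in> fixed K" and K: "K > 0"
  shows "finite {c. \<exists>P\<in>pts K. over c P \<and> w \<notin> P}"
proof -
  obtain a where a: "\<And>i. a i \<in> rat_field" "a K = 1" "(\<Sum>i\<le>K. a i * w ^ i) = 0"
    using characteristic_equation[OF w K] by blast
  have "\<forall>i. \<exists>p q. q \<noteq> 0 \<and> a i = ev p / ev q" using rat_representation a(1) by blast
  then obtain p q where pq: "\<And>i. q i \<noteq> 0" "\<And>i. a i = ev (p i) / ev (q i)" by metis
  have "{c. \<exists>P\<in>pts K. over c P \<and> w \<notin> P} \<subseteq> insert None (\<Union>i<K. Some ` {r. poly (q i) r = 0})"
  proof
    fix c assume "c \<in> {c. \<exists>P\<in>pts K. over c P \<and> w \<notin> P}"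
    then obtain P where P: "P \<in> pts K" "over c P" "w \<notin> P" by blast
    interpret tower_valuation emb x y f N \<zeta> \<delta> "fixed K" P by (rule tower_valuation[OF P(1)])
    show "c \<in> insert None (\<Union>i<K. Some ` {r. poly (q i) r = 0})"
    proof (rule ccontr)
      assume n: "c \<notin> insert None (\<Union>i<K. Some ` {r. poly (q i) r = 0})"
      then obtain r where r: "c = Some r" "\<And>i. i < K \<Longrightarrow> poly (q i) r \<noteq> 0" by (cases c) auto
      have x: "x \<in> P" using P(2) r nonunits_subset add[of "x - emb r" "emb r"] emb_mem by (auto simp: over_def)
      have "- a i \<in> P" if i: "i < K" for i
      proof -
        have "ev (q i) \<in> P - nonunits P" using ev_residue[of r "q i"] P(2) r i residue_unit by auto
        then show ?thesis unfolding pq(2) divide_inverse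
          using unit_iff[of "ev (q i)"] ev_mem[OF x] by (intro uminus mult) auto
      qed
      moreover have "w ^ K = (\<Sum>i<K. - a i * w ^ i)"
      proof -
        have "w ^ K + (\<Sum>i<K. a i * w ^ i) = 0"
          using a(2,3) by (simp add: lessThan_Suc_atMost[symmetric] add.commute)
        then show ?thesis by (simp add: sum_negf eq_neg_iff_add_eq_0)
      qed
      ultimately have "w \<in> P" using integrally_closed[OF w K, of "\<lambda>i. - a i"] by blast
      with P show False by simp
    qed
  qed
  moreover have "finite (insert None (\<Union>i<K. Some ` {r. poly (q i) r = 0}))"
    using pq(1) by (auto intro: poly_roots_finite)
  ultimately show ?thesis by (rule finite_subset)
qed

lemma funpow_fixed_image:
  assumes K: "K > 0"
  shows "(\<delta> ^^ i) ` fixed K = fixed K"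
proof
  show "(\<delta> ^^ i) ` fixed K \<subseteq> fixed K" using fixed_funpow by auto
  show "fixed K \<subseteq> (\<delta> ^^ i) ` fixed K"
  proof
    fix w assume w: "w \<in> fixed K"
    have "w = (\<delta> ^^ (i + (K * i - i))) w" using fixed_multiple[OF w, of "K * i"] K by simp
    then show "w \<in> (\<delta> ^^ i) ` fixed K" using fixed_funpow[OF w, of "K * i - i"] by (simp add: funpow_add)
  qed
qed

lemma funpow_image_image: "(\<delta> ^^ i) ` (\<delta> ^^ j) ` P = (\<delta> ^^ (i + j)) ` P"
  by (simp add: funpow_add image_comp)

lemma pts_subset: "P \<in> pts K \<Longrightarrow> P \<subseteq> fixed K"
  by (auto simp: pts_def points_def valuation_ring_def)

lemma funpow_image_multiple: "P \<in> pts K \<Longrightarrow> K dvd i \<Longrightarrow> (\<delta> ^^ i) ` P = P"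
  using pts_subset fixed_multiple by (force simp: image_iff)

lemma funpow_image_mod: "P \<in> pts K \<Longrightarrow> (\<delta> ^^ (i mod K)) ` P = (\<delta> ^^ i) ` P"
proof -
  assume P: "P \<in> pts K"
  have "(\<delta> ^^ i) ` P = (\<delta> ^^ (i mod K + K * (i div K))) ` P" by simp
  also have "\<dots> = (\<delta> ^^ (i mod K)) ` P"
    unfolding funpow_image_image[symmetric] by (subst funpow_image_multiple[OF P]) auto
  finally show ?thesis ..
qed

lemma funpow_nonunits: "P \<in> pts K \<Longrightarrow> nonunits ((\<delta> ^^ i) ` P) = (\<delta> ^^ i) ` nonunits P"
  using valuation_subring_image(2)[OF funpow_hom] tower_valuation
  by (meson tower_valuation_def)

lemma funpow_pts: assumes P: "P \<in> pts K" and K: "K > 0" shows "(\<delta> ^^ i) ` P \<in> pts K"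
proof -
  interpret h: field_hom "\<delta> ^^ i" by (rule funpow_hom)
  interpret D: dvr "(\<delta> ^^ i) ` fixed K" "(\<delta> ^^ i) ` P" by (rule dvr_image(1)[OF funpow_hom pts_dvr[OF P K]])
  have "emb a \<in> (\<delta> ^^ i) ` P" for a
    using P funpow_emb[of i a] by (auto simp: pts_def points_def image_iff intro!: bexI[of _ "emb a"])
  then show ?thesis using D.valuation_ring D.proper funpow_fixed_image[OF K]
    by (auto simp: pts_def points_def)
qed

lemma funpow_over: assumes P: "P \<in> pts K" shows "over c ((\<delta> ^^ i) ` P) \<longleftrightarrow> over c P"
proof -
  interpret h: field_hom "\<delta> ^^ i" by (rule funpow_hom)
  have "(\<delta> ^^ i) w \<in> (\<delta> ^^ i) ` X \<longleftrightarrow> w \<in> X" for w X by auto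
  then have "w \<in> (\<delta> ^^ i) ` X \<longleftrightarrow> w \<in> X" if "w \<in> rat_field" for w X
    using rat_funpow[OF that, of i] by metis
  then show ?thesis
    using subfield_diff[OF subfield_rat x_rat emb_rat] x_rat
    by (auto simp: over_def funpow_nonunits[OF P] split: option.splits)
qed

lemma funpow_ord:
  "P \<in> pts K \<Longrightarrow> K > 0 \<Longrightarrow> w \<in> fixed K \<Longrightarrow> w \<noteq> 0 \<Longrightarrow> place_ord ((\<delta> ^^ i) ` P) ((\<delta> ^^ i) w) = place_ord P w"
  using dvr_image(2)[OF funpow_hom pts_dvr] by blast

text \<open>On \<open>fixed K\<close> the power \<open>\<delta> ^^ j\<close> is inverse to
  \<open>\<delta> ^^ i\<close>; naming the inverse by a natural number avoids negative powers of
  \<delta>.\<close>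

lemma funpow_ord':
  assumes P: "P \<in> pts K" "K > 0" and w: "w \<in> fixed K" "w \<noteq> 0" and ij: "K dvd i + j"
  shows "place_ord P ((\<delta> ^^ i) w) = place_ord ((\<delta> ^^ j) ` P) w"
proof -
  have "(\<delta> ^^ i) ` (\<delta> ^^ j) ` P = P" unfolding funpow_image_image using P ij by (simp add: funpow_image_multiple)
  then show ?thesis using funpow_ord[OF funpow_pts[OF P] P(2) w, of i j] by simp
qed

lemma pts_restrict:
  assumes P: "P \<in> pts K" and K: "K > 0" "J dvd K"
  shows "P \<inter> fixed J \<in> pts J" "over c (P \<inter> fixed J) \<longleftrightarrow> over c P"
    "nonunits (P \<inter> fixed J) = nonunits P \<inter> fixed J"
proof -
  interpret tower_valuation emb x y f N \<zeta> \<delta> "fixed K" P by (rule tower_valuation[OF P])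
  interpret R: valuation_subring "fixed J" "P \<inter> fixed J"
    by (rule restrict[OF subfield_fixed fixed_mono[OF K(2)]])
  show nu: "nonunits (P \<inter> fixed J) = nonunits P \<inter> fixed J"
    by (rule nonunits_restrict[OF subfield_fixed])
  have "\<not> rat_field \<subseteq> P \<inter> fixed J" using rat_not_subset[OF P K(1)] by auto
  then have "P \<inter> fixed J \<noteq> fixed J" using rat_fixed[of J] by auto
  then show "P \<inter> fixed J \<in> pts J"
    using R.valuation_ring emb_mem emb_fixed by (auto simp: pts_def points_def)
  show "over c (P \<inter> fixed J) \<longleftrightarrow> over c P"
    using nu x_fixed subfield_diff[OF subfield_fixed x_fixed emb_fixed]
    by (auto simp: over_def split: option.splits)
qed

lemma relative_norm_fixed:
  assumes w: "w \<in> fixed K" and n: "J * n = K" and K: "K > 0"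
  shows "(\<Prod>i<n. (\<delta> ^^ (J * i)) w) \<in> fixed J"
proof -
  interpret d: field_hom "\<delta> ^^ J" by (rule funpow_hom)
  obtain n' where n': "n = Suc n'" using n K by (cases n) auto
  have "(\<delta> ^^ J) (\<Prod>i<n. (\<delta> ^^ (J * i)) w) = (\<Prod>i<n. (\<delta> ^^ (J * Suc i)) w)"
    by (simp add: d.hom_prod funpow_add)
  also have "\<dots> = (\<Prod>i<n'. (\<delta> ^^ (J * Suc i)) w) * (\<delta> ^^ K) w" unfolding n' n[symmetric] by simp
  also have "(\<delta> ^^ K) w = w" using w by (simp add: fixed_def)
  also have "(\<Prod>i<n'. (\<delta> ^^ (J * Suc i)) w) * w = (\<Prod>i<n. (\<delta> ^^ (J * i)) w)"
    unfolding n' by (subst prod.lessThan_Suc_shift) (simp add: mult.commute)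
  finally show ?thesis by (simp add: fixed_def)
qed

text \<open>
  If \<open>P'\<close> is not conjugate to \<open>P\<close>, an element vanishing at \<open>P'\<close> but at no other conjugate of \<open>P\<close> or
  \<open>P'\<close> has a norm that vanishes at \<open>P'\<close> but not at \<open>P\<close>.
\<close>

lemma conjugate_points:
  assumes P: "P \<in> pts K" "P' \<in> pts K" and K: "K > 0" and n: "J * n = K"
    and same: "P \<inter> fixed J = P' \<inter> fixed J"
  shows "\<exists>i<n. P' = (\<delta> ^^ (J * i)) ` P"
proof (rule ccontr)
  assume nc: "\<not> ?thesis"
  have n0: "n > 0" using n K by (cases n) auto
  interpret P: dvr "fixed K" P by (rule pts_dvr[OF P(1) K])
  interpret P': dvr "fixed K" P' by (rule pts_dvr[OF P(2) K])
  \<comment> \<open>Only \<open>P'\<close> itself is left out. A conjugation that fixes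
    \<open>P'\<close> adds another positive contribution to the order of the norm there, so it does
    no harm.\<close>
  define T where "T = (\<lambda>i. (\<delta> ^^ (J * i)) ` P) ` {..<n} \<union> ((\<lambda>i. (\<delta> ^^ (J * i)) ` P') ` {..<n} - {P'})"
  have T: "dvr (fixed K) Q \<and> Q \<noteq> P'" if "Q \<in> T" for Q
    using that nc P K funpow_pts pts_dvr unfolding T_def by blast
  have fT: "finite T" by (simp add: T_def)
  obtain u where u: "u \<in> fixed K" "u \<noteq> 0" "place_ord P' u = 1" "\<And>Q. Q \<in> T \<Longrightarrow> place_ord Q u = 0"
    using dvr_approximation[OF P'.dvr_axioms fT T] by blast
  define v where "v = (\<Prod>i<n. (\<delta> ^^ (J * i)) u)"
  have conj: "(\<delta> ^^ i) u \<in> fixed K \<and> (\<delta> ^^ i) u \<noteq> 0" for i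
    using fixed_funpow[OF u(1)] u(2) funpow_eq_0_iff by blast
  have v: "v \<in> fixed J" "v \<in> fixed K" "v \<noteq> 0"
    using relative_norm_fixed[OF u(1) n K] conj by (auto simp: v_def intro!: subfield_prod subfield_fixed)
  have ord: "place_ord Q ((\<delta> ^^ (J * i)) u) = place_ord ((\<delta> ^^ (J * ((n - i) mod n))) ` Q) u"
    if "Q \<in> pts K" "i < n" for Q i
  proof -
    have *: "i + (n - i) mod n = (if i = 0 then 0 else n)" using that by auto
    have "J * i + J * ((n - i) mod n) = J * (i + (n - i) mod n)" by (simp add: distrib_left)
    then have "K dvd J * i + J * ((n - i) mod n)" using n unfolding * by auto
    then show ?thesis using that K u by (intro funpow_ord') auto
  qed
  have "place_ord P v = (\<Sum>i<n. place_ord P ((\<delta> ^^ (J * i)) u))"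
    unfolding v_def using conj by (intro P.ord_prod) auto
  also have "\<dots> = 0"
    by (intro sum.neutral ballI) (simp add: ord[OF P(1)], rule u(4), auto simp: T_def n0)
  finally have "v \<notin> nonunits P" using P.nonunit_iff_ord v by auto
  have terms: "place_ord P' ((\<delta> ^^ (J * i)) u) \<ge> 0" if "i < n" for i
  proof (cases "(\<delta> ^^ (J * ((n - i) mod n))) ` P' = P'")
    case True
    then show ?thesis using u(3) by (simp add: ord[OF P(2) that])
  next
    case False
    then have "(\<delta> ^^ (J * ((n - i) mod n))) ` P' \<in> T" using n0 by (auto simp: T_def)
    then show ?thesis using u(4) by (simp add: ord[OF P(2) that])
  qed
  have "place_ord P' v = (\<Sum>i<n. place_ord P' ((\<delta> ^^ (J * i)) u))"
    unfolding v_def using conj by (intro P'.ord_prod) auto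
  also have "\<dots> \<ge> place_ord P' ((\<delta> ^^ (J * 0)) u)"
    using terms n0 by (intro member_le_sum) auto
  finally have "v \<in> nonunits P'" using P'.nonunit_iff_ord v u(3) by auto
  then have "v \<in> nonunits P' \<inter> fixed J" using v by auto
  also have "\<dots> = nonunits P \<inter> fixed J"
    using P.nonunits_restrict[OF subfield_fixed, of J] P'.nonunits_restrict[OF subfield_fixed, of J] same by simp
  finally show False using \<open>v \<notin> nonunits P\<close> by auto
qed

lemma conjugate_points_over:
  assumes P: "P \<in> pts K" "over c P" and P': "P' \<in> pts K" "over c P'" and K: "K > 0"
  shows "\<exists>i<K. P' = (\<delta> ^^ i) ` P"
  using conjugate_points[OF P(1) P'(1) K, of 1 K] pts_restrict_rat[OF P P'] fixed_1 by auto

section \<open>Fibres over the points of the line, and finiteness of supports\<close>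

definition fibre :: "nat \<Rightarrow> 'a option \<Rightarrow> 'f set set" where
  "fibre K c = {P \<in> pts K. over c P}"

lemma finite_fibre: "K > 0 \<Longrightarrow> finite (fibre K c)"
proof -
  assume K: "K > 0"
  obtain P where P: "P \<in> pts K" "over c P" using pts_exists by blast
  have "fibre K c \<subseteq> (\<lambda>i. (\<delta> ^^ i) ` P) ` {..<K}"
    using conjugate_points_over[OF P _ _ K] by (fastforce simp: fibre_def)
  then show ?thesis by (rule finite_subset) auto
qed

lemma fibre_nonempty: "fibre K c \<noteq> {}"
  using pts_exists by (auto simp: fibre_def)

lemma finite_poles: "w \<in> fixed K \<Longrightarrow> K > 0 \<Longrightarrow> finite {P \<in> pts K. w \<notin> P}"
proof -
  assume w: "w \<in> fixed K" and K: "K > 0"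
  have "{P \<in> pts K. w \<notin> P} \<subseteq> (\<Union>c\<in>{c. \<exists>P\<in>pts K. over c P \<and> w \<notin> P}. fibre K c)"
    using over_exists K by (fastforce simp: fibre_def)
  then show ?thesis
    by (rule finite_subset) (use pts_finite_poles[OF w K] finite_fibre[OF K] in auto)
qed

lemma finite_support: "w \<in> fixed K \<Longrightarrow> w \<noteq> 0 \<Longrightarrow> K > 0 \<Longrightarrow> finite {P \<in> pts K. place_ord P w \<noteq> 0}"
proof -
  assume w: "w \<in> fixed K" "w \<noteq> 0" and K: "K > 0"
  have "{P \<in> pts K. place_ord P w \<noteq> 0} \<subseteq> {P \<in> pts K. w \<notin> P} \<union> {P \<in> pts K. inverse w \<notin> P}"
  proof
    fix P assume P: "P \<in> {P \<in> pts K. place_ord P w \<noteq> 0}"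
    interpret dvr "fixed K" P using P pts_dvr K by auto
    show "P \<in> {P \<in> pts K. w \<notin> P} \<union> {P \<in> pts K. inverse w \<notin> P}"
      using P mem_iff_ord[OF w] mem_iff_ord[of "inverse w"] ord_inverse[OF w] w
        subfield_inverse[OF subfield_fixed w(1)] by auto
  qed
  then show ?thesis
    by (rule finite_subset) (use finite_poles[OF _ K] w subfield_inverse[OF subfield_fixed w(1)] in auto)
qed

section \<open>Ramification in Kummer covers\<close>

text \<open>The classical ramification index over \<open>c\<close> of a \<open>K\<close>-th root of
  \<open>f\<close>. It starts as a mere formula; \<open>card_stabilizer\<close> identifies it with
  the order of the stabilizer and with the order of vanishing of \<open>param c\<close>.\<close>

definition ram :: "nat \<Rightarrow> 'a option \<Rightarrow> nat" where "ram K c = K div gcd (nat \<bar>pord c f\<bar>) K"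

lemma ord_rat:
  assumes P: "P \<in> pts K" "over c P" and K: "K > 0" and w: "w \<in> rat_field" "w \<noteq> 0"
  shows "place_ord P w = place_ord P (param c) * place_ord (P \<inter> rat_field) w"
    "place_ord P (param c) > 0" "ramification P (P \<inter> rat_field) = place_ord P (param c)"
proof -
  interpret tower_valuation emb x y f N \<zeta> \<delta> "fixed K" P by (rule tower_valuation[OF P(1)])
  note Q = rat_dvr[OF P(2)]
  note r = dvr_restrict_ord[OF pts_dvr[OF P(1) K] Q rat_fixed]
  have e: "ramification P (P \<inter> rat_field) = place_ord P (param c)"
    using r(1)[OF param_rat param_neq_0] rat_param_ord[OF P(2)] by simp
  then show "ramification P (P \<inter> rat_field) = place_ord P (param c)" .
  show "place_ord P w = place_ord P (param c) * place_ord (P \<inter> rat_field) w" using r(1)[OF w] e by simp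
  show "place_ord P (param c) > 0" using r(2)[OF w] e by simp
qed

lemma ord_rat_ev:
  assumes P: "P \<in> pts K" "over c P" and K: "K > 0" and p: "p \<noteq> 0"
  shows "place_ord P (ev p) = place_ord P (param c) * pord c p"
proof -
  interpret tower_valuation emb x y f N \<zeta> \<delta> "fixed K" P by (rule tower_valuation[OF P(1)])
  interpret dvr "fixed K" P by (rule pts_dvr[OF P(1) K])
  obtain u r where u: "u \<in> rat_field" "ev p = param c powi pord c p * u" "r \<noteq> 0" "u - emb r \<in> nonunits P"
    using ev_decomposition[OF P(2) p] by blast
  have U: "u \<in> P - nonunits P" using residue_unit u by blast
  have "u \<noteq> 0" using U zero_nonunit by auto
  then have "place_ord P u = 0" using unit_iff_ord[of u] U u(1) rat_fixed by auto
  moreover have "param c \<in> fixed K" "u \<in> fixed K" using param_rat u(1) rat_fixed by auto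
  ultimately show ?thesis unfolding u(2) using param_neq_0[of c] \<open>u \<noteq> 0\<close>
    by (subst ord_mult) (auto simp: ord_powi intro!: subfield_powi subfield_fixed)
qed

text \<open>Let d be the gcd. A power of the Kummer generator, corrected by a power of
  \<open>param c\<close>, gives \<open>w\<close> whose d-th power is a unit with known residue, so
  \<open>w\<close> has a nonzero constant \<open>b\<close> as residue. Since
  \<open>\<delta> ^^ i\<close> multiplies \<open>w\<close> by the i-th power of a primitive d-th
  root of unity and, fixing \<open>P\<close>, preserves residues, d divides
  \<open>i\<close>.\<close>

lemma stabilizer_multiple:
  assumes P: "P \<in> pts K" "over c P" and KM: "K * M = N" and f0: "f \<noteq> 0"
    and stab: "(\<delta> ^^ i) ` P = P"
  shows "gcd (nat \<bar>pord c f\<bar>) K dvd i"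
proof -
  have K: "K > 0" using KM N_pos by (cases K) auto
  define d where "d = gcd (nat \<bar>pord c f\<bar>) K"
  have dK: "d dvd K" "d dvd nat \<bar>pord c f\<bar>" unfolding d_def by (rule gcd_dvd2, rule gcd_dvd1)
  then have "int d dvd int (nat \<bar>pord c f\<bar>)" by (simp only: int_dvd_int_iff)
  then have d: "d dvd K" "int d dvd pord c f" "d > 0" using K dK by (auto intro: Nat.gr0I)
  interpret tower_valuation emb x y f N \<zeta> \<delta> "fixed K" P by (rule tower_valuation[OF P(1)])
  obtain u r where u: "u \<in> rat_field" "ev f = param c powi pord c f * u" "r \<noteq> 0" "u - emb r \<in> nonunits P"
    using ev_decomposition[OF P(2) f0] by blast
  obtain Kd where Kd: "K = d * Kd" using d(1) by (elim dvdE)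
  obtain nd where nd: "pord c f = int d * nd" using d(2) by (elim dvdE)
  define w where "w = (y ^ M) ^ Kd * param c powi (- nd)"
  have "((y ^ M) ^ Kd) ^ d = y ^ N" unfolding power_mult[symmetric] using KM Kd by (simp add: mult_ac)
  moreover have "(param c powi (- nd)) ^ d = param c powi (- pord c f)"
    using power_int_mult[of "param c" "- nd" "int d"] by (simp add: nd mult.commute)
  ultimately have "w ^ d = y ^ N * param c powi (- pord c f)"
    by (simp add: w_def power_mult_distrib)
  also have "\<dots> = u" unfolding y_power u(2) using param_neq_0[of c] by (simp add: power_int_minus)
  finally have wd: "w ^ d = u" .
  have yM: "y ^ M \<in> fixed K"
    unfolding fixed_eq_hull[OF KM] using hull_subset[of "range emb \<union> {x, y ^ M}" is_subfield] by auto
  have pK: "param c \<in> fixed K" using param_rat rat_fixed by auto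
  have wL: "w \<in> fixed K" unfolding w_def
    by (intro subfield_mult subfield_power subfield_powi subfield_fixed yM pK)
  obtain b0 where b0: "b0 ^ d = r" using nth_root_exists[OF d(3)] by blast
  define \<eta> where "\<eta> = \<zeta> ^ (M * Kd)"
  have N': "N = M * Kd * d" using KM Kd by (simp add: mult_ac)
  have MK: "M * Kd > 0" using N' N_pos by (cases "M * Kd") auto
  have eta: "\<eta> ^ j = 1 \<longleftrightarrow> d dvd j" for j
    unfolding \<eta>_def power_mult[symmetric] primitive N' using MK by simp
  have inj: "inj_on (\<lambda>i. \<eta> ^ i) {..<d}"
    unfolding inj_on_def \<eta>_def power_mult[symmetric]
  proof (intro ballI impI)
    fix i j assume ij: "i \<in> {..<d}" "j \<in> {..<d}" "\<zeta> ^ (M * Kd * i) = \<zeta> ^ (M * Kd * j)"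
    have lt: "M * Kd * i < N" if "i < d" for i unfolding N' using that MK by (intro mult_strict_left_mono) auto
    from ij have "M * Kd * i = M * Kd * j" using primitive_eq_iff[of "M * Kd * i" "M * Kd * j"] lt by auto
    then show "i = j" using MK by auto
  qed
  \<comment> \<open>Here \<open>b0\<close> is one d-th root of the residue of \<open>w ^ d\<close>.
    The product of the differences of \<open>w\<close> with all these roots is a nonunit, so one
    factor is, which determines the residue of \<open>w\<close>.\<close>
  have "(\<Prod>j<d. w - emb \<eta> ^ j * emb b0) = w ^ d - emb b0 ^ d"
  proof (rule prod_roots_of_unity[OF d(3)])
    show "emb \<eta> ^ d = 1" using eta[of d] by (simp flip: emb.hom_power)
    show "inj_on (\<lambda>i. emb \<eta> ^ i) {..<d}" using inj by (auto simp: inj_on_def simp flip: emb.hom_power)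
  qed
  also have "\<dots> = u - emb r" by (simp add: wd b0 flip: emb.hom_power)
  finally have pr: "(\<Prod>j<d. w - emb \<eta> ^ j * emb b0) \<in> nonunits P" using u by simp
  have wP: "w \<in> P"
  proof (rule integrally_closed[OF wL d(3), of "\<lambda>i. if i = 0 then u else 0"])
    have "(\<Sum>i<d. (if i = 0 then u else 0) * w ^ i) = (\<Sum>i\<in>{0}. u * w ^ i)"
      using d(3) by (intro sum.mono_neutral_cong_right) auto
    then show "w ^ d = (\<Sum>i<d. (if i = 0 then u else 0) * w ^ i)" by (simp add: wd)
  qed (use residue_unit[OF u(4,3)] zero in auto)
  have fac: "w - emb \<eta> ^ j * emb b0 \<in> P" for j
    using wP emb_mem by (intro diff mult power) auto
  have "\<exists>j\<in>J. w - emb \<eta> ^ j * emb b0 \<in> nonunits P"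
    if "finite J" "(\<Prod>j\<in>J. w - emb \<eta> ^ j * emb b0) \<in> nonunits P" for J :: "nat set"
    using that
  proof (induction J)
    case (insert j J)
    have "(\<Prod>j\<in>J. w - emb \<eta> ^ j * emb b0) \<in> P" by (rule prod[OF fac])
    from nonunit_prime[OF fac[of j] this] show ?case using insert by auto
  qed (use one_unit in auto)
  from this[OF _ pr] obtain j where j: "w - emb \<eta> ^ j * emb b0 \<in> nonunits P" by auto
  define b where "b = \<eta> ^ j * b0"
  have wb: "w - emb b \<in> nonunits P" using j by (simp add: b_def emb.hom_mult emb.hom_power)
  have "b ^ d = (\<eta> ^ d) ^ j * r" by (simp add: b_def power_mult_distrib b0 mult.commute flip: power_mult)
  then have b: "b \<noteq> 0" using eta[of d] u(3) d(3) by (auto simp: power_0_left)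
  interpret di: field_hom "\<delta> ^^ i" by (rule funpow_hom)
  have "(\<delta> ^^ i) w = (emb (\<zeta> ^ i) ^ (M * Kd)) * w"
  proof -
    have powi: "(\<delta> ^^ i) (param c powi m) = param c powi m" for m
      using rat_funpow[OF subfield_powi[OF subfield_rat param_rat]] by blast
    show ?thesis by (simp add: w_def di.hom_mult di.hom_power powi funpow_y power_mult_distrib power_mult)
  qed
  also have "emb (\<zeta> ^ i) ^ (M * Kd) = emb (\<eta> ^ i)"
    by (simp add: \<eta>_def mult.commute flip: emb.hom_power power_mult)
  finally have dw: "(\<delta> ^^ i) w = emb (\<eta> ^ i) * w" .
  have "(\<delta> ^^ i) (w - emb b) \<in> (\<delta> ^^ i) ` nonunits P" using wb by blast
  also have "\<dots> = nonunits P" using funpow_nonunits[OF P(1), of i] stab by simp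
  finally have "emb (\<eta> ^ i) * w - emb b \<in> nonunits P" by (simp add: di.hom_minus dw funpow_emb)
  moreover have "emb (\<eta> ^ i) * (w - emb b) \<in> nonunits P" using wb emb_mem nonunit_mult' by blast
  ultimately have "(emb (\<eta> ^ i) * w - emb b) - emb (\<eta> ^ i) * (w - emb b) \<in> nonunits P" by (rule nonunit_diff)
  also have "(emb (\<eta> ^ i) * w - emb b) - emb (\<eta> ^ i) * (w - emb b) = emb ((\<eta> ^ i - 1) * b)"
    by (simp add: emb.hom_mult emb.hom_minus algebra_simps)
  finally have "(\<eta> ^ i - 1) * b = 0" using emb_unit by blast
  then show ?thesis using b eta unfolding d_def by auto
qed

text \<open>Let e be the order of \<open>param c\<close> at \<open>P\<close>. The stabilizer has at
  most \<open>ram K c\<close> elements by the preceding lemma. Next, \<open>ram K c\<close> divides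
  e, because e times \<open>pord c f\<close> is the order of a \<open>K\<close>-th power. Finally e
  divides the order of the stabilizer: an element with a simple zero at \<open>P\<close> and none at
  the other conjugates has a norm of exactly that order at \<open>P\<close>, and the norm is a
  rational function. Hence all three agree.\<close>

lemma card_stabilizer:
  assumes P: "P \<in> pts K" "over c P" and KM: "K * M = N" and f0: "f \<noteq> 0"
  shows "card {i. i < K \<and> (\<delta> ^^ i) ` P = P} = ram K c" "place_ord P (param c) = int (ram K c)"
proof -
  have K: "K > 0" using KM N_pos by (cases K) auto
  interpret dvr "fixed K" P by (rule pts_dvr[OF P(1) K])
  define d where "d = gcd (nat \<bar>pord c f\<bar>) K"
  have dK: "d dvd K" unfolding d_def by (rule gcd_dvd2)
  then have d: "d dvd K" "d > 0" using K by (auto intro: Nat.gr0I)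
  define St where "St = {i. i < K \<and> (\<delta> ^^ i) ` P = P}"
  define e where "e = place_ord P (param c)"
  have "1 \<in> rat_field" by (rule subfield_one[OF subfield_rat])
  then have e: "e > 0" using ord_rat(2)[OF P K, of 1] by (simp add: e_def)
  have upper: "card St \<le> ram K c"
  proof -
    have "St \<subseteq> (\<lambda>j. d * j) ` {..<K div d}"
    proof
      fix i assume "i \<in> St"
      then have i: "i < K" "d dvd i" using stabilizer_multiple[OF P KM f0] by (auto simp: St_def d_def)
      then obtain j where j: "i = d * j" by (elim dvdE)
      obtain Kd where "K = d * Kd" using d(1) by (elim dvdE)
      then show "i \<in> (\<lambda>j. d * j) ` {..<K div d}" using i j d by auto
    qed
    then have "card St \<le> card ((\<lambda>j. d * j) ` {..<K div d})" by (intro card_mono) auto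
    also have "\<dots> \<le> K div d" using card_image_le[of "{..<K div d}" "\<lambda>j. d * j"] by simp
    finally show ?thesis by (simp add: ram_def d_def)
  qed
  have "int (ram K c) dvd e"
  proof -
    have yM: "y ^ M \<in> fixed K"
      unfolding fixed_eq_hull[OF KM] using hull_subset[of "range emb \<union> {x, y ^ M}" is_subfield] by auto
    have evf: "(y ^ M) ^ K = ev f" using y_power KM by (simp add: mult.commute flip: power_mult)
    have "ev f \<noteq> 0" unfolding ev_eq_0_iff by (rule f0)
    then have "y ^ M \<noteq> 0" using K unfolding evf[symmetric] by (metis power_0_left neq0_conv)
    then have eq: "int K * place_ord P (y ^ M) = e * pord c f"
      using ord_power[OF yM, of K] ord_rat_ev[OF P K f0] evf by (simp add: e_def)
    obtain n' where n': "nat \<bar>pord c f\<bar> = d * n'" unfolding d_def by (metis gcd_dvd1 dvdE)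
    obtain K' where K': "K = d * K'" using d by (elim dvdE)
    have cop: "coprime n' K'"
    proof -
      have "d * gcd n' K' = d" using n' K' by (metis d_def gcd_mult_distrib_nat)
      then show ?thesis using d by (simp add: coprime_iff_gcd_eq_1)
    qed
    have "int d * int K' * \<bar>place_ord P (y ^ M)\<bar> = e * (int d * int n')"
      using arg_cong[OF eq, of abs] e n' K' by (simp add: abs_mult) (metis abs_ge_zero int_nat_eq of_nat_mult)
    then have "int K' * \<bar>place_ord P (y ^ M)\<bar> = e * int n'" using d by simp
    then have "int K' dvd e * int n'" by (metis dvd_triv_left)
    moreover have "coprime (int K') (int n')" using cop by (simp add: ac_simps)
    ultimately have "int K' dvd e" by (simp add: coprime_dvd_mult_left_iff)
    moreover have "ram K c = K div d" by (simp only: ram_def d_def)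
    then have "ram K c = K'" using K' d(2) by simp
    ultimately show ?thesis by simp
  qed
  moreover have "e dvd int (card St)"
  proof -
    define T where "T = (\<lambda>i. (\<delta> ^^ i) ` P) ` {..<K} - {P}"
    have T: "dvr (fixed K) Q \<and> Q \<noteq> P" if "Q \<in> T" for Q
      using that P K funpow_pts pts_dvr unfolding T_def by blast
    have fT: "finite T" by (simp add: T_def)
    obtain u where u: "u \<in> fixed K" "u \<noteq> 0" "place_ord P u = 1" "\<And>Q. Q \<in> T \<Longrightarrow> place_ord Q u = 0"
      using dvr_approximation[OF dvr_axioms fT T] by blast
    have conj: "(\<delta> ^^ i) u \<in> fixed K \<and> (\<delta> ^^ i) u \<noteq> 0" for i
      using fixed_funpow[OF u(1)] u(2) funpow_eq_0_iff by blast
    have "place_ord P (norm K u) = (\<Sum>i<K. place_ord P ((\<delta> ^^ i) u))"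
      unfolding norm_def using conj by (intro ord_prod) auto
    also have "\<dots> = (\<Sum>i<K. if (\<delta> ^^ i) ` P = P then 1 else 0)"
    proof (intro sum.cong refl)
      fix i assume i: "i \<in> {..<K}"
      have o: "place_ord P ((\<delta> ^^ i) u) = place_ord ((\<delta> ^^ (K - i)) ` P) u"
        using i P K u by (intro funpow_ord') auto
      have iff: "(\<delta> ^^ (K - i)) ` P = P \<longleftrightarrow> (\<delta> ^^ i) ` P = P"
      proof -
        have "(\<delta> ^^ i) ` (\<delta> ^^ (K - i)) ` P = P" "(\<delta> ^^ (K - i)) ` (\<delta> ^^ i) ` P = P"
          unfolding funpow_image_image using i funpow_image_multiple[OF P(1), of K] by auto
        then show ?thesis by metis
      qed
      show "place_ord P ((\<delta> ^^ i) u) = (if (\<delta> ^^ i) ` P = P then 1 else 0)"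
      proof (cases "(\<delta> ^^ i) ` P = P")
        case False
        have "(\<delta> ^^ (K - i)) ` P = (\<delta> ^^ ((K - i) mod K)) ` P" using funpow_image_mod[OF P(1)] by simp
        then have "(\<delta> ^^ (K - i)) ` P \<in> T" using False iff K by (auto simp: T_def)
        then show ?thesis using o u(4) False by simp
      qed (use o iff u in auto)
    qed
    also have "\<dots> = int (card St)" by (simp add: St_def sum.If_cases Collect_conj_eq lessThan_def)
    finally have "int (card St) = e * place_ord (P \<inter> rat_field) (norm K u)"
      using ord_rat(1)[OF P K norm_in_rat[OF u(1)]] norm_eq_0_iff[OF K] u(2) by (simp add: e_def)
    then show ?thesis by simp
  qed
  moreover have "card St > 0"
    using K by (auto simp: St_def card_gt_0_iff intro!: exI[of _ 0])
  ultimately have "int (ram K c) \<le> e" "e \<le> int (card St)"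
    using e zdvd_imp_le by (blast, auto intro: zdvd_imp_le)
  with upper show "card {i. i < K \<and> (\<delta> ^^ i) ` P = P} = ram K c" "place_ord P (param c) = int (ram K c)"
    unfolding St_def[symmetric] e_def[symmetric] by linarith+
qed

end

section \<open>Counting in orbits, and degrees of formal sums\<close>

lemma card_cyclic_transporter:
  assumes n: "n > 0" and p: "(g ^^ n) p = p" and q: "q = (g ^^ j) p"
  shows "card {i. i < n \<and> (g ^^ i) p = q} = card {i. i < n \<and> (g ^^ i) p = p}"
proof -
  have mod: "(g ^^ (i mod n)) p = (g ^^ i) p" for i
    using p by (rule funpow_mod_eq)
  define k where "k = j mod n"
  have k: "k < n" "q = (g ^^ k) p" using n q mod by (auto simp: k_def)
  have "bij_betw (\<lambda>i. (i + k) mod n) {i. i < n \<and> (g ^^ i) p = p} {i. i < n \<and> (g ^^ i) p = q}"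
  proof (rule bij_betwI[of _ _ _ "\<lambda>i. (i + (n - k)) mod n"])
    show "(\<lambda>i. (i + k) mod n) \<in> {i. i < n \<and> (g ^^ i) p = p} \<rightarrow> {i. i < n \<and> (g ^^ i) p = q}"
      using n k by (auto simp: mod funpow_add add.commute[of _ k])
    show "(\<lambda>i. (i + (n - k)) mod n) \<in> {i. i < n \<and> (g ^^ i) p = q} \<rightarrow> {i. i < n \<and> (g ^^ i) p = p}"
    proof
      fix i assume i: "i \<in> {i. i < n \<and> (g ^^ i) p = q}"
      have "(g ^^ (i + (n - k))) p = (g ^^ (n - k)) ((g ^^ i) p)" by (simp add: funpow_add add.commute[of i])
      also have "\<dots> = (g ^^ (n - k)) ((g ^^ k) p)" using i k by simp
      also have "\<dots> = (g ^^ (n - k + k)) p" by (simp only: funpow_add comp_apply)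
      also have "\<dots> = p" using p k by simp
      finally show "(i + (n - k)) mod n \<in> {i. i < n \<and> (g ^^ i) p = p}" using n by (simp add: mod)
    qed
    show "((i + k) mod n + (n - k)) mod n = i" if "i \<in> {i. i < n \<and> (g ^^ i) p = p}" for i
      unfolding mod_add_left_eq using that k by simp
    show "((i + (n - k)) mod n + k) mod n = i" if "i \<in> {i. i < n \<and> (g ^^ i) p = q}" for i
      unfolding mod_add_left_eq using that k by simp
  qed
  then show ?thesis using bij_betw_same_card by fastforce
qed

lemma sum_card_fibres:
  assumes "finite B" "\<And>i. i < (n::nat) \<Longrightarrow> h i \<in> B" "\<And>b. b \<in> B \<Longrightarrow> card {i. i < n \<and> h i = b} = t"
  shows "n = card B * t"
proof -
  have "n = (\<Sum>i<n. 1)" by simp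
  also have "\<dots> = (\<Sum>b\<in>B. \<Sum>i\<in>{i. i < n \<and> h i = b}. 1)"
    using sum.group[of "{..<n}" B h "\<lambda>_. 1::nat"] assms(1,2) by (auto simp: image_subset_iff)
  also have "\<dots> = card B * t" using assms(3) by simp
  finally show ?thesis .
qed

lemma lookup_frag_extend:
  "Poly_Mapping.lookup (frag_extend g D) P = (\<Sum>Q\<in>Poly_Mapping.keys D. Poly_Mapping.lookup D Q * Poly_Mapping.lookup (g Q) P)"
  by (simp add: frag_extend_def lookup_sum)

lemma div_degree_superset:
  "finite A \<Longrightarrow> Poly_Mapping.keys D \<subseteq> A \<Longrightarrow> div_degree D = (\<Sum>P\<in>A. Poly_Mapping.lookup D P)"
  unfolding div_degree_def by (intro sum.mono_neutral_left) (auto simp: in_keys_iff)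

lemma div_degree_0: "div_degree 0 = 0"
  by (simp add: div_degree_def)

lemma div_degree_add: "div_degree (D + E) = div_degree D + div_degree E"
proof -
  let ?A = "Poly_Mapping.keys D \<union> Poly_Mapping.keys E"
  have "Poly_Mapping.keys (D + E) \<subseteq> ?A" by (rule Poly_Mapping.keys_add)
  then show ?thesis
    by (simp add: div_degree_superset[of ?A] lookup_add sum.distrib)
qed

lemma div_degree_diff: "div_degree (D - E) = div_degree D - div_degree E"
  using div_degree_add[of "D - E" E] by simp

lemma div_degree_uminus: "div_degree (- D) = - div_degree D"
  using div_degree_diff[of 0 D] by (simp add: div_degree_0)

lemma div_degree_sum: "div_degree (sum h I) = (\<Sum>i\<in>I. div_degree (h i))"
  by (induction I rule: infinite_finite_induct) (auto simp: div_degree_0 div_degree_add)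

lemma div_degree_cmul: "div_degree (frag_cmul c D) = c * div_degree D"
  using div_degree_superset[of "Poly_Mapping.keys D" "frag_cmul c D"]
  by (auto simp: sum_distrib_left div_degree_def[of D] keys_cmul)

lemma div_degree_frag_of: "div_degree (frag_of P) = 1"
  by (simp add: div_degree_def keys_frag_of)

lemma div_degree_frag_extend:
  "div_degree (frag_extend g D) = (\<Sum>Q\<in>Poly_Mapping.keys D. Poly_Mapping.lookup D Q * div_degree (g Q))"
  by (simp add: frag_extend_def div_degree_sum div_degree_cmul)

context kummer_cover begin

lemma image_funpow: "((\<lambda>P. (\<delta> ^^ J) ` P) ^^ i) P = (\<delta> ^^ (J * i)) ` P"
proof (induction i)
  case (Suc i)
  have "((\<lambda>P. (\<delta> ^^ J) ` P) ^^ Suc i) P = (\<delta> ^^ J) ` (\<delta> ^^ (J * i)) ` P"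
    using Suc by simp
  then show ?case by (simp only: funpow_image_image mult_Suc_right)
qed simp

end

locale kummer_tower = kummer_cover emb x y f N \<zeta> \<delta>
  for emb :: "'a::{alg_closed_field,field_char_0} \<Rightarrow> 'f::field" and x y f N \<zeta> \<delta> +
  assumes f_neq_0: "f \<noteq> 0"
begin

lemma dvd_pos: "K dvd N \<Longrightarrow> K > 0"
  using N_pos by (auto intro: Nat.gr0I)

lemma card_stabilizer':
  assumes "P \<in> pts K" "over c P" "K dvd N"
  shows "card {i. i < K \<and> (\<delta> ^^ i) ` P = P} = ram K c" "place_ord P (param c) = int (ram K c)"
  using card_stabilizer[OF assms(1,2) _ f_neq_0] assms(3) by (metis dvd_div_mult_self mult.commute)+

lemma card_transporter:
  assumes P: "P \<in> fibre K c" and P': "P' \<in> fibre K c" and K: "K dvd N"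
  shows "card {i. i < K \<and> (\<delta> ^^ i) ` P = P'} = ram K c"
proof -
  have PP: "P \<in> pts K" "over c P" "P' \<in> pts K" "over c P'" using P P' by (auto simp: fibre_def)
  obtain j where j: "j < K" "P' = (\<delta> ^^ j) ` P" using conjugate_points_over[OF PP dvd_pos[OF K]] by blast
  have i: "((\<lambda>P. \<delta> ` P) ^^ i) P = (\<delta> ^^ i) ` P" for i by (induction i) (auto simp: image_image)
  have "card {i. i < K \<and> ((\<lambda>P. \<delta> ` P) ^^ i) P = P'} = card {i. i < K \<and> ((\<lambda>P. \<delta> ` P) ^^ i) P = P}"
    by (rule card_cyclic_transporter[of _ _ _ _ j]) (use j dvd_pos[OF K] funpow_image_multiple[OF PP(1)] in \<open>auto simp: i\<close>)
  then show ?thesis using card_stabilizer'(1)[OF PP(1,2) K] by (simp add: i)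
qed

lemma card_fibre: assumes K: "K dvd N" shows "K = card (fibre K c) * ram K c"
proof -
  obtain P where P: "P \<in> fibre K c" using fibre_nonempty by blast
  show ?thesis
    by (rule sum_card_fibres[of _ _ "\<lambda>i. (\<delta> ^^ i) ` P"])
       (use P K dvd_pos[OF K] finite_fibre card_transporter[OF P] funpow_pts funpow_over in \<open>auto simp: fibre_def\<close>)
qed

lemma ram_pos: "K dvd N \<Longrightarrow> ram K c > 0"
  using card_fibre[of K c] dvd_pos[of K] by (auto intro: Nat.gr0I)

definition relram :: "nat \<Rightarrow> nat \<Rightarrow> 'a option \<Rightarrow> nat" where "relram J K c = ram K c div ram J c"

definition relfibre :: "nat \<Rightarrow> nat \<Rightarrow> 'f set \<Rightarrow> 'f set set" where
  "relfibre J K Q = {P \<in> pts K. P \<inter> fixed J = Q}"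

lemma relfibre_subset_fibre:
  assumes Q: "Q \<in> fibre J c" and K: "K dvd N" "J dvd K"
  shows "relfibre J K Q \<subseteq> fibre K c"
  using pts_restrict[OF _ dvd_pos[OF K(1)] K(2)] Q by (auto simp: relfibre_def fibre_def)

lemma finite_relfibre:
  assumes Q: "Q \<in> pts J" and K: "K dvd N" "J dvd K"
  shows "finite (relfibre J K Q)"
proof -
  have J: "J dvd N" using K by (rule dvd_trans[rotated])
  obtain c where "over c Q" using over_exists[OF Q dvd_pos[OF J]] by blast
  then have "Q \<in> fibre J c" using Q by (simp add: fibre_def)
  then show ?thesis using relfibre_subset_fibre[OF _ K] finite_fibre[OF dvd_pos[OF K(1)]] finite_subset by blast
qed

lemma funpow_restrict: "(\<delta> ^^ i) ` P \<inter> fixed J = (\<delta> ^^ i) ` (P \<inter> fixed J)" if "J > 0"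
proof -
  interpret h: field_hom "\<delta> ^^ i" by (rule funpow_hom)
  have "(\<delta> ^^ i) w \<in> fixed J \<longleftrightarrow> w \<in> fixed J" for w
  proof
    assume "(\<delta> ^^ i) w \<in> fixed J"
    then have "(\<delta> ^^ i) w \<in> (\<delta> ^^ i) ` fixed J" using funpow_fixed_image[OF that] by auto
    then show "w \<in> fixed J" by auto
  qed (rule fixed_funpow)
  then show ?thesis by auto
qed

lemma relfibre_conjugate:
  assumes P: "P \<in> pts K" "P' \<in> pts K" and same: "P \<inter> fixed J = P' \<inter> fixed J" and K: "K dvd N" "J dvd K"
  shows "card {i. i < K div J \<and> (\<delta> ^^ (J * i)) ` P = P'} = card {i. i < K div J \<and> (\<delta> ^^ (J * i)) ` P = P}"
proof -
  have Kp: "K > 0" by (rule dvd_pos[OF K(1)])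
  have n: "J * (K div J) = K" using K by simp
  have n0: "K div J > 0" using n Kp by (metis mult_0_right neq0_conv)
  obtain j where j: "P' = (\<delta> ^^ (J * j)) ` P" using conjugate_points[OF P Kp n same] by blast
  show ?thesis
    using card_cyclic_transporter[of "K div J" "\<lambda>P. (\<delta> ^^ J) ` P" P P' j] n0 n j
      funpow_image_multiple[OF P(1), of K] by (simp add: image_funpow)
qed

text \<open>Double counting. The fibre of level \<open>K\<close> splits into relative fibres, each
  an orbit of a group of order \<open>K div J\<close> with stabilizers of a common order t.
  Comparison with the count of the whole fibres at both levels gives ram K = t ram J; in particular
  the division in \<open>relram\<close> is exact.\<close>

lemma card_relative_stabilizer:
  assumes P: "P \<in> fibre K c" and K: "K dvd N" "J dvd K"
  shows "card {i. i < K div J \<and> (\<delta> ^^ (J * i)) ` P = P} = relram J K c"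
    and "ram K c = relram J K c * ram J c"
    and "K div J = card (relfibre J K (P \<inter> fixed J)) * relram J K c"
proof -
  have Kp: "K > 0" and JN: "J dvd N" using dvd_pos[OF K(1)] K by auto
  have Jp: "J > 0" by (rule dvd_pos[OF JN])
  define t where "t = (\<lambda>P. card {i. i < K div J \<and> (\<delta> ^^ (J * i)) ` P = P})"
  \<comment> \<open>The group is commutative, so conjugate points have the same stabilizer.\<close>
  have t_const: "t P' = t P" if P': "P' \<in> fibre K c" for P'
  proof -
    obtain j where j: "P' = (\<delta> ^^ j) ` P"
      using conjugate_points_over[of P K c P'] P P' Kp by (auto simp: fibre_def)
    interpret h: field_hom "\<delta> ^^ j" by (rule funpow_hom)
    have "(\<delta> ^^ i) ` P' = P' \<longleftrightarrow> (\<delta> ^^ i) ` P = P" for i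
    proof -
      have "(\<delta> ^^ i) ` P' = (\<delta> ^^ j) ` (\<delta> ^^ i) ` P" unfolding j funpow_image_image by (simp add: add.commute)
      then show ?thesis unfolding j by (simp add: inj_image_eq_iff h.inj_f)
    qed
    then show ?thesis by (simp add: t_def)
  qed
  have count: "K div J = card (relfibre J K (P' \<inter> fixed J)) * t P" if P': "P' \<in> fibre K c" for P'
  proof (rule sum_card_fibres[of _ _ "\<lambda>i. (\<delta> ^^ (J * i)) ` P'"])
    have pP': "P' \<in> pts K" using P' by (simp add: fibre_def)
    show "finite (relfibre J K (P' \<inter> fixed J))"
      using pts_restrict(1)[OF pP' Kp K(2)] K by (rule finite_relfibre)
    show "(\<delta> ^^ (J * i)) ` P' \<in> relfibre J K (P' \<inter> fixed J)" for i
      using funpow_pts[OF pP' Kp] funpow_restrict[OF Jp] funpow_image_multiple[OF pts_restrict(1)[OF pP' Kp K(2)]]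
      by (simp add: relfibre_def)
    show "card {i. i < K div J \<and> (\<delta> ^^ (J * i)) ` P' = b} = t P" if "b \<in> relfibre J K (P' \<inter> fixed J)" for b
      using that relfibre_conjugate[OF pP', of b J] K t_const[OF P'] by (auto simp: relfibre_def t_def)
  qed
  have surj: "\<exists>P'\<in>fibre K c. P' \<inter> fixed J = Q" if Q: "Q \<in> fibre J c" for Q
  proof -
    have "P \<inter> fixed J \<in> pts J" "over c (P \<inter> fixed J)" using pts_restrict[OF _ Kp K(2)] P by (auto simp: fibre_def)
    then obtain j where "Q = (\<delta> ^^ j) ` (P \<inter> fixed J)"
      using conjugate_points_over[of "P \<inter> fixed J" J c Q] Q Jp by (auto simp: fibre_def)
    then show ?thesis using funpow_restrict[OF Jp] funpow_pts[OF _ Kp] funpow_over P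
      by (intro bexI[of _ "(\<delta> ^^ j) ` P"]) (auto simp: fibre_def)
  qed
  have "card (fibre K c) = (\<Sum>Q\<in>fibre J c. card (relfibre J K Q))"
  proof -
    have "fibre K c = (\<Union>Q\<in>fibre J c. relfibre J K Q)"
      using relfibre_subset_fibre[OF _ K] pts_restrict[OF _ Kp K(2)] by (auto simp: fibre_def relfibre_def)
    moreover have "\<forall>Q\<in>fibre J c. \<forall>Q'\<in>fibre J c. Q \<noteq> Q' \<longrightarrow> relfibre J K Q \<inter> relfibre J K Q' = {}"
      by (auto simp: relfibre_def)
    ultimately show ?thesis using finite_relfibre[OF _ K] finite_fibre[OF Jp]
      by (simp add: card_UN_disjoint fibre_def)
  qed
  then have "card (fibre K c) * t P = (\<Sum>Q\<in>fibre J c. card (relfibre J K Q) * t P)" by (simp add: sum_distrib_right)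
  also have "\<dots> = (\<Sum>Q\<in>fibre J c. K div J)" 
  proof (intro sum.cong refl)
    fix Q assume "Q \<in> fibre J c"
    then obtain P' where "P' \<in> fibre K c" "P' \<inter> fixed J = Q" using surj by blast
    then show "card (relfibre J K Q) * t P = K div J" using count[of P'] by simp
  qed
  finally have e: "card (fibre K c) * t P = card (fibre J c) * (K div J)" by simp
  have "card (fibre K c) * ram K c = K" "card (fibre J c) * ram J c = J"
    using card_fibre[OF K(1)] card_fibre[OF JN] by metis+
  then have "card (fibre K c) * ram K c = card (fibre J c) * ram J c * (K div J)" using K by simp
  also have "\<dots> = card (fibre K c) * (t P * ram J c)" using e by (simp add: mult_ac)
  finally have "card (fibre K c) * ram K c = card (fibre K c) * (t P * ram J c)" .
  moreover have "card (fibre K c) \<noteq> 0" using \<open>card (fibre K c) * ram K c = K\<close> Kp by (metis mult_0 neq0_conv)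
  ultimately have r: "ram K c = t P * ram J c" by (metis mult_cancel1)
  then have tr: "t P = relram J K c" using ram_pos[OF JN, of c] by (simp add: relram_def)
  show "card {i. i < K div J \<and> (\<delta> ^^ (J * i)) ` P = P} = relram J K c" using tr by (simp add: t_def)
  show "ram K c = relram J K c * ram J c" using r tr by simp
  show "K div J = card (relfibre J K (P \<inter> fixed J)) * relram J K c" using count[OF P] tr by simp
qed

text \<open>The order of \<open>param c\<close> is \<open>ram\<close> at either level, and it is
  multiplied by the ramification index when passing from level \<open>J\<close> to level
  \<open>K\<close>.\<close>

lemma ramification_eq_relram:
  assumes P: "P \<in> fibre K c" and K: "K dvd N" "J dvd K"
  shows "ramification P (P \<inter> fixed J) = int (relram J K c)"
proof -
  have PP: "P \<in> pts K" "over c P" using P by (auto simp: fibre_def)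
  have Kp: "K > 0" and JN: "J dvd N" using dvd_pos[OF K(1)] K by auto
  have Q: "P \<inter> fixed J \<in> pts J" "over c (P \<inter> fixed J)" using pts_restrict[OF PP(1) Kp K(2)] PP by auto
  have "int (ram K c) = ramification P (P \<inter> fixed J) * int (ram J c)"
    using dvr_restrict_ord(1)[OF pts_dvr[OF PP(1) Kp] pts_dvr[OF Q(1) dvd_pos[OF JN]] fixed_mono[OF K(2)], of "param c"]
      card_stabilizer'(2)[OF PP K(1)] card_stabilizer'(2)[OF Q JN] param_rat param_neq_0 rat_fixed by auto
  then show ?thesis using card_relative_stabilizer(2)[OF P K] ram_pos[OF JN, of c] by simp
qed

section \<open>Divisors on the tower\<close>

definition dv :: "nat \<Rightarrow> ('f set \<Rightarrow>\<^sub>0 int) set" where "dv K = {D. Poly_Mapping.keys D \<subseteq> pts K}"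

definition dv0 :: "nat \<Rightarrow> ('f set \<Rightarrow>\<^sub>0 int) set" where "dv0 K = {D \<in> dv K. div_degree D = 0}"

definition trans :: "nat \<Rightarrow> ('f set \<Rightarrow>\<^sub>0 int) \<Rightarrow> ('f set \<Rightarrow>\<^sub>0 int)" where
  "trans i = frag_extend (\<lambda>P. frag_of ((\<delta> ^^ i) ` P))"

definition pdiv :: "nat \<Rightarrow> 'f \<Rightarrow> ('f set \<Rightarrow>\<^sub>0 int)" where "pdiv K = principal_div emb (fixed K)"

definition pull :: "nat \<Rightarrow> nat \<Rightarrow> ('f set \<Rightarrow>\<^sub>0 int) \<Rightarrow> ('f set \<Rightarrow>\<^sub>0 int)" where
  "pull J K = pullback emb (fixed J) (fixed K)"

lemma dv_0: "0 \<in> dv K" and dv_add: "D \<in> dv K \<Longrightarrow> E \<in> dv K \<Longrightarrow> D + E \<in> dv K"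
  and dv_uminus: "D \<in> dv K \<Longrightarrow> - D \<in> dv K" and dv_diff: "D \<in> dv K \<Longrightarrow> E \<in> dv K \<Longrightarrow> D - E \<in> dv K"
  and dv_cmul: "D \<in> dv K \<Longrightarrow> frag_cmul a D \<in> dv K" and dv_frag_of: "P \<in> pts K \<Longrightarrow> frag_of P \<in> dv K"
  using Poly_Mapping.keys_add[of D E] keys_diff[of D E] keys_cmul[of a D] by (auto simp: dv_def keys_frag_of)

lemma dv_sum: "(\<And>i. i \<in> I \<Longrightarrow> h i \<in> dv K) \<Longrightarrow> sum h I \<in> dv K"
  by (induction I rule: infinite_finite_induct) (auto simp: dv_0 dv_add)

lemma dv_frag_extend: "(\<And>P. P \<in> Poly_Mapping.keys D \<Longrightarrow> g P \<in> dv K) \<Longrightarrow> frag_extend g D \<in> dv K"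
  unfolding frag_extend_def by (intro dv_sum dv_cmul)

lemma dv0_0: "0 \<in> dv0 K" and dv0_add: "D \<in> dv0 K \<Longrightarrow> E \<in> dv0 K \<Longrightarrow> D + E \<in> dv0 K"
  and dv0_uminus: "D \<in> dv0 K \<Longrightarrow> - D \<in> dv0 K" and dv0_diff: "D \<in> dv0 K \<Longrightarrow> E \<in> dv0 K \<Longrightarrow> D - E \<in> dv0 K"
  by (auto simp: dv0_def dv_0 dv_add dv_uminus dv_diff div_degree_0 div_degree_add div_degree_uminus div_degree_diff)

lemma dv0_dv: "D \<in> dv0 K \<Longrightarrow> D \<in> dv K"
  by (simp add: dv0_def)

lemma dv_lookup: "D \<in> dv K \<Longrightarrow> P \<notin> pts K \<Longrightarrow> Poly_Mapping.lookup D P = 0"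
  by (auto simp: dv_def in_keys_iff)

lemma dv_eqI:
  assumes "D \<in> dv K" "E \<in> dv K" "\<And>P. P \<in> pts K \<Longrightarrow> Poly_Mapping.lookup D P = Poly_Mapping.lookup E P"
  shows "D = E"
  by (rule poly_mapping_eqI) (metis assms dv_lookup)

lemma trans_simps:
  "trans i 0 = 0" "trans i (D + E) = trans i D + trans i E" "trans i (D - E) = trans i D - trans i E"
  "trans i (- D) = - trans i D" "trans i (frag_of P) = frag_of ((\<delta> ^^ i) ` P)"
  "trans i (frag_cmul a D) = frag_cmul a (trans i D)"
  by (simp_all add: trans_def frag_extend_add frag_extend_diff frag_extend_minus frag_extend_cmul)

lemma trans_sum: "trans i (sum h I) = (\<Sum>j\<in>I. trans i (h j))"
  by (induction I rule: infinite_finite_induct) (auto simp: trans_simps)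

lemma trans_dv: "D \<in> dv K \<Longrightarrow> K > 0 \<Longrightarrow> trans i D \<in> dv K"
  unfolding trans_def by (intro dv_frag_extend dv_frag_of funpow_pts) (auto simp: dv_def)

lemma trans_degree: "div_degree (trans i D) = div_degree D"
  by (simp add: trans_def div_degree_frag_extend div_degree_frag_of) (simp add: div_degree_def)

lemma trans_dv0: "D \<in> dv0 K \<Longrightarrow> K > 0 \<Longrightarrow> trans i D \<in> dv0 K"
  by (simp add: dv0_def trans_dv trans_degree)

lemma trans_trans: "trans i (trans j D) = trans (i + j) D"
proof -
  have "trans i (sum h I) = (\<Sum>k\<in>I. trans i (h k))" for h and I :: "'f set set"
    by (induction I rule: infinite_finite_induct) (auto simp: trans_simps)
  then show ?thesis
    unfolding trans_def[of j] trans_def[of "i + j"] frag_extend_def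
    by (simp add: trans_simps funpow_image_image)
qed

lemma lookup_trans:
  assumes D: "D \<in> dv K" and P: "P \<in> pts K" and ij: "K dvd i + j"
  shows "Poly_Mapping.lookup (trans i D) P = Poly_Mapping.lookup D ((\<delta> ^^ j) ` P)"
proof -
  have "(\<delta> ^^ i) ` Q = P \<longleftrightarrow> Q = (\<delta> ^^ j) ` P" if "Q \<in> pts K" for Q
  proof -
    have "(\<delta> ^^ j) ` (\<delta> ^^ i) ` Q = Q" "(\<delta> ^^ i) ` (\<delta> ^^ j) ` P = P"
      unfolding funpow_image_image using ij funpow_image_multiple P that by (auto simp: add.commute)
    then show ?thesis by metis
  qed
  note iff = this
  have "Poly_Mapping.lookup (trans i D) P =
      (\<Sum>Q\<in>Poly_Mapping.keys D. if Q = (\<delta> ^^ j) ` P then Poly_Mapping.lookup D Q else 0)"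
    unfolding trans_def lookup_frag_extend
  proof (intro sum.cong refl)
    fix Q assume "Q \<in> Poly_Mapping.keys D"
    then have "(\<delta> ^^ i) ` Q = P \<longleftrightarrow> Q = (\<delta> ^^ j) ` P" using D by (intro iff) (auto simp: dv_def)
    then show "Poly_Mapping.lookup D Q * Poly_Mapping.lookup (frag_of ((\<delta> ^^ i) ` Q)) P =
        (if Q = (\<delta> ^^ j) ` P then Poly_Mapping.lookup D Q else 0)"
      by (simp add: eq_commute[of P])
  qed
  then show ?thesis by (simp add: in_keys_iff sum.delta)
qed

lemma trans_multiple: "D \<in> dv K \<Longrightarrow> K > 0 \<Longrightarrow> K dvd i \<Longrightarrow> trans i D = D"
  by (rule dv_eqI[of _ K]) (auto simp: trans_dv lookup_trans[of _ K _ i 0])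

lemma lookup_pdiv:
  assumes w: "w \<in> fixed K" "w \<noteq> 0" and K: "K > 0" and P: "P \<in> pts K"
  shows "Poly_Mapping.lookup (pdiv K w) P = place_ord P w"
  using finite_support[OF w K] P
  by (simp add: pdiv_def principal_div_def lookup_sum pts_def if_distrib[of "(*) _"] sum.delta cong: if_cong)

lemma pdiv_dv: "pdiv K w \<in> dv K"
  unfolding pdiv_def principal_div_def by (intro dv_sum dv_cmul dv_frag_of) (simp add: pts_def)

lemma pdiv_mult:
  "v \<in> fixed K \<Longrightarrow> v \<noteq> 0 \<Longrightarrow> w \<in> fixed K \<Longrightarrow> w \<noteq> 0 \<Longrightarrow> K > 0 \<Longrightarrow> pdiv K (v * w) = pdiv K v + pdiv K w"
  by (rule dv_eqI[of _ K])
     (auto simp: pdiv_dv dv_add lookup_add lookup_pdiv subfield_mult[OF subfield_fixed] dvr.ord_mult[OF pts_dvr])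

lemma pdiv_one: "K > 0 \<Longrightarrow> pdiv K 1 = 0"
  by (rule dv_eqI[of _ K])
     (auto simp: pdiv_dv dv_0 lookup_pdiv subfield_one[OF subfield_fixed] dvr.ord_one[OF pts_dvr])

lemma pdiv_inverse: "w \<in> fixed K \<Longrightarrow> w \<noteq> 0 \<Longrightarrow> K > 0 \<Longrightarrow> pdiv K (inverse w) = - pdiv K w"
  using pdiv_mult[of w K "inverse w"] pdiv_one[of K] subfield_inverse[OF subfield_fixed, of w K]
  by (simp add: eq_neg_iff_add_eq_0 add.commute)

lemma pdiv_emb: "a \<noteq> 0 \<Longrightarrow> K > 0 \<Longrightarrow> pdiv K (emb a) = 0"
proof (rule dv_eqI[of _ K])
  fix P assume a: "a \<noteq> 0" "K > 0" and P: "P \<in> pts K"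
  interpret tower_valuation emb x y f N \<zeta> \<delta> "fixed K" P by (rule tower_valuation[OF P])
  interpret dvr "fixed K" P by (rule pts_dvr[OF P a(2)])
  show "Poly_Mapping.lookup (pdiv K (emb a)) P = Poly_Mapping.lookup 0 P"
    using lookup_pdiv[OF emb_fixed, of a K P] a P emb_unit[of a] unit_iff_ord[OF emb_fixed, of a] by simp
qed (simp_all add: pdiv_dv dv_0)

lemma pdiv_trans:
  assumes w: "w \<in> fixed K" "w \<noteq> 0" and K: "K > 0"
  shows "trans i (pdiv K w) = pdiv K ((\<delta> ^^ i) w)"
proof (rule dv_eqI[of _ K])
  fix P assume P: "P \<in> pts K"
  have j: "K dvd i + (K * i - i)" using K by simp
  show "Poly_Mapping.lookup (trans i (pdiv K w)) P = Poly_Mapping.lookup (pdiv K ((\<delta> ^^ i) w)) P"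
    using lookup_trans[OF pdiv_dv P j] lookup_pdiv[OF w K funpow_pts[OF P K]]
      lookup_pdiv[OF fixed_funpow[OF w(1)] _ K P] funpow_ord'[OF P K w j] w(2) by (simp add: funpow_eq_0_iff)
qed (auto simp: pdiv_dv trans_dv K)

lemma pdiv_norm:
  assumes w: "w \<in> fixed K" "w \<noteq> 0" and K: "K > 0"
  shows "pdiv K (norm j w) = (\<Sum>i<j. trans i (pdiv K w))"
proof -
  have "pdiv K (\<Prod>i<j. (\<delta> ^^ i) w) = (\<Sum>i<j. pdiv K ((\<delta> ^^ i) w))"
  proof (induction j)
    case (Suc j)
    have "(\<Prod>i<j. (\<delta> ^^ i) w) \<in> fixed K" "(\<Prod>i<j. (\<delta> ^^ i) w) \<noteq> 0"
      using w fixed_funpow funpow_eq_0_iff by (auto intro!: subfield_prod subfield_fixed)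
    then show ?case using Suc w fixed_funpow[OF w(1)] funpow_eq_0_iff K by (simp add: pdiv_mult)
  qed (simp add: pdiv_one K)
  then show ?thesis by (simp add: norm_def pdiv_trans[OF w K])
qed

section \<open>Degrees on the fibres, and the degree of principal divisors\<close>

definition fibre_degree :: "nat \<Rightarrow> 'a option \<Rightarrow> ('f set \<Rightarrow>\<^sub>0 int) \<Rightarrow> int" where
  "fibre_degree K c D = (\<Sum>P\<in>fibre K c. Poly_Mapping.lookup D P)"

lemma fibre_degree_simps:
  "fibre_degree K c 0 = 0" "fibre_degree K c (D + E) = fibre_degree K c D + fibre_degree K c E"
  "fibre_degree K c (D - E) = fibre_degree K c D - fibre_degree K c E"
  "fibre_degree K c (frag_cmul a D) = a * fibre_degree K c D"
  by (simp_all add: fibre_degree_def lookup_add lookup_minus sum.distrib sum_subtractf sum_distrib_left)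

lemma fibre_degree_sum: "fibre_degree K c (sum h I) = (\<Sum>i\<in>I. fibre_degree K c (h i))"
  by (induction I rule: infinite_finite_induct) (auto simp: fibre_degree_simps)

definition center :: "'f set \<Rightarrow> 'a option" where "center P = (THE c. over c P)"

lemma center: "P \<in> pts K \<Longrightarrow> K > 0 \<Longrightarrow> over (center P) P"
  unfolding center_def using over_exists over_unique by (metis the_equality)

lemma center_eq: "P \<in> pts K \<Longrightarrow> over c P \<Longrightarrow> center P = c"
  unfolding center_def using over_unique by (metis the_equality)

lemma fibre_eq: "K > 0 \<Longrightarrow> P \<in> fibre K c \<longleftrightarrow> P \<in> pts K \<and> center P = c"
  using center center_eq by (auto simp: fibre_def)

lemma fibre_degree_keys:
  "D \<in> dv K \<Longrightarrow> K > 0 \<Longrightarrow> fibre_degree K c D = (\<Sum>P\<in>{P \<in> Poly_Mapping.keys D. center P = c}. Poly_Mapping.lookup D P)"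
  unfolding fibre_degree_def using finite_fibre
  by (intro sum.mono_neutral_right) (auto simp: fibre_eq dv_def in_keys_iff)

text \<open>The order of the norm at \<open>P\<close> adds up the orders of \<open>w\<close> along
  the orbit of \<open>P\<close>, in which each point of the fibre occurs \<open>ram K c\<close>
  times.\<close>

lemma fibre_degree_norm:
  assumes w: "w \<in> fixed K" "w \<noteq> 0" and K: "K dvd N" and P: "P \<in> fibre K c"
  shows "int (ram K c) * fibre_degree K c (pdiv K w) = place_ord P (norm K w)"
proof -
  have Kp: "K > 0" by (rule dvd_pos[OF K])
  have PP: "P \<in> pts K" "over c P" using P by (auto simp: fibre_def)
  have nw: "norm K w \<in> fixed K" "norm K w \<noteq> 0"
    using norm_in_rat[OF w(1)] rat_fixed norm_eq_0_iff[OF Kp] w by auto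
  have inF: "(\<delta> ^^ (K - i)) ` P \<in> fibre K c" for i
    using funpow_pts[OF PP(1) Kp] funpow_over[OF PP(1)] PP(2) by (simp add: fibre_def)
  have "place_ord P (norm K w) = Poly_Mapping.lookup (pdiv K (norm K w)) P"
    using lookup_pdiv[OF nw Kp PP(1)] by simp
  also have "\<dots> = (\<Sum>i<K. Poly_Mapping.lookup (pdiv K w) ((\<delta> ^^ (K - i)) ` P))"
    unfolding pdiv_norm[OF w Kp] lookup_sum
    by (intro sum.cong refl lookup_trans[OF pdiv_dv PP(1)]) auto
  also have "\<dots> = (\<Sum>Q\<in>fibre K c. \<Sum>i\<in>{i \<in> {..<K}. (\<delta> ^^ (K - i)) ` P = Q}. Poly_Mapping.lookup (pdiv K w) ((\<delta> ^^ (K - i)) ` P))"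
    by (rule sum.group[symmetric]) (use finite_fibre[OF Kp] inF in auto)
  also have "\<dots> = (\<Sum>Q\<in>fibre K c. int (ram K c) * Poly_Mapping.lookup (pdiv K w) Q)"
  proof (intro sum.cong refl)
    fix Q assume Q: "Q \<in> fibre K c"
    then have pQ: "Q \<in> pts K" by (simp add: fibre_def)
    have iff: "(\<delta> ^^ (K - i)) ` P = Q \<longleftrightarrow> (\<delta> ^^ i) ` Q = P" if "i < K" for i
    proof -
      have "(\<delta> ^^ i) ` (\<delta> ^^ (K - i)) ` P = P" "(\<delta> ^^ (K - i)) ` (\<delta> ^^ i) ` Q = Q"
        unfolding funpow_image_image using that funpow_image_multiple[OF PP(1), of K] funpow_image_multiple[OF pQ, of K] by auto
      then show ?thesis by metis
    qed
    have "{i \<in> {..<K}. (\<delta> ^^ (K - i)) ` P = Q} = {i. i < K \<and> (\<delta> ^^ i) ` Q = P}"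
      by (intro Collect_cong) (simp add: iff cong: conj_cong)
    then have "card {i \<in> {..<K}. (\<delta> ^^ (K - i)) ` P = Q} = ram K c" using card_transporter[OF Q P K] by simp
    then show "(\<Sum>i\<in>{i \<in> {..<K}. (\<delta> ^^ (K - i)) ` P = Q}. Poly_Mapping.lookup (pdiv K w) ((\<delta> ^^ (K - i)) ` P)) =
        int (ram K c) * Poly_Mapping.lookup (pdiv K w) Q" by simp
  qed
  finally show ?thesis by (simp add: fibre_degree_def sum_distrib_left)
qed

end

lemma frag_cmul_diff_distrib2: "frag_cmul a (X - Y) = frag_cmul a X - frag_cmul a Y"
  by (rule poly_mapping_eqI) (simp add: lookup_minus algebra_simps)

context kummer_tower begin

lemma div_degree_fibres:
  assumes D: "D \<in> dv K" and K: "K > 0" and C: "finite C" "center ` Poly_Mapping.keys D \<subseteq> C"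
  shows "div_degree D = (\<Sum>c\<in>C. fibre_degree K c D)"
  unfolding div_degree_def using C
  by (subst sum.group[symmetric, of _ C center]) (auto simp: fibre_degree_keys[OF D K])

lemma fibre_degree_ev:
  assumes p: "p \<noteq> 0" and K: "K dvd N"
  shows "fibre_degree K c (pdiv K (ev p)) = int K * pord c p"
proof -
  have Kp: "K > 0" by (rule dvd_pos[OF K])
  have e: "ev p \<in> fixed K" "ev p \<noteq> 0" using poly_rat rat_fixed p ev_eq_0_iff by blast+
  have "Poly_Mapping.lookup (pdiv K (ev p)) P = int (ram K c) * pord c p" if "P \<in> fibre K c" for P
    using that ord_rat_ev[OF _ _ Kp p] card_stabilizer'(2)[OF _ _ K] lookup_pdiv[OF e Kp]
    by (simp add: fibre_def)
  then have "fibre_degree K c (pdiv K (ev p)) = int (card (fibre K c) * ram K c) * pord c p"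
    by (simp add: fibre_degree_def)
  then show ?thesis using card_fibre[OF K, of c] by simp
qed

lemma pord_linear: "pord c [:- a, 1:] = (if c = Some a then 1 else if c = None then - 1 else 0)"
proof (cases c)
  case (Some b)
  have "Polynomial.order b [:- a, 1:] = (if b = a then 1 else 0)"
    using order_power_n_n[of a 1] by (auto intro: order_0I)
  then show ?thesis using Some by (simp add: pord_def)
qed (simp add: pord_def)

text \<open>A linear factor x - a has degree \<open>K\<close> on the fibre over a and degree
  \<open>- K\<close> on the fibre at infinity; the general case follows by factorization.\<close>

lemma degree_pdiv_ev:
  assumes p: "p \<noteq> 0" and K: "K dvd N"
  shows "div_degree (pdiv K (ev p)) = 0"
proof -
  have Kp: "K > 0" by (rule dvd_pos[OF K])
  have ev: "ev q \<in> fixed K" for q using poly_rat rat_fixed by blast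
  have linear: "div_degree (pdiv K (x - emb a)) = 0" for a
  proof -
    define q where "q = [:- a, 1:]"
    have nz: "q \<noteq> 0" by (simp add: q_def)
    have "center ` Poly_Mapping.keys (pdiv K (ev q)) \<subseteq> {Some a, None}"
    proof
      fix c assume "c \<in> center ` Poly_Mapping.keys (pdiv K (ev q))"
      then obtain P where P: "P \<in> Poly_Mapping.keys (pdiv K (ev q))" "c = center P" by blast
      then have "P \<in> pts K" using pdiv_dv[of K "ev q"] unfolding dv_def by blast
      then have PP: "P \<in> pts K" "over c P" using center[OF _ Kp] P(2) by blast+
      have "ev q \<noteq> 0" unfolding ev_eq_0_iff by (rule nz)
      then have "place_ord P (ev q) \<noteq> 0" using P(1) lookup_pdiv[OF ev _ Kp PP(1)] by (simp add: in_keys_iff)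
      then have "pord c q \<noteq> 0" using ord_rat_ev[OF PP Kp nz] by auto
      then show "c \<in> {Some a, None}" unfolding q_def pord_linear by (auto split: if_splits)
    qed
    then have "div_degree (pdiv K (ev q)) = (\<Sum>c\<in>{Some a, None}. fibre_degree K c (pdiv K (ev q)))"
      by (intro div_degree_fibres pdiv_dv Kp) auto
    also have "\<dots> = 0" by (simp only: fibre_degree_ev[OF nz K]) (simp only: q_def pord_linear, simp)
    finally show ?thesis by (simp only: q_def ev_linear)
  qed
  obtain A where A: "p = Polynomial.smult (lead_coeff p) (\<Prod>r\<in>#A. [:- r, 1:])"
    using alg_closed_imp_factorization[OF p] by blast
  have nz: "(\<Prod>r\<in>#A. [:- r, 1:]) \<noteq> 0" for A :: "'a multiset"
    by (auto simp: prod_mset_zero_iff)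
  have evnz: "ev (\<Prod>r\<in>#A. [:- r, 1:]) \<noteq> 0" for A using nz ev_eq_0_iff by blast
  have "div_degree (pdiv K (ev (\<Prod>r\<in>#A. [:- r, 1:]))) = 0"
  proof (induction A)
    case empty
    show ?case by (simp add: pdiv_one[OF Kp] div_degree_0)
  next
    case (add r A)
    have xr: "x - emb r \<in> fixed K" using x_fixed emb_fixed by (intro subfield_diff subfield_fixed)
    have "ev (\<Prod>r\<in>#add_mset r A. [:- r, 1:]) = (x - emb r) * ev (\<Prod>r\<in>#A. [:- r, 1:])"
      by (simp only: image_mset_add_mset prod_mset.add_mset ev.hom_mult ev_linear)
    then show ?case using add linear[of r] pdiv_mult[OF xr x_neq(1) ev evnz Kp] by (simp add: div_degree_add)
  qed
  moreover have "ev p = emb (lead_coeff p) * ev (\<Prod>r\<in>#A. [:- r, 1:])"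
  proof -
    have smult: "Polynomial.smult a g = [:a:] * g" for a and g :: "'a poly" by simp
    show ?thesis by (subst A, subst smult) (simp only: ev.hom_mult ev_const)
  qed
  moreover have "lead_coeff p \<noteq> 0" using p by simp
  ultimately show ?thesis using pdiv_mult[OF emb_fixed _ ev evnz Kp, of "lead_coeff p" A] pdiv_emb[OF _ Kp, of "lead_coeff p"]
    by (simp add: div_degree_add div_degree_0)
qed

text \<open>The divisor of the norm has \<open>K\<close> times the degree, and the norm is a
  quotient of polynomials in x.\<close>

lemma degree_pdiv:
  assumes w: "w \<in> fixed K" "w \<noteq> 0" and K: "K dvd N"
  shows "div_degree (pdiv K w) = 0"
proof -
  have Kp: "K > 0" by (rule dvd_pos[OF K])
  have ev: "ev q \<in> fixed K" for q using poly_rat rat_fixed by blast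
  obtain p q where pq: "q \<noteq> 0" "norm K w = ev p / ev q"
    using rat_representation[OF norm_in_rat[OF w(1)]] by blast
  have "p \<noteq> 0" using norm_eq_0_iff[OF Kp, of w] w pq by auto
  have nz: "ev p \<noteq> 0" "ev q \<noteq> 0" using \<open>p \<noteq> 0\<close> pq ev_eq_0_iff by blast+
  have "pdiv K (norm K w) = pdiv K (ev p) - pdiv K (ev q)"
    using pdiv_mult[OF ev nz(1) subfield_inverse[OF subfield_fixed ev] _ Kp, of q] pdiv_inverse[OF ev nz(2) Kp] nz(2) pq(2)
    by (simp add: divide_inverse)
  then have "div_degree (pdiv K (norm K w)) = 0"
    using degree_pdiv_ev[OF \<open>p \<noteq> 0\<close> K] degree_pdiv_ev[OF pq(1) K] by (simp add: div_degree_diff)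
  moreover have "div_degree (pdiv K (norm K w)) = int K * div_degree (pdiv K w)"
    unfolding pdiv_norm[OF w Kp] by (simp add: div_degree_sum trans_degree)
  ultimately show ?thesis using Kp by simp
qed

lemma pdiv_dv0: "w \<in> fixed K \<Longrightarrow> w \<noteq> 0 \<Longrightarrow> K dvd N \<Longrightarrow> pdiv K w \<in> dv0 K"
  by (simp add: dv0_def pdiv_dv degree_pdiv)

text \<open>Subtracting from \<open>w\<close> its value at a point where numerator and denominator
  do not vanish gives a function without poles but with a zero. Its divisor would have positive
  degree unless it is 0.\<close>

lemma constant_of_pdiv_0:
  assumes w: "w \<in> rat_field" "w \<noteq> 0" and K: "K dvd N" and z: "pdiv K w = 0"
  shows "\<exists>r. w = emb r"
proof -
  have Kp: "K > 0" by (rule dvd_pos[OF K])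
  have wK: "w \<in> fixed K" using w rat_fixed by blast
  obtain p q where pq: "q \<noteq> 0" "w = ev p / ev q" using rat_representation[OF w(1)] by blast
  then have p0: "p \<noteq> 0" using w by auto
  have "finite {r. poly (p * q) r = 0}" using pq p0 by (intro poly_roots_finite) auto
  then obtain a where "poly (p * q) a \<noteq> 0" using infinite_UNIV_char_0 by (metis (mono_tags) ex_new_if_finite mem_Collect_eq)
  then have a: "poly p a \<noteq> 0" "poly q a \<noteq> 0" by auto
  obtain P where P: "P \<in> pts K" "over (Some a) P" using pts_exists by blast
  interpret P: tower_valuation emb x y f N \<zeta> \<delta> "fixed K" P by (rule tower_valuation[OF P(1)])
  define h where "h = w - emb (poly p a / poly q a)"
  have hK: "h \<in> fixed K" using wK emb_fixed by (auto simp: h_def intro: subfield_diff subfield_fixed)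
  have hP: "h \<in> nonunits P"
  proof -
    have evq: "ev q \<in> P - nonunits P" using P.residue_unit[OF P.ev_residue[OF P(2)] a(2)] .
    then have q': "ev q \<noteq> 0" "inverse (ev q) \<in> P" using P.unit_iff by auto
    have "h = (emb (poly q a) * (ev p - emb (poly p a)) - emb (poly p a) * (ev q - emb (poly q a))) * (inverse (ev q) * emb (inverse (poly q a)))"
      using q' a by (simp add: h_def pq(2) emb.hom_div emb.hom_inverse field_simps)
    also have "\<dots> \<in> nonunits P"
      by (intro P.nonunit_mult P.nonunit_diff P.nonunit_mult' P.ev_residue P.mult P.emb_mem P(2) q')
    finally show ?thesis .
  qed
  have "h = 0"
  proof (rule ccontr)
    assume h0: "h \<noteq> 0"
    have nonneg: "Poly_Mapping.lookup (pdiv K h) Q \<ge> 0" if Q: "Q \<in> pts K" for Q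
    proof -
      interpret Q: tower_valuation emb x y f N \<zeta> \<delta> "fixed K" Q by (rule tower_valuation[OF Q])
      interpret Q: dvr "fixed K" Q by (rule pts_dvr[OF Q Kp])
      have "place_ord Q w = 0" using lookup_pdiv[OF wK w(2) Kp Q] z by simp
      then have "w \<in> Q" using Q.mem_iff_ord[OF wK w(2)] by simp
      then have "h \<in> Q" unfolding h_def by (intro Q.diff Q.emb_mem)
      then show ?thesis using Q.mem_iff_ord[OF hK h0] lookup_pdiv[OF hK h0 Kp Q] by simp
    qed
    have "Poly_Mapping.lookup (pdiv K h) P > 0"
      using dvr.nonunit_iff_ord[OF pts_dvr[OF P(1) Kp] hK h0] hP lookup_pdiv[OF hK h0 Kp P(1)] by simp
    then have "div_degree (pdiv K h) > 0"
      unfolding div_degree_def using nonneg pdiv_dv[of K h]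
      by (intro sum_pos2[of _ P]) (auto simp: dv_def in_keys_iff)
    then show False using degree_pdiv[OF hK h0 K] by simp
  qed
  then show ?thesis by (auto simp: h_def)
qed

section \<open>Pullback from level J to level K, and the relative trace\<close>

lemma pull_simps:
  "pull J K 0 = 0" "pull J K (D + E) = pull J K D + pull J K E" "pull J K (D - E) = pull J K D - pull J K E"
  "pull J K (- D) = - pull J K D" "pull J K (frag_cmul a D) = frag_cmul a (pull J K D)"
  by (simp_all add: pull_def pullback_def frag_extend_add frag_extend_diff frag_extend_minus frag_extend_cmul)

lemma pull_dv: "pull J K E \<in> dv K"
  unfolding pull_def pullback_def
  by (intro dv_frag_extend dv_sum dv_cmul dv_frag_of) (auto simp: pts_def)

lemma lookup_pull:
  assumes E: "E \<in> dv J" and P: "P \<in> fibre K c" and K: "K dvd N" "J dvd K"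
  shows "Poly_Mapping.lookup (pull J K E) P = int (relram J K c) * Poly_Mapping.lookup E (P \<inter> fixed J)"
proof -
  have PP: "P \<in> pts K" using P by (simp add: fibre_def)
  have "Poly_Mapping.lookup (\<Sum>P\<in>{P \<in> points emb (fixed K). P \<inter> fixed J = Q}. frag_cmul (ramification P Q) (frag_of P)) P =
    (if Q = P \<inter> fixed J then int (relram J K c) else 0)" if Q: "Q \<in> Poly_Mapping.keys E" for Q
  proof -
    have "Q \<in> pts J" using Q E by (auto simp: dv_def)
    then have fin: "finite {P \<in> points emb (fixed K). P \<inter> fixed J = Q}"
      using finite_relfibre[OF _ K] by (simp add: relfibre_def pts_def)
    have "Poly_Mapping.lookup (\<Sum>P\<in>{P \<in> points emb (fixed K). P \<inter> fixed J = Q}. frag_cmul (ramification P Q) (frag_of P)) P =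
        (\<Sum>P'\<in>{P \<in> points emb (fixed K). P \<inter> fixed J = Q}. if P' = P then ramification P Q else 0)"
      unfolding lookup_sum by (intro sum.cong) auto
    also have "\<dots> = (if Q = P \<inter> fixed J then ramification P Q else 0)"
      using fin PP by (auto simp: sum.delta pts_def)
    finally show ?thesis using ramification_eq_relram[OF P K] by simp
  qed
  then have "Poly_Mapping.lookup (pull J K E) P =
      (\<Sum>Q\<in>Poly_Mapping.keys E. if Q = P \<inter> fixed J then Poly_Mapping.lookup E Q * int (relram J K c) else 0)"
    unfolding pull_def pullback_def lookup_frag_extend by (intro sum.cong) auto
  then show ?thesis by (simp add: sum.delta in_keys_iff)
qed

lemma in_fibre_center: "P \<in> pts K \<Longrightarrow> K > 0 \<Longrightarrow> P \<in> fibre K (center P)"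
  by (simp add: fibre_eq)

lemma dv_eqI_fibre:
  assumes "D \<in> dv K" "E \<in> dv K" "K > 0"
    "\<And>P c. P \<in> fibre K c \<Longrightarrow> Poly_Mapping.lookup D P = Poly_Mapping.lookup E P"
  shows "D = E"
  by (rule dv_eqI[OF assms(1,2)]) (use assms(3,4) in_fibre_center in blast)

lemma pull_pdiv:
  assumes w: "w \<in> fixed J" "w \<noteq> 0" and K: "K dvd N" "J dvd K"
  shows "pull J K (pdiv J w) = pdiv K w"
proof (rule dv_eqI_fibre[of _ K])
  have Kp: "K > 0" and JN: "J dvd N" and Jp: "J > 0" using dvd_pos K dvd_trans by blast+
  fix P c assume P: "P \<in> fibre K c"
  then have PP: "P \<in> pts K" by (simp add: fibre_def)
  have Q: "P \<inter> fixed J \<in> pts J" by (rule pts_restrict(1)[OF PP Kp K(2)])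
  have wK: "w \<in> fixed K" using w fixed_mono[OF K(2)] by blast
  show "Poly_Mapping.lookup (pull J K (pdiv J w)) P = Poly_Mapping.lookup (pdiv K w) P"
    using lookup_pull[OF pdiv_dv P K] lookup_pdiv[OF w Jp Q] lookup_pdiv[OF wK w(2) Kp PP]
      dvr_restrict_ord(1)[OF pts_dvr[OF PP Kp] pts_dvr[OF Q Jp] fixed_mono[OF K(2)] w] ramification_eq_relram[OF P K]
    by simp
qed (use K dvd_pos pull_dv pdiv_dv in auto)

lemma trans_pull:
  assumes E: "E \<in> dv J" and K: "K dvd N" "J dvd K"
  shows "trans i (pull J K E) = pull J K (trans i E)"
proof (rule dv_eqI_fibre[of _ K])
  have Kp: "K > 0" and Jp: "J > 0" using dvd_pos K dvd_trans by blast+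
  fix P c assume P: "P \<in> fibre K c"
  then have PP: "P \<in> pts K" "over c P" by (auto simp: fibre_def)
  define j where "j = K * i - i"
  have j: "K dvd i + j" using Kp by (simp add: j_def)
  then have jJ: "J dvd i + j" using K dvd_trans by blast
  have P': "(\<delta> ^^ j) ` P \<in> fibre K c" using PP funpow_pts[OF PP(1) Kp] funpow_over by (simp add: fibre_def)
  show "Poly_Mapping.lookup (trans i (pull J K E)) P = Poly_Mapping.lookup (pull J K (trans i E)) P"
    using lookup_trans[OF pull_dv PP(1) j] lookup_pull[OF E P' K] lookup_pull[OF trans_dv[OF E Jp] P K]
      lookup_trans[OF E pts_restrict(1)[OF PP(1) Kp K(2)] jJ] funpow_restrict[OF Jp] by simp
qed (use K dvd_pos pull_dv trans_dv in auto)

lemma pull_degree: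
  assumes E: "E \<in> dv J" and K: "K dvd N" "J dvd K"
  shows "div_degree (pull J K E) = int (K div J) * div_degree E"
proof -
  have Kp: "K > 0" and Jp: "J > 0" using dvd_pos K dvd_trans by blast+
  have "div_degree (\<Sum>P\<in>{P \<in> points emb (fixed K). P \<inter> fixed J = Q}. frag_cmul (ramification P Q) (frag_of P)) = int (K div J)"
    if Q: "Q \<in> Poly_Mapping.keys E" for Q
  proof -
    have QJ: "Q \<in> pts J" using Q E by (auto simp: dv_def)
    then obtain c where c: "Q \<in> fibre J c" using over_exists Jp by (auto simp: fibre_def)
    obtain P where P: "P \<in> pts K" "P \<inter> fixed J = Q"
    proof -
      obtain P0 where P0: "P0 \<in> pts K" "over c P0" using pts_exists by blast
      then obtain i where "Q = (\<delta> ^^ i) ` (P0 \<inter> fixed J)"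
        using conjugate_points_over[of "P0 \<inter> fixed J" J c Q] pts_restrict[OF P0(1) Kp K(2)] c Jp by (auto simp: fibre_def)
      then show thesis using that[of "(\<delta> ^^ i) ` P0"] funpow_pts[OF P0(1) Kp] funpow_restrict[OF Jp] by simp
    qed
    have Pc: "P \<in> fibre K c" using relfibre_subset_fibre[OF c K] P by (auto simp: relfibre_def)
    have "div_degree (\<Sum>P\<in>{P \<in> points emb (fixed K). P \<inter> fixed J = Q}. frag_cmul (ramification P Q) (frag_of P)) =
        (\<Sum>P\<in>relfibre J K Q. ramification P Q)"
      by (simp add: div_degree_sum div_degree_cmul div_degree_frag_of relfibre_def pts_def)
    also have "\<dots> = (\<Sum>P\<in>relfibre J K Q. int (relram J K c))"
    proof (intro sum.cong refl)
      fix P' assume P': "P' \<in> relfibre J K Q"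
      then have "P' \<in> fibre K c" "P' \<inter> fixed J = Q" using relfibre_subset_fibre[OF c K] by (auto simp: relfibre_def)
      then show "ramification P' Q = int (relram J K c)" using ramification_eq_relram[OF _ K] by blast
    qed
    also have "\<dots> = int (card (relfibre J K Q) * relram J K c)" by simp
    also have "\<dots> = int (K div J)" using card_relative_stabilizer(3)[OF Pc K] P(2) by simp
    finally show ?thesis .
  qed
  then show ?thesis
    unfolding pull_def pullback_def div_degree_frag_extend
    by (simp add: div_degree_def sum_distrib_left mult.commute)
qed

lemma pull_dv0: "E \<in> dv0 J \<Longrightarrow> K dvd N \<Longrightarrow> J dvd K \<Longrightarrow> pull J K E \<in> dv0 K"
  by (simp add: dv0_def pull_dv pull_degree)

text \<open>The divisor \<open>E\<close> is the pushforward of \<open>D\<close>. The relative group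
  carries a point to each point of the same relative fibre exactly \<open>relram\<close> times, and
  this is the multiplicity with which that point occurs in the pullback.\<close>

lemma relative_trace_pull:
  assumes D: "D \<in> dv K" and K: "K dvd N" "J dvd K"
  shows "\<exists>E\<in>dv J. div_degree E = div_degree D \<and> (\<Sum>i<K div J. trans (J * i) D) = pull J K E"
proof -
  have Kp: "K > 0" and Jp: "J > 0" using dvd_pos K dvd_trans by blast+
  define E where "E = frag_extend (\<lambda>P. frag_of (P \<inter> fixed J)) D"
  have restr: "P \<inter> fixed J \<in> pts J" if "P \<in> pts K" for P by (rule pts_restrict(1)[OF that Kp K(2)])
  have E: "E \<in> dv J" unfolding E_def using D restr by (intro dv_frag_extend dv_frag_of) (auto simp: dv_def)
  moreover have "div_degree E = div_degree D"
    by (simp add: E_def div_degree_frag_extend div_degree_frag_of) (simp add: div_degree_def)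
  moreover have "(\<Sum>i<K div J. trans (J * i) D) = pull J K E"
  proof (rule dv_eqI_fibre[of _ K])
    fix P c assume P: "P \<in> fibre K c"
    then have PP: "P \<in> pts K" by (simp add: fibre_def)
    have "Poly_Mapping.lookup (\<Sum>i<K div J. trans (J * i) D) P =
        (\<Sum>i<K div J. \<Sum>Q\<in>Poly_Mapping.keys D. Poly_Mapping.lookup D Q * (if (\<delta> ^^ (J * i)) ` Q = P then 1 else 0))"
      unfolding lookup_sum trans_def lookup_frag_extend by (intro sum.cong refl) (simp add: eq_commute)
    also have "\<dots> = (\<Sum>Q\<in>Poly_Mapping.keys D. Poly_Mapping.lookup D Q * int (card {i. i < K div J \<and> (\<delta> ^^ (J * i)) ` Q = P}))"
      by (subst sum.swap) (simp add: sum_distrib_left[symmetric] sum.If_cases lessThan_def Collect_conj_eq)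
    also have "\<dots> = (\<Sum>Q\<in>Poly_Mapping.keys D. Poly_Mapping.lookup D Q * (if Q \<inter> fixed J = P \<inter> fixed J then int (relram J K c) else 0))"
    proof (intro sum.cong refl)
      fix Q assume "Q \<in> Poly_Mapping.keys D"
      then have Q: "Q \<in> pts K" using D by (auto simp: dv_def)
      have "card {i. i < K div J \<and> (\<delta> ^^ (J * i)) ` Q = P} = (if Q \<inter> fixed J = P \<inter> fixed J then relram J K c else 0)"
      proof (cases "Q \<inter> fixed J = P \<inter> fixed J")
        case True
        have "Q \<in> fibre K c"
          using pts_restrict(2)[OF Q Kp K(2), of c] pts_restrict(2)[OF PP Kp K(2), of c] P Q True by (simp add: fibre_def)
        then show ?thesis using relfibre_conjugate[OF Q PP True K] card_relative_stabilizer(1)[OF _ K] True by simp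
      next
        case False
        have "(\<delta> ^^ (J * i)) ` Q \<noteq> P" for i
          using False funpow_restrict[OF Jp, of "J * i" Q] funpow_image_multiple[OF restr[OF Q], of "J * i"] by auto
        then show ?thesis using False by simp
      qed
      then show "Poly_Mapping.lookup D Q * int (card {i. i < K div J \<and> (\<delta> ^^ (J * i)) ` Q = P}) =
          Poly_Mapping.lookup D Q * (if Q \<inter> fixed J = P \<inter> fixed J then int (relram J K c) else 0)" by simp
    qed
    also have "\<dots> = int (relram J K c) * Poly_Mapping.lookup E (P \<inter> fixed J)"
      unfolding E_def lookup_frag_extend sum_distrib_left
      by (intro sum.cong) auto
    also have "\<dots> = Poly_Mapping.lookup (pull J K E) P" using lookup_pull[OF E P K] by simp
    finally show "Poly_Mapping.lookup (\<Sum>i<K div J. trans (J * i) D) P = Poly_Mapping.lookup (pull J K E) P" .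
  qed (use D Kp trans_dv pull_dv in \<open>auto intro!: dv_sum\<close>)
  ultimately show ?thesis by blast
qed

section \<open>The action of the deck transformation on divisor classes\<close>

definition prin :: "nat \<Rightarrow> ('f set \<Rightarrow>\<^sub>0 int) set" where "prin K = pdiv K ` (fixed K - {0})"

lemma prin_0: "K > 0 \<Longrightarrow> 0 \<in> prin K"
  unfolding prin_def using pdiv_one subfield_one[OF subfield_fixed] by (intro image_eqI[of _ _ 1]) auto

lemma prin_add: "D \<in> prin K \<Longrightarrow> E \<in> prin K \<Longrightarrow> K > 0 \<Longrightarrow> D + E \<in> prin K"
  unfolding prin_def by (auto simp flip: pdiv_mult intro!: imageI subfield_mult subfield_fixed)

lemma prin_uminus: "D \<in> prin K \<Longrightarrow> K > 0 \<Longrightarrow> - D \<in> prin K"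
proof -
  assume "D \<in> prin K" and K: "K > 0"
  then obtain w where w: "w \<in> fixed K" "w \<noteq> 0" "D = pdiv K w" by (auto simp: prin_def)
  then have "- D = pdiv K (inverse w)" using pdiv_inverse K by simp
  then show ?thesis using w subfield_inverse[OF subfield_fixed] by (auto simp: prin_def)
qed

lemma prin_diff: "D \<in> prin K \<Longrightarrow> E \<in> prin K \<Longrightarrow> K > 0 \<Longrightarrow> D - E \<in> prin K"
  using prin_add[of D K "- E"] prin_uminus[of E K] by simp

lemma prin_cmul: "D \<in> prin K \<Longrightarrow> K > 0 \<Longrightarrow> frag_cmul a D \<in> prin K"
proof (induction a rule: int_induct[of _ 0])
  case base
  then show ?case by (simp add: prin_0)
next
  case (step1 i)
  then show ?case by (simp add: frag_cmul_distrib prin_add)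
next
  case (step2 i)
  then show ?case by (simp add: frag_cmul_diff_distrib prin_diff)
qed

lemma prin_sum: "(\<And>i. i \<in> I \<Longrightarrow> h i \<in> prin K) \<Longrightarrow> K > 0 \<Longrightarrow> sum h I \<in> prin K"
  by (induction I rule: infinite_finite_induct) (auto simp: prin_0 prin_add)

lemma prin_dv0: "D \<in> prin K \<Longrightarrow> K dvd N \<Longrightarrow> D \<in> dv0 K"
  unfolding prin_def using pdiv_dv0 by blast

lemma prin_trans: "D \<in> prin K \<Longrightarrow> K > 0 \<Longrightarrow> trans i D \<in> prin K"
  unfolding prin_def using fixed_funpow funpow_eq_0_iff by (auto simp: pdiv_trans intro!: imageI)

text \<open>Each fibre is one orbit, so a point is \<open>\<delta> ^^ e\<close> applied to a base
  point, and base point minus point telescopes into 1 - \<delta> applied to the partial orbit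
  \<open>A\<close>. A divisor of degree 0 on the fibres is a combination of such differences, since
  the base points cancel.\<close>

lemma fibrewise_degree_0:
  assumes D: "D \<in> dv K" and K: "K > 0" and z: "\<And>c. fibre_degree K c D = 0"
  shows "\<exists>E\<in>dv K. D = E - trans 1 E"
proof -
  have "\<forall>c. \<exists>P. P \<in> fibre K c" using fibre_nonempty by blast
  then obtain b where b: "\<And>c. b c \<in> fibre K c" by metis
  have "\<forall>P. \<exists>i. P \<in> pts K \<longrightarrow> P = (\<delta> ^^ i) ` b (center P)"
  proof
    fix P
    have "b (center P) \<in> pts K" "over (center P) (b (center P))" using b by (auto simp: fibre_def)
    then show "\<exists>i. P \<in> pts K \<longrightarrow> P = (\<delta> ^^ i) ` b (center P)"
      using conjugate_points_over[of "b (center P)" K "center P" P] center[of P K] K by blast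
  qed
  then obtain e where e: "\<And>P. P \<in> pts K \<Longrightarrow> P = (\<delta> ^^ e P) ` b (center P)" by metis
  define A where "A = (\<lambda>P. \<Sum>j<e P. frag_of ((\<delta> ^^ j) ` b (center P)))"
  have bp: "(\<delta> ^^ j) ` b c \<in> pts K" for j c using b funpow_pts K by (auto simp: fibre_def)
  have A: "A P - trans 1 (A P) = frag_of (b (center P)) - frag_of P" if P: "P \<in> pts K" for P
  proof -
    have "trans 1 (A P) = (\<Sum>j<e P. frag_of ((\<delta> ^^ Suc j) ` b (center P)))"
      unfolding A_def trans_sum by (simp only: trans_simps funpow_image_image) simp
    then have "A P - trans 1 (A P) = (\<Sum>j<e P. frag_of ((\<delta> ^^ j) ` b (center P)) - frag_of ((\<delta> ^^ Suc j) ` b (center P)))"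
      by (simp add: A_def sum_subtractf)
    also have "\<dots> = frag_of ((\<delta> ^^ 0) ` b (center P)) - frag_of ((\<delta> ^^ e P) ` b (center P))"
      by (rule sum_lessThan_telescope')
    finally show ?thesis using e[OF P] by simp
  qed
  define E where "E = - frag_extend A D"
  have keys: "P \<in> pts K" if "P \<in> Poly_Mapping.keys D" for P using that D by (auto simp: dv_def)
  have E: "E \<in> dv K"
    unfolding E_def A_def by (intro dv_uminus dv_frag_extend dv_sum dv_frag_of bp)
  have "E - trans 1 E = - (\<Sum>P\<in>Poly_Mapping.keys D. frag_cmul (Poly_Mapping.lookup D P) (A P - trans 1 (A P)))"
  proof -
    have "E - trans 1 E = - (frag_extend A D - trans 1 (frag_extend A D))" by (simp add: E_def trans_simps(4))
    then show ?thesis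
      by (simp only: frag_extend_def trans_sum trans_simps(6) sum_subtractf[symmetric] frag_cmul_diff_distrib2)
  qed
  also have "\<dots> = - (\<Sum>P\<in>Poly_Mapping.keys D. frag_cmul (Poly_Mapping.lookup D P) (frag_of (b (center P)) - frag_of P))"
    using A keys by simp
  also have "\<dots> = (\<Sum>P\<in>Poly_Mapping.keys D. frag_cmul (Poly_Mapping.lookup D P) (frag_of P)) -
      (\<Sum>P\<in>Poly_Mapping.keys D. frag_cmul (Poly_Mapping.lookup D P) (frag_of (b (center P))))"
    by (simp add: frag_cmul_diff_distrib2 sum_subtractf)
  also have "(\<Sum>P\<in>Poly_Mapping.keys D. frag_cmul (Poly_Mapping.lookup D P) (frag_of P)) = D"
    using frag_expansion[of D] by (simp add: frag_extend_def)
  also have "(\<Sum>P\<in>Poly_Mapping.keys D. frag_cmul (Poly_Mapping.lookup D P) (frag_of (b (center P)))) =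
      (\<Sum>c\<in>center ` Poly_Mapping.keys D. \<Sum>P\<in>{P \<in> Poly_Mapping.keys D. center P = c}. frag_cmul (Poly_Mapping.lookup D P) (frag_of (b (center P))))"
    by (rule sum.image_gen) simp
  also have "\<dots> = (\<Sum>c\<in>center ` Poly_Mapping.keys D. frag_cmul (fibre_degree K c D) (frag_of (b c)))"
  proof (intro sum.cong refl)
    fix c
    have "frag_cmul (sum h I) X = (\<Sum>i\<in>I. frag_cmul (h i) X)" for h and I :: "'f set set" and X :: "'f set \<Rightarrow>\<^sub>0 int"
      by (rule poly_mapping_eqI) (simp add: lookup_sum sum_distrib_right)
    then show "(\<Sum>P\<in>{P \<in> Poly_Mapping.keys D. center P = c}. frag_cmul (Poly_Mapping.lookup D P) (frag_of (b (center P)))) =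
        frag_cmul (fibre_degree K c D) (frag_of (b c))"
      by (simp add: fibre_degree_keys[OF D K])
  qed
  also have "\<dots> = 0" by (simp add: z)
  finally show ?thesis using E by auto
qed

text \<open>
  Functions with norm \<open>x - a\<close> correct the degrees of a divisor on the fibres, and a totally
  ramified point corrects the total degree.
\<close>

lemma one_minus_trans_surjective:
  assumes D: "D \<in> dv0 K" and K: "K dvd N" and P0: "P0 \<in> pts K" "\<delta> ` P0 = P0"
  shows "\<exists>E\<in>dv0 K. D - (E - trans 1 E) \<in> prin K"
proof -
  have Kp: "K > 0" by (rule dvd_pos[OF K])
  have DD: "D \<in> dv K" using D by (rule dv0_dv)
  have KM: "K * (N div K) = N" using K by simp
  have "\<forall>a. \<exists>g. g \<in> fixed K \<and> norm K g = x - emb a" using linear_polynomial_is_norm_fixed[OF KM] by blast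
  then obtain g where g: "\<And>a. g a \<in> fixed K" "\<And>a. norm K (g a) = x - emb a" by metis
  have g0: "g a \<noteq> 0" for a using norm_eq_0_iff[OF Kp, of "g a"] g(2) x_neq(1) by simp
  have fg: "fibre_degree K c (pdiv K (g a)) = pord c [:- a, 1:]" for c a
  proof -
    obtain P where P: "P \<in> fibre K c" using fibre_nonempty by blast
    then have PP: "P \<in> pts K" "over c P" by (auto simp: fibre_def)
    have nz: "[:- a, 1:] \<noteq> 0" by simp
    have "int (ram K c) * fibre_degree K c (pdiv K (g a)) = place_ord P (ev [:- a, 1:])"
      using fibre_degree_norm[OF g(1) g0 K P] by (simp only: g(2) ev_linear)
    also have "\<dots> = int (ram K c) * pord c [:- a, 1:]"
      using ord_rat_ev[OF PP Kp nz] card_stabilizer'(2)[OF PP K] by simp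
    finally show ?thesis using ram_pos[OF K, of c] by simp
  qed
  \<comment> \<open>The function of norm x - a has degree 1 on the fibre over a, -1 over infinity
    and 0 elsewhere. Using it for each point over a finite a matches the degrees on all finite
    fibres; at infinity they match because the total degree of \<open>D\<close> is 0.\<close>
  define \<gamma> where "\<gamma> = (\<lambda>P. case center P of Some a \<Rightarrow> pdiv K (g a) | None \<Rightarrow> 0)"
  have gp: "\<gamma> P \<in> prin K" for P
    using g(1) g0 prin_0[OF Kp] by (auto simp: \<gamma>_def prin_def split: option.splits)
  then have Gp: "frag_extend \<gamma> D \<in> prin K" unfolding frag_extend_def by (intro prin_sum prin_cmul Kp)
  have fgam: "fibre_degree K c (\<gamma> P) = (if center P = None then 0 else if center P = c then 1 else if c = None then - 1 else 0)" for c P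
    by (auto simp: \<gamma>_def fg[unfolded pord_linear] fibre_degree_simps split: option.splits)
  have "fibre_degree K c (frag_extend \<gamma> D) = fibre_degree K c D" for c
  proof -
    have e: "fibre_degree K c (frag_extend \<gamma> D) = (\<Sum>P\<in>Poly_Mapping.keys D. Poly_Mapping.lookup D P * fibre_degree K c (\<gamma> P))" for c
      by (simp add: frag_extend_def fibre_degree_sum fibre_degree_simps)
    have f: "fibre_degree K c D = (\<Sum>P\<in>Poly_Mapping.keys D. if center P = c then Poly_Mapping.lookup D P else 0)" for c
      unfolding fibre_degree_keys[OF DD Kp] by (rule sum.inter_filter) simp
    show ?thesis
    proof (cases c)
      case (Some a)
      then show ?thesis unfolding e f by (intro sum.cong) (auto simp: fgam)
    next
      case None
      have "0 = (\<Sum>P\<in>Poly_Mapping.keys D. Poly_Mapping.lookup D P)" using D by (simp add: dv0_def div_degree_def)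
      also have "\<dots> = fibre_degree K None D - fibre_degree K None (frag_extend \<gamma> D)"
        unfolding e f sum_subtractf[symmetric] by (intro sum.cong) (auto simp: fgam)
      finally show ?thesis using None by simp
    qed
  qed
  then have z: "fibre_degree K c (D - frag_extend \<gamma> D) = 0" for c by (simp add: fibre_degree_simps)
  have "D - frag_extend \<gamma> D \<in> dv K" using DD Gp prin_dv0[OF _ K] dv0_dv by (intro dv_diff) auto
  from fibrewise_degree_0[OF this Kp z] obtain E where E: "E \<in> dv K" "D - frag_extend \<gamma> D = E - trans 1 E" by blast
  \<comment> \<open>As \<delta> fixes \<open>P0\<close>, subtracting a multiple of it changes the
    degree of \<open>E\<close> but not \<open>E - trans 1 E\<close>.\<close>
  define E0 where "E0 = E - frag_cmul (div_degree E) (frag_of P0)"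
  have "trans 1 E0 = trans 1 E - frag_cmul (div_degree E) (frag_of P0)"
    using P0 by (simp add: E0_def trans_simps)
  then have "D - (E0 - trans 1 E0) = frag_extend \<gamma> D" using E(2) by (simp add: E0_def algebra_simps)
  moreover have "E0 \<in> dv0 K"
    using E(1) P0 by (simp add: dv0_def E0_def dv_diff dv_cmul dv_frag_of div_degree_diff div_degree_cmul div_degree_frag_of)
  ultimately show ?thesis using Gp by (intro bexI[of _ E0]) auto
qed

end

section \<open>The kernel of the deck transformation minus one\<close>

context kummer_tower begin

definition fibre_sum :: "nat \<Rightarrow> 'a option \<Rightarrow> ('f set \<Rightarrow>\<^sub>0 int)" where
  "fibre_sum K c = (\<Sum>P\<in>fibre K c. frag_of P)"

lemma lookup_fibre_sum:
  "K > 0 \<Longrightarrow> Poly_Mapping.lookup (fibre_sum K c) P = (if P \<in> fibre K c then 1 else 0)"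
  using finite_fibre[of K c] by (simp add: fibre_sum_def lookup_sum sum.delta')

lemma fibre_sum_dv: "fibre_sum K c \<in> dv K"
  unfolding fibre_sum_def by (intro dv_sum dv_frag_of) (simp add: fibre_def)

lemma pull_fibre_sum:
  assumes K: "K dvd N" "J dvd K"
  shows "pull J K (fibre_sum J c) = frag_cmul (int (relram J K c)) (fibre_sum K c)"
proof (rule dv_eqI_fibre[of _ K])
  have Kp: "K > 0" and Jp: "J > 0" using dvd_pos K dvd_trans by blast+
  fix P c' assume P: "P \<in> fibre K c'"
  then have PP: "P \<in> pts K" "over c' P" by (auto simp: fibre_def)
  have "P \<inter> fixed J \<in> fibre J c \<longleftrightarrow> P \<in> fibre K c"
    using pts_restrict[OF PP(1) Kp K(2)] PP(1) by (simp add: fibre_def)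
  moreover have "P \<in> fibre K c \<Longrightarrow> c' = c" using over_unique[OF PP] by (simp add: fibre_def)
  ultimately show "Poly_Mapping.lookup (pull J K (fibre_sum J c)) P =
      Poly_Mapping.lookup (frag_cmul (int (relram J K c)) (fibre_sum K c)) P"
    using lookup_pull[OF fibre_sum_dv P K] by (auto simp: lookup_fibre_sum Kp Jp)
qed (use K dvd_pos pull_dv fibre_sum_dv dv_cmul in auto)

lemma trans_fibre_sum: "K > 0 \<Longrightarrow> trans i (fibre_sum K c) = fibre_sum K c"
proof (rule dv_eqI[of _ K])
  fix P assume K: "K > 0" and P: "P \<in> pts K"
  have ij: "K dvd i + (K * i - i)" using K by simp
  show "Poly_Mapping.lookup (trans i (fibre_sum K c)) P = Poly_Mapping.lookup (fibre_sum K c) P"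
    using lookup_trans[OF fibre_sum_dv P ij] P funpow_pts[OF P K] funpow_over[OF P] K
    by (auto simp: lookup_fibre_sum fibre_def)
qed (auto intro: trans_dv fibre_sum_dv)

text \<open>The coefficients are constant along orbits, and each fibre is a single orbit.\<close>

lemma invariant_divisor:
  assumes D: "D \<in> dv K" and K: "K > 0" and inv: "trans 1 D = D" and C: "finite C" "center ` Poly_Mapping.keys D \<subseteq> C"
  shows "\<exists>m. D = (\<Sum>c\<in>C. frag_cmul (m c) (fibre_sum K c))"
proof -
  have inv': "trans i D = D" for i
  proof (induction i)
    case 0
    then show ?case using trans_multiple[OF D K, of 0] by simp
  next
    case (Suc i)
    then show ?case using trans_trans[of 1 i D] inv by simp
  qed
  have "\<forall>c. \<exists>P. P \<in> fibre K c" using fibre_nonempty by blast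
  then obtain b where b: "\<And>c. b c \<in> fibre K c" by metis
  have "D = (\<Sum>c\<in>C. frag_cmul (Poly_Mapping.lookup D (b c)) (fibre_sum K c))"
  proof (rule dv_eqI[OF D])
    show "(\<Sum>c\<in>C. frag_cmul (Poly_Mapping.lookup D (b c)) (fibre_sum K c)) \<in> dv K"
      by (intro dv_sum dv_cmul fibre_sum_dv)
    fix P assume P: "P \<in> pts K"
    have "b (center P) \<in> pts K" "over (center P) (b (center P))" using b by (auto simp: fibre_def)
    then obtain i where i: "b (center P) = (\<delta> ^^ i) ` P"
      using conjugate_points_over[OF P center[OF P K] _ _ K] by blast
    have "K dvd (K * i - i) + i" using K by simp
    then have "Poly_Mapping.lookup D (b (center P)) = Poly_Mapping.lookup D P"
      using lookup_trans[OF D P, of "K * i - i" i] inv' i by simp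
    moreover have "Poly_Mapping.lookup (\<Sum>c\<in>C. frag_cmul (Poly_Mapping.lookup D (b c)) (fibre_sum K c)) P =
        (\<Sum>c\<in>C. if c = center P then Poly_Mapping.lookup D (b c) else 0)"
      unfolding lookup_sum by (intro sum.cong) (auto simp: lookup_fibre_sum K fibre_eq P)
    moreover have "center P \<in> C \<or> Poly_Mapping.lookup D P = 0"
      using C(2) by (cases "P \<in> Poly_Mapping.keys D") (auto simp: not_in_keys_iff_lookup_eq_zero)
    ultimately show "Poly_Mapping.lookup D P =
        Poly_Mapping.lookup (\<Sum>c\<in>C. frag_cmul (Poly_Mapping.lookup D (b c)) (fibre_sum K c)) P"
      using C(1) by (auto simp: sum.delta')
  qed
  then show ?thesis by (rule exI[of _ "\<lambda>c. Poly_Mapping.lookup D (b c)"])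
qed

text \<open>The divisors whose class in J_s lies in the pullback of the level below, hence dies in
  A_s. Computations are done modulo this set before any quotient group is formed.\<close>

definition trivial_divs :: "nat \<Rightarrow> nat \<Rightarrow> ('f set \<Rightarrow>\<^sub>0 int) set" where
  "trivial_divs J K = {D + pull J K E | D E. D \<in> prin K \<and> E \<in> dv0 J}"

lemma trivial_divsI: "D \<in> prin K \<Longrightarrow> E \<in> dv0 J \<Longrightarrow> D + pull J K E \<in> trivial_divs J K"
  by (auto simp: trivial_divs_def)

lemma trivial_divs_prin: "D \<in> prin K \<Longrightarrow> D \<in> trivial_divs J K"
  using trivial_divsI[of D K 0 J] by (simp add: dv0_0 pull_simps)

lemma trivial_divs_pull: "K > 0 \<Longrightarrow> E \<in> dv0 J \<Longrightarrow> pull J K E \<in> trivial_divs J K"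
  using trivial_divsI[of 0 K E J] by (simp add: prin_0)

lemma trivial_divs_add:
  assumes "K > 0" "X \<in> trivial_divs J K" "Y \<in> trivial_divs J K"
  shows "X + Y \<in> trivial_divs J K"
proof -
  obtain D E D' E' where "X = D + pull J K E" "D \<in> prin K" "E \<in> dv0 J" "Y = D' + pull J K E'" "D' \<in> prin K" "E' \<in> dv0 J"
    using assms by (auto simp: trivial_divs_def)
  then show ?thesis
    using trivial_divsI[of "D + D'" K "E + E'" J] prin_add dv0_add assms(1) by (simp add: pull_simps add_ac)
qed

lemma trivial_divs_uminus:
  assumes "K > 0" "X \<in> trivial_divs J K"
  shows "- X \<in> trivial_divs J K"
proof -
  obtain D E where "X = D + pull J K E" "D \<in> prin K" "E \<in> dv0 J" using assms by (auto simp: trivial_divs_def)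
  then show ?thesis
    using trivial_divsI[of "- D" K "- E" J] prin_uminus dv0_uminus assms(1) by (simp add: pull_simps)
qed

lemma trivial_divs_diff:
  "K > 0 \<Longrightarrow> X \<in> trivial_divs J K \<Longrightarrow> Y \<in> trivial_divs J K \<Longrightarrow> X - Y \<in> trivial_divs J K"
  using trivial_divs_add[of K X J "- Y"] trivial_divs_uminus[of K Y J] by simp

lemma trivial_divs_0: "K > 0 \<Longrightarrow> 0 \<in> trivial_divs J K"
  by (simp add: trivial_divs_prin prin_0)

lemma trivial_divs_cmul: "K > 0 \<Longrightarrow> X \<in> trivial_divs J K \<Longrightarrow> frag_cmul a X \<in> trivial_divs J K"
proof (induction a rule: int_induct[of _ 0])
  case base
  then show ?case by (simp add: trivial_divs_0)
next
  case (step1 i)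
  then show ?case by (simp add: frag_cmul_distrib trivial_divs_add)
next
  case (step2 i)
  then show ?case by (simp add: frag_cmul_diff_distrib trivial_divs_diff)
qed

lemma trivial_divs_trans:
  assumes K: "K dvd N" "J dvd K" and X: "X \<in> trivial_divs J K"
  shows "trans i X \<in> trivial_divs J K"
proof -
  have Kp: "K > 0" and Jp: "J > 0" using dvd_pos K dvd_trans by blast+
  obtain D E where "X = D + pull J K E" "D \<in> prin K" "E \<in> dv0 J" using X by (auto simp: trivial_divs_def)
  then show ?thesis
    using trivial_divsI[OF prin_trans[OF _ Kp, of D i] trans_dv0[OF _ Jp, of E i]] trans_pull[OF dv0_dv K, of E i]
    by (simp add: trans_simps)
qed

text \<open>
  A class fixed by the deck transformation is, after a modification by \<open>J\<close> that uses the
  surjectivity of \<open>1 - \<delta>\<close> on the level below and by Hilbert 90, the class of an invariant divisor.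
\<close>

lemma kernel_one_minus_trans:
  assumes K: "K dvd N" "J dvd K" and P0: "P0 \<in> pts K" "over c0 P0" "\<delta> ` P0 = P0" "relram J K c0 = K div J"
    and R: "finite R" "c0 \<in> R" "\<And>c. c \<notin> R \<Longrightarrow> relram J K c = 1"
    and D: "D \<in> dv0 K" "D - trans 1 D \<in> trivial_divs J K"
  shows "\<exists>m. div_degree (\<Sum>c\<in>R. frag_cmul (m c) (fibre_sum K c)) = 0 \<and>
    D - (\<Sum>c\<in>R. frag_cmul (m c) (fibre_sum K c)) \<in> trivial_divs J K"
proof -
  have Kp: "K > 0" and JN: "J dvd N" and Jp: "J > 0" using dvd_pos K dvd_trans by blast+
  define Q0 where "Q0 = P0 \<inter> fixed J"
  have Q0: "Q0 \<in> pts J" "\<delta> ` Q0 = Q0"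
    using pts_restrict[OF P0(1) Kp K(2)] funpow_restrict[OF Jp, of 1 P0] P0(3) by (simp_all add: Q0_def)
  have fix0: "(\<delta> ^^ i) ` P0 = P0" for i
  proof (induction i)
    case (Suc i)
    have "(\<delta> ^^ Suc i) ` P0 = \<delta> ` (\<delta> ^^ i) ` P0" by (simp add: image_comp)
    then show ?case using Suc P0(3) by simp
  qed simp
  have single: "fibre K c0 = {P0}"
  proof -
    have "P = P0" if P: "P \<in> fibre K c0" for P
    proof -
      have "P \<in> pts K" "over c0 P" using P by (simp_all add: fibre_def)
      then obtain i where "P = (\<delta> ^^ i) ` P0" using conjugate_points_over[OF P0(1,2) _ _ Kp] by blast
      then show ?thesis by (simp only: fix0)
    qed
    moreover have "P0 \<in> fibre K c0" using P0 by (simp add: fibre_def)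
    ultimately show ?thesis by blast
  qed
  have pull0: "pull J K (frag_of Q0) = frag_cmul (int (K div J)) (fibre_sum K c0)"
  proof -
    have "fibre J c0 = {Q0}"
    proof -
      have oQ: "over c0 Q0" using pts_restrict(2)[OF P0(1) Kp K(2)] P0(2) by (simp add: Q0_def)
      have fixQ: "(\<delta> ^^ i) ` Q0 = Q0" for i
        using funpow_restrict[OF Jp, of i P0] by (simp only: fix0 Q0_def)
      have "Q = Q0" if Q: "Q \<in> fibre J c0" for Q
      proof -
        have "Q \<in> pts J" "over c0 Q" using Q by (simp_all add: fibre_def)
        then obtain i where "Q = (\<delta> ^^ i) ` Q0" using conjugate_points_over[OF Q0(1) oQ _ _ Jp] by blast
        then show ?thesis by (simp only: fixQ)
      qed
      moreover have "Q0 \<in> fibre J c0" using Q0(1) oQ by (simp add: fibre_def)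
      ultimately show ?thesis by blast
    qed
    then show ?thesis using pull_fibre_sum[OF K, of c0] P0(4) by (simp add: fibre_sum_def)
  qed
  obtain p E where pE: "D - trans 1 D = p + pull J K E" "p \<in> prin K" "E \<in> dv0 J"
    using D(2) by (auto simp: trivial_divs_def)
  \<comment> \<open>So far \<open>D - trans 1 D\<close> is principal only up to the pullback of
    \<open>E\<close>. Surjectivity of 1 - \<delta> one level down absorbs \<open>E\<close>, and
    after subtracting the pullback of \<open>E'\<close> the class is fixed in J_s itself, as Hilbert
    90 requires.\<close>
  obtain E' where E': "E' \<in> dv0 J" "E - (E' - trans 1 E') \<in> prin J"
    using one_minus_trans_surjective[OF pE(3) JN Q0] by blast
  define D1 where "D1 = D - pull J K E'"
  have D1: "D1 \<in> dv0 K" unfolding D1_def using D(1) pull_dv0[OF E'(1) K] by (rule dv0_diff)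
  have "D1 - trans 1 D1 = p + pull J K (E - (E' - trans 1 E'))"
    using pE(1) trans_pull[OF dv0_dv[OF E'(1)] K, of 1] by (simp add: D1_def trans_simps pull_simps algebra_simps)
  moreover have "pull J K (E - (E' - trans 1 E')) \<in> prin K"
  proof -
    obtain g where g: "g \<in> fixed J" "g \<noteq> 0" "E - (E' - trans 1 E') = pdiv J g" using E'(2) by (auto simp: prin_def)
    then have "pull J K (E - (E' - trans 1 E')) = pdiv K g" using pull_pdiv[OF _ _ K] by simp
    then show ?thesis using g fixed_mono[OF K(2)] by (auto simp: prin_def)
  qed
  ultimately have "D1 - trans 1 D1 \<in> prin K" using pE(2) prin_add Kp by simp
  then obtain g where g: "g \<in> fixed K" "g \<noteq> 0" "D1 - trans 1 D1 = pdiv K g" by (auto simp: prin_def)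
  \<comment> \<open>The divisor of the norm telescopes to 0, so the norm of \<open>g\<close> is a
    constant; scaling \<open>g\<close> by a \<open>K\<close>-th root of it makes the norm 1.\<close>
  have "pdiv K (norm K g) = (\<Sum>i<K. trans i D1 - trans (Suc i) D1)"
    unfolding pdiv_norm[OF g(1,2) Kp] g(3)[symmetric] by (simp add: trans_simps trans_trans)
  also have "\<dots> = trans 0 D1 - trans K D1" by (rule sum_lessThan_telescope')
  also have "\<dots> = 0" using trans_multiple[OF dv0_dv[OF D1] Kp] by simp
  finally obtain r where r: "norm K g = emb r"
    using constant_of_pdiv_0[OF norm_in_rat[OF g(1)] _ K(1)] norm_eq_0_iff[OF Kp] g(2) by blast
  have r0: "r \<noteq> 0" using r norm_eq_0_iff[OF Kp, of g] g(2) by auto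
  obtain b where b: "b ^ K = r" using nth_root_exists[OF Kp] by blast
  have b0: "b \<noteq> 0" using b r0 Kp by (auto simp: power_0_left)
  define g2 where "g2 = g * emb (inverse b)"
  have g2: "g2 \<in> fixed K" "g2 \<noteq> 0" using g b0 emb_fixed by (auto simp: g2_def intro: subfield_mult subfield_fixed)
  have "norm K g2 = emb r * emb (inverse b) ^ K" by (simp add: g2_def norm_mult r norm_rat emb_rat)
  also have "\<dots> = 1" using b r0 by (simp add: power_inverse flip: emb.hom_power emb.hom_mult)
  finally have "norm K g2 = 1" .
  moreover have "K * (N div K) = N" using K by simp
  ultimately obtain h where h: "h \<in> fixed K" "h \<noteq> 0" "g2 * \<delta> h = h" using hilbert90 g2(1) by blast
  have dh: "\<delta> h \<in> fixed K" "\<delta> h \<noteq> 0" using fixed_funpow[OF h(1), of 1] h(2) by auto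
  have "pdiv K g2 = pdiv K g"
    unfolding g2_def using pdiv_mult[OF g(1,2) emb_fixed _ Kp, of "inverse b"] pdiv_emb[OF _ Kp, of "inverse b"] b0 by simp
  then have gh: "pdiv K g + trans 1 (pdiv K h) = pdiv K h"
    using pdiv_mult[OF g2 dh Kp] h(3) pdiv_trans[OF h(1,2) Kp, of 1] by simp
  define D2 where "D2 = D1 - pdiv K h"
  have D2: "D2 \<in> dv0 K" unfolding D2_def using D1 pdiv_dv0[OF h(1,2) K(1)] by (rule dv0_diff)
  have "D2 - trans 1 D2 = (D1 - trans 1 D1) + trans 1 (pdiv K h) - pdiv K h"
    by (simp add: D2_def trans_simps)
  then have "D2 - trans 1 D2 = 0" by (simp only: g(3) gh diff_self)
  then have inv: "trans 1 D2 = D2" by simp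
  define C where "C = center ` Poly_Mapping.keys D2 \<union> R"
  have C: "finite C" "center ` Poly_Mapping.keys D2 \<subseteq> C" "R \<subseteq> C" using R(1) by (auto simp: C_def)
  obtain m where m: "D2 = (\<Sum>c\<in>C. frag_cmul (m c) (fibre_sum K c))"
    using invariant_divisor[OF dv0_dv[OF D2] Kp inv C(1,2)] by blast
  \<comment> \<open>Outside \<open>R\<close> the cover from level \<open>J\<close> is unramified, so
    sums over those fibres are pullbacks. Their degree \<open>d\<close> is moved to the totally
    ramified point \<open>Q0\<close>, whose pullback is a multiple of the fibre sum at
    \<open>c0\<close> and is credited to \<open>m'\<close>; what remains is the pullback of a
    divisor of degree 0.\<close>
  define E1 where "E1 = (\<Sum>c\<in>C - R. frag_cmul (m c) (fibre_sum J c))"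
  define d where "d = div_degree E1"
  define E2 where "E2 = E1 - frag_cmul d (frag_of Q0)"
  have E2: "E2 \<in> dv0 J"
    unfolding dv0_def E2_def d_def E1_def using Q0(1)
    by (auto simp: div_degree_diff div_degree_cmul div_degree_frag_of intro!: dv_diff dv_sum dv_cmul fibre_sum_dv dv_frag_of)
  have psum: "pull J K (sum h I) = (\<Sum>i\<in>I. pull J K (h i))" for h :: "'a option \<Rightarrow> _" and I
    by (induction I rule: infinite_finite_induct) (auto simp: pull_simps)
  have "pull J K E1 = (\<Sum>c\<in>C - R. frag_cmul (m c) (fibre_sum K c))"
    unfolding E1_def psum using R(3) by (intro sum.cong) (auto simp: pull_simps pull_fibre_sum[OF K])
  then have D2eq: "D2 = (\<Sum>c\<in>R. frag_cmul (m c) (fibre_sum K c)) + pull J K E1"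
    using m sum.subset_diff[OF C(3,1), of "\<lambda>c. frag_cmul (m c) (fibre_sum K c)"] by (simp add: add.commute)
  define m' where "m' = (\<lambda>c. m c + (if c = c0 then d * int (K div J) else 0))"
  have "(\<Sum>c\<in>R. frag_cmul (m' c) (fibre_sum K c)) =
      (\<Sum>c\<in>R. frag_cmul (m c) (fibre_sum K c)) + (\<Sum>c\<in>R. if c = c0 then frag_cmul (d * int (K div J)) (fibre_sum K c) else 0)"
    unfolding sum.distrib[symmetric] by (intro sum.cong) (auto simp: m'_def frag_cmul_distrib)
  also have "\<dots> = (\<Sum>c\<in>R. frag_cmul (m c) (fibre_sum K c)) + frag_cmul d (pull J K (frag_of Q0))"
    using R(1,2) by (simp add: pull0 sum.delta)
  finally have W: "D2 = (\<Sum>c\<in>R. frag_cmul (m' c) (fibre_sum K c)) + pull J K E2"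
    using D2eq by (simp add: E2_def pull_simps)
  then have "div_degree D2 = div_degree (\<Sum>c\<in>R. frag_cmul (m' c) (fibre_sum K c)) + div_degree (pull J K E2)"
    by (simp add: div_degree_add)
  then have "div_degree (\<Sum>c\<in>R. frag_cmul (m' c) (fibre_sum K c)) = 0"
    using D2 pull_dv0[OF E2 K] by (simp add: dv0_def)
  moreover have "D - (\<Sum>c\<in>R. frag_cmul (m' c) (fibre_sum K c)) = pdiv K h + pull J K (E' + E2)"
    using W by (simp add: D2_def D1_def pull_simps algebra_simps)
  moreover have "pdiv K h + pull J K (E' + E2) \<in> trivial_divs J K"
    using h by (intro trivial_divsI dv0_add E'(1) E2) (auto simp: prin_def)
  ultimately show ?thesis by (intro exI[of _ m']) simp
qed

text \<open>The divisor p(\<delta>) D, by Horner's scheme. Polynomials in place of the group ring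
  let divisibility and congruences in Z[X] be applied directly.\<close>

definition pact :: "int poly \<Rightarrow> ('f set \<Rightarrow>\<^sub>0 int) \<Rightarrow> ('f set \<Rightarrow>\<^sub>0 int)" where
  "pact p D = fold_coeffs (\<lambda>a E. frag_cmul a D + trans 1 E) p 0"

lemma pact_0: "pact 0 D = 0"
  by (simp add: pact_def)

lemma pact_pCons: "pact (pCons a p) D = frag_cmul a D + trans 1 (pact p D)"
  by (cases "a = 0 \<and> p = 0") (auto simp: pact_def trans_simps)

lemma pact_const: "pact [:a:] D = frag_cmul a D"
  by (simp add: pact_pCons pact_0 trans_simps)

lemma pact_one: "pact 1 D = D"
  using pact_const[of 1 D] by (simp add: pCons_one)

lemma pact_add: "pact (p + q) D = pact p D + pact q D"
  by (induction p q rule: poly_induct2) (auto simp: pact_0 pact_pCons trans_simps frag_cmul_distrib)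

lemma pact_minus: "pact (p - q) D = pact p D - pact q D"
  using pact_add[of "p - q" q D] by (simp add: algebra_simps)

lemma pact_sum: "pact (sum h I) D = (\<Sum>i\<in>I. pact (h i) D)"
  by (induction I rule: infinite_finite_induct) (auto simp: pact_0 pact_add)

lemma pact_smult: "pact (Polynomial.smult a p) D = frag_cmul a (pact p D)"
  by (induction p) (auto simp: pact_0 pact_pCons trans_simps frag_cmul_distrib2)

lemma pact_mult: "pact (p * q) D = pact p (pact q D)"
  by (induction p) (auto simp: pact_0 pact_pCons pact_add pact_smult)

lemma pact_add_right: "pact p (D + E) = pact p D + pact p E"
  by (induction p) (auto simp: pact_0 pact_pCons trans_simps frag_cmul_distrib2)

lemma pact_minus_right: "pact p (D - E) = pact p D - pact p E"
  using pact_add_right[of p "D - E" E] by (simp add: algebra_simps)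

lemma pact_cmul_right: "pact p (frag_cmul a D) = frag_cmul a (pact p D)"
  by (metis pact_const pact_mult mult.commute)

lemma pact_monom: "D \<in> dv K \<Longrightarrow> K > 0 \<Longrightarrow> pact (Polynomial.monom 1 i) D = trans i D"
  by (induction i) (auto simp: pact_pCons pact_0 pact_one monom_0 monom_Suc trans_multiple trans_trans trans_simps)

lemma dv0_cmul: "D \<in> dv0 K \<Longrightarrow> frag_cmul a D \<in> dv0 K"
  by (simp add: dv0_def dv_cmul div_degree_cmul)

lemma pact_dv0: "D \<in> dv0 K \<Longrightarrow> K > 0 \<Longrightarrow> pact p D \<in> dv0 K"
  by (induction p) (auto simp: pact_0 pact_pCons dv0_0 intro!: dv0_add trans_dv0 dv0_cmul)

lemma pact_trivial:
  assumes K: "K dvd N" "J dvd K" and X: "X \<in> trivial_divs J K"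
  shows "pact p X \<in> trivial_divs J K"
  by (induction p)
     (auto simp: pact_0 pact_pCons dvd_pos[OF K(1)]
       intro!: trivial_divs_0 trivial_divs_add trivial_divs_cmul trivial_divs_trans[OF K] X)

text \<open>For \<open>K = l ^ s\<close> and \<open>J = l ^ (s - 1)\<close> the polynomial is the
  cyclotomic polynomial of \<open>K\<close>; it acts as pushforward followed by pullback.\<close>

lemma pact_relative_trace:
  assumes K: "K dvd N" "J dvd K" and D: "D \<in> dv0 K"
  shows "pact (\<Sum>i<K div J. Polynomial.monom 1 (J * i)) D \<in> trivial_divs J K"
proof -
  have Kp: "K > 0" by (rule dvd_pos[OF K(1)])
  obtain E where E: "E \<in> dv J" "div_degree E = div_degree D" "(\<Sum>i<K div J. trans (J * i) D) = pull J K E"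
    using relative_trace_pull[OF dv0_dv[OF D] K] by blast
  then have "E \<in> dv0 J" using D by (simp add: dv0_def)
  then show ?thesis using E(3) trivial_divs_pull[OF Kp] by (simp add: pact_sum pact_monom[OF dv0_dv[OF D] Kp])
qed

end

text \<open>Modulo \<open>l\<close> Frobenius turns X^q - 1 and X^(q l) - 1, for q =
  \<open>l ^ (s - 1)\<close>, into powers of X - 1; cancelling the first from the second leaves (X -
  1)^(q (l - 1)). The normalisation of \<open>u\<close> comes from the value of the sum at 1, which
  is \<open>l\<close>, while the power of X - 1 vanishes there.\<close>

lemma prime_cyclotomic_congruence:
  fixes l s :: nat
  assumes l: "l = CARD('p::prime_card)" and s: "s \<ge> 1"
  shows "\<exists>u. (\<Sum>i<l. Polynomial.monom (1::int) (l ^ (s - 1) * i)) = [:- 1, 1:] ^ (l ^ (s - 1) * (l - 1)) + Polynomial.smult (int l) u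
    \<and> poly u 1 = 1"
proof -
  define h where "h = map_poly (of_int :: int \<Rightarrow> 'p mod_ring)"
  have "comm_ring_hom h" unfolding h_def by unfold_locales (auto simp: hom_distribs)
  then interpret h: comm_ring_hom h .
  have pl: "Factorial_Ring.prime l" using prime_card by (simp add: l)
  have l1: "l > 1" using pl prime_gt_1_nat by blast
  have char: "CHAR('p mod_ring poly) = l" by (simp add: l)
  define q where "q = l ^ (s - 1)"
  have q: "q > 0" using l1 by (simp add: q_def)
  have ql: "q * l = l ^ s" using s by (simp add: q_def power_eq_if)
  have qs: "l ^ s = q + q * (l - 1)" unfolding ql[symmetric] using l1 by (cases l) auto
  define X where "X = ([:0, 1:] :: 'p mod_ring poly)"
  have frob: "(X - 1) ^ (l ^ j) = X ^ (l ^ j) - 1" for j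
  proof -
    have "((X - 1) + 1) ^ (l ^ j) = (X - 1) ^ (l ^ j) + 1 ^ (l ^ j)"
      by (rule freshmans_dream') (use pl char in auto)
    then show ?thesis by simp
  qed
  have hX: "h [:- 1, 1:] = X - 1" and hm: "h (Polynomial.monom 1 i) = X ^ i" for i
  proof -
    show hm: "h (Polynomial.monom 1 i) = X ^ i" for i
    proof -
      have "h (Polynomial.monom 1 i) = Polynomial.monom 1 i" by (simp add: h_def map_poly_monom)
      then show ?thesis by (simp add: X_def monom_altdef)
    qed
    have "[:- 1, 1:] = Polynomial.monom (1::int) 1 - 1"
      by (rule poly_eqI) (auto simp: coeff_pCons split: nat.splits)
    then show "h [:- 1, 1:] = X - 1" using hm[of 1] by (simp only: h.hom_minus h.hom_one) simp
  qed
  define S where "S = (\<Sum>i<l. Polynomial.monom (1::int) (q * i))"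
  have hS: "h S = (\<Sum>i<l. (X ^ q) ^ i)"
    unfolding S_def h.hom_sum hm by (simp add: power_mult)
  have "(X - 1) ^ q * h S = (X ^ q - 1) * (\<Sum>i<l. (X ^ q) ^ i)"
    unfolding hS by (simp add: q_def frob)
  also have "\<dots> = X ^ (q * l) - 1" by (simp add: power_diff_1_eq[symmetric] power_mult)
  also note ql
  also have "X ^ (l ^ s) - 1 = (X - 1) ^ (l ^ s)" by (rule frob[symmetric])
  also note qs
  also have "(X - 1) ^ (q + q * (l - 1)) = (X - 1) ^ q * h ([:- 1, 1:] ^ (q * (l - 1)))"
    unfolding h.hom_power hX by (simp add: power_add)
  finally have "(X - 1) ^ q * h S = (X - 1) ^ q * h ([:- 1, 1:] ^ (q * (l - 1)))" .
  moreover have "Polynomial.coeff (X - 1) 1 = 1" by (simp add: X_def)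
  then have "X - 1 \<noteq> 0" by (metis coeff_0 zero_neq_one)
  ultimately have "h S = h ([:- 1, 1:] ^ (q * (l - 1)))" by simp
  then have z: "h (S - [:- 1, 1:] ^ (q * (l - 1))) = 0" by (simp only: h.hom_minus diff_self)
  have "int l dvd Polynomial.coeff (S - [:- 1, 1:] ^ (q * (l - 1))) i" for i
  proof -
    have "(of_int (Polynomial.coeff (S - [:- 1, 1:] ^ (q * (l - 1))) i) :: 'p mod_ring) = 0"
      using arg_cong[OF z, of "\<lambda>p. Polynomial.coeff p i"] by (simp add: h_def coeff_map_poly)
    moreover have "CHAR('p mod_ring) = l" by (simp add: l)
    ultimately show ?thesis by (simp only: of_int_eq_0_iff_char_dvd)
  qed
  then have "[:int l:] dvd S - [:- 1, 1:] ^ (q * (l - 1))" by (simp add: const_poly_dvd_iff)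
  then obtain u where u: "S - [:- 1, 1:] ^ (q * (l - 1)) = [:int l:] * u" by (elim dvdE)
  have "int l * poly u 1 = poly (S - [:- 1, 1:] ^ (q * (l - 1))) 1" unfolding u by simp
  also have "\<dots> = int l" using q l1 by (simp add: S_def poly_sum poly_monom poly_power)
  finally have "poly u 1 = 1" using l1 by simp
  moreover have "S = [:- 1, 1:] ^ (q * (l - 1)) + Polynomial.smult (int l) u" using u by (simp add: algebra_simps)
  ultimately show ?thesis unfolding S_def q_def by blast
qed

text \<open>As \<open>u\<close> is congruent to 1 modulo X - 1, a finite geometric series inverts it
  modulo any power of X - 1.\<close>

lemma unipotent_inverse:
  fixes u :: "int poly"
  assumes "poly u 1 = 1"
  shows "\<exists>v w. v * u + w * [:- 1, 1:] ^ m = 1"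
proof -
  have "poly (u - 1) 1 = 0" using assms by simp
  then have "[:- 1, 1:] dvd u - 1" by (simp only: poly_eq_0_iff_dvd)
  then obtain w where "u - 1 = [:- 1, 1:] * w" by (elim dvdE)
  then have "u = 1 + [:- 1, 1:] * w" by (metis add.commute diff_add_cancel)
  then have u: "u = 1 - [:- 1, 1:] * (- w)" by (simp only: mult_minus_right diff_minus_eq_add)
  have "(\<Sum>i<m. ([:- 1, 1:] * (- w)) ^ i) * u = 1 - ([:- 1, 1:] * (- w)) ^ m"
    unfolding u one_diff_power_eq[symmetric, of "[:- 1, 1:] * (- w)" m] by (simp only: mult.commute one_diff_power_eq)
  then have "(\<Sum>i<m. ([:- 1, 1:] * (- w)) ^ i) * u + (- w) ^ m * [:- 1, 1:] ^ m = 1"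
    by (simp only: power_mult_distrib mult.commute diff_add_cancel)
  then show ?thesis by blast
qed

text \<open>X^c - 1 is X - 1 times a polynomial with value \<open>c\<close> at 1, so its i-th power
  starts with \<open>c ^ i\<close> in powers of X - 1. This is where the twist originates.\<close>

lemma power_minus_one_congruence:
  "\<exists>w::int poly. (Polynomial.monom 1 c - 1) ^ i = [:int c ^ i:] * [:- 1, 1:] ^ i + w * [:- 1, 1:] ^ Suc i"
proof -
  define S where "S = (\<Sum>j<c. [:0, 1:] ^ j :: int poly)"
  have "Polynomial.monom 1 c - (1 :: int poly) = [:0, 1:] ^ c - 1" by (simp add: monom_altdef)
  also have "\<dots> = ([:0, 1:] - 1) * S" unfolding S_def by (rule power_diff_1_eq)
  also have "[:0, 1:] - (1 :: int poly) = [:- 1, 1:]"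
    by (rule poly_eqI) (auto simp: coeff_pCons split: nat.splits)
  finally have m: "Polynomial.monom 1 c - (1 :: int poly) = [:- 1, 1:] * S" .
  have "poly (S ^ i - [:int c ^ i:]) 1 = 0" by (simp add: S_def poly_sum poly_power)
  then have "[:- 1, 1:] dvd S ^ i - [:int c ^ i:]" by (simp only: poly_eq_0_iff_dvd)
  then obtain w where "S ^ i - [:int c ^ i:] = [:- 1, 1:] * w" by (elim dvdE)
  then have Si: "S ^ i = [:int c ^ i:] + [:- 1, 1:] * w" by (simp add: algebra_simps)
  have "(Polynomial.monom 1 c - 1) ^ i = [:int c ^ i:] * [:- 1, 1:] ^ i + w * [:- 1, 1:] ^ Suc i"
    unfolding m power_mult_distrib Si power_Suc by (simp only: distrib_left mult_ac)
  then show ?thesis by blast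
qed

context kummer_tower begin

text \<open>On classes the cyclotomic relation says that the power of \<Delta> equals - l
  u(\<delta>), which settles one direction. For the other, \<open>u\<close> is invertible modulo
  that power of X - 1, so on a class killed by the power of \<Delta> the factor u(\<delta>) can be
  removed.\<close>

lemma torsion_iff_unipotent:
  assumes l: "l = CARD('p::prime_card)" and s: "s \<ge> 1" and N: "l ^ s dvd N" and D: "D \<in> dv0 (l ^ s)"
  shows "frag_cmul (int l) D \<in> trivial_divs (l ^ (s - 1)) (l ^ s) \<longleftrightarrow>
    pact ([:- 1, 1:] ^ totient (l ^ s)) D \<in> trivial_divs (l ^ (s - 1)) (l ^ s)"
proof -
  define J K where "J = l ^ (s - 1)" and "K = l ^ s"
  have pl: "Factorial_Ring.prime l" using prime_card by (simp add: l)
  have l1: "l > 1" using pl prime_gt_1_nat by blast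
  have JK: "J * l = K" using s by (simp add: J_def K_def power_eq_if)
  have "J dvd K" unfolding JK[symmetric] by simp
  then have K: "K dvd N" "J dvd K" using N by (auto simp: K_def)
  have Kp: "K > 0" by (rule dvd_pos[OF K(1)])
  have KJ: "K div J = l" using JK Kp by auto
  have tot: "totient (l ^ s) = J * (l - 1)" using totient_prime_power[OF pl, of s] s by (simp add: J_def)
  define \<Delta> where "\<Delta> = ([:- 1, 1:] :: int poly) ^ totient (l ^ s)"
  obtain u where u: "(\<Sum>i<l. Polynomial.monom (1::int) (J * i)) = \<Delta> + Polynomial.smult (int l) u" "poly u 1 = 1"
    using prime_cyclotomic_congruence[OF l s] unfolding J_def \<Delta>_def tot[unfolded J_def] by blast
  have "pact (\<Delta> + Polynomial.smult (int l) u) D \<in> trivial_divs J K"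
    using pact_relative_trace[OF K D[folded K_def]] u KJ by simp
  then have t: "pact \<Delta> D + pact u (frag_cmul (int l) D) \<in> trivial_divs J K"
    by (simp add: pact_add pact_smult pact_cmul_right)
  have "frag_cmul (int l) D \<in> trivial_divs J K \<longleftrightarrow> pact \<Delta> D \<in> trivial_divs J K"
  proof
    assume "frag_cmul (int l) D \<in> trivial_divs J K"
    then have "pact u (frag_cmul (int l) D) \<in> trivial_divs J K" by (rule pact_trivial[OF K])
    from trivial_divs_diff[OF Kp t this] show "pact \<Delta> D \<in> trivial_divs J K" by simp
  next
    assume a: "pact \<Delta> D \<in> trivial_divs J K"
    from trivial_divs_diff[OF Kp t a] have ul: "pact u (frag_cmul (int l) D) \<in> trivial_divs J K" by simp
    obtain v w where vw: "v * u + w * \<Delta> = 1" using unipotent_inverse[OF u(2)] unfolding \<Delta>_def by blast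
    have "frag_cmul (int l) D = pact (v * u + w * \<Delta>) (frag_cmul (int l) D)" by (simp add: vw pact_one)
    also have "\<dots> = pact v (pact u (frag_cmul (int l) D)) + frag_cmul (int l) (pact w (pact \<Delta> D))"
      by (simp add: pact_add pact_mult pact_cmul_right frag_cmul_distrib2)
    also have "\<dots> \<in> trivial_divs J K"
      by (intro trivial_divs_add trivial_divs_cmul pact_trivial[OF K] Kp ul a)
    finally show "frag_cmul (int l) D \<in> trivial_divs J K" .
  qed
  then show ?thesis by (simp add: J_def K_def \<Delta>_def)
qed

end

section \<open>Block triangular representations\<close>

context comm_group begin

lemma Fl_lincomb_closed: "set b \<subseteq> carrier G \<Longrightarrow> Fl_lincomb G b c \<in> carrier G"
  unfolding Fl_lincomb_def by (intro finprod_closed) (auto intro!: int_pow_closed dest: nth_mem)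

lemma Fl_lincomb_append:
  fixes c c' :: "'p::prime_card mod_ring vec"
  assumes b: "set b \<subseteq> carrier G" "set b' \<subseteq> carrier G" and c: "dim_vec c = length b" "dim_vec c' = length b'"
  shows "Fl_lincomb G (b @ b') (c @\<^sub>v c') = Fl_lincomb G b c \<otimes> Fl_lincomb G b' c'"
proof -
  define g where "g = (\<lambda>i. ((b @ b') ! i) [^] to_int_mod_ring ((c @\<^sub>v c') $ i))"
  have nth: "(b @ b') ! i \<in> carrier G" if "i < length b + length b'" for i
    using nth_mem[of i "b @ b'"] that b by auto
  have "Fl_lincomb G (b @ b') (c @\<^sub>v c') = finprod G g ({..<length b} \<union> (\<lambda>i. i + length b) ` {..<length b'})"
  proof -
    have "{..<length (b @ b')} = {..<length b} \<union> (\<lambda>i. i + length b) ` {..<length b'}"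
      by (auto simp: image_iff intro: le_add_diff_inverse2[symmetric]) (metis add_diff_inverse_nat less_diff_conv2 lessThan_iff linorder_not_less add.commute nat_add_left_cancel_less)
    then show ?thesis by (simp add: Fl_lincomb_def g_def)
  qed
  also have "\<dots> = finprod G g {..<length b} \<otimes> finprod G g ((\<lambda>i. i + length b) ` {..<length b'})"
    using nth by (intro finprod_Un_disjoint) (auto simp: g_def)
  also have "finprod G g {..<length b} = Fl_lincomb G b c"
    unfolding Fl_lincomb_def using b c by (intro finprod_cong') (auto simp: g_def nth_append intro!: int_pow_closed dest: nth_mem)
  also have "finprod G g ((\<lambda>i. i + length b) ` {..<length b'}) = finprod G (\<lambda>i. g (i + length b)) {..<length b'}"
    using nth by (intro finprod_reindex) (auto simp: g_def)
  also have "\<dots> = Fl_lincomb G b' c'"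
    unfolding Fl_lincomb_def using b c by (intro finprod_cong') (auto simp: g_def nth_append intro!: int_pow_closed dest: nth_mem)
  finally show ?thesis .
qed

lemma Fl_lincomb_0: "set b \<subseteq> carrier G \<Longrightarrow> Fl_lincomb G b (0\<^sub>v (length b) :: 'p::prime_card mod_ring vec) = \<one>"
  unfolding Fl_lincomb_def by (intro finprod_one_eqI) simp

lemma Fl_lincomb_hom:
  assumes h: "h \<in> hom G G" and b: "set b \<subseteq> carrier G"
  shows "h (Fl_lincomb G b c) = Fl_lincomb G (map h b) c"
proof -
  interpret h: group_hom G G h using h by unfold_locales
  have hb: "h (b ! i) \<in> carrier G" "b ! i \<in> carrier G" if "i < length b" for i
    using nth_mem[OF that] b h.hom_closed by auto
  have "h (finprod G (\<lambda>i. (b ! i) [^] to_int_mod_ring (c $ i)) {..<n}) =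
      finprod G (\<lambda>i. (map h b ! i) [^] to_int_mod_ring (c $ i)) {..<n}" if "n \<le> length b" for n
    using that
  proof (induction n)
    case (Suc n)
    then show ?case using hb by (simp add: lessThan_Suc Pi_def h.hom_int_pow)
  qed simp
  then show ?thesis by (simp add: Fl_lincomb_def)
qed

lemma torsion_int_pow:
  assumes a: "a \<in> torsion G l"
  shows "a [^] (k::int) = a [^] (k mod int l)"
proof -
  have aG: "a \<in> carrier G" "a [^] l = \<one>" using a by (auto simp: torsion_def)
  have "a [^] k = a [^] (int l * (k div int l) + k mod int l)" by simp
  also have "\<dots> = (a [^] int l) [^] (k div int l) \<otimes> a [^] (k mod int l)"
    using aG(1) by (simp only: int_pow_mult int_pow_pow)
  also have "a [^] int l = \<one>" using aG by (simp add: int_pow_int)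
  finally show ?thesis using aG(1) by simp
qed

lemma torsion_int_pow_mod_ring:
  assumes a: "a \<in> torsion G CARD('p::prime_card)"
  shows "a [^] to_int_mod_ring (of_int k :: 'p mod_ring) = a [^] k"
proof -
  have "to_int_mod_ring (of_int k :: 'p mod_ring) = k mod int CARD('p)"
    by (simp add: of_int_of_int_mod_ring) (transfer, simp)
  then show ?thesis using torsion_int_pow[OF a, of k] by simp
qed

lemma Fl_lincomb_int_pow:
  fixes c :: "'p::prime_card mod_ring vec"
  assumes b: "set b \<subseteq> torsion G CARD('p)" and c: "dim_vec c = length b"
  shows "(Fl_lincomb G b c) [^] (k::int) = Fl_lincomb G b (of_int k \<cdot>\<^sub>v c)"
proof -
  have bG: "b ! i \<in> torsion G CARD('p)" "b ! i \<in> carrier G" if "i < length b" for i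
    using b nth_mem[OF that] unfolding torsion_def by blast+
  have "(finprod G (\<lambda>i. (b ! i) [^] to_int_mod_ring (c $ i)) {..<n}) [^] k =
      finprod G (\<lambda>i. (b ! i) [^] to_int_mod_ring ((of_int k \<cdot>\<^sub>v c) $ i)) {..<n}" if "n \<le> length b" for n
    using that
  proof (induction n)
    case (Suc n)
    have "(b ! n) [^] to_int_mod_ring ((of_int k \<cdot>\<^sub>v c) $ n) = (b ! n) [^] (to_int_mod_ring (c $ n) * k)"
    proof -
      have "of_int k * c $ n = (of_int (to_int_mod_ring (c $ n) * k) :: 'p mod_ring)"
      proof -
        have "of_int (to_int_mod_ring (c $ n)) = c $ n" by (simp add: of_int_of_int_mod_ring)
        then show ?thesis by (simp only: of_int_mult mult.commute)
      qed
      moreover have "(of_int k \<cdot>\<^sub>v c) $ n = of_int k * c $ n" using Suc.prems c by simp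
      ultimately show ?thesis
        using torsion_int_pow_mod_ring[OF bG(1), of n "to_int_mod_ring (c $ n) * k"] Suc.prems by (simp only: less_eq_Suc_le)
    qed
    then have "(b ! n) [^] to_int_mod_ring ((of_int k \<cdot>\<^sub>v c) $ n) = ((b ! n) [^] to_int_mod_ring (c $ n)) [^] k"
      using bG Suc by (simp add: int_pow_pow)
    then show ?case using Suc bG
      by (simp add: lessThan_Suc Pi_def int_pow_distrib)
  qed simp
  then show ?thesis by (simp add: Fl_lincomb_def)
qed

end

section \<open>Coordinates, matrices and the filtration by kernels\<close>

lemma Fl_basis_coordinates:
  fixes v :: "'p::prime_card mod_ring vec"
  assumes "Fl_basis TYPE('p) G V b" "v \<in> carrier_vec (length b)"
  shows "the_inv_into (carrier_vec (length b)) (Fl_lincomb G b) (Fl_lincomb G b v) = v"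
  using assms by (intro the_inv_into_f_f) (auto simp: Fl_basis_def bij_betw_def)

lemma Fl_basis_obtain:
  assumes "Fl_basis TYPE('p::prime_card) G V b" "a \<in> V"
  obtains v :: "'p::prime_card mod_ring vec" where "v \<in> carrier_vec (length b)" "a = Fl_lincomb G b v"
  using assms by (auto simp: Fl_basis_def bij_betw_def)

lemma rep_matrix_entry:
  fixes v :: "'p::prime_card mod_ring vec"
  assumes "Fl_basis TYPE('p) G V b" "v \<in> carrier_vec (length b)" "h (b ! j) = Fl_lincomb G b v"
    and "i < length b" "j < length b"
  shows "rep_matrix G b h $$ (i, j) = v $ i"
  using assms Fl_basis_coordinates[OF assms(1,2)] by (simp add: rep_matrix_def)

lemma rep_matrix_column:
  assumes "Fl_basis TYPE('p::prime_card) G V b" "h (b ! j) \<in> V" "j < length b"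
  shows "h (b ! j) = Fl_lincomb G b (col (rep_matrix G b h :: 'p::prime_card mod_ring mat) j)"
proof -
  obtain v :: "'p mod_ring vec" where v: "v \<in> carrier_vec (length b)" "h (b ! j) = Fl_lincomb G b v"
    using Fl_basis_obtain[OF assms(1,2)] .
  have "col (rep_matrix G b h) j = v"
  proof (rule eq_vecI)
    show "dim_vec (col (rep_matrix G b h :: 'p mod_ring mat) j) = dim_vec v"
      using v by (simp add: rep_matrix_def)
    fix i assume "i < dim_vec v"
    then have i: "i < length b" using v by simp
    then show "col (rep_matrix G b h) j $ i = v $ i"
      using rep_matrix_entry[where h = h and j = j, OF assms(1) v i assms(3)] assms(3) by (simp add: rep_matrix_def)
  qed
  with v show ?thesis by simp
qed

text \<open>What remains of the geometry for the linear algebra. The rule \<open>commutation\<close>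
  is asked only of elements killed by the next power of \<Delta>, where the error terms of higher
  order vanish; \<open>k \<sigma> d\<close> is then the scalar attached to the d-th graded
  piece.\<close>

locale unipotent_endomorphism = comm_group G for G (structure) +
  fixes \<Delta> :: "'a \<Rightarrow> 'a" and \<phi> :: nat and W :: "'a set" and bW :: "'a list" and m :: nat
    and \<Gamma> :: "'s set" and act :: "'s \<Rightarrow> 'a \<Rightarrow> 'a" and k :: "'s \<Rightarrow> nat \<Rightarrow> int" and pt :: "'p::prime_card itself"
  assumes \<Delta>: "\<Delta> \<in> hom G G"
    and surjective: "\<And>a. a \<in> carrier G \<Longrightarrow> \<exists>b\<in>carrier G. \<Delta> b = a"
    and W: "W = {a \<in> carrier G. \<Delta> a = \<one>}"
    and torsion: "\<And>a. a \<in> carrier G \<Longrightarrow> a \<in> torsion G CARD('p) \<longleftrightarrow> (\<Delta> ^^ \<phi>) a = \<one>"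
    and basis: "Fl_basis TYPE('p) G W bW" and m: "m = length bW"
    and act_hom: "\<And>\<sigma>. \<sigma> \<in> \<Gamma> \<Longrightarrow> act \<sigma> \<in> hom G G"
    and commutation: "\<And>\<sigma> d a. \<sigma> \<in> \<Gamma> \<Longrightarrow> a \<in> carrier G \<Longrightarrow> (\<Delta> ^^ Suc d) a = \<one> \<Longrightarrow>
      (\<Delta> ^^ d) (act \<sigma> a) = act \<sigma> ((\<Delta> ^^ d) a) [^] k \<sigma> d"
begin

lemma power_hom: "\<Delta> ^^ d \<in> hom G G"
proof (induction d)
  case 0
  show ?case by (simp add: hom_def id_def)
next
  case (Suc d)
  then show ?case using \<Delta> by (simp add: hom_def Pi_iff)
qed

definition ker :: "nat \<Rightarrow> 'a set" where "ker d = {a \<in> carrier G. (\<Delta> ^^ d) a = \<one>}"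

lemma power_closed: "a \<in> carrier G \<Longrightarrow> (\<Delta> ^^ d) a \<in> carrier G"
  using power_hom by (auto simp: hom_def)

lemma power_one: "(\<Delta> ^^ d) \<one> = \<one>"
  using hom_one[OF power_hom is_group is_group] .

lemma ker_mono: "d \<le> d' \<Longrightarrow> ker d \<subseteq> ker d'"
proof
  fix a assume d: "d \<le> d'" and a: "a \<in> ker d"
  have "(\<Delta> ^^ d') a = (\<Delta> ^^ (d' - d)) ((\<Delta> ^^ d) a)" using d by (simp flip: comp_apply[of "\<Delta> ^^ (d' - d)"] funpow_add)
  then show "a \<in> ker d'" using a power_one by (simp add: ker_def)
qed

lemma power_surjective: "a \<in> carrier G \<Longrightarrow> \<exists>b\<in>carrier G. (\<Delta> ^^ d) b = a"
proof (induction d arbitrary: a)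
  case 0
  then show ?case by auto
next
  case (Suc d)
  obtain c where c: "c \<in> carrier G" "\<Delta> c = a" using surjective Suc.prems by blast
  then obtain b where "b \<in> carrier G" "(\<Delta> ^^ d) b = c" using Suc.IH by blast
  then show ?case using c by auto
qed

lemma act_ker:
  assumes s: "\<sigma> \<in> \<Gamma>" and a: "a \<in> ker d"
  shows "act \<sigma> a \<in> ker d"
proof -
  have aG: "a \<in> carrier G" "(\<Delta> ^^ d) a = \<one>" using a by (auto simp: ker_def)
  have "(\<Delta> ^^ Suc d) a = \<one>" using aG hom_one[OF \<Delta> is_group is_group] by simp
  then have "(\<Delta> ^^ d) (act \<sigma> a) = act \<sigma> \<one> [^] k \<sigma> d" using commutation[OF s aG(1)] aG by simp
  also have "\<dots> = \<one>" using hom_one[OF act_hom[OF s] is_group is_group] by simp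
  finally show ?thesis using act_hom[OF s] aG by (auto simp: ker_def hom_def)
qed

text \<open>
  Preimages of the basis of the kernel under the powers of \<open>\<Delta>\<close> form a basis; \<open>\<Delta>\<^sup>d\<close> identifies the
  last graded piece with the kernel, up to the scalar \<open>k \<sigma> d\<close>.
\<close>

lemma filtration_basis:
  assumes "d \<le> \<phi>"
  shows "\<exists>B. length B = d * m \<and> Fl_basis TYPE('p) G (ker d) B \<and>
    (\<forall>\<sigma>\<in>\<Gamma>. block_upper_triangular m d (\<lambda>i. (of_int (k \<sigma> i) :: 'p mod_ring) \<cdot>\<^sub>m rep_matrix G bW (act \<sigma>)) (rep_matrix G B (act \<sigma>)))"
  using assms
proof (induction d)
  case 0
  have "Fl_basis TYPE('p) G (ker 0) []"
  proof -
    have "carrier_vec 0 = {0\<^sub>v 0 :: 'p mod_ring vec}" by auto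
    then show ?thesis by (auto simp: Fl_basis_def Fl_lincomb_def ker_def bij_betw_def)
  qed
  then show ?case by (intro exI[of _ "[]"]) (simp add: block_upper_triangular_def rep_matrix_def)
next
  case (Suc d)
  then obtain B where B: "length B = d * m" "Fl_basis TYPE('p) G (ker d) B"
    "\<And>\<sigma>. \<sigma> \<in> \<Gamma> \<Longrightarrow> block_upper_triangular m d (\<lambda>i. (of_int (k \<sigma> i) :: 'p mod_ring) \<cdot>\<^sub>m rep_matrix G bW (act \<sigma>)) (rep_matrix G B (act \<sigma>))"
    by auto
  have WG: "W \<subseteq> carrier G" using W by auto
  have bW: "bW ! j \<in> W" if "j < m" for j using basis that m by (auto simp: Fl_basis_def)
  have "\<forall>j. \<exists>b. j < m \<longrightarrow> b \<in> carrier G \<and> (\<Delta> ^^ d) b = bW ! j" using power_surjective bW WG by blast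
  then obtain g where g: "\<And>j. j < m \<Longrightarrow> g j \<in> carrier G \<and> (\<Delta> ^^ d) (g j) = bW ! j" by metis
  define b where "b = map g [0..<m]"
  have b: "length b = m" "set b \<subseteq> carrier G" "map (\<Delta> ^^ d) b = bW" "\<And>j. j < m \<Longrightarrow> (\<Delta> ^^ d) (b ! j) = bW ! j"
    using g m by (auto simp: b_def intro!: nth_equalityI)
  have kerG: "ker d \<subseteq> carrier G" for d by (auto simp: ker_def)
  have BG: "set B \<subseteq> carrier G" using B(2) kerG by (auto simp: Fl_basis_def)
  have bk: "b ! j \<in> ker (Suc d)" if "j < m" for j
    using that b bW[OF that] W nth_mem[of j b] by (auto simp: ker_def)
  define B' where "B' = B @ b"
  have lB': "length B' = Suc d * m" using B b by (simp add: B'_def)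
  \<comment> \<open>Applying \<open>\<Delta> ^^ d\<close> forgets the old basis vectors and reads
    off the coordinates along the new ones; independence and the last diagonal block both rest on
    it.\<close>
  have top: "(\<Delta> ^^ d) (Fl_lincomb G B' (c @\<^sub>v c')) = Fl_lincomb G bW c'"
    if "c \<in> carrier_vec (d * m)" "c' \<in> carrier_vec m" for c c' :: "'p mod_ring vec"
  proof -
    have lin: "Fl_lincomb G B c \<in> ker d" using B that by (auto simp: Fl_basis_def bij_betw_def)
    have "Fl_lincomb G B' (c @\<^sub>v c') = Fl_lincomb G B c \<otimes> Fl_lincomb G b c'"
      unfolding B'_def using BG b that B(1) by (intro Fl_lincomb_append) auto
    then have "(\<Delta> ^^ d) (Fl_lincomb G B' (c @\<^sub>v c')) = (\<Delta> ^^ d) (Fl_lincomb G B c) \<otimes> (\<Delta> ^^ d) (Fl_lincomb G b c')"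
      using hom_mult[OF power_hom] BG b(2) by (simp add: Fl_lincomb_closed)
    also have "\<dots> = Fl_lincomb G bW c'"
      using lin b(3) subset_trans[OF _ WG, of "set bW"] basis
      by (simp add: ker_def Fl_lincomb_hom[OF power_hom b(2)] Fl_lincomb_closed Fl_basis_def)
    finally show ?thesis .
  qed
  have split: "\<exists>c c'. c \<in> carrier_vec (d * m) \<and> c' \<in> carrier_vec m \<and> v = c @\<^sub>v c'"
    if "v \<in> carrier_vec (Suc d * m)" for v :: "'p mod_ring vec"
    using that by (intro exI[of _ "vec_first v (d * m)"] exI[of _ "vec_last v m"])
      (auto simp: vec_first_last_append add.commute)
  have spanned: "\<exists>v. v \<in> carrier_vec (d * m) \<and> a = Fl_lincomb G B' (v @\<^sub>v c')"
    if a: "a \<in> ker (Suc d)" "(\<Delta> ^^ d) a = Fl_lincomb G bW c'" "c' \<in> carrier_vec m" for a and c' :: "'p mod_ring vec"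
  proof -
    have aG: "a \<in> carrier G" using a by (simp add: ker_def)
    define e where "e = Fl_lincomb G b c'"
    have e: "e \<in> carrier G" "(\<Delta> ^^ d) e = (\<Delta> ^^ d) a"
      using a(2) b(2,3) by (auto simp: e_def Fl_lincomb_hom[OF power_hom b(2)] Fl_lincomb_closed)
    have "(\<Delta> ^^ d) (a \<otimes> inv e) = (\<Delta> ^^ d) a \<otimes> inv ((\<Delta> ^^ d) e)"
      using power_hom aG e(1) hom_mult[OF power_hom aG, of "inv e" d]
        group_hom.hom_inv[OF group_hom.intro[OF is_group is_group group_hom_axioms.intro[OF power_hom]] e(1)] by simp
    also have "\<dots> = \<one>" using e aG power_closed by simp
    finally have "a \<otimes> inv e \<in> ker d" using aG e by (simp add: ker_def)
    then obtain v :: "'p mod_ring vec" where v: "v \<in> carrier_vec (length B)" "a \<otimes> inv e = Fl_lincomb G B v"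
      using Fl_basis_obtain[OF B(2)] by blast
    have "a = a \<otimes> inv e \<otimes> e" using aG e by (simp add: m_assoc)
    also have "\<dots> = Fl_lincomb G B' (v @\<^sub>v c')"
      unfolding v(2) unfolding e_def B'_def using BG b v a(3) by (intro Fl_lincomb_append[symmetric]) auto
    finally show ?thesis using v B(1) by auto
  qed
  have basis': "Fl_basis TYPE('p) G (ker (Suc d)) B'"
    unfolding Fl_basis_def
  proof
    show "set B' \<subseteq> ker (Suc d)"
      using B(2) ker_mono[of d "Suc d"] bk b(1) by (auto simp: B'_def Fl_basis_def in_set_conv_nth)
    show "bij_betw (Fl_lincomb G B') (carrier_vec (length B') :: 'p mod_ring vec set) (ker (Suc d))"
      unfolding bij_betw_def
    proof
      show "inj_on (Fl_lincomb G B') (carrier_vec (length B') :: 'p mod_ring vec set)"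
      proof (rule inj_onI)
        fix v w :: "'p mod_ring vec"
        assume vw: "v \<in> carrier_vec (length B')" "w \<in> carrier_vec (length B')" "Fl_lincomb G B' v = Fl_lincomb G B' w"
        obtain c c' where c: "c \<in> carrier_vec (d * m)" "c' \<in> carrier_vec m" "v = c @\<^sub>v c'"
          using split vw(1) lB' by metis
        obtain e e' where e: "e \<in> carrier_vec (d * m)" "e' \<in> carrier_vec m" "w = e @\<^sub>v e'"
          using split vw(2) lB' by metis
        have "Fl_lincomb G bW c' = Fl_lincomb G bW e'"
          using vw(3) top[OF c(1,2)] top[OF e(1,2)] c(3) e(3) by simp
        then have ce: "c' = e'" using basis c(2) e(2) m by (auto simp: Fl_basis_def bij_betw_def inj_on_def)
        have "Fl_lincomb G B c \<otimes> Fl_lincomb G b c' = Fl_lincomb G B e \<otimes> Fl_lincomb G b c'"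
          using vw(3) c e ce BG b B(1) unfolding B'_def
          by (simp add: Fl_lincomb_append[symmetric])
        then have "Fl_lincomb G B c = Fl_lincomb G B e"
          using BG b(2) by (simp add: r_cancel Fl_lincomb_closed)
        then have "c = e" using B(1,2) c(1) e(1) by (auto simp: Fl_basis_def bij_betw_def inj_on_def)
        with ce c e show "v = w" by simp
      qed
      show "Fl_lincomb G B' ` (carrier_vec (length B') :: 'p mod_ring vec set) = ker (Suc d)"
      proof
        show "Fl_lincomb G B' ` (carrier_vec (length B') :: 'p mod_ring vec set) \<subseteq> ker (Suc d)"
        proof
          fix a assume "a \<in> Fl_lincomb G B' ` (carrier_vec (length B') :: 'p mod_ring vec set)"
          then obtain v :: "'p mod_ring vec" where v: "v \<in> carrier_vec (length B')" "a = Fl_lincomb G B' v" by blast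
          obtain c c' where c: "c \<in> carrier_vec (d * m)" "c' \<in> carrier_vec m" "v = c @\<^sub>v c'"
            using split v(1) lB' by metis
          have "Fl_lincomb G bW c' \<in> W" using basis c(2) m by (auto simp: Fl_basis_def bij_betw_def)
          then have "\<Delta> ((\<Delta> ^^ d) a) = \<one>" using top[OF c(1,2)] v(2) c(3) W by simp
          then show "a \<in> ker (Suc d)" using v(2) BG b(2) by (simp add: ker_def B'_def Fl_lincomb_closed)
        qed
        show "ker (Suc d) \<subseteq> Fl_lincomb G B' ` (carrier_vec (length B') :: 'p mod_ring vec set)"
        proof
          fix a assume a: "a \<in> ker (Suc d)"
          then have "(\<Delta> ^^ d) a \<in> W" using W power_closed by (auto simp: ker_def)
          then obtain c' :: "'p mod_ring vec" where c': "c' \<in> carrier_vec m" "(\<Delta> ^^ d) a = Fl_lincomb G bW c'"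
            using Fl_basis_obtain[OF basis] m by metis
          then obtain v where "v \<in> carrier_vec (d * m)" "a = Fl_lincomb G B' (v @\<^sub>v c')" using spanned[OF a] by blast
          moreover have "v @\<^sub>v c' \<in> carrier_vec (length B')" if "v \<in> carrier_vec (d * m)" for v
            using that c'(1) lB' append_carrier_vec[of v "d * m" c' m] by (simp add: add.commute)
          ultimately show "a \<in> Fl_lincomb G B' ` (carrier_vec (length B') :: 'p mod_ring vec set)" by blast
        qed
      qed
    qed
  qed
  have "block_upper_triangular m (Suc d) (\<lambda>i. (of_int (k \<sigma> i) :: 'p mod_ring) \<cdot>\<^sub>m rep_matrix G bW (act \<sigma>)) (rep_matrix G B' (act \<sigma>))"
    if s: "\<sigma> \<in> \<Gamma>" for \<sigma>
  proof -
    define M where "M = (rep_matrix G B' (act \<sigma>) :: 'p mod_ring mat)"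
    define M0 where "M0 = (rep_matrix G B (act \<sigma>) :: 'p mod_ring mat)"
    define MW where "MW = (rep_matrix G bW (act \<sigma>) :: 'p mod_ring mat)"
    \<comment> \<open>The action preserves \<open>ker d\<close>, so the old columns are unchanged
      and are filled up with zeros.\<close>
    have old: "M $$ (p, q) = (if p < d * m then M0 $$ (p, q) else 0)" if pq: "p < Suc d * m" "q < d * m" for p q
    proof -
      have q: "q < length B" "q < length B'" using pq B(1) lB' by auto
      have "B ! q \<in> ker d" using B(2) q by (auto simp: Fl_basis_def)
      then have "act \<sigma> (B ! q) \<in> ker d" by (rule act_ker[OF s])
      then obtain v :: "'p mod_ring vec" where v: "v \<in> carrier_vec (length B)" "act \<sigma> (B ! q) = Fl_lincomb G B v"
        using Fl_basis_obtain[OF B(2)] by blast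
      have "Fl_lincomb G B' (v @\<^sub>v 0\<^sub>v m) = Fl_lincomb G B v \<otimes> Fl_lincomb G b (0\<^sub>v m :: 'p mod_ring vec)"
        unfolding B'_def using BG b v by (intro Fl_lincomb_append) auto
      also have "\<dots> = Fl_lincomb G B v" using b(1) BG by (simp add: Fl_lincomb_0[OF b(2), unfolded b(1)] Fl_lincomb_closed)
      finally have "act \<sigma> (B' ! q) = Fl_lincomb G B' (v @\<^sub>v 0\<^sub>v m)" using v(2) q by (simp add: B'_def nth_append)
      moreover have "v @\<^sub>v 0\<^sub>v m \<in> carrier_vec (length B')" using v(1) B(1) lB' append_carrier_vec[of v "d * m" "0\<^sub>v m" m] by (simp add: add.commute)
      ultimately have "M $$ (p, q) = (v @\<^sub>v 0\<^sub>v m) $ p"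
        unfolding M_def using pq(1) q(2) lB' by (intro rep_matrix_entry[OF basis']) auto
      moreover have "M0 $$ (p, q) = v $ p" if "p < d * m"
        unfolding M0_def using that q(1) B(1) by (intro rep_matrix_entry[OF B(2) v(1)]) (auto simp: v(2))
      ultimately show ?thesis using pq v(1) B(1) by auto
    qed
    \<comment> \<open>The last \<open>m\<close> coordinates of a new column are found after applying
      \<open>\<Delta> ^^ d\<close>, which carries the column into \<open>W\<close>, where the action
      is known up to the scalar.\<close>
    have new: "M $$ (d * m + r, d * m + t) = of_int (k \<sigma> d) * MW $$ (r, t)" if rt: "r < m" "t < m" for r t
    proof -
      define c' where "c' = of_int (k \<sigma> d) \<cdot>\<^sub>v col MW t"
      have MW: "MW \<in> carrier_mat m m" using m by (simp add: MW_def rep_matrix_def)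
      have c': "c' \<in> carrier_vec m" using MW by (auto simp: c'_def)
      have bt: "b ! t \<in> ker (Suc d)" by (rule bk[OF rt(2)])
      have btG: "b ! t \<in> carrier G" "(\<Delta> ^^ Suc d) (b ! t) = \<one>" using bt by (auto simp: ker_def)
      have ab: "act \<sigma> (b ! t) \<in> ker (Suc d)" by (rule act_ker[OF s bt])
      have W1: "W = ker 1" by (simp add: W ker_def)
      have "(\<Delta> ^^ d) (act \<sigma> (b ! t)) = act \<sigma> (bW ! t) [^] k \<sigma> d"
        using commutation[OF s btG] b(4)[OF rt(2)] by simp
      also have "act \<sigma> (bW ! t) = Fl_lincomb G bW (col MW t)"
        unfolding MW_def using act_ker[OF s, of _ 1] bW[OF rt(2)] W1 m rt by (intro rep_matrix_column[OF basis]) auto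
      also have "\<dots> [^] k \<sigma> d = Fl_lincomb G bW c'"
        unfolding c'_def
      proof (rule Fl_lincomb_int_pow)
        \<comment> \<open>The integer scalar may be read modulo \<open>l\<close> because
          \<open>W\<close> lies in the torsion; this uses that \<phi> is positive, which holds as
          \<phi> is at least \<open>Suc d\<close>.\<close>
        have "1 \<le> \<phi>" using Suc.prems by simp
        then have "W \<subseteq> ker \<phi>" unfolding W1 by (rule ker_mono)
        then show "set bW \<subseteq> torsion G CARD('p)" using basis torsion by (auto simp: Fl_basis_def ker_def)
        show "dim_vec (col MW t) = length bW" using MW m by simp
      qed
      finally obtain v where v: "v \<in> carrier_vec (d * m)" "act \<sigma> (b ! t) = Fl_lincomb G B' (v @\<^sub>v c')"
        using spanned[OF ab _ c'] by blast
      have "v @\<^sub>v c' \<in> carrier_vec (length B')" using v c' lB' append_carrier_vec[of v "d * m" c' m] by (simp add: add.commute)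
      moreover have "act \<sigma> (B' ! (d * m + t)) = Fl_lincomb G B' (v @\<^sub>v c')" using v(2) B(1) by (simp add: B'_def nth_append)
      ultimately have "M $$ (d * m + r, d * m + t) = (v @\<^sub>v c') $ (d * m + r)"
        unfolding M_def using rt lB' by (intro rep_matrix_entry[OF basis']) auto
      also have "\<dots> = c' $ r" using v c' rt by simp
      finally show ?thesis using rt MW by (simp add: c'_def)
    qed
    have idx: "i * m + a < d * m" if "i < d" "a < m" for i a
    proof -
      have "i * m + a < Suc i * m" using that by simp
      also have "\<dots> \<le> d * m" using that by (intro mult_le_mono1) auto
      finally show ?thesis .
    qed
    note B3 = B(3)[OF s, unfolded block_upper_triangular_def, folded M0_def MW_def]
    have same: "mat_block M m i j = mat_block M0 m i j" if "i < d" "j < d" for i j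
      unfolding mat_block_def by (intro eq_matI) (use that idx old in \<open>auto simp: trans_less_add2\<close>)
    show ?thesis
      unfolding block_upper_triangular_def M_def[symmetric] MW_def[symmetric]
    proof (intro conjI allI impI)
      show "M \<in> carrier_mat (Suc d * m) (Suc d * m)" using lB' by (simp add: M_def rep_matrix_def)
      fix i j assume ij: "i < Suc d" "j < i"
      show "mat_block M m i j = 0\<^sub>m m m"
      proof (cases "i = d")
        case True
        then show ?thesis unfolding mat_block_def
          by (intro eq_matI) (use ij idx[of j] old in auto)
      next
        case False
        then show ?thesis using same[of i j] B3 ij by auto
      qed
    next
      fix i assume i: "i < Suc d"
      show "mat_block M m i i = of_int (k \<sigma> i) \<cdot>\<^sub>m MW"
      proof (cases "i = d")
        case True
        have "MW \<in> carrier_mat m m" using m by (simp add: MW_def rep_matrix_def)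
        then show ?thesis unfolding mat_block_def True by (intro eq_matI) (use new in auto)
      next
        case False
        then show ?thesis using same[of i i] B3 i by auto
      qed
    qed
  qed
  then show ?case using basis' lB' by blast
qed

lemma block_triangular_basis:
  "\<exists>B. Fl_basis TYPE('p) G (torsion G CARD('p)) B \<and>
    (\<forall>\<sigma>\<in>\<Gamma>. block_upper_triangular m \<phi> (\<lambda>i. (of_int (k \<sigma> i) :: 'p mod_ring) \<cdot>\<^sub>m rep_matrix G bW (act \<sigma>)) (rep_matrix G B (act \<sigma>)))"
proof -
  have "ker \<phi> = torsion G CARD('p)" using torsion by (auto simp: ker_def torsion_def)
  then show ?thesis using filtration_basis[of \<phi>] by auto
qed

end

section \<open>Divisor class groups of the tower\<close>

text \<open>A quotient of a quotient, as in the group of points of A_s. Afterwards it is accessed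
  only through \<open>cls\<close>, which is a surjective homomorphism, and the criterion for a class
  to be trivial.\<close>

locale iterated_quotient = comm_group G for G (structure) +
  fixes H M :: "'a set"
  assumes H: "subgroup H G" and M: "subgroup M G"
begin

definition quot :: "'a set set monoid" where "quot = (G Mod H) Mod ((\<lambda>a. H #> a) ` M)"

definition cls :: "'a \<Rightarrow> 'a set set" where "cls a = ((\<lambda>a. H #> a) ` M) #>\<^bsub>G Mod H\<^esub> (H #> a)"

lemma normal_H: "normal H G"
  using H by (rule subgroup_imp_normal)

lemma coset_hom: "(\<lambda>a. H #> a) \<in> hom G (G Mod H)"
  using normal.r_coset_hom_Mod[OF normal_H] .

lemma image_subgroup: "subgroup ((\<lambda>a. H #> a) ` M) (G Mod H)"
proof -
  interpret group_hom G "G Mod H" "\<lambda>a. H #> a"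
    using coset_hom normal.factorgroup_is_group[OF normal_H] by (simp add: group_hom_def group_hom_axioms_def)
  show ?thesis by (rule subgroup_img_is_subgroup[OF M])
qed

lemma comm_group_quot: "comm_group quot"
  unfolding quot_def by (rule comm_group.abelian_FactGroup[OF abelian_FactGroup[OF H] image_subgroup])

lemma carrier_quot: "carrier quot = cls ` carrier G"
  by (simp add: quot_def cls_def carrier_FactGroup image_image)

lemma cls_hom: "cls \<in> hom G quot"
proof -
  interpret Q: comm_group "G Mod H" by (rule abelian_FactGroup[OF H])
  have "(\<lambda>b. ((\<lambda>a. H #> a) ` M) #>\<^bsub>G Mod H\<^esub> b) \<in> hom (G Mod H) quot"
    unfolding quot_def by (rule normal.r_coset_hom_Mod[OF Q.subgroup_imp_normal[OF image_subgroup]])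
  with coset_hom show ?thesis by (simp add: hom_def cls_def Pi_iff)
qed

lemma coset_eq_iff: "a \<in> carrier G \<Longrightarrow> b \<in> carrier G \<Longrightarrow> H #> a = H #> b \<longleftrightarrow> (\<exists>h\<in>H. a = h \<otimes> b)"
  using repr_independence[OF _ _ H, of a b] rcos_self[OF _ H, of a] by (auto simp: r_coset_def)

lemma cls_eq_one:
  assumes a: "a \<in> carrier G"
  shows "cls a = \<one>\<^bsub>quot\<^esub> \<longleftrightarrow> (\<exists>h\<in>H. \<exists>b\<in>M. a = h \<otimes> b)"
proof -
  interpret Q: comm_group "G Mod H" by (rule abelian_FactGroup[OF H])
  have c: "H #> a \<in> carrier (G Mod H)" using a by (auto simp: carrier_FactGroup)
  have "cls a = \<one>\<^bsub>quot\<^esub> \<longleftrightarrow> H #> a \<in> (\<lambda>a. H #> a) ` M"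
    using Q.coset_join1[OF _ c image_subgroup] Q.coset_join2[OF c image_subgroup] by (auto simp: cls_def quot_def)
  also have "\<dots> \<longleftrightarrow> (\<exists>h\<in>H. \<exists>b\<in>M. a = h \<otimes> b)"
    using coset_eq_iff[OF a] subgroup.mem_carrier[OF M] by (auto simp: image_iff)
  finally show ?thesis .
qed

text \<open>The action on a set of cosets is by taking images twice, so cosets go to whole cosets
  only if \<open>g\<close> maps \<open>H\<close> and \<open>M\<close> onto themselves; inclusions
  would not suffice.\<close>

lemma cls_image:
  assumes g: "g \<in> hom G G" "g ` H = H" "g ` M = M" and a: "a \<in> carrier G"
  shows "((`) g) ` cls a = cls (g a)"
proof -
  have HG: "h \<in> carrier G" if "h \<in> H" for h using that subgroup.mem_carrier[OF H] by blast
  have MG: "b \<in> carrier G" if "b \<in> M" for b using that subgroup.mem_carrier[OF M] by blast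
  have ga: "g a \<in> carrier G" if "a \<in> carrier G" for a using g(1) that by (auto simp: hom_def)
  have coset: "g ` (H #> b) = H #> g b" if b: "b \<in> carrier G" for b
  proof -
    have "g ` (H #> b) = (\<lambda>h. g h \<otimes> g b) ` H"
      using hom_mult[OF g(1) HG b] by (auto simp: r_coset_def image_iff)
    also have "\<dots> = (\<lambda>h. h \<otimes> g b) ` g ` H" by (simp only: image_image)
    also have "\<dots> = H #> g b" by (auto simp: g(2) r_coset_def)
    finally show ?thesis .
  qed
  have expand: "cls b = (\<lambda>c. H #> (c \<otimes> b)) ` M" if b: "b \<in> carrier G" for b
    using normal.rcos_sum[OF normal_H MG b] by (auto simp: cls_def r_coset_def[of "G Mod H"] image_iff)
  have "((`) g) ` cls a = (\<lambda>c. H #> (g c \<otimes> g a)) ` M"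
    unfolding expand[OF a] image_image
    using coset a MG hom_mult[OF g(1) MG a] by (intro image_cong) auto
  also have "\<dots> = (\<lambda>c. H #> (c \<otimes> g a)) ` g ` M" by (simp only: image_image)
  also have "\<dots> = cls (g a)" by (simp add: g(3) expand ga a)
  finally show ?thesis .
qed

end

locale kummer_quotient = kummer_tower emb x y f N \<zeta> \<delta>
  for emb :: "'a::{alg_closed_field,field_char_0} \<Rightarrow> 'f::field" and x y f N \<zeta> \<delta> +
  fixes J K :: nat
  assumes KN: "K dvd N" and JK: "J dvd K"
begin

abbreviation "G \<equiv> Div0 emb (fixed K)"

lemma K_pos: "K > 0" and J_pos: "J > 0"
  using dvd_pos KN JK dvd_trans by blast+

lemma G_simps: "carrier G = dv0 K" "\<one>\<^bsub>G\<^esub> = 0" "D \<otimes>\<^bsub>G\<^esub> E = D + E"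
  by (auto simp: Div0_def Div_def dv0_def dv_def pts_def free_Abelian_group_def)

lemma G_subgroup: "subgroup (dv0 K) (Div emb (fixed K))"
  unfolding Div_def using dv0_0 dv0_add dv0_uminus
  by (intro group.subgroupI) (auto simp: dv0_def dv_def pts_def)

lemma comm_group_G: "comm_group G"
proof -
  interpret D: comm_group "Div emb (fixed K)" unfolding Div_def by (rule abelian_free_Abelian_group)
  have "group (Div emb (fixed K)\<lparr>carrier := dv0 K\<rparr>)"
    by (rule subgroup.subgroup_is_group[OF G_subgroup D.is_group])
  then have "group G" by (simp add: Div0_def G_simps(1)[unfolded Div0_def, simplified])
  then show ?thesis by (rule group.group_comm_groupI) (simp add: G_simps add.commute)
qed

sublocale G: comm_group G by (rule comm_group_G)

lemma G_inv: "D \<in> dv0 K \<Longrightarrow> inv\<^bsub>G\<^esub> D = - D"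
  by (rule G.inv_equality) (auto simp: G_simps dv0_uminus)

lemma G_subgroupI:
  assumes "A \<subseteq> dv0 K" "0 \<in> A" "\<And>D. D \<in> A \<Longrightarrow> - D \<in> A" "\<And>D E. D \<in> A \<Longrightarrow> E \<in> A \<Longrightarrow> D + E \<in> A"
  shows "subgroup A G"
  using assms by (intro G.subgroupI) (auto simp: G_simps G_inv)

sublocale iterated_quotient G "prin K" "pull J K ` dv0 J"
proof (intro iterated_quotient.intro iterated_quotient_axioms.intro comm_group_G)
  show "subgroup (prin K) G"
    using prin_dv0[OF _ KN] prin_0 prin_uminus prin_add K_pos by (intro G_subgroupI) auto
  show "subgroup (pull J K ` dv0 J) G"
  proof (rule G_subgroupI)
    show "pull J K ` dv0 J \<subseteq> dv0 K" using pull_dv0[OF _ KN JK] by blast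
    show "0 \<in> pull J K ` dv0 J" using dv0_0[of J] pull_simps(1)[of J K] by (metis image_eqI)
    show "- D \<in> pull J K ` dv0 J" if "D \<in> pull J K ` dv0 J" for D
      using that dv0_uminus[of _ J] by (force simp flip: pull_simps(4))
    show "D + E \<in> pull J K ` dv0 J" if "D \<in> pull J K ` dv0 J" "E \<in> pull J K ` dv0 J" for D E
      using that dv0_add[of _ J] by (force simp flip: pull_simps(2))
  qed
qed

lemma quot_eq: "quot = Jac emb (fixed K) Mod Jac_pullback_image emb (fixed J) (fixed K)"
  by (simp only: quot_def) (simp add: Jac_def Jac_pullback_image_def div_class_def prin_def pdiv_def principal_divs_def
      pull_def Div0_def[of emb "fixed J"] Div_def dv0_def dv_def pts_def image_image free_Abelian_group_def)

lemma cls_eq: "cls D = Jac_pullback_image emb (fixed J) (fixed K) #>\<^bsub>Jac emb (fixed K)\<^esub> div_class emb (fixed K) D"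
  by (simp only: cls_def) (simp add: Jac_def Jac_pullback_image_def div_class_def prin_def pdiv_def principal_divs_def
      pull_def Div0_def[of emb "fixed J"] Div_def dv0_def dv_def pts_def image_image free_Abelian_group_def)

sublocale A: comm_group quot by (rule comm_group_quot)

sublocale cls: group_hom G quot cls
  using cls_hom by unfold_locales

lemma carrier_A: "carrier quot = cls ` dv0 K"
  by (simp add: carrier_quot G_simps)

lemma cls_closed: "D \<in> dv0 K \<Longrightarrow> cls D \<in> carrier quot"
  by (simp add: carrier_A)

lemma cls_eq_one_iff: "D \<in> dv0 K \<Longrightarrow> cls D = \<one>\<^bsub>quot\<^esub> \<longleftrightarrow> D \<in> trivial_divs J K"
  using cls_eq_one[of D] by (auto simp: G_simps trivial_divs_def)

lemma cls_add: "D \<in> dv0 K \<Longrightarrow> E \<in> dv0 K \<Longrightarrow> cls (D + E) = cls D \<otimes>\<^bsub>quot\<^esub> cls E"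
  using cls.hom_mult[of D E] by (simp add: G_simps)

lemma cls_eq_iff:
  assumes "D \<in> dv0 K" "E \<in> dv0 K"
  shows "cls D = cls E \<longleftrightarrow> D - E \<in> trivial_divs J K"
proof -
  have "cls D = cls (D - E) \<otimes>\<^bsub>quot\<^esub> cls E" using assms cls_add[of "D - E" E] by (simp add: dv0_diff)
  moreover have "cls D = cls E \<longleftrightarrow> cls (D - E) = \<one>\<^bsub>quot\<^esub>"
    using calculation assms by (simp add: cls_closed dv0_diff)
  ultimately show ?thesis using assms cls_eq_one_iff by (simp add: dv0_diff)
qed

lemma cls_int_pow: "D \<in> dv0 K \<Longrightarrow> cls D [^]\<^bsub>quot\<^esub> (a::int) = cls (frag_cmul a D)"
proof -
  assume D: "D \<in> dv0 K"
  have nat: "D [^]\<^bsub>G\<^esub> n = frag_cmul (int n) D" for n :: nat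
    by (induction n) (auto simp: G_simps frag_cmul_distrib algebra_simps)
  have "D [^]\<^bsub>G\<^esub> a = frag_cmul a D"
  proof (cases a rule: int_cases2)
    case (nonneg n)
    show ?thesis unfolding nonneg int_pow_int by (rule nat)
  next
    case (nonpos n)
    show ?thesis
      unfolding nonpos G.int_pow_neg_int[OF D[folded G_simps(1)]] nat G_inv[OF dv0_cmul[OF D]] by simp
  qed
  with cls.hom_int_pow[of D a] D show ?thesis by (simp only: G_simps)
qed

end

section \<open>Galois automorphisms of the tower\<close>

text \<open>Carrying both exponents makes the hypotheses symmetric: the inverse of \<open>h\<close>
  satisfies them with \<open>b\<close> and \<open>c\<close> exchanged. Each inclusion between a set
  and its image under \<open>h\<close> therefore improves to an equality.\<close>

locale tower_automorphism = kummer_tower emb x y f N \<zeta> \<delta>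
  for emb :: "'a::{alg_closed_field,field_char_0} \<Rightarrow> 'f::field" and x y f N \<zeta> \<delta> +
  fixes h :: "'f \<Rightarrow> 'f" and b c :: nat
  assumes h: "field_hom h" and surj: "surj h" and range_emb: "h ` range emb = range emb"
    and \<delta>_h: "\<And>w. \<delta> (h w) = h ((\<delta> ^^ c) w)" and h_\<delta>: "\<And>w. h (\<delta> w) = (\<delta> ^^ b) (h w)"
begin

sublocale h: field_hom h by (rule h)

abbreviation "g \<equiv> inv_into UNIV h"

lemma bij: "bij h"
  using surj by (simp add: bij_def inj_def)

lemma inv_h [simp]: "g (h w) = w" "h (g w) = w"
  using bij by (simp_all add: bij_is_inj bij_is_surj surj_f_inv_f)

lemma inverse: "tower_automorphism emb x y f N \<zeta> \<delta> g c b"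
proof unfold_locales
  have hI: "g u = v \<longleftrightarrow> u = h v" for u v by (metis inv_h)
  show "g 0 = 0" "g 1 = 1" by (simp_all add: hI)
  show "g (u + v) = g u + g v" "g (u * v) = g u * g v" for u v
    by (simp_all add: hI hom_distribs)
  show "surj g" by (rule surjI[of _ h]) simp
  show "g ` range emb = range emb"
  proof -
    have "g ` h ` X = X" for X by (force simp: image_iff)
    then show ?thesis using range_emb by metis
  qed
  show "\<delta> (g w) = g ((\<delta> ^^ b) w)" for w using h_\<delta>[of "g w"] by (metis inv_h)
  show "g (\<delta> w) = (\<delta> ^^ c) (g w)" for w using \<delta>_h[of "g w"] by (metis inv_h)
qed

lemma funpow_h: "(\<delta> ^^ i) (h w) = h ((\<delta> ^^ (c * i)) w)"
proof (induction i)
  case (Suc i)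
  then show ?case by (simp add: \<delta>_h) (simp only: funpow_add comp_def)
qed simp

lemma h_fixed_subset: "h ` fixed K \<subseteq> fixed K"
proof
  fix v assume "v \<in> h ` fixed K"
  then obtain w where w: "w \<in> fixed K" "v = h w" by blast
  have "((\<delta> ^^ K) ^^ i) w = w" for i using w(1) by (induction i) (auto simp: fixed_def)
  from this[of c] have "(\<delta> ^^ (c * K)) w = w" by (simp add: funpow_mult mult.commute)
  then show "v \<in> fixed K" using w(2) by (simp add: fixed_def funpow_h)
qed

lemma h_fixed: "h ` fixed K = fixed K"
proof
  have "h ` g ` fixed K \<subseteq> h ` fixed K"
    using tower_automorphism.h_fixed_subset[OF inverse] by (rule image_mono)
  then show "fixed K \<subseteq> h ` fixed K" by (simp add: image_image)
qed (rule h_fixed_subset)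

lemma h_pts: assumes P: "P \<in> pts K" and K: "K > 0" shows "h ` P \<in> pts K"
proof -
  interpret D: dvr "h ` fixed K" "h ` P" by (rule dvr_image(1)[OF h pts_dvr[OF P K]])
  have "range emb \<subseteq> h ` P" using P range_emb by (auto simp: pts_def points_def)
  then show ?thesis using D.valuation_ring D.proper unfolding h_fixed by (simp add: pts_def points_def)
qed

lemma h_pts_obtain:
  assumes "Q \<in> pts K" "K > 0"
  obtains P where "P \<in> pts K" "Q = h ` P"
proof
  show "g ` Q \<in> pts K" using tower_automorphism.h_pts[OF inverse assms] .
qed (simp add: image_image)

lemma h_Int_fixed: "h ` P \<inter> fixed K = h ` (P \<inter> fixed K)"
  using h_fixed[of K] image_Int[of h P "fixed K"] bij by (simp add: bij_is_inj)

lemma h_ord: "P \<in> pts K \<Longrightarrow> K > 0 \<Longrightarrow> w \<in> fixed K \<Longrightarrow> w \<noteq> 0 \<Longrightarrow> place_ord (h ` P) (h w) = place_ord P w"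
  using dvr_image(2)[OF h pts_dvr] by blast

lemma h_ramification:
  assumes P: "P \<in> pts K" and K: "K > 0" "J > 0" "J dvd K"
  shows "ramification (h ` P) (h ` P \<inter> fixed J) = ramification P (P \<inter> fixed J)"
proof -
  note Q = pts_restrict(1)[OF P K(1,3)]
  note hQ = pts_restrict(1)[OF h_pts[OF P K(1)] K(1,3)]
  interpret Q: dvr "fixed J" "P \<inter> fixed J" by (rule pts_dvr[OF Q K(2)])
  obtain t where t: "t \<in> fixed J" "t \<noteq> 0" "place_ord (P \<inter> fixed J) t = 1"
    using Q.place_ord_uniformizer Q.uniformizer(1) Q.uniformizer_mem by blast
  have tK: "t \<in> fixed K" using t fixed_mono[OF K(3)] by blast
  have ht: "h t \<in> fixed J" "h t \<noteq> 0" using t h_fixed by auto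
  have o: "place_ord (h ` P \<inter> fixed J) (h t) = 1"
    unfolding h_Int_fixed using h_ord[OF Q K(2) t(1,2)] t(3) by simp
  have "place_ord P t = ramification P (P \<inter> fixed J)"
    using dvr_restrict_ord(1)[OF pts_dvr[OF P K(1)] pts_dvr[OF Q K(2)] fixed_mono[OF K(3)] t(1,2)] t(3) by simp
  moreover have "place_ord (h ` P) (h t) = ramification (h ` P) (h ` P \<inter> fixed J)"
    using dvr_restrict_ord(1)[OF pts_dvr[OF h_pts[OF P K(1)] K(1)] pts_dvr[OF hQ K(2)] fixed_mono[OF K(3)] ht] o by simp
  ultimately show ?thesis using h_ord[OF P K(1) tK t(2)] by simp
qed

definition ad :: "('f set \<Rightarrow>\<^sub>0 int) \<Rightarrow> ('f set \<Rightarrow>\<^sub>0 int)" where "ad = frag_extend (\<lambda>P. frag_of (h ` P))"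

lemma ad_simps:
  "ad (D + E) = ad D + ad E" "ad (D - E) = ad D - ad E"
  "ad (frag_cmul a D) = frag_cmul a (ad D)"
  by (simp_all add: ad_def frag_extend_add frag_extend_diff frag_extend_cmul)

lemma ad_dv: "D \<in> dv K \<Longrightarrow> K > 0 \<Longrightarrow> ad D \<in> dv K"
  unfolding ad_def by (intro dv_frag_extend dv_frag_of h_pts) (auto simp: dv_def)

lemma ad_dv0: "D \<in> dv0 K \<Longrightarrow> K > 0 \<Longrightarrow> ad D \<in> dv0 K"
  by (simp add: dv0_def ad_dv) (simp add: ad_def div_degree_frag_extend div_degree_frag_of, simp add: div_degree_def)

lemma lookup_ad: "Poly_Mapping.lookup (ad D) (h ` P) = Poly_Mapping.lookup D P"
proof -
  have "h ` P = h ` Q \<longleftrightarrow> Q = P" for Q using bij by (auto simp: inj_image_eq_iff bij_is_inj)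
  then show ?thesis
    unfolding ad_def lookup_frag_extend by (simp add: lookup_single when_def if_distrib[of "(*) _"] in_keys_iff cong: if_cong)
qed

lemma ad_pdiv:
  assumes w: "w \<in> fixed K" "w \<noteq> 0" and K: "K > 0"
  shows "ad (pdiv K w) = pdiv K (h w)"
proof (rule dv_eqI[of _ K])
  fix Q assume "Q \<in> pts K"
  then obtain P where P: "P \<in> pts K" "Q = h ` P" using h_pts_obtain K by blast
  have hw: "h w \<in> fixed K" "h w \<noteq> 0" using w h_fixed by auto
  show "Poly_Mapping.lookup (ad (pdiv K w)) Q = Poly_Mapping.lookup (pdiv K (h w)) Q"
    using lookup_pdiv[OF w K P(1)] lookup_pdiv[OF hw K h_pts[OF P(1) K]] h_ord[OF P(1) K w] by (simp add: P(2) lookup_ad)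
qed (auto simp: pdiv_dv ad_dv K)

lemma ad_pull:
  assumes E: "E \<in> dv J" and K: "K dvd N" "J dvd K"
  shows "ad (pull J K E) = pull J K (ad E)"
proof (rule dv_eqI[of _ K])
  have Kp: "K > 0" and Jp: "J > 0" using dvd_pos K dvd_trans by blast+
  show "ad (pull J K E) \<in> dv K" "pull J K (ad E) \<in> dv K" by (simp_all add: pull_dv ad_dv Kp)
  fix Q assume "Q \<in> pts K"
  then obtain P where P: "P \<in> pts K" "Q = h ` P" using h_pts_obtain Kp by blast
  \<comment> \<open>The two labels of points on the line are kept apart; only the ramification
    indices are compared, and \<open>h\<close> preserves those.\<close>
  obtain c1 where c1: "P \<in> fibre K c1" using over_exists[OF P(1) Kp] P by (auto simp: fibre_def)
  obtain c2 where c2: "h ` P \<in> fibre K c2" using over_exists[OF h_pts[OF P(1) Kp] Kp] h_pts[OF P(1) Kp] by (auto simp: fibre_def)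
  have "relram J K c1 = relram J K c2"
    using ramification_eq_relram[OF c1 K] ramification_eq_relram[OF c2 K] h_ramification[OF P(1) Kp Jp K(2)] by simp
  then show "Poly_Mapping.lookup (ad (pull J K E)) Q = Poly_Mapping.lookup (pull J K (ad E)) Q"
    using lookup_pull[OF E c1 K] lookup_pull[OF ad_dv[OF E Jp] c2 K] by (simp add: P(2) lookup_ad h_Int_fixed)
qed

lemma ad_inverse: "ad (tower_automorphism.ad g D) = D"
  unfolding ad_def tower_automorphism.ad_def[OF inverse]
  using frag_extend_compose[of "\<lambda>P. frag_of (h ` P)" "\<lambda>P. g ` P" D]
  by (simp add: comp_def image_image) (metis frag_expansion)

lemma ad_image_eqI:
  assumes "ad ` A \<subseteq> A" "tower_automorphism.ad g ` A \<subseteq> A"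
  shows "ad ` A = A"
proof
  show "A \<subseteq> ad ` A"
  proof
    fix D assume "D \<in> A"
    then have "tower_automorphism.ad g D \<in> A" using assms(2) by blast
    then show "D \<in> ad ` A" using ad_inverse[of D] by (metis imageI)
  qed
qed (fact assms(1))

lemma ad_prin_subset: assumes K: "K > 0" shows "ad ` prin K \<subseteq> prin K"
proof -
  have "h w \<in> fixed K" if "w \<in> fixed K" for w using that h_fixed by blast
  then show ?thesis using ad_pdiv K by (auto simp: prin_def)
qed

lemma ad_prin: "K > 0 \<Longrightarrow> ad ` prin K = prin K"
  using ad_image_eqI[OF ad_prin_subset tower_automorphism.ad_prin_subset[OF inverse]] by blast

lemma ad_pull_dv0_subset:
  assumes K: "K dvd N" "J dvd K"
  shows "ad ` pull J K ` dv0 J \<subseteq> pull J K ` dv0 J"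
proof -
  have "J > 0" using dvd_pos K dvd_trans by blast
  then show ?thesis using ad_pull[OF dv0_dv K] ad_dv0 by auto
qed

lemma ad_pull_dv0: "K dvd N \<Longrightarrow> J dvd K \<Longrightarrow> ad ` pull J K ` dv0 J = pull J K ` dv0 J"
  using ad_image_eqI[OF ad_pull_dv0_subset tower_automorphism.ad_pull_dv0_subset[OF inverse]] by blast

lemma ad_trivial:
  assumes K: "K dvd N" "J dvd K" and D: "D \<in> trivial_divs J K"
  shows "ad D \<in> trivial_divs J K"
proof -
  have Kp: "K > 0" and Jp: "J > 0" using dvd_pos K dvd_trans by blast+
  obtain D' E where D': "D = D' + pull J K E" "D' \<in> prin K" "E \<in> dv0 J" using D by (auto simp: trivial_divs_def)
  then have "ad D' \<in> prin K" using ad_prin_subset[OF Kp] by blast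
  then show ?thesis
    using trivial_divsI[OF _ ad_dv0[OF D'(3) Jp]] by (simp add: D'(1) ad_simps ad_pull[OF dv0_dv[OF D'(3)] K])
qed

lemma trans_ad: "trans 1 (ad D) = ad (trans c D)"
proof -
  have "\<delta> ` h ` P = h ` (\<delta> ^^ c) ` P" for P by (simp add: image_image \<delta>_h)
  moreover have "\<delta> ^^ 1 = \<delta>" by simp
  ultimately show ?thesis
    using frag_extend_compose[of "\<lambda>P. frag_of (\<delta> ` P)" "\<lambda>P. h ` P" D]
      frag_extend_compose[of "\<lambda>P. frag_of (h ` P)" "\<lambda>P. (\<delta> ^^ c) ` P" D]
    by (simp only: ad_def trans_def comp_def)
qed

lemma pact_ad:
  assumes D: "D \<in> dv0 K" and K: "K > 0"
  shows "pact [:- 1, 1:] (ad D) = ad (pact (Polynomial.monom 1 c - 1) D)"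
  by (simp add: pact_pCons pact_0 trans_simps pact_minus pact_one pact_monom[OF dv0_dv[OF D] K] trans_ad[unfolded One_nat_def] ad_simps)

lemma pact_power_ad:
  assumes D: "D \<in> dv0 K" and K: "K > 0"
  shows "pact ([:- 1, 1:] ^ i) (ad D) = ad (pact ((Polynomial.monom 1 c - 1) ^ i) D)"
  by (induction i) (simp_all only: power_0 pact_one power_Suc pact_mult pact_ad[OF pact_dv0[OF D K] K])

text \<open>Moving (\<delta> - 1)^i past \<open>h\<close> turns it into (\<delta>^c - 1)^i, which is
  c^i (\<delta> - 1)^i up to a multiple of (\<delta> - 1)^(i + 1); by hypothesis that multiple is
  trivial on \<open>D\<close>.\<close>

lemma pact_power_ad_cong:
  assumes K: "K dvd N" "J dvd K" and D: "D \<in> dv0 K" "pact ([:- 1, 1:] ^ Suc i) D \<in> trivial_divs J K"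
  shows "pact ([:- 1, 1:] ^ i) (ad D) - ad (frag_cmul (int c ^ i) (pact ([:- 1, 1:] ^ i) D)) \<in> trivial_divs J K"
proof -
  obtain w :: "int poly" where w: "(Polynomial.monom 1 c - 1) ^ i = [:int c ^ i:] * [:- 1, 1:] ^ i + w * [:- 1, 1:] ^ Suc i"
    using power_minus_one_congruence by blast
  have "pact ([:- 1, 1:] ^ i) (ad D) - ad (frag_cmul (int c ^ i) (pact ([:- 1, 1:] ^ i) D)) =
      ad (pact w (pact ([:- 1, 1:] ^ Suc i) D))"
    unfolding pact_power_ad[OF D(1) dvd_pos[OF K(1)]] w pact_add pact_mult[of w] pact_mult[of "[:int c ^ i:]"] pact_const ad_simps
    by simp
  then show ?thesis using ad_trivial[OF K pact_trivial[OF K D(2)]] by simp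
qed

end

section \<open>The block form for the tower\<close>

context kummer_quotient begin

text \<open>The endomorphism \<delta> - 1 on classes, through a chosen representative; the choice is
  immaterial because \<open>trivial_divs\<close> is stable under \<delta>.\<close>

definition Delta :: "('f set \<Rightarrow>\<^sub>0 int) set set \<Rightarrow> ('f set \<Rightarrow>\<^sub>0 int) set set" where
  "Delta a = cls (pact [:- 1, 1:] (SOME D. D \<in> dv0 K \<and> a = cls D))"

lemma pact_linear: "pact [:- 1, 1:] D = trans 1 D - D"
  by (simp add: pact_pCons pact_0 pact_one trans_simps)

lemma Delta_cls: assumes D: "D \<in> dv0 K" shows "Delta (cls D) = cls (pact [:- 1, 1:] D)"
proof -
  define E where "E = (SOME E. E \<in> dv0 K \<and> cls D = cls E)"
  have E: "E \<in> dv0 K" "cls D = cls E"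
    using someI_ex[of "\<lambda>E. E \<in> dv0 K \<and> cls D = cls E"] D unfolding E_def by blast+
  have "pact [:- 1, 1:] (D - E) \<in> trivial_divs J K"
    using E D by (intro pact_trivial[OF KN JK]) (simp add: cls_eq_iff)
  then have "cls (pact [:- 1, 1:] D) = cls (pact [:- 1, 1:] E)"
    using D E K_pos by (simp only: cls_eq_iff pact_dv0 pact_minus_right)
  then show ?thesis by (simp only: Delta_def E_def)
qed

lemma Delta_power_cls: "D \<in> dv0 K \<Longrightarrow> (Delta ^^ d) (cls D) = cls (pact ([:- 1, 1:] ^ d) D)"
  by (induction d) (simp_all only: funpow.simps id_apply comp_apply power_0 power_Suc pact_one pact_mult
      Delta_cls[OF pact_dv0[OF _ K_pos]])

lemma Delta_hom: "Delta \<in> hom quot quot"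
proof (rule homI)
  fix a assume "a \<in> carrier quot"
  then obtain D where "D \<in> dv0 K" "a = cls D" by (auto simp: carrier_A)
  then show "Delta a \<in> carrier quot" using cls_closed[OF pact_dv0[OF _ K_pos]] by (simp only: Delta_cls)
next
  fix a a' assume "a \<in> carrier quot" "a' \<in> carrier quot"
  then obtain D E where D: "D \<in> dv0 K" "a = cls D" "E \<in> dv0 K" "a' = cls E" by (auto simp: carrier_A)
  have "Delta (cls (D + E)) = Delta (cls D) \<otimes>\<^bsub>quot\<^esub> Delta (cls E)"
    unfolding Delta_cls[OF dv0_add[OF D(1,3)]] Delta_cls[OF D(1)] Delta_cls[OF D(3)] pact_add_right
    by (intro cls_add pact_dv0 D K_pos)
  then show "Delta (a \<otimes>\<^bsub>quot\<^esub> a') = Delta a \<otimes>\<^bsub>quot\<^esub> Delta a'" using D by (simp only: cls_add)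
qed

lemma Delta_surjective:
  assumes P0: "P0 \<in> pts K" "\<delta> ` P0 = P0" and a: "a \<in> carrier quot"
  shows "\<exists>b\<in>carrier quot. Delta b = a"
proof -
  obtain D where D: "D \<in> dv0 K" "a = cls D" using a by (auto simp: carrier_A)
  obtain E where E: "E \<in> dv0 K" "D - (E - trans 1 E) \<in> prin K"
    using one_minus_trans_surjective[OF D(1) KN P0] by blast
  have E': "- E \<in> dv0 K" by (rule dv0_uminus[OF E(1)])
  have p: "pact [:- 1, 1:] (- E) = E - trans 1 E" by (simp only: pact_linear trans_simps) simp
  have "cls D = cls (pact [:- 1, 1:] (- E))"
    using trivial_divs_prin[OF E(2), of J] D(1) pact_dv0[OF E' K_pos, of "[:- 1, 1:]"] by (simp only: cls_eq_iff p)
  then have "Delta (cls (- E)) = a" using Delta_cls[OF E'] D(2) by metis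
  then show ?thesis using cls_closed[OF E'] by blast
qed

text \<open>A combination of fibre sums is already invariant as a divisor. Conversely,
  \<open>kernel_one_minus_trans\<close> replaces an invariant class by such a combination over
  \<open>R\<close>, which lies in the generated subgroup.\<close>

lemma Delta_kernel:
  assumes P0: "P0 \<in> pts K" "over c0 P0" "\<delta> ` P0 = P0" "relram J K c0 = K div J"
    and R: "finite R" "c0 \<in> R" "\<And>c. c \<notin> R \<Longrightarrow> relram J K c = 1"
  shows "cls ` (generate (Div emb (fixed K)) (fibre_sum K ` R) \<inter> dv0 K) = {a \<in> carrier quot. Delta a = \<one>\<^bsub>quot\<^esub>}"
    (is "cls ` (?W \<inter> _) = _")
proof (intro equalityI subsetI)
  fix a assume "a \<in> cls ` (?W \<inter> dv0 K)"
  then obtain D where D: "D \<in> ?W" "D \<in> dv0 K" "a = cls D" by blast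
  have "trans 1 D = D \<and> D \<in> dv K"
    using D(1)
  proof (induction rule: generate.induct)
    case one
    then show ?case by (simp add: Div_def trans_simps dv_0)
  next
    case (incl D)
    then show ?case using trans_fibre_sum[OF K_pos] fibre_sum_dv by blast
  next
    case (inv D)
    then obtain c where "D = fibre_sum K c" by blast
    then have D: "trans 1 D = D" "D \<in> dv K" using trans_fibre_sum[OF K_pos] fibre_sum_dv by blast+
    then have "inv\<^bsub>Div emb (fixed K)\<^esub> D = - D" by (simp add: Div_def dv_def pts_def)
    then show ?case using D trans_simps(4)[of 1 D] by (simp only: dv_uminus)
  next
    case (eng D E)
    then show ?case using trans_simps(2)[of 1 D E] by (simp add: Div_def dv_add)
  qed
  then have "pact [:- 1, 1:] D = 0" by (simp only: pact_linear) simp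
  then have "Delta a = \<one>\<^bsub>quot\<^esub>"
    unfolding D(3) Delta_cls[OF D(2)] using cls_eq_one_iff[OF dv0_0] trivial_divs_0[OF K_pos] by simp
  then show "a \<in> {a \<in> carrier quot. Delta a = \<one>\<^bsub>quot\<^esub>}" using D cls_closed by blast
next
  fix a assume "a \<in> {a \<in> carrier quot. Delta a = \<one>\<^bsub>quot\<^esub>}"
  then obtain D where D: "D \<in> dv0 K" "a = cls D" "Delta (cls D) = \<one>\<^bsub>quot\<^esub>" by (auto simp: carrier_A)
  have "pact [:- 1, 1:] D \<in> trivial_divs J K"
    using D(3) unfolding Delta_cls[OF D(1)] cls_eq_one_iff[OF pact_dv0[OF D(1) K_pos]] .
  then have "- pact [:- 1, 1:] D \<in> trivial_divs J K" by (rule trivial_divs_uminus[OF K_pos])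
  then have "D - trans 1 D \<in> trivial_divs J K" by (simp only: pact_linear minus_diff_eq)
  then obtain m where m: "div_degree (\<Sum>c\<in>R. frag_cmul (m c) (fibre_sum K c)) = 0"
    "D - (\<Sum>c\<in>R. frag_cmul (m c) (fibre_sum K c)) \<in> trivial_divs J K"
    using kernel_one_minus_trans[OF KN JK P0 R D(1)] by blast
  let ?D = "\<Sum>c\<in>R. frag_cmul (m c) (fibre_sum K c)"
  have D': "?D \<in> dv0 K" using m(1) fibre_sum_dv by (auto simp: dv0_def intro!: dv_sum dv_cmul)
  have "?D \<in> ?W"
  proof -
    interpret D: comm_group "Div emb (fixed K)" unfolding Div_def by (rule abelian_free_Abelian_group)
    have sub: "fibre_sum K ` R \<subseteq> carrier (Div emb (fixed K))"
      using fibre_sum_dv by (auto simp: Div_def dv_def pts_def)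
    interpret W: subgroup ?W "Div emb (fixed K)" by (rule D.generate_is_subgroup[OF sub])
    have cmul: "frag_cmul (m c) (fibre_sum K c) \<in> ?W" if "c \<in> R" for c
    proof -
      have c: "fibre_sum K c \<in> ?W" using that by (intro generate.incl) blast
      have "fibre_sum K c [^]\<^bsub>Div emb (fixed K)\<^esub> m c \<in> ?W"
        by (rule D.subgroup_int_pow_closed[OF W.subgroup_axioms c])
      then show ?thesis using fibre_sum_dv by (simp add: Div_def dv_def pts_def)
    qed
    have "(\<Sum>c\<in>R'. frag_cmul (m c) (fibre_sum K c)) \<in> ?W" if "finite R'" "R' \<subseteq> R" for R'
      using that
    proof (induction R')
      case empty
      then show ?case using W.one_closed by (simp add: Div_def)
    next
      case (insert c R')
      then show ?case using W.m_closed[OF cmul[of c]] by (simp add: Div_def)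
    qed
    then show ?thesis using R(1) by blast
  qed
  moreover have "a = cls ?D" using cls_eq_iff[OF D(1) D'] m(2) D(2) by simp
  ultimately show "a \<in> cls ` (?W \<inter> dv0 K)" using D' by blast
qed

definition act :: "('f \<Rightarrow> 'f) \<Rightarrow> ('f set \<Rightarrow>\<^sub>0 int) set set \<Rightarrow> ('f set \<Rightarrow>\<^sub>0 int) set set" where
  "act h a = ((`) (frag_extend (\<lambda>P. frag_of (h ` P)))) ` a"

lemma act_cls:
  assumes h: "tower_automorphism emb x y f N \<zeta> \<delta> h b c" and D: "D \<in> dv0 K"
  shows "act h (cls D) = cls (tower_automorphism.ad h D)"
proof -
  interpret T: tower_automorphism emb x y f N \<zeta> \<delta> h b c by fact
  have "T.ad \<in> hom G G" using T.ad_dv0 K_pos by (intro homI) (auto simp: G_simps T.ad_simps)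
  from cls_image[OF this T.ad_prin[OF K_pos] T.ad_pull_dv0[OF KN JK]] D show ?thesis
    by (simp add: act_def T.ad_def G_simps)
qed

lemma act_hom:
  assumes h: "tower_automorphism emb x y f N \<zeta> \<delta> h b c"
  shows "act h \<in> hom quot quot"
proof -
  interpret T: tower_automorphism emb x y f N \<zeta> \<delta> h b c by fact
  show ?thesis
    by (intro homI) (auto simp: carrier_A act_cls[OF h] T.ad_dv0 K_pos T.ad_simps dv0_add simp flip: cls_add)
qed

lemma act_Delta_power:
  assumes h: "tower_automorphism emb x y f N \<zeta> \<delta> h b c"
    and a: "a \<in> carrier quot" "(Delta ^^ Suc d) a = \<one>\<^bsub>quot\<^esub>"
  shows "(Delta ^^ d) (act h a) = act h ((Delta ^^ d) a) [^]\<^bsub>quot\<^esub> (int c ^ d)"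
proof -
  interpret T: tower_automorphism emb x y f N \<zeta> \<delta> h b c by fact
  obtain D where D: "D \<in> dv0 K" "a = cls D" using a by (auto simp: carrier_A)
  let ?D = "pact ([:- 1, 1:] ^ d) D"
  have D': "?D \<in> dv0 K" by (rule pact_dv0[OF D(1) K_pos])
  have "pact ([:- 1, 1:] ^ Suc d) D \<in> trivial_divs J K"
    using a(2) unfolding D(2) Delta_power_cls[OF D(1)] cls_eq_one_iff[OF pact_dv0[OF D(1) K_pos]] .
  note cong = T.pact_power_ad_cong[OF KN JK D(1) this]
  have "(Delta ^^ d) (act h a) = cls (pact ([:- 1, 1:] ^ d) (T.ad D))"
    using act_cls[OF h D(1)] Delta_power_cls[OF T.ad_dv0[OF D(1) K_pos], of d] by (simp only: D(2))
  also have "\<dots> = cls (T.ad (frag_cmul (int c ^ d) ?D))"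
    using cong pact_dv0[OF T.ad_dv0[OF D(1) K_pos] K_pos] T.ad_dv0[OF dv0_cmul[OF D'] K_pos]
    by (simp only: cls_eq_iff)
  also have "\<dots> = cls (T.ad ?D) [^]\<^bsub>quot\<^esub> (int c ^ d)"
    using cls_int_pow[OF T.ad_dv0[OF D' K_pos]] by (simp only: T.ad_simps)
  also have "cls (T.ad ?D) = act h ((Delta ^^ d) a)"
    using act_cls[OF h D'] Delta_power_cls[OF D(1)] by (simp only: D(2))
  finally show ?thesis .
qed

lemma block_form:
  fixes H :: "'s \<Rightarrow> 'f \<Rightarrow> 'f" and c :: "'s \<Rightarrow> nat"
  assumes l: "l = CARD('p::prime_card)" and s: "s \<ge> 1" "K = l ^ s" "J = l ^ (s - 1)"
    and P0: "P0 \<in> pts K" "over c0 P0" "\<delta> ` P0 = P0" "relram J K c0 = K div J"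
    and R: "finite R" "c0 \<in> R" "\<And>c. c \<notin> R \<Longrightarrow> relram J K c = 1"
    and basis: "Fl_basis TYPE('p) quot (cls ` (generate (Div emb (fixed K)) (fibre_sum K ` R) \<inter> dv0 K)) bW"
    and H: "\<And>\<sigma>. \<sigma> \<in> \<Gamma> \<Longrightarrow> \<exists>b. tower_automorphism emb x y f N \<zeta> \<delta> (H \<sigma>) b (c \<sigma>)"
  shows "\<exists>B. Fl_basis TYPE('p) quot (torsion quot l) B \<and>
    (\<forall>\<sigma>\<in>\<Gamma>. block_upper_triangular (length bW) (totient (l ^ s))
      (\<lambda>i. (of_int (int (c \<sigma>) ^ i) :: 'p mod_ring) \<cdot>\<^sub>m rep_matrix quot bW (act (H \<sigma>)))
      (rep_matrix quot B (act (H \<sigma>))))"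
proof -
  have "unipotent_endomorphism TYPE('p) quot Delta (totient (l ^ s)) {a \<in> carrier quot. Delta a = \<one>\<^bsub>quot\<^esub>} bW (length bW)
    \<Gamma> (\<lambda>\<sigma>. act (H \<sigma>)) (\<lambda>\<sigma> i. int (c \<sigma>) ^ i)"
  proof (intro unipotent_endomorphism.intro unipotent_endomorphism_axioms.intro A.comm_group_axioms Delta_hom refl)
    show "\<exists>b\<in>carrier quot. Delta b = a" if "a \<in> carrier quot" for a
      by (rule Delta_surjective[OF P0(1,3) that])
    show "Fl_basis TYPE('p) quot {a \<in> carrier quot. Delta a = \<one>\<^bsub>quot\<^esub>} bW"
      by (subst Delta_kernel[OF P0 R, symmetric]) (assumption | rule basis)+
    show "act (H \<sigma>) \<in> hom quot quot" if "\<sigma> \<in> \<Gamma>" for \<sigma> using H[OF that] act_hom by blast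
    show "(Delta ^^ d) (act (H \<sigma>) a) = act (H \<sigma>) ((Delta ^^ d) a) [^]\<^bsub>quot\<^esub> (int (c \<sigma>) ^ d)"
      if "\<sigma> \<in> \<Gamma>" "a \<in> carrier quot" "(Delta ^^ Suc d) a = \<one>\<^bsub>quot\<^esub>" for \<sigma> d a
      using H[OF that(1)] act_Delta_power[OF _ that(2,3)] by blast
    show "a \<in> torsion quot CARD('p) \<longleftrightarrow> (Delta ^^ totient (l ^ s)) a = \<one>\<^bsub>quot\<^esub>" if a: "a \<in> carrier quot" for a
    proof -
      obtain D where D: "D \<in> dv0 K" "a = cls D" using a by (auto simp: carrier_A)
      have "a \<in> torsion quot CARD('p) \<longleftrightarrow> cls (frag_cmul (int l) D) = \<one>\<^bsub>quot\<^esub>"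
        using a cls_int_pow[OF D(1), of "int l"] by (simp add: torsion_def D(2) l int_pow_int)
      also have "\<dots> \<longleftrightarrow> frag_cmul (int l) D \<in> trivial_divs J K" by (rule cls_eq_one_iff[OF dv0_cmul[OF D(1)]])
      also have "\<dots> \<longleftrightarrow> pact ([:- 1, 1:] ^ totient (l ^ s)) D \<in> trivial_divs J K"
        unfolding s(2,3) using torsion_iff_unipotent[OF l s(1)] KN D(1) unfolding s(2) by blast
      also have "\<dots> \<longleftrightarrow> (Delta ^^ totient (l ^ s)) a = \<one>\<^bsub>quot\<^esub>"
        unfolding D(2) Delta_power_cls[OF D(1)] cls_eq_one_iff[OF pact_dv0[OF D(1) K_pos]] ..
      finally show ?thesis .
    qed
  qed
  from unipotent_endomorphism.block_triangular_basis[OF this] show ?thesis unfolding l .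
qed

end

section \<open>The superelliptic tower\<close>

lemma primitive_power_cong:
  fixes w :: "'b::field"
  assumes w: "\<And>i. w ^ i = 1 \<longleftrightarrow> M dvd i" and M: "M > 0"
  shows "w ^ a = w ^ b \<longleftrightarrow> a mod M = b mod M"
proof -
  have w0: "w \<noteq> 0" using w[of M] M by (auto simp: power_0_left)
  have "w ^ a = w ^ b \<longleftrightarrow> a mod M = b mod M" if "a \<le> b" for a b
  proof -
    have "w ^ b = w ^ (a + (b - a))" using that by simp
    then have "w ^ b = w ^ a * w ^ (b - a)" by (simp only: power_add)
    then have "w ^ a = w ^ b \<longleftrightarrow> M dvd b - a" using w0 w by simp
    also have "\<dots> \<longleftrightarrow> a mod M = b mod M" using mod_eq_dvd_iff_nat[OF that, of M] by auto
    finally show ?thesis .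
  qed
  from this[of a b] this[of b a] show ?thesis by (metis nat_le_linear)
qed

lemma root_of_unity_powers:
  fixes w z :: "'b::field"
  assumes w: "\<And>i. w ^ i = 1 \<longleftrightarrow> M dvd i" and M: "M > 0" and z: "z ^ M = 1"
  obtains i where "z = w ^ i"
proof -
  have "inj_on (\<lambda>i. w ^ i) {..<M}" by (auto simp: inj_on_def primitive_power_cong[OF w M])
  then have "(\<Prod>i<M. z - w ^ i * 1) = z ^ M - 1 ^ M"
    using w M by (intro prod_roots_of_unity) auto
  then have "(\<Prod>i<M. z - w ^ i) = 0" using z by simp
  then show thesis using that by (auto simp: prod_zero_iff)
qed

lemma to_int_mod_ring_of_nat: "to_int_mod_ring (of_nat i :: 'p::prime_card mod_ring) = int (i mod CARD('p))"
proof -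
  have "to_int_mod_ring (of_int (int i) :: 'p mod_ring) = int i mod int CARD('p)"
    by (simp add: of_int_of_int_mod_ring del: of_int_of_nat_eq) (transfer, simp)
  then show ?thesis by (simp add: zmod_int)
qed

text \<open>On the powers of \<open>w\<close> the automorphism is raising to some power
  \<open>j\<close>, whose residue is the value of the character; applying this to
  \<open>w ^ c\<close> gives j c \<equiv> 1 modulo \<open>l\<close>.\<close>

lemma cyclotomic_char_inverse:
  fixes w :: "'b::field"
  assumes w: "\<And>i. w ^ i = 1 \<longleftrightarrow> CARD('p::prime_card) dvd i" and \<sigma>: "field_hom \<sigma>" "\<sigma> (w ^ c) = w"
  shows "cyclotomic_char \<sigma> * of_nat c = (1 :: 'p mod_ring)"
proof -
  interpret \<sigma>: field_hom \<sigma> by (rule \<sigma>)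
  have l: "CARD('p) > 0" "CARD('p) > 1" using prime_gt_1_nat[OF prime_card[where 'a = 'p]] by simp_all
  note cong = primitive_power_cong[OF w l(1)]
  have "\<sigma> w ^ CARD('p) = 1" using w[of "CARD('p)"] by (simp flip: \<sigma>.hom_power)
  then obtain j where j: "\<sigma> w = w ^ j" using root_of_unity_powers[OF w l(1)] by metis
  have "cyclotomic_char \<sigma> = (of_nat j :: 'p mod_ring)"
    unfolding cyclotomic_char_def
  proof (rule the_equality)
    show "\<forall>z. z ^ CARD('p) = 1 \<longrightarrow> \<sigma> z = z ^ nat (to_int_mod_ring (of_nat j :: 'p mod_ring))"
    proof (intro allI impI)
      fix z :: 'b assume "z ^ CARD('p) = 1"
      then obtain i where i: "z = w ^ i" using root_of_unity_powers[OF w l(1)] by metis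
      have "\<sigma> z = w ^ (j * i)" by (simp add: i \<sigma>.hom_power j power_mult)
      also have "\<dots> = w ^ (i * (j mod CARD('p)))" unfolding cong by (simp add: mod_mult_right_eq mult.commute)
      finally show "\<sigma> z = z ^ nat (to_int_mod_ring (of_nat j :: 'p mod_ring))"
        by (simp only: i to_int_mod_ring_of_nat nat_int power_mult)
    qed
    fix d :: "'p mod_ring" assume d: "\<forall>z. z ^ CARD('p) = 1 \<longrightarrow> \<sigma> z = z ^ nat (to_int_mod_ring d)"
    have "w ^ j = w ^ nat (to_int_mod_ring d)" using d w[of "CARD('p)"] j by simp
    then have "j mod CARD('p) = nat (to_int_mod_ring d) mod CARD('p)" by (simp only: cong)
    moreover obtain i where i: "d = of_nat i" "i < CARD('p)" using surj_of_nat_mod_ring by blast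
    ultimately show "d = of_nat j" by (metis i to_int_mod_ring_of_nat nat_int mod_less of_int_mod_ring_to_int_mod_ring)
  qed
  moreover have "w ^ (j * c) = w ^ 1" using \<sigma>(2) by (simp add: \<sigma>.hom_power j power_mult)
  then have "to_int_mod_ring (of_nat (j * c) :: 'p mod_ring) = to_int_mod_ring (of_nat 1 :: 'p mod_ring)"
    unfolding cong to_int_mod_ring_of_nat by simp
  then have "of_nat (j * c) = (of_nat 1 :: 'p mod_ring)" by (metis of_int_mod_ring_to_int_mod_ring)
  ultimately show ?thesis by simp
qed

section \<open>The superelliptic curve as a Kummer tower, with its Galois action\<close>

context superelliptic_setup begin

lemma l_gt_1: "l > 1" and l_pos: "l ^ i > 0"
  using prime_gt_1_nat[OF prime_l] by simp_all

lemma f_neq_zero: "f \<noteq> 0"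
  using lam finite_S by (auto simp: f_eq)

lemma kummer_curve: "kummer_curve emb x y f (l ^ n)"
  unfolding kummer_curve_def
  using emb x_transcendental irreducible_model l_pos[of n] y_eq function_field by (simp add: tower_field_def)

lemma kummer_tower_exists: "\<exists>\<zeta> \<delta>. kummer_tower emb x y f (l ^ n) \<zeta> \<delta>"
proof -
  interpret kummer_curve emb x y f "l ^ n" by (rule kummer_curve)
  obtain \<zeta> :: 'a where \<zeta>: "\<And>i. \<zeta> ^ i = 1 \<longleftrightarrow> l ^ n dvd i" using primitive_root_exists[OF prime_l] by metis
  have "field_hom (\<lambda>a::'a. a)" by unfold_locales auto
  then obtain \<delta> where "field_hom \<delta>" "\<And>a. \<delta> (emb a) = emb a" "\<delta> x = x" "\<delta> y = emb \<zeta> * y"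
    using hom_extension[of "\<lambda>a. a" \<zeta>] \<zeta>[of "l ^ n"] by (auto simp: map_poly_idI)
  with \<zeta> f_neq_zero show ?thesis
    by (intro exI[of _ \<zeta>] exI[of _ \<delta>] kummer_tower.intro kummer_cover.intro kummer_curve
        kummer_cover_axioms.intro kummer_tower_axioms.intro)
qed

lemma order_f: "Polynomial.order \<xi> f = (if \<xi> \<in> S then e \<xi> else 0)"
proof -
  have "Polynomial.order \<xi> (\<Prod>\<eta>\<in>T. [:- \<eta>, 1:] ^ e \<eta>) = (if \<xi> \<in> T then e \<xi> else 0)" if "finite T" for T
    using that
  proof (induction T)
    case (insert \<eta> T)
    define q where "q = [:- \<eta>, 1:] ^ e \<eta>"
    define r where "r = (\<Prod>\<eta>\<in>T. [:- \<eta>, 1:] ^ e \<eta>)"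
    have "q \<noteq> 0" "r \<noteq> 0" using insert.hyps by (simp_all add: q_def r_def)
    then have "Polynomial.order \<xi> (q * r) = Polynomial.order \<xi> q + Polynomial.order \<xi> r" by (intro order_mult) simp
    moreover have "Polynomial.order \<xi> q = (if \<xi> = \<eta> then e \<eta> else 0)"
      unfolding q_def using order_power_n_n[of \<eta> "e \<eta>"] by (auto intro!: order_0I)
    moreover have "Polynomial.order \<xi> r = (if \<xi> \<in> T then e \<xi> else 0)" unfolding r_def by (rule insert.IH)
    ultimately show ?case unfolding prod.insert[OF insert.hyps] q_def r_def using insert.hyps(2) by auto
  qed (simp add: order_0I)
  then show ?thesis using lam(2) finite_S by (simp add: f_eq order_smult)
qed

text \<open>If \<open>l\<close> divided all exponents, \<open>f\<close> would be
  \<open>g ^ l\<close>, the constant having an l-th root, and the model would have the proper factor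
  y^(l^(n - 1)) - g.\<close>

lemma totally_ramified_exists: obtains \<xi> where "\<xi> \<in> S" "\<not> l dvd e \<xi>"
proof (rule ccontr)
  assume "\<not> thesis"
  then have dvd: "e \<xi> = l * (e \<xi> div l)" if "\<xi> \<in> S" for \<xi> using that \<open>\<And>\<xi>. \<xi> \<in> S \<Longrightarrow> \<not> l dvd e \<xi> \<Longrightarrow> thesis\<close> by fastforce
  obtain \<mu> where \<mu>: "\<mu> ^ l = lam" using nth_root_exists[of l lam] l_gt_1 by auto
  define g where "g = Polynomial.smult \<mu> (\<Prod>\<xi>\<in>S. [:- \<xi>, 1:] ^ (e \<xi> div l))"
  have "(\<Prod>\<xi>\<in>S. [:- \<xi>, 1:] ^ e \<xi>) = (\<Prod>\<xi>\<in>S. ([:- \<xi>, 1:] ^ (e \<xi> div l)) ^ l)"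
    using dvd by (intro prod.cong refl) (metis power_mult mult.commute)
  then have g: "f = g ^ l" by (simp add: f_eq g_def smult_power \<mu> prod_power_distrib flip: power_mult)
  define p where "p = Polynomial.monom 1 (l ^ n) - [:f:]"
  define a where "a = Polynomial.monom 1 (l ^ (n - 1)) - [:g:]"
  have n: "l ^ n = l ^ (n - 1) * l" using n_pos by (cases n) auto
  have deg: "degree (Polynomial.monom 1 m - [:q:]) = m" if "m > 0" for m and q :: "'a poly"
    using that degree_monom_eq[of "1 :: 'a poly" m] degree_diff_less
    by (intro order_antisym degree_le le_degree) (auto simp: coeff_pCons split: nat.splits)
  have "p = Polynomial.monom 1 (l ^ (n - 1)) ^ l - [:g:] ^ l"
    by (simp add: p_def n g monom_power poly_const_pow)
  then have ap: "a dvd p" unfolding a_def by (simp only: power_diff_sumr2 dvd_triv_left)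
  have "p dvd a \<or> is_unit a"
    using irreducible_model ap unfolding p_def[symmetric] by (meson irreducibleD')
  moreover have da: "degree a = l ^ (n - 1)" "degree p = l ^ n" unfolding a_def p_def using l_pos by (simp_all only: deg)
  moreover have "a \<noteq> 0" using da(1) l_pos[of "n - 1"] by auto
  moreover have "l ^ (n - 1) < l ^ n" using l_gt_1 n_pos by simp
  ultimately show False
    using dvd_imp_degree_le[of p a] dvd_imp_degree_le[of a 1] l_pos[of "n - 1"] by (metis degree_1 le_0_eq linorder_not_less not_gr_zero one_neq_zero)
qed

end

locale superelliptic_cover = superelliptic_setup k l n f lam S e emb x y + kummer_tower emb x y f "l ^ n" \<zeta> \<delta>
  for k :: "'a::{alg_closed_field,field_char_0} set" and l n f lam S e and emb :: "'a \<Rightarrow> 'f::field" and x y \<zeta> \<delta>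
begin

lemma tower_field_eq: "s \<le> n \<Longrightarrow> tower_field emb x y l n s = fixed (l ^ s)"
  unfolding tower_field_def by (rule fixed_eq_hull[symmetric]) (simp flip: power_add)

text \<open>The branch locus lies over the finite set \<open>S\<close>, so the cover is unramified
  at infinity; by the formula for \<open>ram\<close> this means that \<open>l ^ n\<close> divides
  the pole order of \<open>f\<close> there.\<close>

lemma dvd_degree: "l ^ n dvd degree f"
proof -
  obtain P where P: "P \<in> pts (l ^ n)" "over None P" using pts_exists by blast
  have r: "ramification P (P \<inter> rat_field) = int (ram (l ^ n) None)"
    using ord_rat(3)[OF P l_pos] card_stabilizer'(2)[OF P] f_neq_zero
    by (metis dvd_refl rat_field_def subfield_rat subfield_one zero_neq_one)
  have "\<not> ramification P (P \<inter> rat_field) > 1"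
  proof
    assume r: "ramification P (P \<inter> rat_field) > 1"
    note t = tower_field_eq[of 0, unfolded power_0 fixed_1, OF le0] tower_field_eq[OF order_refl]
    have "P \<inter> rat_field \<in> branch_locus emb rat_field (fixed (l ^ n))"
      unfolding branch_locus_def using P(1) r by (auto simp: pts_def)
    then obtain \<xi> where "x - emb \<xi> \<in> nonunits (P \<inter> rat_field)"
      using branch[unfolded t] by blast
    then have "over (Some \<xi>) (P \<inter> fixed 1)" by (simp only: over_def fixed_1 option.case)
    moreover have "over None (P \<inter> fixed 1)" "P \<inter> fixed 1 \<in> pts 1"
      using pts_restrict[OF P(1) l_pos one_dvd] P(2) by blast+
    ultimately show False using over_unique by blast
  qed
  then have "ram (l ^ n) None = 1" using r ram_pos[of "l ^ n" None] by simp
  then have "l ^ n = gcd (degree f) (l ^ n)"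
    using l_pos[of n] by (simp add: ram_def pord_def) (metis dvd_mult_div_cancel gcd_dvd2 mult.right_neutral One_nat_def)
  then show ?thesis by (metis gcd_dvd1)
qed

lemma ram_infinity: "s \<le> n \<Longrightarrow> ram (l ^ s) None = 1"
  using dvd_degree le_imp_power_dvd[of s n l] l_pos[of s]
  by (simp add: ram_def pord_def gcd_nat.absorb2[OF dvd_trans[of "l ^ s" "l ^ n"]])

text \<open>At the remaining finite points, whether in a higher stratum or outside \<open>S\<close>,
  the order of \<open>f\<close> is divisible by \<open>l ^ s\<close>.\<close>

lemma ram_outside_strata:
  assumes s: "s \<le> n" and c: "c \<notin> Some ` strata_below l S e s"
  shows "ram (l ^ s) c = 1"
proof (cases c)
  case None
  then show ?thesis using ram_infinity[OF s] by simp
next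
  case (Some \<xi>)
  have "l ^ s dvd Polynomial.order \<xi> f"
  proof (cases "\<xi> \<in> S")
    case True
    then have "s \<le> multiplicity l (e \<xi>)" using c Some by (auto simp: strata_below_def stratum_def)
    then show ?thesis using True by (simp add: order_f multiplicity_dvd')
  qed (simp add: order_f)
  then show ?thesis using l_pos[of s] by (simp add: ram_def pord_def Some gcd_nat.absorb2)
qed

lemma relram_outside_strata:
  assumes s: "s \<le> n" and c: "c \<notin> Some ` strata_below l S e s"
  shows "relram (l ^ (s - 1)) (l ^ s) c = 1"
proof -
  have K: "l ^ s dvd l ^ n" "l ^ (s - 1) dvd l ^ s" using s by (simp_all add: le_imp_power_dvd)
  obtain P where "P \<in> fibre (l ^ s) c" using pts_exists by (auto simp: fibre_def)
  from card_relative_stabilizer(2)[OF this K] ram_outside_strata[OF assms] show ?thesis by simp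
qed

text \<open>An exponent prime to \<open>l\<close> gives ramification index \<open>l ^ i\<close> at
  every level \<open>i\<close>, so the stabilizer of a point above is the whole group.\<close>

lemma totally_ramified_point:
  assumes s: "s \<ge> 1" "s \<le> n"
  obtains \<xi> P where "\<xi> \<in> strata_below l S e s" "P \<in> pts (l ^ s)" "over (Some \<xi>) P" "\<delta> ` P = P"
    "relram (l ^ (s - 1)) (l ^ s) (Some \<xi>) = l ^ s div l ^ (s - 1)"
proof -
  obtain \<xi> where \<xi>: "\<xi> \<in> S" "\<not> l dvd e \<xi>" by (rule totally_ramified_exists)
  have "algebraic_semidom_class.coprime (e \<xi>) l" using prime_imp_coprime[OF prime_l \<xi>(2)] by (simp only: algebraic_semidom_class.coprime_commute)
  then have r: "ram (l ^ i) (Some \<xi>) = l ^ i" for i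
    using \<xi>(1) by (simp add: ram_def pord_def order_f)
  have K: "l ^ s dvd l ^ n" using s by (simp add: le_imp_power_dvd)
  obtain P where P: "P \<in> pts (l ^ s)" "over (Some \<xi>) P" using pts_exists by blast
  have "card {i. i < l ^ s \<and> (\<delta> ^^ i) ` P = P} = card {..<l ^ s}" using card_stabilizer'(1)[OF P K] r by simp
  then have "{i. i < l ^ s \<and> (\<delta> ^^ i) ` P = P} = {..<l ^ s}" by (intro card_subset_eq) auto
  moreover have "1 < l ^ s" using one_less_power[OF l_gt_1, of s] s by simp
  ultimately have "(\<delta> ^^ 1) ` P = P" by blast
  moreover have "\<xi> \<in> strata_below l S e s"
    using \<xi> s by (auto simp: strata_below_def stratum_def not_dvd_imp_multiplicity_0 intro!: bexI[of _ 0])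
  ultimately show thesis using that[of \<xi> P] P r by (simp add: relram_def)
qed

lemma fibre_div_eq: "fibre_div emb x (fixed K) \<xi> = fibre_sum K (Some \<xi>)"
  by (simp add: fibre_div_def fibre_sum_def fibre_def over_def pts_def)

lemma map_poly_f: "\<sigma> \<in> Gal k \<Longrightarrow> map_poly \<sigma> f = f"
proof -
  assume \<sigma>: "\<sigma> \<in> Gal k"
  then interpret \<sigma>: field_isom \<sigma> by (simp add: Gal_def)
  show ?thesis using \<sigma> f_coeffs by (intro poly_eqI) (simp add: Gal_def)
qed

lemma lift_aut:
  assumes \<sigma>: "\<sigma> \<in> Gal k"
  shows "field_hom (lift_aut emb x y \<sigma>)" "lift_aut emb x y \<sigma> (emb a) = emb (\<sigma> a)"
    "lift_aut emb x y \<sigma> x = x" "lift_aut emb x y \<sigma> y = y"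
proof -
  let ?P = "\<lambda>h. field_hom h \<and> (\<forall>a. h (emb a) = emb (\<sigma> a)) \<and> h x = x \<and> h y = y"
  have "field_hom \<sigma>" using \<sigma> by (simp add: Gal_def field_isom_def)
  then obtain h where h: "?P h" using hom_extension[of \<sigma> 1] map_poly_f[OF \<sigma>] by auto
  have "?P (lift_aut emb x y \<sigma>)"
    unfolding lift_aut_def
  proof (rule theI[of ?P])
    fix g assume "?P g"
    with h show "g = h" by (intro hom_eqI) auto
  qed (rule h)
  then show "field_hom (lift_aut emb x y \<sigma>)" "lift_aut emb x y \<sigma> (emb a) = emb (\<sigma> a)"
    "lift_aut emb x y \<sigma> x = x" "lift_aut emb x y \<sigma> y = y" by blast+
qed

lemma Gal_inverse:
  assumes "\<sigma> \<in> Gal k"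
  shows "inv_into UNIV \<sigma> \<in> Gal k" "\<sigma> (inv_into UNIV \<sigma> a) = a"
proof -
  interpret \<sigma>: field_isom \<sigma> using assms by (simp add: Gal_def)
  have "inv_into UNIV \<sigma> a = a" if "a \<in> k" for a using assms that by (metis (mono_tags, lifting) Gal_def inv_f_f mem_Collect_eq \<sigma>.inj_f)
  then show "inv_into UNIV \<sigma> \<in> Gal k" unfolding Gal_def by (auto intro!: field_isom.intro surjective.intro \<sigma>.inv.field_hom_axioms surjI[of _ \<sigma>])
  show "\<sigma> (inv_into UNIV \<sigma> a) = a" by (simp add: surj_f_inv_f \<sigma>.surj)
qed

text \<open>Homomorphisms of the function field agree once they agree on constants, x and y. On y
  the relation with \<open>c\<close> says \<zeta> = \<sigma>(\<zeta>)^c, and \<open>b\<close> is the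
  exponent with \<sigma>(\<zeta>) = \<zeta>^b.\<close>

lemma Gal_tower_automorphism:
  assumes \<sigma>: "\<sigma> \<in> Gal k" and c: "\<sigma> (\<zeta> ^ c) = \<zeta>"
  shows "\<exists>b. tower_automorphism emb x y f (l ^ n) \<zeta> \<delta> (lift_aut emb x y \<sigma>) b c"
proof -
  define h where "h = lift_aut emb x y \<sigma>"
  note h = lift_aut[OF \<sigma>, folded h_def]
  interpret h: field_hom h by (rule h)
  interpret \<sigma>: field_isom \<sigma> using \<sigma> by (simp add: Gal_def)
  define g where "g = lift_aut emb x y (inv_into UNIV \<sigma>)"
  note g = lift_aut[OF Gal_inverse(1)[OF \<sigma>], folded g_def]
  interpret g: field_hom g by (rule g)
  have "h \<circ> g = id"
    by (rule hom_eqI) (unfold_locales, auto simp: hom_distribs h g Gal_inverse[OF \<sigma>])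
  then have "surj h" by (metis surj_id surj_fun_eq fun.set_map surjI comp_apply id_apply)
  have "\<sigma> \<zeta> ^ (l ^ n) = 1" using primitive_power by (simp flip: \<sigma>.hom_power)
  then obtain b where b: "\<sigma> \<zeta> = \<zeta> ^ b" using root_of_unity_powers[OF primitive N_pos] by metis
  have c': "\<sigma> \<zeta> ^ c = \<zeta>" using c by (simp add: \<sigma>.hom_power)
  have "\<delta> \<circ> h = h \<circ> (\<delta> ^^ c)"
  proof -
    interpret c: field_hom "\<delta> ^^ c" by (rule funpow_hom)
    show ?thesis
      by (rule hom_eqI) (unfold_locales, auto simp: hom_distribs h funpow_emb funpow_x funpow_y \<delta>_emb \<delta>_x \<delta>_y c' simp flip: emb.hom_power)
  qed
  moreover have "h \<circ> \<delta> = (\<delta> ^^ b) \<circ> h"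
  proof -
    interpret b: field_hom "\<delta> ^^ b" by (rule funpow_hom)
    show ?thesis
      by (rule hom_eqI) (unfold_locales, auto simp: hom_distribs h funpow_emb funpow_x funpow_y \<delta>_emb \<delta>_x \<delta>_y b)
  qed
  moreover have "h ` range emb = range emb"
    using h(2) Gal_inverse(2)[OF \<sigma>] unfolding image_image h(2) by (metis range_composition surj_def \<sigma>.surj image_cong surjI)
  ultimately have "tower_automorphism emb x y f (l ^ n) \<zeta> \<delta> h b c"
    using \<open>surj h\<close> by unfold_locales (auto simp: fun_eq_iff)
  then show ?thesis unfolding h_def by blast
qed

lemma Gal_root_preimage: "\<sigma> \<in> Gal k \<Longrightarrow> \<exists>c. \<sigma> (\<zeta> ^ c) = \<zeta>"
proof -
  assume \<sigma>: "\<sigma> \<in> Gal k"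
  interpret \<sigma>: field_isom \<sigma> using \<sigma> by (simp add: Gal_def)
  have "\<sigma> (inv_into UNIV \<sigma> \<zeta> ^ (l ^ n)) = \<sigma> 1"
    using primitive_power by (simp add: \<sigma>.hom_power Gal_inverse(2)[OF \<sigma>])
  then have "inv_into UNIV \<sigma> \<zeta> ^ (l ^ n) = 1" by (simp only: \<sigma>.eq_iff)
  then obtain c where "inv_into UNIV \<sigma> \<zeta> = \<zeta> ^ c" using root_of_unity_powers[OF primitive N_pos] by metis
  then show ?thesis using Gal_inverse(2)[OF \<sigma>, of \<zeta>] by metis
qed

text \<open>The exponent \<open>c\<close> for \<zeta> also works for the l-th root of unity
  \<open>w\<close>, so it is inverse to the cyclotomic character modulo \<open>l\<close>, and its
  i-th power is the character to the power -i.\<close>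

lemma twist_eq:
  fixes \<psi> :: "('a \<Rightarrow> 'a) \<Rightarrow> 'p::prime_card mod_ring mat"
  assumes l: "l = CARD('p)" and \<sigma>: "\<sigma> \<in> Gal k" "\<sigma> (\<zeta> ^ c) = \<zeta>"
  shows "twist \<psi> (- int i) \<sigma> = of_int (int c ^ i) \<cdot>\<^sub>m \<psi> \<sigma>"
proof -
  interpret \<sigma>: field_isom \<sigma> using \<sigma> by (simp add: Gal_def)
  define w where "w = \<zeta> ^ (l ^ (n - 1))"
  have n: "l ^ n = l ^ (n - 1) * l" using n_pos by (cases n) auto
  have "w ^ i = 1 \<longleftrightarrow> CARD('p) dvd i" for i
    using l_pos[of "n - 1"] unfolding w_def power_mult[symmetric] primitive n l[symmetric] by (simp only: nat_mult_dvd_cancel1)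
  moreover have "\<sigma> (w ^ c) = w"
    using \<sigma>(2) by (metis w_def power_mult mult.commute \<sigma>.hom_power)
  ultimately have "cyclotomic_char \<sigma> * of_nat c = (1 :: 'p mod_ring)"
    using cyclotomic_char_inverse \<sigma>.field_hom_axioms by blast
  then have "of_nat c = inverse (cyclotomic_char \<sigma> :: 'p mod_ring)" by (rule inverse_unique[symmetric])
  then have "cyclotomic_char \<sigma> powi (- int i) = (of_int (int c ^ i) :: 'p mod_ring)"
    by (simp add: power_int_minus power_inverse)
  then show ?thesis by (simp only: twist_def)
qed

lemma torsion_block_form:
  fixes \<psi> :: "('a \<Rightarrow> 'a) \<Rightarrow> 'p::prime_card mod_ring mat"
  assumes l: "l = CARD('p)" and s: "1 \<le> s" "s \<le> n"
    and basis: "Fl_basis TYPE('p) (A_group emb x y l n s) (W_space emb x y l n S e s) bW"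
    and \<psi>: "\<And>\<sigma>. \<sigma> \<in> Gal k \<Longrightarrow> \<psi> \<sigma> = rep_matrix (A_group emb x y l n s) bW (A_act emb x y \<sigma>)"
  shows "\<exists>B. Fl_basis TYPE('p) (A_group emb x y l n s) (torsion (A_group emb x y l n s) l) B \<and>
    (\<forall>\<sigma>\<in>Gal k. block_upper_triangular (length bW) (totient (l ^ s)) (\<lambda>i. twist \<psi> (- int i) \<sigma>)
      (rep_matrix (A_group emb x y l n s) B (A_act emb x y \<sigma>)))"
proof -
  have K: "l ^ s dvd l ^ n" "l ^ (s - 1) dvd l ^ s" using s by (simp_all add: le_imp_power_dvd)
  interpret Q: kummer_quotient emb x y f "l ^ n" \<zeta> \<delta> "l ^ (s - 1)" "l ^ s"
    using K by unfold_locales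
  have t: "tower_field emb x y l n s = fixed (l ^ s)" "tower_field emb x y l n (s - 1) = fixed (l ^ (s - 1))"
    using s by (simp_all add: tower_field_eq)
  have A: "A_group emb x y l n s = Q.quot" unfolding A_group_def t Q.quot_eq ..
  have cls: "A_class emb x y l n s = Q.cls" unfolding A_class_def t Q.cls_eq ..
  have W: "W_space emb x y l n S e s =
      Q.cls ` (generate (Div emb (fixed (l ^ s))) (fibre_sum (l ^ s) ` Some ` strata_below l S e s) \<inter> dv0 (l ^ s))"
    unfolding W_space_def W_divs_def t cls Q.G_simps(1) by (simp add: image_image fibre_div_eq)
  have act: "A_act emb x y \<sigma> = Q.act (lift_aut emb x y \<sigma>)" for \<sigma>
    by (simp add: fun_eq_iff A_act_def Q.act_def div_act_def)
  \<comment> \<open>One exponent per automorphism is fixed here, modulo \<open>l ^ n\<close> the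
    inverse of the one by which \<sigma> acts on \<zeta>.\<close>
  obtain c where c: "\<And>\<sigma>. \<sigma> \<in> Gal k \<Longrightarrow> \<sigma> (\<zeta> ^ c \<sigma>) = \<zeta>" using Gal_root_preimage by metis
  obtain \<xi> P where P: "\<xi> \<in> strata_below l S e s" "P \<in> pts (l ^ s)" "over (Some \<xi>) P" "\<delta> ` P = P"
    "relram (l ^ (s - 1)) (l ^ s) (Some \<xi>) = l ^ s div l ^ (s - 1)"
    by (rule totally_ramified_point[OF s])
  have "strata_below l S e s \<subseteq> S" by (auto simp: strata_below_def stratum_def)
  then have fin: "finite (Some ` strata_below l S e s)" using finite_S finite_subset by blast
  have H: "\<exists>b. tower_automorphism emb x y f (l ^ n) \<zeta> \<delta> (lift_aut emb x y \<sigma>) b (c \<sigma>)" if "\<sigma> \<in> Gal k" for \<sigma>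
    by (rule Gal_tower_automorphism[OF that c[OF that]])
  obtain B where B: "Fl_basis TYPE('p) Q.quot (torsion Q.quot l) B"
    "\<And>\<sigma>. \<sigma> \<in> Gal k \<Longrightarrow> block_upper_triangular (length bW) (totient (l ^ s))
      (\<lambda>i. (of_int (int (c \<sigma>) ^ i) :: 'p mod_ring) \<cdot>\<^sub>m rep_matrix Q.quot bW (Q.act (lift_aut emb x y \<sigma>)))
      (rep_matrix Q.quot B (Q.act (lift_aut emb x y \<sigma>)))"
    using Q.block_form[OF l s(1) refl refl P(2-5) fin imageI[OF P(1)] relram_outside_strata[OF s(2)]
        basis[unfolded A W], of "Gal k" "lift_aut emb x y" c] H by blast
  have "(\<lambda>i. twist \<psi> (- int i) \<sigma>) =
      (\<lambda>i. of_int (int (c \<sigma>) ^ i) \<cdot>\<^sub>m rep_matrix Q.quot bW (Q.act (lift_aut emb x y \<sigma>)))" if "\<sigma> \<in> Gal k" for \<sigma>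
    using twist_eq[OF l that c[OF that]] \<psi>[OF that] by (simp only: A act)
  with B show ?thesis unfolding A act by (intro exI[of _ B]) simp
qed

end

theorem corollary6p7:
  fixes k :: "'a::{alg_closed_field,field_char_0} set"
    and l n s m :: nat
    and f :: "'a poly" and lam :: 'a and S :: "'a set" and e :: "'a \<Rightarrow> nat"
    and emb :: "'a \<Rightarrow> 'f::field" and x y :: 'f
    and bW :: "('f set \<Rightarrow>\<^sub>0 int) set set list"
    and \<psi> :: "('a \<Rightarrow> 'a) \<Rightarrow> 'p::prime_card mod_ring mat"
  assumes "superelliptic_setup k l n f lam S e emb x y"
    and "l = CARD('p)"
    and "1 \<le> s" and "s \<le> n"
    and "Fl_basis TYPE('p) (A_group emb x y l n s) (W_space emb x y l n S e s) bW"
    and "m = length bW"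
    and "\<And>\<sigma>. \<sigma> \<in> Gal k \<Longrightarrow> \<psi> \<sigma> = rep_matrix (A_group emb x y l n s) bW (A_act emb x y \<sigma>)"
  shows "\<exists>B. Fl_basis TYPE('p) (A_group emb x y l n s) (torsion (A_group emb x y l n s) l) B \<and>
           (\<forall>\<sigma>\<in>Gal k.
              block_upper_triangular m (totient (l ^ s)) (\<lambda>i. twist \<psi> (- int i) \<sigma>)
                (rep_matrix (A_group emb x y l n s) B (A_act emb x y \<sigma>)))"
proof -
  \<comment> \<open>The root of unity and the deck transformation are auxiliary choices that leave
    no trace in the conclusion.\<close>
  obtain \<zeta> \<delta> where "kummer_tower emb x y f (l ^ n) \<zeta> \<delta>"
    using superelliptic_setup.kummer_tower_exists[OF assms(1)] by blast
  then interpret superelliptic_cover k l n f lam S e emb x y \<zeta> \<delta>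
    using assms(1) by (intro superelliptic_cover.intro)
  show ?thesis unfolding assms(6) by (rule torsion_block_form[OF assms(2-5,7)])
qed

end
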